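(* Let $G$ be a non-abelian locally free group. If $R$ is a domain with $|R|\leq |G|$, then the group ring $RG$ is (right) primitive. In particular, $KG$ is primitive for any field $K$.
   Context: A group is locally free if all of its finitely generated subgroups are free. A ring $S$ is (right) primitive if it has a faithful irreducible (simple) right $S$-module. $|X|$ denotes cardinality. *)

theory Defs
  imports "HOL-Algebra.Ring" "HOL-Algebra.Generated_Groups"
begin

definition word_eval :: "('g, 'b) monoid_scheme \<Rightarrow> (bool \<times> 'g) list \<Rightarrow> 'g" where
  "word_eval G w = foldr (\<lambda>(b, x) acc. (if b then x else inv\<^bsub>G\<^esub> x) \<otimes>\<^bsub>G\<^esub> acc) w \<one>\<^bsub>G\<^esub>"

definition reduced_word :: "(bool \<times> 'g) list \<Rightarrow> bool" where
  "reduced_word w \<longleftrightarrow>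
     (\<forall>i. Suc i < length w \<longrightarrow>
        \<not> (snd (w ! i) = snd (w ! Suc i) \<and> fst (w ! i) \<noteq> fst (w ! Suc i)))"

definition free_basis :: "('g, 'b) monoid_scheme \<Rightarrow> 'g set \<Rightarrow> bool" where
  "free_basis G B \<longleftrightarrow> B \<subseteq> carrier G \<and>
     (\<forall>w. w \<noteq> [] \<and> set (map snd w) \<subseteq> B \<and> reduced_word w \<longrightarrow> word_eval G w \<noteq> \<one>\<^bsub>G\<^esub>)"

definition is_free_group :: "('g, 'b) monoid_scheme \<Rightarrow> bool" where
  "is_free_group H \<longleftrightarrow> group H \<and> (\<exists>B. free_basis H B \<and> generate H B = carrier H)"

definition locally_free :: "('g, 'b) monoid_scheme \<Rightarrow> bool" where
  "locally_free G \<longleftrightarrow> group G \<and>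
     (\<forall>S. finite S \<and> S \<subseteq> carrier G \<longrightarrow> is_free_group (G\<lparr>carrier := generate G S\<rparr>))"

definition gr_carrier :: "('g, 'b) monoid_scheme \<Rightarrow> ('g \<Rightarrow> 'r::ring_1) set" where
  "gr_carrier G = {f. finite {g. f g \<noteq> 0} \<and> {g. f g \<noteq> 0} \<subseteq> carrier G}"

definition gr_mult :: "('g, 'b) monoid_scheme \<Rightarrow> ('g \<Rightarrow> 'r::ring_1) \<Rightarrow> ('g \<Rightarrow> 'r) \<Rightarrow> 'g \<Rightarrow> 'r" where
  "gr_mult G f h x = (if x \<in> carrier G
       then (\<Sum>y\<in>{y. f y \<noteq> 0}. f y * h (inv\<^bsub>G\<^esub> y \<otimes>\<^bsub>G\<^esub> x)) else 0)"

definition gr_one :: "('g, 'b) monoid_scheme \<Rightarrow> 'g \<Rightarrow> 'r::ring_1" where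
  "gr_one G x = (if x = \<one>\<^bsub>G\<^esub> then 1 else 0)"

definition group_ring :: "('g, 'b) monoid_scheme \<Rightarrow> ('g \<Rightarrow> 'r::ring_1) ring" where
  "group_ring G = \<lparr> carrier = gr_carrier G, mult = gr_mult G, one = gr_one G,
     zero = (\<lambda>x. 0), add = (\<lambda>f h x. f x + h x) \<rparr>"

definition right_module :: "('a, 'c) ring_scheme \<Rightarrow> 'm set \<Rightarrow> ('m \<Rightarrow> 'm \<Rightarrow> 'm) \<Rightarrow> 'm
     \<Rightarrow> ('m \<Rightarrow> 'a \<Rightarrow> 'm) \<Rightarrow> bool" where
  "right_module S M addM zeroM act \<longleftrightarrow>
     ring S \<and> comm_group \<lparr>carrier = M, mult = addM, one = zeroM\<rparr> \<and>
     (\<forall>m\<in>M. \<forall>s\<in>carrier S. act m s \<in> M) \<and>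
     (\<forall>m\<in>M. \<forall>n\<in>M. \<forall>s\<in>carrier S. act (addM m n) s = addM (act m s) (act n s)) \<and>
     (\<forall>m\<in>M. \<forall>s\<in>carrier S. \<forall>t\<in>carrier S. act m (s \<oplus>\<^bsub>S\<^esub> t) = addM (act m s) (act m t)) \<and>
     (\<forall>m\<in>M. \<forall>s\<in>carrier S. \<forall>t\<in>carrier S. act m (s \<otimes>\<^bsub>S\<^esub> t) = act (act m s) t) \<and>
     (\<forall>m\<in>M. act m \<one>\<^bsub>S\<^esub> = m)"

definition submodule :: "('a, 'c) ring_scheme \<Rightarrow> 'm set \<Rightarrow> 'm set \<Rightarrow> ('m \<Rightarrow> 'm \<Rightarrow> 'm) \<Rightarrow> 'm
     \<Rightarrow> ('m \<Rightarrow> 'a \<Rightarrow> 'm) \<Rightarrow> bool" where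
  "submodule S N M addM zeroM act \<longleftrightarrow>
     subgroup N \<lparr>carrier = M, mult = addM, one = zeroM\<rparr> \<and>
     (\<forall>n\<in>N. \<forall>s\<in>carrier S. act n s \<in> N)"

definition simple_right_module :: "('a, 'c) ring_scheme \<Rightarrow> 'm set \<Rightarrow> ('m \<Rightarrow> 'm \<Rightarrow> 'm) \<Rightarrow> 'm
     \<Rightarrow> ('m \<Rightarrow> 'a \<Rightarrow> 'm) \<Rightarrow> bool" where
  "simple_right_module S M addM zeroM act \<longleftrightarrow>
     right_module S M addM zeroM act \<and> M \<noteq> {zeroM} \<and>
     (\<forall>N. submodule S N M addM zeroM act \<longrightarrow> N = {zeroM} \<or> N = M)"

definition faithful_right_module :: "('a, 'c) ring_scheme \<Rightarrow> 'm set \<Rightarrow> 'm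
     \<Rightarrow> ('m \<Rightarrow> 'a \<Rightarrow> 'm) \<Rightarrow> bool" where
  "faithful_right_module S M zeroM act \<longleftrightarrow>
     (\<forall>s\<in>carrier S. (\<forall>m\<in>M. act m s = zeroM) \<longrightarrow> s = \<zero>\<^bsub>S\<^esub>)"

text \<open>Right primitive: there is a faithful simple right module. Since every simple module is
  cyclic (a quotient of S), its cardinality is at most that of S, so w.l.o.g. its elements
  are taken from the element type 'a of S.\<close>
definition right_primitive :: "('a, 'c) ring_scheme \<Rightarrow> bool" where
  "right_primitive S \<longleftrightarrow>
     (\<exists>(M::'a set) addM zeroM act.
        simple_right_module S M addM zeroM act \<and> faithful_right_module S M zeroM act)"

end

theory Submission
  imports Defs "HOL-Library.Countable_Set" "HOL-Combinatorics.Permutations" "HOL-Computational_Algebra.Polynomial" "HOL-Algebra.Ideal"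
begin

text \<open>
  The simple module is the quotient by a maximal right ideal containing, for every \<open>s\<close> in a family
  \<open>S\<close> that meets all nonzero ideals, an element \<open>1 + l\<^sub>1 s l'\<^sub>1 + l\<^sub>2 s l'\<^sub>2\<close> with group elements \<open>l\<^sub>j\<close>,
  \<open>l'\<^sub>j\<close> depending on \<open>s\<close>. It is faithful because a nonzero annihilator would put \<open>1\<close> into that
  right ideal. So the point is to choose the multipliers such that these elements generate a proper right
  ideal, and this holds as soon as certain products of quotients of the occurring group elements never
  equal \<open>1\<close>: otherwise, in an identity \<open>\<Sum>\<^sub>s (1 + l\<^sub>1 s l'\<^sub>1 + l\<^sub>2 s l'\<^sub>2) t\<^sub>s = 1\<close>, the cancelling
  terms could be followed forever through a finite set.

  If \<open>G\<close> is finitely generated, it is free and products of powers of two basis elements serve as multipliers.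
  Otherwise they are formed from elements \<open>y\<^sub>s\<close> chosen by transfinite recursion such that \<open>y\<^sub>s\<close> is free
  over a subgroup \<open>H\<^sub>s\<close> containing all previous data. Such an element exists if \<open>H\<^sub>s\<close> is finitely
  generated, by counting homomorphisms on subgroups of finite index, and if \<open>|H\<^sub>s| < |G|\<close>, by ping-pong
  over a valued field after embedding \<open>G\<close> into \<open>SL\<^sub>2\<close> of an ultrapower of the rationals.

  Over a field, \<open>S\<close> can be taken to consist of elements with coefficients in the image of the
  integers: a nonzero ideal contains one because commutators with generic group elements reduce the
  number of coefficients needed.
\<close>

section \<open>Free and locally free groups\<close>

text \<open>Every member of \<open>S\<close> costs one stage of the recursion, so \<open>S\<close>
  may have at most |G| members. This is where |R| \<le> |G| enters, and it is what forces integer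
  coefficients over a large field. If \<open>S\<close> is ordered by its cardinal, every stage sees
  fewer than |G| earlier elements.

  There are two multipliers for each \<open>s\<close> because with a single one a path could enter
  and leave the same sandwich \<open>l s l'\<close>: the multipliers between would cancel and
  uncontrolled products of quotients of support elements would remain. With two, every path can be
  continued through the other multiplier.

  Nothing in a group is free over the whole group, so a finitely generated \<open>G\<close> allows
  no recursion and its multipliers must come from inside one free group. Conversely, an infinitely
  generated small subgroup has no rank to count with. Its matrices only have entries in a small
  field, and some matrix of \<open>G\<close> has an entry transcendental over that field. A
  valuation unbounded on this entry makes the matrix attract all generic vectors to one line, which
  is what ping-pong needs.\<close>

abbreviation no_cancel :: "bool \<times> 'a \<Rightarrow> bool \<times> 'a \<Rightarrow> bool" where
  "no_cancel p q \<equiv> \<not> (snd p = snd q \<and> fst p \<noteq> fst q)"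

lemma reduced_word_iff: "reduced_word w \<longleftrightarrow> successively no_cancel w"
proof (induction w)
  case Nil
  then show ?case by (simp add: reduced_word_def)
next
  case (Cons p w)
  have all_nat: "(\<forall>i. P i) \<longleftrightarrow> P 0 \<and> (\<forall>i. P (Suc i))" for P :: "nat \<Rightarrow> bool"
    by (metis not0_implies_Suc)
  have "reduced_word (p # w) \<longleftrightarrow> (w = [] \<or> no_cancel p (hd w)) \<and> reduced_word w"
    unfolding reduced_word_def by (subst all_nat) (cases w; simp)
  then show ?case using Cons.IH by (auto simp: successively_Cons)
qed

lemma not_reduced_word_split:
  assumes "\<not> reduced_word w"
  obtains u v b x where "w = u @ (b, x) # (\<not> b, x) # v"
proof -
  from assms obtain i where i: "Suc i < length w" "snd (w ! i) = snd (w ! Suc i)"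
      "fst (w ! i) \<noteq> fst (w ! Suc i)"
    by (auto simp: reduced_word_def)
  have "w = take i w @ w ! i # w ! Suc i # drop (Suc (Suc i)) w"
    using i(1) by (simp add: Cons_nth_drop_Suc)
  moreover have "w ! i = (fst (w ! i), snd (w ! i))" "w ! Suc i = (\<not> fst (w ! i), snd (w ! i))"
    using i by (auto simp: prod_eq_iff)
  ultimately show ?thesis using that by metis
qed

definition letters :: "(bool \<times> 'a) list \<Rightarrow> 'a set" where
  "letters w = snd ` set w"

lemma letters_simps [simp]: "letters [] = {}" "letters (p # w) = insert (snd p) (letters w)"
  "letters (u @ v) = letters u \<union> letters v" "letters (map (map_prod g f) w) = f ` letters w"
  "finite (letters w)"
  by (force simp: letters_def)+

definition winv :: "(bool \<times> 'a) list \<Rightarrow> (bool \<times> 'a) list" where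
  "winv w = rev (map (\<lambda>(b, x). (\<not> b, x)) w)"

lemma winv_simps [simp]: "winv [] = []" "winv (p # w) = winv w @ [(\<not> fst p, snd p)]"
  "winv (u @ v) = winv v @ winv u" "winv w = [] \<longleftrightarrow> w = []" "letters (winv w) = letters w"
  by (force simp: winv_def letters_def split: prod.splits)+

lemma reduced_winv [simp]: "reduced_word (winv w) = reduced_word w"
  unfolding reduced_word_iff winv_def
  by (auto simp: successively_map case_prod_unfold elim!: successively_mono)

lemma word_eval_Nil [simp]: "word_eval G [] = \<one>\<^bsub>G\<^esub>"
  by (simp add: word_eval_def)

lemma word_eval_Cons [simp]:
  "word_eval G (p # w) = (if fst p then snd p else inv\<^bsub>G\<^esub> (snd p)) \<otimes>\<^bsub>G\<^esub> word_eval G w"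
  by (cases p) (simp add: word_eval_def)

lemma free_basisD:
  "free_basis G B \<Longrightarrow> w \<noteq> [] \<Longrightarrow> letters w \<subseteq> B \<Longrightarrow> reduced_word w \<Longrightarrow> word_eval G w \<noteq> \<one>\<^bsub>G\<^esub>"
  by (simp add: free_basis_def letters_def)

lemma word_eval_consistent:
  assumes "group G" "subgroup H G" "letters w \<subseteq> H"
  shows "word_eval (G\<lparr>carrier := H\<rparr>) w = word_eval G w"
  using assms(3) by (induction w) (auto simp: group.m_inv_consistent[OF assms(1,2)])

context group
begin

lemma word_eval_closed [simp]: "letters w \<subseteq> carrier G \<Longrightarrow> word_eval G w \<in> carrier G"
  by (induction w) auto

lemma word_eval_append:
  "letters u \<subseteq> carrier G \<Longrightarrow> letters v \<subseteq> carrier G \<Longrightarrow>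
   word_eval G (u @ v) = word_eval G u \<otimes> word_eval G v"
  by (induction u) (auto simp: m_assoc)

lemma word_eval_winv:
  "letters w \<subseteq> carrier G \<Longrightarrow> word_eval G (winv w) = inv (word_eval G w)"
  by (induction w) (auto simp: word_eval_append inv_mult_group)

lemma word_eval_cancel:
  assumes "letters u \<subseteq> carrier G" "letters v \<subseteq> carrier G" "x \<in> carrier G"
  shows "word_eval G (u @ (b, x) # (\<not> b, x) # v) = word_eval G (u @ v)"
  using assms by (cases b) (auto simp: word_eval_append m_assoc[symmetric])

lemma generate_eq_words:
  assumes "B \<subseteq> carrier G"
  shows "generate G B = {word_eval G w | w. letters w \<subseteq> B}" (is "_ = ?W")
proof
  show "generate G B \<subseteq> ?W"
  proof
    fix g assume "g \<in> generate G B"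
    then show "g \<in> ?W"
    proof induction
      case one
      then show ?case by (auto intro!: exI[of _ "[]"])
    next
      case (incl h)
      then show ?case using assms by (auto intro!: exI[of _ "[(True, h)]"] simp: subset_iff)
    next
      case (inv h)
      then show ?case using assms by (auto intro!: exI[of _ "[(False, h)]"] simp: subset_iff)
    next
      case (eng h1 h2)
      then obtain w1 w2 where "letters w1 \<subseteq> B" "letters w2 \<subseteq> B" "h1 = word_eval G w1" "h2 = word_eval G w2"
        by auto
      then show ?case
        using assms by (auto intro!: exI[of _ "w1 @ w2"] simp: word_eval_append dest: order_trans)
    qed
  qed
  show "?W \<subseteq> generate G B"
  proof clarify
    fix w :: "(bool \<times> 'a) list" assume "letters w \<subseteq> B"
    then show "word_eval G w \<in> generate G B"
      by (induction w) (auto intro: generate.intros)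
  qed
qed

lemma reduced_word_exists:
  assumes "B \<subseteq> carrier G" "g \<in> generate G B"
  obtains w where "letters w \<subseteq> B" "reduced_word w" "word_eval G w = g"
proof -
  define P where "P w \<longleftrightarrow> letters w \<subseteq> B \<and> word_eval G w = g" for w
  have "\<exists>w. P w" using assms by (auto simp: generate_eq_words P_def)
  then have P: "P (arg_min length P)" and m: "\<And>w. P w \<Longrightarrow> length (arg_min length P) \<le> length w"
    using arg_min_nat_lemma[of P _ length] by blast+
  have "reduced_word (arg_min length P)"
  proof (rule ccontr)
    assume "\<not> ?thesis"
    then obtain u v b x where w: "arg_min length P = u @ (b, x) # (\<not> b, x) # v"
      by (rule not_reduced_word_split)
    have "P (u @ v)"
    proof -
      have "letters u \<subseteq> B" "letters v \<subseteq> B" "x \<in> B" using P by (auto simp: w P_def)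
      then have "letters u \<subseteq> carrier G" "letters v \<subseteq> carrier G" "x \<in> carrier G" using assms(1) by auto
      from word_eval_cancel[OF this, of b] show ?thesis
        using P \<open>letters u \<subseteq> B\<close> \<open>letters v \<subseteq> B\<close> unfolding w P_def by simp
    qed
    then show False using m[of "u @ v"] w by simp
  qed
  then show ?thesis using P that by (auto simp: P_def)
qed

text \<open>Equal first letters are stripped by induction. If they differ, \<open>winv u @ v\<close>
  is itself reduced, since the only new junction is between the two first letters; being nonempty,
  it cannot evaluate to \<open>\<one>\<close>.\<close>

lemma reduced_word_unique:
  assumes B: "free_basis G B" and "letters u \<subseteq> B" "letters v \<subseteq> B" "reduced_word u" "reduced_word v"
    and "word_eval G u = word_eval G v"
  shows "u = v"
  using assms(2-)
proof (induction u arbitrary: v)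
  case Nil
  then show ?case using free_basisD[OF B, of v] by auto
next
  case (Cons p u)
  have BG: "B \<subseteq> carrier G" using B by (simp add: free_basis_def)
  show ?case
  proof (cases v)
    case Nil
    then show ?thesis using Cons.prems free_basisD[OF B, of "p # u"] by auto
  next
    case v: (Cons q v')
    show ?thesis
    proof (cases "p = q")
      case True
      have "word_eval G u = word_eval G v'"
        using Cons.prems BG unfolding v True
        by (auto split: if_splits simp: subset_iff image_iff intro!: word_eval_closed)
      then show ?thesis using Cons.IH[of v'] Cons.prems True v
        by (auto simp: reduced_word_iff successively_Cons)
    next
      case False
      have "reduced_word (winv (p # u) @ v)"
        using Cons.prems(3,4) False reduced_winv[of "p # u"] unfolding reduced_word_iff successively_append_iff v
        by (auto simp: prod_eq_iff)
      then have "word_eval G (winv (p # u) @ v) \<noteq> \<one>"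
        using v Cons.prems by (intro free_basisD[OF B]) (auto simp del: winv_simps(2))
      moreover have "word_eval G (winv (p # u) @ v) = inv (word_eval G (p # u)) \<otimes> word_eval G v"
      proof -
        have c: "letters (p # u) \<subseteq> carrier G" "letters v \<subseteq> carrier G"
          using Cons.prems(1,2) BG by auto
        then show ?thesis
          by (metis word_eval_append word_eval_winv winv_simps(5))
      qed
      ultimately show ?thesis using Cons.prems BG
        by (metis l_inv order_trans word_eval_closed)
    qed
  qed
qed

text \<open>A nonempty word with value \<open>\<one>\<close> is not reduced, so it contains a
  cancelling pair, and that pair cancels in every group to which the letters are mapped. Deleting it
  shortens the word.\<close>

lemma word_eval_hom_trivial:
  assumes B: "free_basis G B" and Q: "group Q" and f: "f ` B \<subseteq> carrier Q"
    and "letters w \<subseteq> B" "word_eval G w = \<one>"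
  shows "word_eval Q (map (map_prod id f) w) = \<one>\<^bsub>Q\<^esub>"
  using assms(4,5)
proof (induction "length w" arbitrary: w rule: less_induct)
  case less
  have BG: "B \<subseteq> carrier G" using B by (simp add: free_basis_def)
  show ?case
  proof (cases "w = []")
    case False
    then have "\<not> reduced_word w" using less.prems free_basisD[OF B] by blast
    then obtain u v b x where w: "w = u @ (b, x) # (\<not> b, x) # v"
      by (rule not_reduced_word_split)
    have "word_eval G (u @ v) = \<one>"
      using less.prems BG unfolding w by (subst (asm) word_eval_cancel) auto
    then have "word_eval Q (map (map_prod id f) (u @ v)) = \<one>\<^bsub>Q\<^esub>"
      using less.prems by (intro less.hyps) (auto simp: w)
    moreover have "word_eval Q (map (map_prod id f) w) = word_eval Q (map (map_prod id f) (u @ v))"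
      using less.prems f unfolding w
      by (simp, subst group.word_eval_cancel[OF Q]) (auto simp: image_iff subset_iff)
    ultimately show ?thesis by simp
  qed auto
qed

text \<open>The universal property. An arbitrary word is chosen for every element; two words with
  the same value differ by a relator, which \<open>word_eval_hom_trivial\<close> makes trivial in
  \<open>Q\<close>. The formula on words is exported because finite actions are evaluated along
  words that need not be reduced.\<close>

lemma free_basis_hom_extend:
  assumes B: "free_basis G B" and Q: "group Q" and f: "f ` B \<subseteq> carrier Q"
  obtains \<phi> where "\<phi> \<in> hom (G\<lparr>carrier := generate G B\<rparr>) Q" "\<And>b. b \<in> B \<Longrightarrow> \<phi> b = f b"
    "\<And>w. letters w \<subseteq> B \<Longrightarrow> \<phi> (word_eval G w) = word_eval Q (map (map_prod id f) w)"
proof -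
  interpret Q: group Q by fact
  have BG: "B \<subseteq> carrier G" using B by (simp add: free_basis_def)
  let ?m = "map (map_prod id f)"
  define \<phi> where "\<phi> g = word_eval Q (?m (SOME w. letters w \<subseteq> B \<and> word_eval G w = g))" for g
  have mc: "letters (?m w) \<subseteq> carrier Q" if "letters w \<subseteq> B" for w :: "(bool \<times> 'a) list"
    using that f by (auto simp: image_iff subset_iff)
  have wc: "letters w \<subseteq> carrier G" if "letters w \<subseteq> B" for w :: "(bool \<times> 'a) list"
    using that BG by auto
  have mw: "?m (winv w) = winv (?m w)" for w
    by (simp add: winv_def rev_map case_prod_unfold map_prod_def)
  have \<phi>: "\<phi> (word_eval G w) = word_eval Q (?m w)" if w: "letters w \<subseteq> B" for w
  proof -
    define v where "v = (SOME v. letters v \<subseteq> B \<and> word_eval G v = word_eval G w)"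
    have v: "letters v \<subseteq> B" "word_eval G v = word_eval G w"
      unfolding v_def using someI[of "\<lambda>v. letters v \<subseteq> B \<and> word_eval G v = word_eval G w" w] w by auto
    have "word_eval G (v @ winv w) = \<one>"
      using v w wc by (simp add: word_eval_append word_eval_winv)
    then have "word_eval Q (?m (v @ winv w)) = \<one>\<^bsub>Q\<^esub>"
      using v w by (intro word_eval_hom_trivial[OF B Q f]) auto
    then have "word_eval Q (?m v) \<otimes>\<^bsub>Q\<^esub> inv\<^bsub>Q\<^esub> word_eval Q (?m w) = \<one>\<^bsub>Q\<^esub>"
      using mc[OF v(1)] mc[OF w] by (simp only: map_append mw) (simp add: Q.word_eval_append Q.word_eval_winv del: set_map)
    then have "word_eval Q (?m v) = word_eval Q (?m w)"
      using mc[OF v(1)] mc[OF w] by (metis Q.inv_equality Q.inv_inv Q.inv_closed Q.word_eval_closed)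
    then show ?thesis by (simp add: \<phi>_def v_def)
  qed
  show ?thesis
  proof
    show "\<phi> \<in> hom (G\<lparr>carrier := generate G B\<rparr>) Q"
    proof (rule homI)
      fix g assume "g \<in> carrier (G\<lparr>carrier := generate G B\<rparr>)"
      then obtain w where "letters w \<subseteq> B" "g = word_eval G w" by (auto simp: generate_eq_words[OF BG])
      then show "\<phi> g \<in> carrier Q" using \<phi> mc by simp
    next
      fix g h assume "g \<in> carrier (G\<lparr>carrier := generate G B\<rparr>)" "h \<in> carrier (G\<lparr>carrier := generate G B\<rparr>)"
      then obtain u v where uv: "letters u \<subseteq> B" "g = word_eval G u" "letters v \<subseteq> B" "h = word_eval G v"
        by (auto simp: generate_eq_words[OF BG])
      then have "g \<otimes> h = word_eval G (u @ v)" using wc by (simp add: word_eval_append)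
      then have "\<phi> (g \<otimes> h) = word_eval Q (?m u @ ?m v)" using \<phi>[of "u @ v"] uv by simp
      also have "\<dots> = \<phi> g \<otimes>\<^bsub>Q\<^esub> \<phi> h"
        using uv \<phi> mc by (simp add: Q.word_eval_append)
      finally show "\<phi> (g \<otimes>\<^bsub>G\<lparr>carrier := generate G B\<rparr>\<^esub> h) = \<phi> g \<otimes>\<^bsub>Q\<^esub> \<phi> h" by simp
    qed
  next
    fix b assume "b \<in> B"
    then show "\<phi> b = f b" using \<phi>[of "[(True, b)]"] f BG by (simp add: subset_iff image_subset_iff)
  qed (use \<phi> in auto)
qed

end

section \<open>Consequences of local freeness: commuting elements, roots, metabelian
  subgroups\<close>

context group
begin

lemma generate_letters:
  assumes "B \<subseteq> carrier G" "g \<in> generate G B"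
  obtains C where "finite C" "C \<subseteq> B" "g \<in> generate G C"
proof -
  obtain w where "letters w \<subseteq> B" "word_eval G w = g"
    using assms by (auto simp: generate_eq_words)
  moreover from this have "g \<in> generate G (letters w)"
    using assms(1) by (subst generate_eq_words) auto
  ultimately show ?thesis using that[of "letters w"] by simp
qed

text \<open>\<open>is_free_group\<close> puts no bound on its basis. Finitely many generators
  involve only a finite set \<open>D\<close> of basis letters, and a basis element that is a reduced
  word over \<open>D\<close> must, by uniqueness, be a letter of \<open>D\<close>.\<close>

lemma free_basis_finite:
  assumes B: "free_basis G B" and S: "finite S" "generate G S = generate G B" "S \<subseteq> carrier G"
  shows "finite B"
proof -
  have BG: "B \<subseteq> carrier G" using B by (simp add: free_basis_def)
  have "\<forall>s\<in>S. \<exists>C. finite C \<and> C \<subseteq> B \<and> s \<in> generate G C"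
    using generate_letters[OF BG] S(2) generate.incl[of _ S G] by (metis (full_types))
  then obtain C where C: "\<And>s. s \<in> S \<Longrightarrow> finite (C s) \<and> C s \<subseteq> B \<and> s \<in> generate G (C s)"
    by metis
  define D where "D = (\<Union>s\<in>S. C s)"
  have D: "finite D" "D \<subseteq> B" using C S(1) by (auto simp: D_def)
  have "S \<subseteq> generate G D"
  proof
    fix s assume "s \<in> S"
    then have "generate G (C s) \<subseteq> generate G D"
      using D BG by (intro mono_generate) (auto simp: D_def)
    then show "s \<in> generate G D" using C[OF \<open>s \<in> S\<close>] by auto
  qed
  then have "generate G B \<subseteq> generate G D"
    using D BG S by (metis generate_subgroup_incl generate_is_subgroup order_trans)
  have "B \<subseteq> D"
  proof
    fix b assume b: "b \<in> B"
    then have "b \<in> generate G D" using \<open>generate G B \<subseteq> generate G D\<close> generate.incl by fast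
    then obtain w where w: "letters w \<subseteq> D" "reduced_word w" "word_eval G w = b"
      using reduced_word_exists[of D b] D BG by blast
    have "w = [(True, b)]"
      using w b D BG by (intro reduced_word_unique[OF B]) (auto simp: reduced_word_iff)
    then show "b \<in> D" using w by simp
  qed
  then show ?thesis using D finite_subset by blast
qed

text \<open>\<open>locally_free\<close> speaks of each subgroup as a group in its own right; here
  the basis is transferred to \<open>G\<close>, where words over different subgroups can be
  compared.\<close>

lemma locally_free_basis:
  assumes "locally_free G" "finite S" "S \<subseteq> carrier G"
  obtains B where "finite B" "free_basis G B" "generate G B = generate G S"
proof -
  let ?H = "generate G S"
  have H: "subgroup ?H G" using assms(3) by (rule generate_is_subgroup)
  obtain B where B: "free_basis (G\<lparr>carrier := ?H\<rparr>) B" "generate (G\<lparr>carrier := ?H\<rparr>) B = ?H"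
    using assms by (auto simp: locally_free_def is_free_group_def)
  have BH: "B \<subseteq> ?H" using B(1) by (simp add: free_basis_def)
  have "free_basis G B"
    unfolding free_basis_def letters_def[symmetric] set_map
  proof safe
    fix w :: "(bool \<times> 'a) list" assume w: "w \<noteq> []" "letters w \<subseteq> B" "reduced_word w" "word_eval G w = \<one>"
    then have "word_eval (G\<lparr>carrier := ?H\<rparr>) w = \<one>"
      using BH by (subst word_eval_consistent[OF is_group H]) (auto simp: letters_def)
    then show False using free_basisD[OF B(1)] w by simp
  qed (use BH H subgroup.subset in blast)
  moreover have "generate G B = ?H" using B(2) generate_consistent[OF BH H] by simp
  ultimately show ?thesis using that free_basis_finite assms by metis
qed

lemma generate_singleton_comm:
  assumes "x \<in> carrier G" "a \<in> generate G {x}" "b \<in> generate G {x}"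
  shows "a \<otimes> b = b \<otimes> a"
proof -
  obtain i j :: int where "a = x [^] i" "b = x [^] j" using assms by (auto simp: generate_pow)
  then show ?thesis using assms(1) by (simp add: int_pow_mult[symmetric] add.commute)
qed

lemma noncommuting_basis:
  assumes B: "B \<subseteq> carrier G" and ab: "a \<in> generate G B" "b \<in> generate G B" "a \<otimes> b \<noteq> b \<otimes> a"
  obtains (thesisI) x y where "x \<in> B" "y \<in> B" "x \<noteq> y"
proof (rule ccontr)
  assume "\<not> thesis"
  then have *: "x = y" if "x \<in> B" "y \<in> B" for x y using that thesisI by blast
  obtain x where x: "x \<in> carrier G" "B \<subseteq> {x}"
  proof (cases "B = {}")
    case False
    then obtain x where x: "x \<in> B" by auto
    then have "B \<subseteq> {x}" using * by blast
    then show ?thesis using x B that by blast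
  qed (use that[of \<one>] in auto)
  then have "generate G B \<subseteq> generate G {x}" by (intro mono_generate) auto
  then show False using generate_singleton_comm[OF x(1)] ab by blast
qed

lemma free_basis_pow:
  assumes B: "free_basis G B" and t: "t \<in> B" and "t [^] (k::int) = \<one>"
  shows "k = 0"
proof -
  have tG: "t \<in> carrier G" using B t by (auto simp: free_basis_def)
  have pow: "t [^] (n::nat) \<noteq> \<one>" if "n > 0" for n
  proof -
    have "successively no_cancel (replicate n (True, t))"
      by (auto simp: successively_conv_nth)
    moreover have "word_eval G (replicate n (True, t)) = t [^] n"
      using tG by (induction n) (auto simp: nat_pow_comm[of t 1, simplified])
    moreover have "letters (replicate n (True, t)) \<subseteq> B" using t by (auto simp: letters_def)
    ultimately show ?thesis
      using free_basisD[OF B, of "replicate n (True, t)"] that by (simp add: reduced_word_iff)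
  qed
  show ?thesis
  proof (rule ccontr)
    assume "k \<noteq> 0"
    then have "nat \<bar>k\<bar> > 0" by simp
    moreover have "t [^] nat \<bar>k\<bar> = \<one>"
    proof -
      have "t [^] \<bar>k\<bar> = \<one>"
        using assms(3) tG int_pow_neg[of t k] by (cases "k \<ge> 0") auto
      then show ?thesis using int_pow_int[of G t "nat \<bar>k\<bar>"] by simp
    qed
    ultimately show False using pow by blast
  qed
qed

text \<open>Write \<open>z\<close> as a reduced word \<open>w\<close> and let \<open>c\<close>
  differ from the basis element in its first letter. Then \<open>c w\<close> is reduced. Commuting
  would equate it with \<open>w c\<close>, which either is reduced and begins with a different
  letter or, if \<open>w\<close> ends in the inverse of \<open>c\<close>, collapses to a shorter
  word than \<open>c w\<close>.\<close>

lemma free_center_trivial: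
  assumes B: "free_basis G B" and xy: "x \<in> B" "y \<in> B" "x \<noteq> y"
    and z: "z \<in> generate G B" "z \<noteq> \<one>"
  obtains c where "c \<in> B" "z \<otimes> c \<noteq> c \<otimes> z"
proof -
  have BG: "B \<subseteq> carrier G" using B by (simp add: free_basis_def)
  obtain w where w: "letters w \<subseteq> B" "reduced_word w" "word_eval G w = z"
    using reduced_word_exists[OF BG z(1)] by blast
  then obtain p v where pv: "w = p # v" using z(2) by (cases w) auto
  obtain c where c: "c \<in> B" "c \<noteq> snd p" using xy by metis
  have cG: "c \<in> carrier G" using c BG by auto
  have wG: "letters w \<subseteq> carrier G" using w BG by auto
  have cw: "reduced_word ((True, c) # w)" using w c pv by (auto simp: reduced_word_iff)
  have "z \<otimes> c \<noteq> c \<otimes> z"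
  proof
    assume eq: "z \<otimes> c = c \<otimes> z"
    show False
    proof (cases "last w = (False, c)")
      case False
      have "reduced_word (w @ [(True, c)])"
        using w(2) False pv unfolding reduced_word_iff successively_append_iff
        by (auto simp: prod_eq_iff)
      moreover have "word_eval G (w @ [(True, c)]) = word_eval G ((True, c) # w)"
        using eq cG wG w(3) by (simp add: word_eval_append)
      ultimately have "w @ [(True, c)] = (True, c) # w"
        using w c cw by (intro reduced_word_unique[OF B]) auto
      then show False using pv c by simp
    next
      case True
      then obtain u where u: "w = u @ [(False, c)]" using pv by (metis append_butlast_last_id list.distinct(1))
      then have "u \<noteq> []" using pv c by auto
      have "word_eval G u = word_eval G ((True, c) # w)"
        using eq cG wG w(3) unfolding u by (auto simp: word_eval_append m_assoc)
      then have "u = (True, c) # w"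
        using w c cw u by (intro reduced_word_unique[OF B]) (auto simp: reduced_word_iff successively_append_iff)
      then show False using u by simp
    qed
  qed
  then show ?thesis using that c by blast
qed

lemma commute_generate:
  assumes "z \<in> carrier G" "S \<subseteq> carrier G" "\<And>s. s \<in> S \<Longrightarrow> z \<otimes> s = s \<otimes> z" "g \<in> generate G S"
  shows "z \<otimes> g = g \<otimes> z"
  using assms(4)
proof induction
  case (inv h)
  then have h: "h \<in> carrier G" using assms(2) by auto
  have "z \<otimes> inv h = inv h \<otimes> (h \<otimes> z) \<otimes> inv h" using h assms(1) by (simp add: m_assoc[symmetric])
  also have "\<dots> = inv h \<otimes> z" using assms(1) h assms(3)[OF inv, symmetric] by (simp add: m_assoc)
  finally show ?case .
next
  case (eng h1 h2)
  then have "h1 \<in> carrier G" "h2 \<in> carrier G" using assms(2) generate_in_carrier by auto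
  then show ?case using eng assms(1) by (metis m_assoc)
qed (use assms in auto)

text \<open>A free group with two basis elements has trivial centre, so a nontrivial element
  commuting with all generators leaves exactly one basis element \<open>t\<close>. Questions about
  commuting elements thus become questions about exponents.\<close>

lemma locally_free_central_cyclic:
  assumes lf: "locally_free G" and S: "finite S" "S \<subseteq> carrier G"
    and z: "z \<in> generate G S" "z \<noteq> \<one>" "\<And>s. s \<in> S \<Longrightarrow> z \<otimes> s = s \<otimes> z"
  obtains t where "t \<in> carrier G" "\<And>k::int. t [^] k = \<one> \<Longrightarrow> k = 0"
    "\<And>g. g \<in> generate G S \<Longrightarrow> \<exists>k::int. g = t [^] k"
proof -
  obtain B where B: "free_basis G B" "generate G B = generate G S"
    using locally_free_basis[OF lf S] by metis
  have BG: "B \<subseteq> carrier G" using B by (simp add: free_basis_def)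
  have zG: "z \<in> carrier G" using generate_in_carrier[OF S(2) z(1)] .
  have one: "x = y" if xyB: "x \<in> B" "y \<in> B" for x y
  proof (rule ccontr)
    assume "x \<noteq> y"
    then obtain c where "c \<in> B" "z \<otimes> c \<noteq> c \<otimes> z"
      using free_center_trivial[OF B(1) xyB _ _ z(2)] z B(2) by metis
    then show False using commute_generate[OF zG S(2) z(3), of c] B(2) generate.incl[of c B G] by auto
  qed
  have "B \<noteq> {}"
  proof
    assume "B = {}"
    then have "generate G S = {\<one>}" using B(2) generate_empty by simp
    then show False using z by simp
  qed
  then obtain t where t: "B = {t}" using one by blast
  show ?thesis
  proof (rule that[of t])
    show "t \<in> carrier G" using t BG by simp
    show "k = 0" if "t [^] k = \<one>" for k :: int using free_basis_pow[OF B(1) _ that] t by simp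
    show "\<exists>k::int. g = t [^] k" if "g \<in> generate G S" for g
      using that B(2)[symmetric] t BG by (auto simp: generate_pow)
  qed
qed

lemma locally_free_torsion_free:
  assumes "locally_free G" "g \<in> carrier G" "m \<noteq> (0::int)" "g [^] m = \<one>"
  shows "g = \<one>"
proof (rule ccontr)
  assume "g \<noteq> \<one>"
  then obtain t where t: "t \<in> carrier G" "\<And>k::int. t [^] k = \<one> \<Longrightarrow> k = 0"
      "\<And>a. a \<in> generate G {g} \<Longrightarrow> \<exists>k::int. a = t [^] k"
    using locally_free_central_cyclic[OF assms(1), of "{g}" g] assms(2) generate.incl[of g "{g}" G] by auto
  obtain k :: int where k: "g = t [^] k" using t(3) generate.incl[of g "{g}" G] by auto
  then have "t [^] (k * m) = \<one>" using assms(4) t(1) by (simp add: int_pow_pow)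
  then show False using t(2) assms(3) k \<open>g \<noteq> \<one>\<close> by fastforce
qed

lemma locally_free_root_unique:
  assumes lf: "locally_free G" and g: "g \<in> carrier G" "h \<in> carrier G" and m: "m \<noteq> (0::int)" "g [^] m = h [^] m"
  shows "g = h"
proof (cases "g [^] m = \<one>")
  case True
  then show ?thesis using locally_free_torsion_free[OF lf g(1) m(1)] locally_free_torsion_free[OF lf g(2) m(1)] m(2) by simp
next
  case False
  have gen: "g \<in> generate G {g, h}" "h \<in> generate G {g, h}" by (auto intro: generate.incl)
  have "g [^] m \<in> generate G {g, h}"
    using subgroup_int_pow_closed[OF generate_is_subgroup gen(1)] g by simp
  moreover have "g [^] m \<otimes> s = s \<otimes> g [^] m" if "s \<in> {g, h}" for s
  proof -
    have "a [^] m \<otimes> a = a \<otimes> a [^] m" if "a \<in> carrier G" for a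
      using that int_pow_mult[of a m 1] int_pow_mult[of a 1 m] by (simp add: add.commute)
    from this[of g] this[of h] show ?thesis using that g m(2) by auto
  qed
  ultimately obtain t where t: "t \<in> carrier G" "\<And>k::int. t [^] k = \<one> \<Longrightarrow> k = 0"
      "\<And>a. a \<in> generate G {g, h} \<Longrightarrow> \<exists>k::int. a = t [^] k"
    using locally_free_central_cyclic[OF lf, of "{g, h}" "g [^] m"] g False by auto
  obtain i j :: int where ij: "g = t [^] i" "h = t [^] j" using t(3) gen by metis
  then have "t [^] ((i - j) * m) = \<one>"
    using m(2) t(1) by (simp add: int_pow_pow left_diff_distrib int_pow_diff)
  then show ?thesis using t(2) m(1) ij by fastforce
qed

text \<open>An element \<open>g\<close> commuting with \<open>h\<close> lies with it in one cyclic
  subgroup, so \<open>g^j = h^i\<close> for some nonzero \<open>j\<close>. Uniqueness of roots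
  allows one such \<open>g\<close> for each pair \<open>(i, j)\<close>.\<close>

lemma locally_free_countable_centralizer:
  assumes lf: "locally_free G" and h: "h \<in> carrier G" "h \<noteq> \<one>"
  shows "countable {g \<in> carrier G. g \<otimes> h = h \<otimes> g}"
proof -
  let ?R = "\<lambda>(i::int, j::int). {g \<in> carrier G. j \<noteq> 0 \<and> g [^] j = h [^] i}"
  have "countable (?R p)" for p
  proof (cases "?R p = {}")
    case False
    then obtain g where "g \<in> ?R p" by blast
    then have "?R p \<subseteq> {g}" using locally_free_root_unique[OF lf] by fastforce
    then show ?thesis by (meson countable_insert countable_empty countable_subset)
  qed auto
  moreover have "{g \<in> carrier G. g \<otimes> h = h \<otimes> g} \<subseteq> (\<Union>p. ?R p)"
  proof clarify
    fix g assume g: "g \<in> carrier G" "g \<otimes> h = h \<otimes> g"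
    obtain t where t: "t \<in> carrier G" "\<And>k::int. t [^] k = \<one> \<Longrightarrow> k = 0"
        "\<And>a. a \<in> generate G {g, h} \<Longrightarrow> \<exists>k::int. a = t [^] k"
    proof (rule locally_free_central_cyclic[OF lf, of "{g, h}" h])
      show "h \<otimes> s = s \<otimes> h" if "s \<in> {g, h}" for s using that g by auto
    qed (use g h generate.incl[of h "{g, h}" G] in auto)
    obtain i j :: int where ij: "g = t [^] i" "h = t [^] j"
      using t(3) generate.incl[of g "{g, h}" G] generate.incl[of h "{g, h}" G] by blast
    have "j \<noteq> 0" using ij h by auto
    moreover have "g [^] j = h [^] i" using ij t(1) by (simp add: int_pow_pow mult.commute)
    ultimately show "g \<in> (\<Union>p. ?R p)" using g by auto
  qed
  ultimately show ?thesis by (meson countable_UN countable_subset countableI_type)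
qed

lemma locally_free_countable_conjugators:
  assumes lf: "locally_free G" and h: "h \<in> carrier G" "h \<noteq> \<one>" "h' \<in> carrier G"
  shows "countable {g \<in> carrier G. g \<otimes> h = h' \<otimes> g}" (is "countable ?C")
proof (cases "?C = {}")
  case False
  then obtain a where a: "a \<in> carrier G" "a \<otimes> h = h' \<otimes> a" by blast
  have "?C \<subseteq> (\<lambda>c. a \<otimes> c) ` {g \<in> carrier G. g \<otimes> h = h \<otimes> g}"
  proof
    fix g assume "g \<in> ?C"
    then have g: "g \<in> carrier G" and gh: "g \<otimes> h = h' \<otimes> g" by blast+
    have "inv a \<otimes> h' = inv a \<otimes> (h' \<otimes> a) \<otimes> inv a" using a(1) h by (simp add: m_assoc)
    also have "\<dots> = h \<otimes> inv a" unfolding a(2)[symmetric] using a(1) h by (simp add: m_assoc[symmetric])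
    finally have ah: "inv a \<otimes> h' = h \<otimes> inv a" .
    have "inv a \<otimes> g \<otimes> h = inv a \<otimes> h' \<otimes> g" using g a(1) h by (simp add: m_assoc gh)
    also have "\<dots> = h \<otimes> (inv a \<otimes> g)" using g a(1) h by (simp add: m_assoc ah)
    finally have "inv a \<otimes> g \<in> {g \<in> carrier G. g \<otimes> h = h \<otimes> g}" using g a(1) by simp
    moreover have "g = a \<otimes> (inv a \<otimes> g)" using g a(1) by (simp add: m_assoc[symmetric])
    ultimately show "g \<in> (\<lambda>c. a \<otimes> c) ` {g \<in> carrier G. g \<otimes> h = h \<otimes> g}" by blast
  qed
  then show ?thesis by (rule countable_subset) (intro countable_image locally_free_countable_centralizer lf h)
next
  case True
  then show ?thesis by (simp only: countable_empty)
qed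

text \<open>Serves to show that stabilizers of lines modulo a maximal ideal are abelian. For two
  basis elements, the commutator of \<open>x\<close> and \<open>y\<close> does not commute with that
  of the inverse of \<open>x\<close> and \<open>y\<close>.\<close>

lemma locally_free_metabelian_abelian:
  assumes lf: "locally_free G" and K: "subgroup K G" and ab: "a \<in> K" "b \<in> K"
    and metab: "\<And>p q r s. p \<in> K \<Longrightarrow> q \<in> K \<Longrightarrow> r \<in> K \<Longrightarrow> s \<in> K \<Longrightarrow>
      (p \<otimes> q \<otimes> inv (q \<otimes> p)) \<otimes> (r \<otimes> s \<otimes> inv (s \<otimes> r)) = (r \<otimes> s \<otimes> inv (s \<otimes> r)) \<otimes> (p \<otimes> q \<otimes> inv (q \<otimes> p))"
  shows "a \<otimes> b = b \<otimes> a"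
proof (rule ccontr)
  assume nc: "a \<otimes> b \<noteq> b \<otimes> a"
  have KG: "K \<subseteq> carrier G" using K subgroup.subset by blast
  then have S: "{a, b} \<subseteq> carrier G" using ab by auto
  obtain B where B: "free_basis G B" "generate G B = generate G {a, b}"
    using locally_free_basis[OF lf _ S] by auto
  have BG: "B \<subseteq> carrier G" using B by (simp add: free_basis_def)
  obtain x y where xy: "x \<in> B" "y \<in> B" "x \<noteq> y"
    using noncommuting_basis[OF BG _ _ nc] B(2) generate.incl[of a "{a,b}" G] generate.incl[of b "{a,b}" G] by auto
  have "generate G {a, b} \<subseteq> K" using generate_subgroup_incl[OF _ K] ab by auto
  then have xyK: "x \<in> K" "y \<in> K" using xy B(2) generate.incl[of _ B G] by auto
  then have xyG: "x \<in> carrier G" "y \<in> carrier G" using KG by auto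
  \<comment> \<open>The commutator of \<open>?c\<close> and \<open>?d\<close> written out, with its
    one cancelling pair, the inverse of \<open>y\<close> followed by \<open>y\<close>, removed; the
    rest is reduced.\<close>
  let ?w = "[(True,x),(True,y),(False,x),(False,y),(False,x),(True,y),(True,x),(True,x),(False,y),(False,x),
    (True,y),(False,x),(False,y),(True,x)]"
  let ?c = "x \<otimes> y \<otimes> inv (y \<otimes> x)" and ?d = "inv x \<otimes> y \<otimes> inv (y \<otimes> inv x)"
  have comm_one: "c \<otimes> d \<otimes> inv c \<otimes> inv d = \<one>" if "c \<in> carrier G" "d \<in> carrier G" "c \<otimes> d = d \<otimes> c" for c d
    unfolding that(3) using that(1,2) by (simp add: m_assoc)
  have "?c \<otimes> ?d = ?d \<otimes> ?c" using metab xyK subgroup.m_inv_closed[OF K] by blast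
  then have "?c \<otimes> ?d \<otimes> inv ?c \<otimes> inv ?d = \<one>"
    using xyG by (intro comm_one) auto
  moreover have "?c \<otimes> ?d \<otimes> inv ?c \<otimes> inv ?d = word_eval G ?w"
  proof -
    have c: "inv y \<otimes> (y \<otimes> g) = g" if "g \<in> carrier G" for g
      using that xyG by (simp add: m_assoc[symmetric])
    show ?thesis using xyG by (simp add: m_assoc inv_mult_group c)
  qed
  moreover have "word_eval G ?w \<noteq> \<one>"
    using xy by (intro free_basisD[OF B(1)]) (auto simp: reduced_word_iff)
  ultimately show False by simp
qed

lemma locally_free_infinite:
  assumes lf: "locally_free G" and x: "x \<in> carrier G" "x \<noteq> \<one>"
  shows "infinite (carrier G)"
proof -
  have "inj (\<lambda>k::int. x [^] k)"
  proof (rule injI)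
    fix i j :: int assume "x [^] i = x [^] j"
    then have "x [^] (i - j) = \<one>" using x by (simp add: int_pow_diff)
    then show "i = j" using locally_free_torsion_free[OF lf x(1), of "i - j"] x(2) by auto
  qed
  moreover have "range (\<lambda>k::int. x [^] k) \<subseteq> carrier G" using x by auto
  ultimately show ?thesis using finite_subset finite_imageD infinite_UNIV_int by metis
qed

end

section \<open>Finite actions of free groups\<close>

definition perm_group :: "'p set \<Rightarrow> ('p \<Rightarrow> 'p) monoid" where
  "perm_group P = \<lparr>carrier = {f. f permutes P}, monoid.mult = (\<circ>), one = id\<rparr>"

lemma perm_group_simps [simp]: "f \<in> carrier (perm_group P) \<longleftrightarrow> f permutes P"
  "monoid.mult (perm_group P) = (\<circ>)" "\<one>\<^bsub>perm_group P\<^esub> = id"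
  by (simp_all add: perm_group_def)

lemma group_perm_group: "group (perm_group P)"
proof (rule groupI)
  fix f assume "f \<in> carrier (perm_group P)"
  then show "\<exists>g\<in>carrier (perm_group P). g \<otimes>\<^bsub>perm_group P\<^esub> f = \<one>\<^bsub>perm_group P\<^esub>"
    by (intro bexI[of _ "Hilbert_Choice.inv f"]) (auto simp: permutes_inv permutes_inv_o)
qed (auto simp: permutes_compose permutes_id)

lemma finite_perm_group: "finite P \<Longrightarrow> finite (carrier (perm_group P))"
  by (simp add: perm_group_def finite_permutations)

lemma perm_group_inv_apply:
  assumes "f permutes P" "f x = y"
  shows "(inv\<^bsub>perm_group P\<^esub> f) y = x"
proof -
  interpret group "perm_group P" by (rule group_perm_group)
  have "inv\<^bsub>perm_group P\<^esub> f \<circ> f = id" using l_inv[of f] assms(1) by simp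
  then show ?thesis using assms(2) by (metis comp_apply id_apply)
qed

lemma partial_injection_extends:
  assumes "finite P" "D \<subseteq> P" "inj_on f D" "f ` D \<subseteq> P"
  obtains q where "q permutes P" "\<And>x. x \<in> D \<Longrightarrow> q x = f x"
proof -
  have fin: "finite (P - D)" "finite (P - f ` D)" using assms(1) by auto
  have "card (P - D) = card (P - f ` D)"
    using assms by (simp add: card_Diff_subset finite_subset card_image)
  then obtain g where g: "bij_betw g (P - D) (P - f ` D)"
    using finite_same_card_bij[OF fin] by blast
  let ?q = "\<lambda>x. if x \<in> D then f x else if x \<in> P then g x else x"
  have "bij_betw ?q (D \<union> (P - D)) (f ` D \<union> (P - f ` D))"
  proof (rule bij_betw_combine)
    show "bij_betw ?q D (f ` D)" using assms(3) by (simp add: bij_betw_def inj_on_def image_iff)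
    show "bij_betw ?q (P - D) (P - f ` D)" using g by (subst bij_betw_cong[where g = g]) auto
  qed auto
  moreover have "D \<union> (P - D) = P" "f ` D \<union> (P - f ` D) = P" using assms by auto
  ultimately have "bij_betw ?q P P" by simp
  then have "?q permutes P" using assms(2) by (intro bij_imp_permutes) auto
  then show ?thesis using that[of ?q] by auto
qed

text \<open>The group of order two, with exclusive or as multiplication, so that homomorphisms into
  it are predicates.\<close>

definition xor_group :: "bool monoid" where
  "xor_group = \<lparr>carrier = UNIV, monoid.mult = (\<noteq>), one = False\<rparr>"

lemma group_xor_group: "group xor_group"
  by (rule groupI) (auto simp: xor_group_def)

section \<open>Freeness over a subgroup; rank as a count of homomorphisms\<close>

context group
begin

text \<open>A pair \<open>(e, h)\<close> contributes \<open>y\<close> or its inverse, followed by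
  the coefficient \<open>h\<close>. With \<open>alt_red\<close>, which forbids a trivial coefficient
  between opposite powers of \<open>y\<close>, these are normal forms of a free product, rotated so
  as to begin with a power of \<open>y\<close>.\<close>

fun alt_eval :: "'a \<Rightarrow> (bool \<times> 'a) list \<Rightarrow> 'a" where
  "alt_eval y [] = \<one>"
| "alt_eval y (p # l) = (if fst p then y else inv y) \<otimes> snd p \<otimes> alt_eval y l"

abbreviation alt_red :: "(bool \<times> 'a) list \<Rightarrow> bool" where
  "alt_red \<equiv> successively (\<lambda>p q. fst p \<noteq> fst q \<longrightarrow> snd p \<noteq> \<one>)"

text \<open>For a subgroup \<open>H\<close> this says that \<open>y\<close> has infinite order and
  that \<open>H\<close> and \<open>y\<close> generate the free product of \<open>H\<close> with the
  powers of \<open>y\<close>. A leading coefficient can be conjugated to the end, so words beginning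
  with \<open>y\<close> are enough.\<close>

definition free_over :: "'a set \<Rightarrow> 'a \<Rightarrow> bool" where
  "free_over H y \<longleftrightarrow> y \<in> carrier G \<and>
     (\<forall>l. l \<noteq> [] \<and> letters l \<subseteq> H \<and> alt_red l \<longrightarrow> alt_eval y l \<noteq> \<one>)"

lemma free_over_mono: "free_over H y \<Longrightarrow> K \<subseteq> H \<Longrightarrow> free_over K y"
  unfolding free_over_def by (meson order_trans)

text \<open>Every coefficient is replaced by its reduced word over \<open>B\<close>. These words do
  not contain \<open>z\<close>, so cancellation could occur only across an empty one, which is the
  case that \<open>alt_red\<close> excludes.\<close>

lemma free_basis_insert_free_over:
  assumes B: "free_basis G (insert z B)" and z: "z \<notin> B"
  shows "free_over (generate G B) z"
proof -
  have BG: "B \<subseteq> carrier G" "z \<in> carrier G" using B by (auto simp: free_basis_def)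
  have "\<forall>h\<in>generate G B. \<exists>w. letters w \<subseteq> B \<and> reduced_word w \<and> word_eval G w = h"
    using reduced_word_exists[OF BG(1)] by metis
  then obtain wd where wd: "\<And>h. h \<in> generate G B \<Longrightarrow>
      letters (wd h) \<subseteq> B \<and> reduced_word (wd h) \<and> word_eval G (wd h) = h" by metis
  define W where "W l = concat (map (\<lambda>(e, h). (e, z) # wd h) l)" for l
  have W_simps: "W [] = []" "W (p # l) = (fst p, z) # wd (snd p) @ W l" for p l
    by (auto simp: W_def split: prod.splits)
  have W: "letters (W l) \<subseteq> insert z B \<and> reduced_word (W l) \<and> word_eval G (W l) = alt_eval z l \<and>
      (l \<noteq> [] \<longrightarrow> W l \<noteq> [] \<and> hd (W l) = (fst (hd l), z))"
    if "letters l \<subseteq> generate G B" "alt_red l" for l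
    using that
  proof (induction l)
    case Nil
    then show ?case by (simp add: W_simps reduced_word_iff)
  next
    case (Cons p l)
    then have IH: "letters (W l) \<subseteq> insert z B" "reduced_word (W l)" "word_eval G (W l) = alt_eval z l"
        "l \<noteq> [] \<longrightarrow> W l \<noteq> [] \<and> hd (W l) = (fst (hd l), z)"
      by (auto simp: successively_Cons)
    have p: "letters (wd (snd p)) \<subseteq> B" "reduced_word (wd (snd p))" "word_eval G (wd (snd p)) = snd p"
      using wd Cons.prems by auto
    have zl: "snd q \<noteq> z" if "q \<in> set (wd (snd p))" for q
      using p(1) z that by (auto simp: letters_def)
    have "successively no_cancel (wd (snd p) @ W l)"
    proof (cases "l = [] \<or> wd (snd p) = []")
      case True
      then show ?thesis using IH p by (auto simp: reduced_word_iff W_simps)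
    next
      case False
      then show ?thesis using IH p zl[of "last (wd (snd p))"]
        by (auto simp: reduced_word_iff successively_append_iff)
    qed
    moreover have "no_cancel (fst p, z) (hd (wd (snd p) @ W l))" if "wd (snd p) @ W l \<noteq> []"
    proof (cases "wd (snd p) = []")
      case True
      then have "snd p = \<one>" "l \<noteq> []" using p that by (auto simp: W_simps)
      then show ?thesis using Cons.prems IH True by (auto simp: successively_Cons)
    next
      case False
      then show ?thesis using zl[of "hd (wd (snd p))"] by auto
    qed
    moreover have "word_eval G (wd (snd p) @ W l) = snd p \<otimes> alt_eval z l"
      using p IH BG by (subst word_eval_append) auto
    moreover have "snd p \<in> carrier G" "alt_eval z l \<in> carrier G"
      using p IH BG by (metis word_eval_closed order_trans insert_subset)+
    ultimately show ?case
      using IH p BG by (auto simp: W_simps reduced_word_iff successively_Cons m_assoc)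
  qed
  show ?thesis unfolding free_over_def
  proof (intro conjI allI impI)
    fix l assume l: "l \<noteq> [] \<and> letters l \<subseteq> generate G B \<and> alt_red l"
    then show "alt_eval z l \<noteq> \<one>" using W[of l] free_basisD[OF B, of "W l"] by auto
  qed (use BG in auto)
qed

lemma generate_insert_cong:
  assumes "generate G A = generate G B" "A \<subseteq> carrier G" "B \<subseteq> carrier G" "z \<in> carrier G"
  shows "generate G (insert z A) = generate G (insert z B)"
proof -
  have *: "generate G (insert z A) \<subseteq> generate G (insert z B)"
    if "generate G A = generate G B" "A \<subseteq> carrier G" "B \<subseteq> carrier G" for A B
  proof (rule generate_subgroup_incl)
    have "generate G B \<subseteq> generate G (insert z B)" using that assms(4) by (intro mono_generate) auto
    then show "insert z A \<subseteq> generate G (insert z B)"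
      using that generate.incl[of _ A G] generate.incl[of z "insert z B" G] by auto
  qed (use that assms(4) generate_is_subgroup in auto)
  show ?thesis using *[OF assms(1-3)] *[OF assms(1)[symmetric] assms(3,2)] by blast
qed

text \<open>Homomorphisms to the group of order two, set to \<open>False\<close> off
  \<open>H\<close> so that they are counted without repetition. A free group of rank
  \<open>n\<close> has \<open>2^n\<close> of them, which gives a notion of rank that mentions no
  basis.\<close>

definition Hom2 :: "'a set \<Rightarrow> ('a \<Rightarrow> bool) set" where
  "Hom2 H = {f. (\<forall>x\<in>H. \<forall>y\<in>H. f (x \<otimes> y) \<longleftrightarrow> f x \<noteq> f y) \<and> (\<forall>x. x \<notin> H \<longrightarrow> \<not> f x)}"

lemma Hom2_inj:
  assumes S: "S \<subseteq> carrier G"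
  shows "inj_on (\<lambda>f. {s \<in> S. f s}) (Hom2 (generate G S))"
proof (rule inj_onI)
  fix f g assume fg: "f \<in> Hom2 (generate G S)" "g \<in> Hom2 (generate G S)" "{s \<in> S. f s} = {s \<in> S. g s}"
  note gs = generate_is_subgroup[OF S]
  have hom_one: "\<not> f \<one>" if "f \<in> Hom2 (generate G S)" for f
    using that generate.one[of G S] by (force simp: Hom2_def)
  have hom_inv: "f (inv x) = f x" if "f \<in> Hom2 (generate G S)" "x \<in> generate G S" for f x
  proof -
    have "f (x \<otimes> inv x) \<longleftrightarrow> f x \<noteq> f (inv x)"
      using that generate_m_inv_closed[OF S that(2)] by (simp add: Hom2_def)
    then show ?thesis using hom_one[OF that(1)] generate_in_carrier[OF S that(2)] by simp
  qed
  have S_eq: "f s = g s" if "s \<in> S" for s using arg_cong[OF fg(3), of "\<lambda>A. s \<in> A"] that by simp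
  have "f x = g x" if "x \<in> generate G S" for x
    using that
  proof induction
    case one
    then show ?case using hom_one[OF fg(1)] hom_one[OF fg(2)] by simp
  next
    case (incl h)
    then show ?case by (rule S_eq)
  next
    case (inv h)
    then show ?case using hom_inv[OF fg(1)] hom_inv[OF fg(2)] S_eq generate.incl[of h S G] by simp
  next
    case (eng a b)
    then show ?case using fg(1,2) by (auto simp: Hom2_def)
  qed
  moreover have "f x = g x" if "x \<notin> generate G S" for x using fg(1,2) that by (simp add: Hom2_def)
  ultimately show "f = g" by blast
qed

lemma Hom2_card_le:
  assumes "S \<subseteq> carrier G" "finite S"
  shows "finite (Hom2 (generate G S))" "card (Hom2 (generate G S)) \<le> 2 ^ card S"
proof -
  have sub: "(\<lambda>f. {s \<in> S. f s}) ` Hom2 (generate G S) \<subseteq> Pow S" by auto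
  show "finite (Hom2 (generate G S))"
    using finite_imageD[OF _ Hom2_inj] sub assms finite_subset finite_Pow_iff by metis
  show "card (Hom2 (generate G S)) \<le> 2 ^ card S"
    using card_mono[OF _ sub] card_image[OF Hom2_inj] assms by (simp add: card_Pow)
qed

lemma Hom2_card_free:
  assumes B: "free_basis G B" "finite B"
  shows "card (Hom2 (generate G B)) = 2 ^ card B"
proof -
  have BG: "B \<subseteq> carrier G" using B by (simp add: free_basis_def)
  have "Pow B \<subseteq> (\<lambda>f. {s \<in> B. f s}) ` Hom2 (generate G B)"
  proof
    fix T assume T: "T \<in> Pow B"
    have "(\<lambda>b. b \<in> T) ` B \<subseteq> carrier xor_group" by (simp add: xor_group_def)
    from free_basis_hom_extend[OF B(1) group_xor_group this] obtain \<phi>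
      where \<phi>: "\<phi> \<in> hom (G\<lparr>carrier := generate G B\<rparr>) xor_group" "\<And>b. b \<in> B \<Longrightarrow> \<phi> b = (b \<in> T)"
      by metis
    let ?f = "\<lambda>x. x \<in> generate G B \<and> \<phi> x"
    have "?f \<in> Hom2 (generate G B)"
      using \<phi>(1) by (auto simp: Hom2_def hom_def xor_group_def generate.eng)
    moreover have "{s \<in> B. ?f s} = T" using \<phi>(2) T generate.incl[of _ B G] by auto
    ultimately show "T \<in> (\<lambda>f. {s \<in> B. f s}) ` Hom2 (generate G B)"
      by (intro image_eqI[of _ _ ?f]) simp_all
  qed
  then have "card (Pow B) \<le> card (Hom2 (generate G B))"
    using surj_card_le[OF Hom2_card_le(1)[OF BG B(2)]] by simp
  then show ?thesis using Hom2_card_le(2)[OF BG B(2)] B(2) by (simp add: card_Pow)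
qed

lemma hom_word_eval:
  assumes Q: "group Q" and H: "subgroup H G" and \<phi>: "\<phi> \<in> hom (G\<lparr>carrier := H\<rparr>) Q" and "letters w \<subseteq> H"
  shows "\<phi> (word_eval G w) = word_eval Q (map (map_prod id \<phi>) w)"
proof -
  interpret h: group_hom "G\<lparr>carrier := H\<rparr>" Q \<phi>
    using Q \<phi> subgroup.subgroup_is_group[OF H is_group] by (simp add: group_hom_def group_hom_axioms_def)
  have inv: "\<phi> (inv x) = inv\<^bsub>Q\<^esub> \<phi> x" if "x \<in> H" for x
    using h.hom_inv[of x] that m_inv_consistent[OF H that] by simp
  have "word_eval G w \<in> H \<and> \<phi> (word_eval G w) = word_eval Q (map (map_prod id \<phi>) w)"
    using assms(4)
  proof (induction w)
    case (Cons p w)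
    then show ?case
      using h.hom_mult inv subgroup.m_inv_closed[OF H] subgroup.m_closed[OF H] by auto
  qed (use h.hom_one subgroup.one_closed[OF H] in auto)
  then show ?thesis by simp
qed

text \<open>M. Hall's theorem: the action on the cosets occurring along finitely many words is completed
  to a finite permutation action.\<close>

lemma free_subgroup_separable:
  assumes B: "free_basis G B" and X: "finite X" "X \<subseteq> generate G B"
    and z: "z \<in> generate G B" "z \<notin> generate G X"
  obtains P :: "'a set set" and p \<phi> where "finite P" "p \<in> P"
    "\<phi> \<in> hom (G\<lparr>carrier := generate G B\<rparr>) (perm_group P)"
    "\<And>x. x \<in> X \<Longrightarrow> \<phi> x p = p" "\<phi> z p \<noteq> p"
proof -
  have BG: "B \<subseteq> carrier G" using B by (simp add: free_basis_def)
  have XG: "X \<subseteq> carrier G" using X generate_in_carrier[OF BG] by auto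
  define H where "H = generate G X"
  have H: "subgroup H G" unfolding H_def by (rule generate_is_subgroup[OF XG])
  have HG: "H \<subseteq> carrier G" using H subgroup.subset by auto
  have "\<forall>g\<in>insert z X. \<exists>w. letters w \<subseteq> B \<and> word_eval G w = g"
    using X(2) z(1) BG by (force simp: generate_eq_words)
  then obtain wd where wd: "\<And>g. g \<in> insert z X \<Longrightarrow> letters (wd g) \<subseteq> B \<and> word_eval G (wd g) = g" by metis
  \<comment> \<open>Suffixes, because a word acts on the point \<open>H\<close> from its right end.
    With all of them in \<open>P\<close>, each chosen word can be followed without leaving
    \<open>P\<close>.\<close>
  define P where "P = (\<lambda>(g, n). word_eval G (drop n (wd g)) <# H) ` (SIGMA g:insert z X. {..length (wd g)})"
  have finP: "finite P" using X(1) by (auto simp: P_def)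
  have drop_wd: "letters (drop n (wd g)) \<subseteq> B" if "g \<in> insert z X" for g n
    using wd[OF that] by (auto simp: letters_def dest: in_set_dropD)
  have PG: "c \<subseteq> carrier G" if "c \<in> P" for c
  proof -
    obtain r where r: "r \<in> (SIGMA g:insert z X. {..length (wd g)})"
        "c = (\<lambda>(g, n). word_eval G (drop n (wd g)) <# H) r"
      using \<open>c \<in> P\<close> unfolding P_def by (rule imageE)
    obtain g n where "r = (g, n)" by (cases r)
    then have "g \<in> insert z X" "c = word_eval G (drop n (wd g)) <# H" using r by auto
    then show ?thesis using drop_wd[of g n] BG HG l_coset_subset_G by auto
  qed
  have pP: "H \<in> P"
  proof -
    have "H = word_eval G (drop (length (wd z)) (wd z)) <# H" using HG by (simp add: lcos_mult_one)
    then show ?thesis unfolding P_def by (intro image_eqI[of _ _ "(z, length (wd z))"]) auto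
  qed
  \<comment> \<open>Left multiplication by \<open>b\<close> is injective on the cosets that it keeps
    inside \<open>P\<close>. How this partial injection is completed to a permutation does not
    matter along the chosen words.\<close>
  have "\<exists>q. q permutes P \<and> (\<forall>c\<in>P. b <# c \<in> P \<longrightarrow> q c = b <# c)" if b: "b \<in> B" for b
  proof -
    have bG: "b \<in> carrier G" using b BG by auto
    have "inj_on (\<lambda>c. b <# c) {c \<in> P. b <# c \<in> P}"
    proof (rule inj_onI)
      fix c d assume cd: "c \<in> {c \<in> P. b <# c \<in> P}" "d \<in> {c \<in> P. b <# c \<in> P}" "b <# c = b <# d"
      have e: "inv b <# (b <# e) = e" if "e \<in> P" for e
        using PG[OF that] bG by (simp add: lcos_m_assoc lcos_mult_one)
      have "c \<in> P" "d \<in> P" using cd(1,2) by blast+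
      then show "c = d" using e[of c] e[of d] unfolding cd(3) by (rule_tac trans[OF sym])
    qed
    then obtain q where "q permutes P" "\<And>c. c \<in> {c \<in> P. b <# c \<in> P} \<Longrightarrow> q c = b <# c"
      by (rule partial_injection_extends[OF finP, rotated]) auto
    then show ?thesis by (intro exI[of _ q]) simp
  qed
  then obtain q where q: "\<And>b. b \<in> B \<Longrightarrow> q b permutes P" "\<And>b c. b \<in> B \<Longrightarrow> c \<in> P \<Longrightarrow> b <# c \<in> P \<Longrightarrow> q b c = b <# c"
    by metis
  have "q ` B \<subseteq> carrier (perm_group P)" using q(1) by auto
  from free_basis_hom_extend[OF B group_perm_group this] obtain \<phi>
    where \<phi>: "\<phi> \<in> hom (G\<lparr>carrier := generate G B\<rparr>) (perm_group P)"
      "\<And>w. letters w \<subseteq> B \<Longrightarrow> \<phi> (word_eval G w) = word_eval (perm_group P) (map (map_prod id q) w)"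
    by metis
  have act: "word_eval (perm_group P) (map (map_prod id q) (drop n (wd g))) H = word_eval G (drop n (wd g)) <# H"
    if g: "g \<in> insert z X" and "n \<le> length (wd g)" for g n
    using that(2)
  proof (induction "length (wd g) - n" arbitrary: n)
    case 0
    then show ?case using HG by (simp add: lcos_mult_one)
  next
    case (Suc m)
    then have n: "n < length (wd g)" by simp
    define p where "p = wd g ! n"
    let ?c = "word_eval G (drop (Suc n) (wd g)) <# H" and ?d = "word_eval G (drop n (wd g)) <# H"
    have dr: "drop n (wd g) = p # drop (Suc n) (wd g)" using n by (simp add: p_def Cons_nth_drop_Suc)
    have b: "snd p \<in> B" using drop_wd[OF g, of n] unfolding dr by simp
    then have bG: "snd p \<in> carrier G" using BG by auto
    have cP: "?c \<in> P" unfolding P_def using g n by (intro image_eqI[of _ _ "(g, Suc n)"]) auto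
    have dP: "?d \<in> P" unfolding P_def using g n by (intro image_eqI[of _ _ "(g, n)"]) auto
    have vG: "word_eval G (drop (Suc n) (wd g)) \<in> carrier G" using drop_wd[OF g] BG by (intro word_eval_closed) auto
    have IH: "word_eval (perm_group P) (map (map_prod id q) (drop (Suc n) (wd g))) H = ?c"
      using Suc n by auto
    show ?case
    proof (cases "fst p")
      case True
      then have "?d = snd p <# ?c" using vG bG HG by (simp add: dr lcos_m_assoc)
      then show ?thesis using True IH q(2)[OF b cP] dP by (simp add: dr)
    next
      case False
      then have "?d = inv (snd p) <# ?c" using vG bG HG by (simp add: dr lcos_m_assoc)
      then have "snd p <# ?d = ?c" using bG PG[OF cP] by (simp add: lcos_m_assoc lcos_mult_one)
      then have "q (snd p) ?d = ?c" using q(2)[OF b dP] cP by simp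
      then have "(inv\<^bsub>perm_group P\<^esub> (q (snd p))) ?c = ?d" by (rule perm_group_inv_apply[OF q(1)[OF b]])
      then show ?thesis using False IH by (simp add: dr)
    qed
  qed
  have act: "\<phi> g H = g <# H" if "g \<in> insert z X" for g
    using act[OF that, of 0] wd[OF that] \<phi>(2)[of "wd g"] by simp
  show ?thesis
  proof (rule that[OF finP pP \<phi>(1)])
    show "\<phi> x H = H" if "x \<in> X" for x
      using act[of x] that generate.incl[OF that, of G] coset_join3[of x H] H XG by (auto simp: H_def)
    have "z \<in> z <# H" using z(1) generate_in_carrier[OF BG] subgroup.one_closed[OF H]
      by (force simp: l_coset_def)
    then show "\<phi> z H \<noteq> H" using act[of z] z(2) by (auto simp: H_def)
  qed
qed

text \<open>Free groups of finite rank are Hopfian, by counting. Homomorphisms to a finite group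
  \<open>Q\<close> are determined by their values on \<open>S\<close>, and there are
  \<open>|Q|^n\<close> of them, so all maps from \<open>S\<close> to \<open>Q\<close> occur. A
  relation \<open>w\<close> on \<open>S\<close> would then hold for all values in \<open>Q\<close>,
  whereas for a suitable \<open>Q\<close> the corresponding word in \<open>B\<close>
  survives.\<close>

lemma generating_set_free:
  assumes B: "free_basis G B" "finite B" and S: "finite S" "S \<subseteq> carrier G" "generate G S = generate G B"
    and c: "card S = card B"
  shows "free_basis G S"
  unfolding free_basis_def letters_def[symmetric] set_map
proof safe
  fix w :: "(bool \<times> 'a) list" assume w: "w \<noteq> []" "letters w \<subseteq> S" "reduced_word w" "word_eval G w = \<one>"
  have BG: "B \<subseteq> carrier G" using B by (simp add: free_basis_def)
  obtain \<beta> where \<beta>: "bij_betw \<beta> S B" using finite_same_card_bij[OF S(1) B(2) c] by blast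
  let ?w = "map (map_prod id \<beta>) w"
  have "reduced_word ?w" using w(2,3) bij_betw_imp_inj_on[OF \<beta>]
    unfolding reduced_word_iff successively_map
    by (auto elim!: successively_mono simp: letters_def inj_on_def subset_iff)
  moreover have lw: "letters ?w \<subseteq> B" using w(2) \<beta> by (auto simp: bij_betw_def)
  ultimately have ne: "word_eval G ?w \<noteq> \<one>" using w(1) by (intro free_basisD[OF B(1)]) auto
  have w1: "word_eval G ?w \<in> generate G B" using lw unfolding generate_eq_words[OF BG] by blast
  \<comment> \<open>Separation from the trivial subgroup is residual finiteness.\<close>
  have w2: "word_eval G ?w \<notin> generate G {}" using ne generate_empty by auto
  from free_subgroup_separable[OF B(1) finite.emptyI empty_subsetI w1 w2]
  obtain P :: "'a set set" and p \<phi> where P: "finite P"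
    "\<phi> \<in> hom (G\<lparr>carrier := generate G B\<rparr>) (perm_group P)" "\<phi> (word_eval G ?w) p \<noteq> p"
    by metis
  let ?Q = "carrier (perm_group P)"
  have finQ: "finite ?Q" by (rule finite_perm_group[OF P(1)])
  have BgB: "B \<subseteq> generate G B" and SgB: "S \<subseteq> generate G B"
    using generate.incl[of _ B G] generate.incl[of _ S G] S(3) by auto
  let ?L = "G\<lparr>carrier := generate G B\<rparr>"
  let ?HH = "hom ?L (perm_group P)"
  have ext: "\<exists>\<psi>\<in>?HH. \<forall>b\<in>B. \<psi> b = f b" if "f \<in> B \<rightarrow> ?Q" for f
  proof -
    have "f ` B \<subseteq> ?Q" using that by auto
    from free_basis_hom_extend[OF B(1) group_perm_group this] show ?thesis by metis
  qed
  define \<Psi> where "\<Psi> f = restrict (SOME \<psi>. \<psi> \<in> ?HH \<and> (\<forall>b\<in>B. \<psi> b = f b)) S" for f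
  have \<Psi>: "\<exists>\<psi>\<in>?HH. (\<forall>b\<in>B. \<psi> b = f b) \<and> \<Psi> f = restrict \<psi> S" if "f \<in> B \<rightarrow> ?Q" for f
    unfolding \<Psi>_def using someI_ex[of "\<lambda>\<psi>. \<psi> \<in> ?HH \<and> (\<forall>b\<in>B. \<psi> b = f b)"] ext[OF that] by blast
  have sg: "subgroup (generate G B) G" by (rule generate_is_subgroup[OF BG])
  have "inj_on \<Psi> (B \<rightarrow>\<^sub>E ?Q)"
  proof (rule inj_onI)
    fix f g assume fg: "f \<in> B \<rightarrow>\<^sub>E ?Q" "g \<in> B \<rightarrow>\<^sub>E ?Q" "\<Psi> f = \<Psi> g"
    obtain \<psi> where \<psi>: "\<psi> \<in> ?HH" "\<forall>b\<in>B. \<psi> b = f b" "\<Psi> f = restrict \<psi> S" using \<Psi>[of f] fg by auto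
    obtain \<chi> where \<chi>: "\<chi> \<in> ?HH" "\<forall>b\<in>B. \<chi> b = g b" "\<Psi> g = restrict \<chi> S" using \<Psi>[of g] fg by auto
    have eq: "\<psi> s = \<chi> s" if "s \<in> S" for s using fg(3) \<psi>(3) \<chi>(3) that by (metis restrict_apply')
    have "f b = g b" if b: "b \<in> B" for b
    proof -
      obtain v where v: "letters v \<subseteq> S" "word_eval G v = b"
        using BgB b unfolding S(3)[symmetric] generate_eq_words[OF S(2)] by blast
      have "\<psi> b = word_eval (perm_group P) (map (map_prod id \<psi>) v)"
        using hom_word_eval[OF group_perm_group sg \<psi>(1), of v] v SgB by auto
      also have "map (map_prod id \<psi>) v = map (map_prod id \<chi>) v"
        using v(1) eq by (auto simp: letters_def)
      also have "word_eval (perm_group P) \<dots> = \<chi> b"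
        using hom_word_eval[OF group_perm_group sg \<chi>(1), of v] v SgB by auto
      finally show ?thesis using \<psi>(2) \<chi>(2) b by simp
    qed
    then show "f = g" using fg by (metis PiE_ext)
  qed
  moreover have "\<Psi> ` (B \<rightarrow>\<^sub>E ?Q) \<subseteq> S \<rightarrow>\<^sub>E ?Q"
  proof clarify
    fix f assume "f \<in> B \<rightarrow>\<^sub>E ?Q"
    then obtain \<psi> where "\<psi> \<in> ?HH" "\<Psi> f = restrict \<psi> S" using \<Psi>[of f] by auto
    then show "\<Psi> f \<in> S \<rightarrow>\<^sub>E ?Q" using SgB by (auto simp: hom_def)
  qed
  moreover have "card (B \<rightarrow>\<^sub>E ?Q) = card (S \<rightarrow>\<^sub>E ?Q)" using c S(1) B(2) by (simp add: card_PiE)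
  moreover have "finite (S \<rightarrow>\<^sub>E ?Q)" using S(1) finQ by (simp add: finite_PiE)
  \<comment> \<open>An injection between finite sets of equal size; the hypothesis
    \<open>card S = card B\<close> enters here.\<close>
  ultimately have surj: "\<Psi> ` (B \<rightarrow>\<^sub>E ?Q) = S \<rightarrow>\<^sub>E ?Q"
    by (metis card_image card_subset_eq)
  \<comment> \<open>The homomorphism sending each \<open>s\<close> to the image of its partner
    \<open>\<beta> s\<close> takes \<open>w\<close> to the image of the surviving word, although
    \<open>w\<close> evaluates to \<open>\<one>\<close>.\<close>
  have "restrict (\<phi> \<circ> \<beta>) S \<in> S \<rightarrow>\<^sub>E ?Q"
  proof -
    have "\<phi> (\<beta> s) \<in> ?Q" if "s \<in> S" for s
    proof -
      have "\<beta> s \<in> carrier ?L" using bij_betwE[OF \<beta>] BgB that by auto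
      then show ?thesis by (rule hom_in_carrier[OF P(2)])
    qed
    then show ?thesis by auto
  qed
  then have "restrict (\<phi> \<circ> \<beta>) S \<in> \<Psi> ` (B \<rightarrow>\<^sub>E ?Q)" unfolding surj .
  then obtain f where f: "restrict (\<phi> \<circ> \<beta>) S = \<Psi> f" "f \<in> B \<rightarrow>\<^sub>E ?Q" by (rule imageE)
  then obtain \<psi> where \<psi>: "\<psi> \<in> ?HH" "restrict \<psi> S = restrict (\<phi> \<circ> \<beta>) S" using \<Psi>[of f] by force
  have e: "\<psi> s = \<phi> (\<beta> s)" if "s \<in> S" for s using fun_cong[OF \<psi>(2), of s] that by simp
  have "\<psi> (word_eval G w) = word_eval (perm_group P) (map (map_prod id \<psi>) w)"
    using hom_word_eval[OF group_perm_group sg \<psi>(1), of w] w SgB by auto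
  also have "map (map_prod id \<psi>) w = map (map_prod id \<phi>) ?w"
    using w(2) e by (auto simp: letters_def)
  also have "word_eval (perm_group P) \<dots> = \<phi> (word_eval G ?w)"
    using hom_word_eval[OF group_perm_group sg P(2), of ?w] lw BgB by auto
  finally have "\<phi> (word_eval G ?w) = \<psi> \<one>" using w(4) by simp
  also have "\<psi> \<one> = id"
    using hom_word_eval[OF group_perm_group sg \<psi>(1), of "[]"] by simp
  finally show False using P(3) by simp
qed (use S in auto)

end

section \<open>Rank under adjunction; elements free over finitely generated subgroups\<close>

context group
begin

text \<open>If the rank grew, \<open>B\<close> with \<open>z\<close> added would generate a free
  group of rank \<open>card B + 1\<close> and have exactly that many elements. By the Hopf property
  it is a basis, which makes \<open>z\<close> free over the subgroup.\<close>

lemma Hom2_card_insert_le: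
  assumes lf: "locally_free G" and X: "finite X" "X \<subseteq> carrier G" and z: "z \<in> carrier G"
    and nf: "\<not> free_over (generate G X) z"
  shows "card (Hom2 (generate G (insert z X))) \<le> card (Hom2 (generate G X))"
proof -
  obtain B where B: "finite B" "free_basis G B" "generate G B = generate G X"
    using locally_free_basis[OF lf X] by blast
  have zX: "finite (insert z X)" "insert z X \<subseteq> carrier G" using X z by auto
  obtain C where C: "finite C" "free_basis G C" "generate G C = generate G (insert z X)"
    using locally_free_basis[OF lf zX] by blast
  have BG: "B \<subseteq> carrier G" using B by (simp add: free_basis_def)
  have gen: "generate G (insert z B) = generate G C"
    using generate_insert_cong[OF B(3) BG X(2) z] C(3) by simp
  have zB: "finite (insert z B)" "insert z B \<subseteq> carrier G" using B BG z by auto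
  have "card (Hom2 (generate G C)) \<le> 2 ^ card (insert z B)"
    using Hom2_card_le(2)[OF zB(2,1)] gen by simp
  then have le: "card C \<le> card (insert z B)"
    using Hom2_card_free[OF C(2,1)] by simp
  have "card C \<le> card B"
  proof (rule ccontr)
    assume "\<not> card C \<le> card B"
    then have "card (insert z B) = card C" "z \<notin> B"
      using le B(1) by (auto simp: card_insert_if split: if_splits)
    then have "free_basis G (insert z B)"
      using generating_set_free[OF C(2,1) zB gen] by simp
    then have "free_over (generate G X) z"
      using free_basis_insert_free_over[OF _ \<open>z \<notin> B\<close>] B(3) by simp
    then show False using nf by simp
  qed
  then show ?thesis using Hom2_card_free[OF C(2,1)] Hom2_card_free[OF B(2,1)] B(3) C(3) by simp
qed

text \<open>The Schreier bound: a point stabilizer of a transitive action of a free group of rank \<open>n\<close> on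
  \<open>k\<close> points has rank \<open>(n - 1) k + 1\<close>. Only the lower bound is needed; it comes from the
  \<open>2\<^sup>n\<^sup>k\<close> lifts of the action to the product with a two-element set.\<close>

lemma stabilizer_Hom2_card:
  assumes B: "free_basis G B" "finite B" "2 \<le> card B"
    and P: "finite P" "p \<in> P" and \<phi>: "\<phi> \<in> hom (G\<lparr>carrier := generate G B\<rparr>) (perm_group P)"
    and z: "z \<in> generate G B" "\<phi> z p \<noteq> p"
    and X: "finite X" "X \<subseteq> generate G B" "\<And>x. x \<in> X \<Longrightarrow> \<phi> x p = p"
  obtains Y where "finite Y" "Y \<subseteq> generate G B" "2 ^ card B < card (Hom2 (generate G (X \<union> Y)))"
proof -
  define L where "L = generate G B"
  have BG: "B \<subseteq> carrier G" using B by (simp add: free_basis_def)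
  have L: "subgroup L G" unfolding L_def by (rule generate_is_subgroup[OF BG])
  have LG: "L \<subseteq> carrier G" using L subgroup.subset by auto
  have BL: "b \<in> L" if "b \<in> B" for b using that generate.incl[of b B G] by (simp add: L_def)
  have Lm: "g \<otimes> h \<in> L" if "g \<in> L" "h \<in> L" for g h using subgroup.m_closed[OF L that] .
  have Li: "inv g \<in> L" if "g \<in> L" for g using subgroup.m_inv_closed[OF L that] .
  have \<phi>m: "\<phi> (g \<otimes> h) x = \<phi> g (\<phi> h x)" if "g \<in> L" "h \<in> L" for g h x
    using \<phi> that by (simp add: hom_def L_def)
  have \<phi>p: "\<phi> g permutes P" if "g \<in> L" for g
    using hom_in_carrier[OF \<phi>, of g] that by (simp add: L_def)
  have \<phi>1: "\<phi> \<one> = id"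
    using hom_word_eval[OF group_perm_group L, of \<phi> P "[]"] \<phi> by (simp add: L_def)
  have \<phi>i: "\<phi> g (\<phi> (inv g) x) = x" "\<phi> (inv g) (\<phi> g x) = x" if "g \<in> L" for g x
    using \<phi>m[OF that Li[OF that]] \<phi>m[OF Li[OF that] that] that LG \<phi>1
    by (metis r_inv l_inv id_apply subsetD)+
  define Orb where "Orb = (\<lambda>g. \<phi> g p) ` L"
  have OP: "Orb \<subseteq> P" using \<phi>p P(2) by (auto simp: Orb_def permutes_in_image)
  have finO: "finite Orb" using OP P(1) finite_subset by blast
  have pO: "p \<in> Orb" unfolding Orb_def using \<phi>1 subgroup.one_closed[OF L] by (intro image_eqI[of _ _ \<one>]) auto
  have zO: "\<phi> z p \<in> Orb" using z by (auto simp: Orb_def L_def)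
  have k2: "2 \<le> card Orb"
  proof -
    have "card {p, \<phi> z p} \<le> card Orb" using pO zO finO by (intro card_mono) auto
    then show ?thesis using z(2) by simp
  qed
  have Om: "\<phi> g x \<in> Orb" if gx: "g \<in> L" "x \<in> Orb" for g x
  proof -
    obtain h where "h \<in> L" "x = \<phi> h p" using gx(2) unfolding Orb_def by blast
    then show ?thesis unfolding Orb_def using gx(1) \<phi>m Lm by (intro image_eqI[of _ _ "g \<otimes> h"]) auto
  qed
  \<comment> \<open>A transversal of the stabilizer of \<open>p\<close>. Normalizing it to
    \<open>\<one>\<close> at \<open>p\<close> leaves \<open>card Orb - 1\<close> free bits in the
    count below, not \<open>card Orb\<close>.\<close>
  have "\<forall>x\<in>Orb. \<exists>g\<in>L. \<phi> g p = x \<and> (x = p \<longrightarrow> g = \<one>)"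
    using \<phi>1 subgroup.one_closed[OF L] unfolding Orb_def by (metis id_apply imageE)
  then obtain q where q: "\<And>x. x \<in> Orb \<Longrightarrow> q x \<in> L" "\<And>x. x \<in> Orb \<Longrightarrow> \<phi> (q x) p = x" "q p = \<one>"
    using pO by metis
  \<comment> \<open>The Schreier generators of the stabilizer.\<close>
  define sg where "sg b x = inv (q (\<phi> b x)) \<otimes> b \<otimes> q x" for b x
  have sgL: "sg b x \<in> L" if "b \<in> B" "x \<in> Orb" for b x
    using that BL q(1) Om Lm Li by (simp add: sg_def)
  have sgp: "\<phi> (sg b x) p = p" if "b \<in> B" "x \<in> Orb" for b x
  proof -
    have "\<phi> (sg b x) p = \<phi> (inv (q (\<phi> b x))) (\<phi> b x)"
      using that BL q Om Lm Li by (simp add: sg_def \<phi>m)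
    also have "\<dots> = \<phi> (inv (q (\<phi> b x))) (\<phi> (q (\<phi> b x)) p)" using that q(2) BL Om by simp
    also have "\<dots> = p" using that q(1) BL Om by (simp add: \<phi>i)
    finally show ?thesis .
  qed
  define Y where "Y = (\<lambda>(b, x). sg b x) ` (B \<times> Orb)"
  have Y: "finite Y" "Y \<subseteq> L" using B(2) finO sgL by (auto simp: Y_def)
  define K where "K = generate G (X \<union> Y)"
  have XYL: "X \<union> Y \<subseteq> L" using X(2) Y(2) by (auto simp: L_def)
  have KL: "K \<subseteq> L" unfolding K_def by (rule generate_subgroup_incl[OF XYL L])
  have Kp: "\<phi> g p = p" if "g \<in> K" for g
    using that unfolding K_def
  proof induction
    case (incl h)
    then show ?case using X(3) sgp by (auto simp: Y_def)
  next
    case (inv h)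
    then have "\<phi> h p = p" "h \<in> L" using X(3) sgp XYL by (auto simp: Y_def)
    then show ?case using \<phi>i(2)[of h p] by simp
  next
    case (eng g h)
    then show ?case using \<phi>m[of g h p] KL by (auto simp: K_def)
  qed (simp add: \<phi>1)
  have SK: "sg b x \<in> K" if "b \<in> B" "x \<in> Orb" for b x
    unfolding K_def using that by (intro generate.incl) (auto simp: Y_def)
  let ?PB = "P \<times> (UNIV :: bool set)"
  \<comment> \<open>One bit \<open>c (b, x)\<close> for every basis element and orbit point: the
    lift of \<open>b\<close> flips the second coordinate over \<open>x\<close> by this bit. By
    freeness every choice of bits gives an action.\<close>
  define cc where "cc c b x \<longleftrightarrow> x \<in> Orb \<and> c (b, x)" for c and b :: 'a and x
  have liftp: "(\<lambda>(x, e). if x \<in> P then (\<phi> b x, e \<noteq> cc c b x) else (x, e)) permutes ?PB"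
    if b: "b \<in> B" for b c
  proof (rule bij_imp_permutes)
    have inj: "inj_on (\<lambda>(x, e). if x \<in> P then (\<phi> b x, e \<noteq> cc c b x) else (x, e)) ?PB"
      using permutes_inj[OF \<phi>p[OF BL[OF b]]] by (auto simp: inj_on_def inj_def)
    have sub: "(\<lambda>(x, e). if x \<in> P then (\<phi> b x, e \<noteq> cc c b x) else (x, e)) ` ?PB \<subseteq> ?PB"
      using \<phi>p[OF BL[OF b]] by (auto simp: permutes_in_image)
    show "bij_betw (\<lambda>(x, e). if x \<in> P then (\<phi> b x, e \<noteq> cc c b x) else (x, e)) ?PB ?PB"
      unfolding bij_betw_def using inj endo_inj_surj[OF _ sub inj] P(1) by simp
  qed (auto split: if_splits)
  define lft where "lft c b = (\<lambda>(x, e). if x \<in> P then (\<phi> b x, e \<noteq> cc c b x) else (x, e))" for c b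
  have "\<exists>\<Phi>. \<Phi> \<in> hom (G\<lparr>carrier := L\<rparr>) (perm_group ?PB) \<and> (\<forall>b\<in>B. \<Phi> b = lft c b)" for c
  proof -
    have l: "lft c ` B \<subseteq> carrier (perm_group ?PB)"
      using liftp[of _ c] by (auto simp: lft_def)
    obtain \<Phi> where "\<Phi> \<in> hom (G\<lparr>carrier := L\<rparr>) (perm_group ?PB)" "\<And>b. b \<in> B \<Longrightarrow> \<Phi> b = lft c b"
      unfolding L_def using free_basis_hom_extend[OF B(1) group_perm_group l] by (metis (no_types))
    then show ?thesis by (intro exI[of _ \<Phi>]) simp
  qed
  then have "\<forall>c. \<exists>\<Phi>. \<Phi> \<in> hom (G\<lparr>carrier := L\<rparr>) (perm_group ?PB) \<and> (\<forall>b\<in>B. \<Phi> b = lft c b)" by simp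
  from choice[OF this] obtain \<Phi> where \<Phi>': "\<And>c. \<Phi> c \<in> hom (G\<lparr>carrier := L\<rparr>) (perm_group ?PB)"
    "\<And>c b. b \<in> B \<Longrightarrow> \<Phi> c b = lft c b" by blast
  have \<Phi>: "\<And>c. \<Phi> c \<in> hom (G\<lparr>carrier := L\<rparr>) (perm_group ?PB)"
    "\<And>c b. b \<in> B \<Longrightarrow> \<Phi> c b = (\<lambda>(x, e). if x \<in> P then (\<phi> b x, e \<noteq> cc c b x) else (x, e))"
    using \<Phi>' by (simp_all add: lft_def)
  have \<Phi>m: "\<Phi> c (g \<otimes> h) x = \<Phi> c g (\<Phi> c h x)" if "g \<in> L" "h \<in> L" for c g h x
    using \<Phi>(1)[of c] that by (simp add: hom_def)
  have \<Phi>1: "\<Phi> c \<one> = id" for c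
    using hom_word_eval[OF group_perm_group L \<Phi>(1), of "[]" c] by simp
  \<comment> \<open>The cocycle of the lifted action: how \<open>g\<close> shifts the fibre over
    \<open>x\<close>. At the point \<open>p\<close>, fixed by \<open>K\<close>, it is a homomorphism
    on \<open>K\<close>.\<close>
  define \<tau> where "\<tau> c g x = snd (\<Phi> c g (x, False))" for c g x
  have \<tau>: "\<forall>x\<in>P. \<forall>e. \<Phi> c g (x, e) = (\<phi> g x, e \<noteq> \<tau> c g x)" if "g \<in> L" for c g
    using that unfolding L_def
  proof induction
    case one
    then show ?case by (simp add: \<tau>_def \<Phi>1 \<phi>1)
  next
    case (incl h)
    then show ?case by (auto simp: \<tau>_def \<Phi>(2))
  next
    case (inv b)
    have bL: "b \<in> L" using BL[OF inv] .
    show ?case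
    proof (intro ballI allI)
      fix x e assume x: "x \<in> P"
      let ?y = "\<phi> (inv b) x"
      have y: "?y \<in> P" using x \<phi>p[OF Li[OF bL]] by (simp add: permutes_in_image)
      have *: "\<Phi> c (inv b) (x, e) = (?y, e \<noteq> cc c b ?y)" for e
      proof -
        have "\<Phi> c b (?y, e \<noteq> cc c b ?y) = (x, e)"
          using y \<phi>i(1)[OF bL] by (auto simp: \<Phi>(2)[OF inv])
        then have "\<Phi> c (inv b) (x, e) = \<Phi> c (inv b) (\<Phi> c b (?y, e \<noteq> cc c b ?y))" by simp
        also have "\<dots> = (?y, e \<noteq> cc c b ?y)"
          using \<Phi>m[OF Li[OF bL] bL, symmetric] bL LG \<Phi>1 by (simp add: subset_iff)
        finally show ?thesis .
      qed
      then show "\<Phi> c (inv b) (x, e) = (\<phi> (inv b) x, e \<noteq> \<tau> c (inv b) x)" by (simp add: \<tau>_def)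
    qed
  next
    case (eng g h)
    have gh: "g \<in> L" "h \<in> L" using eng by (auto simp: L_def)
    have hP: "\<phi> h x \<in> P" if "x \<in> P" for x using \<phi>p[OF gh(2)] that by (simp add: permutes_in_image)
    have *: "\<Phi> c (g \<otimes> h) (x, e) = (\<phi> (g \<otimes> h) x, e \<noteq> (\<tau> c h x \<noteq> \<tau> c g (\<phi> h x)))" if x: "x \<in> P" for x e
    proof -
      have "\<Phi> c h (x, e) = (\<phi> h x, e \<noteq> \<tau> c h x)" using eng.IH(2) x by blast
      moreover have "\<Phi> c g (\<phi> h x, e \<noteq> \<tau> c h x) = (\<phi> g (\<phi> h x), (e \<noteq> \<tau> c h x) \<noteq> \<tau> c g (\<phi> h x))"
        using eng.IH(1) hP[OF x] by blast
      ultimately show ?thesis unfolding \<Phi>m[OF gh] \<phi>m[OF gh] by auto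
    qed
    have "\<tau> c (g \<otimes> h) x \<longleftrightarrow> (\<tau> c h x \<noteq> \<tau> c g (\<phi> h x))" if "x \<in> P" for x
      using *[OF that, of False] by (simp add: \<tau>_def[of c "g \<otimes> h"])
    then show ?case using * by simp
  qed
  have \<tau>m: "\<tau> c (g \<otimes> h) x \<longleftrightarrow> \<tau> c g (\<phi> h x) \<noteq> \<tau> c h x" if "g \<in> L" "h \<in> L" "x \<in> P" for c g h x
  proof -
    have hP: "\<phi> h x \<in> P" using \<phi>p[OF that(2)] that(3) by (simp add: permutes_in_image)
    have "\<Phi> c h (x, False) = (\<phi> h x, \<tau> c h x)" using \<tau>[OF that(2)] that(3) by simp
    then have "\<Phi> c (g \<otimes> h) (x, False) = \<Phi> c g (\<phi> h x, \<tau> c h x)" by (simp add: \<Phi>m[OF that(1,2)])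
    also have "\<dots> = (\<phi> g (\<phi> h x), \<tau> c h x \<noteq> \<tau> c g (\<phi> h x))" using \<tau>[OF that(1)] hP by simp
    finally show ?thesis by (auto simp: \<tau>_def)
  qed
  have \<tau>b: "\<tau> c b x \<longleftrightarrow> c (b, x)" if "b \<in> B" "x \<in> Orb" for c b x
    using that OP by (auto simp: \<tau>_def \<Phi>(2) cc_def)
  define f where "f c g \<longleftrightarrow> g \<in> K \<and> \<tau> c g p" for c g
  have fH: "f c \<in> Hom2 K" for c
  proof -
    have "g \<otimes> h \<in> K" if "g \<in> K" "h \<in> K" for g h using that unfolding K_def by (rule generate.eng)
    moreover have "\<tau> c (g \<otimes> h) p \<longleftrightarrow> \<tau> c g p \<noteq> \<tau> c h p" if "g \<in> K" "h \<in> K" for g h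
      using \<tau>m[of g h p c] Kp[OF that(2)] that KL P(2) by auto
    ultimately show ?thesis by (simp add: Hom2_def f_def)
  qed
  let ?C = "B \<times> Orb \<rightarrow>\<^sub>E (UNIV :: bool set)"
  let ?T = "(Orb - {p}) \<rightarrow>\<^sub>E (UNIV :: bool set)"
  \<comment> \<open>These data recover \<open>c\<close>: in \<open>b q(x) = q(b x) (sg b x)\<close>
    the cocycle of every factor except \<open>b\<close> is known, and that of \<open>b\<close> at
    \<open>x\<close> is the bit \<open>c (b, x)\<close>.\<close>
  define \<Psi> where "\<Psi> c = (f c, restrict (\<lambda>x. \<tau> c (q x) p) (Orb - {p}))" for c
  have inj: "inj_on \<Psi> ?C"
  proof (rule inj_onI)
    fix c d assume c: "c \<in> ?C" and d: "d \<in> ?C" and eq: "\<Psi> c = \<Psi> d"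
    have feq: "f c g = f d g" for g using eq by (simp add: \<Psi>_def)
    have qeq: "\<tau> c (q x) p = \<tau> d (q x) p" if "x \<in> Orb" for x
    proof (cases "x = p")
      case True
      then show ?thesis using q(3) by (simp add: \<tau>_def \<Phi>1)
    next
      case False
      have "restrict (\<lambda>x. \<tau> c (q x) p) (Orb - {p}) = restrict (\<lambda>x. \<tau> d (q x) p) (Orb - {p})"
        using eq by (simp add: \<Psi>_def)
      from fun_cong[OF this, of x] show ?thesis using that False by simp
    qed
    have rec: "e (b, x) \<longleftrightarrow> (\<tau> e (q x) p \<noteq> (\<tau> e (q (\<phi> b x)) p \<noteq> f e (sg b x)))"
      if b: "b \<in> B" and x: "x \<in> Orb" for e b x
    proof -
      have bx: "\<phi> b x \<in> Orb" using Om BL b x by simp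
      have qL: "q x \<in> L" "q (\<phi> b x) \<in> L" using q(1) x bx by auto
      have "b \<otimes> q x = q (\<phi> b x) \<otimes> sg b x"
        using qL BL[OF b] LG by (auto simp: sg_def m_assoc[symmetric] subset_iff)
      then have "\<tau> e (b \<otimes> q x) p = \<tau> e (q (\<phi> b x) \<otimes> sg b x) p" by simp
      moreover have "\<tau> e (b \<otimes> q x) p \<longleftrightarrow> e (b, x) \<noteq> \<tau> e (q x) p"
        using \<tau>m[OF BL[OF b] qL(1) P(2)] q(2)[OF x] \<tau>b[OF b x] by simp
      moreover have "\<tau> e (q (\<phi> b x) \<otimes> sg b x) p \<longleftrightarrow> \<tau> e (q (\<phi> b x)) p \<noteq> f e (sg b x)"
        using \<tau>m[OF qL(2) sgL[OF b x] P(2)] sgp[OF b x] SK[OF b x] by (simp add: f_def)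
      ultimately show ?thesis by auto
    qed
    have "c (b, x) = d (b, x)" if "b \<in> B" "x \<in> Orb" for b x
      unfolding rec[OF that, of c] rec[OF that, of d] using that feq qeq Om BL by simp
    then have "c y = d y" if "y \<in> B \<times> Orb" for y using that by auto
    then show "c = d" by (rule PiE_ext[OF c d])
  qed
  have XYG: "X \<union> Y \<subseteq> carrier G" "finite (X \<union> Y)" using XYL LG X(1) Y(1) by auto
  have finK: "finite (Hom2 K)" unfolding K_def by (rule Hom2_card_le(1)[OF XYG])
  have "\<Psi> ` ?C \<subseteq> Hom2 K \<times> ?T" using fH by (auto simp: \<Psi>_def)
  moreover have "finite (Hom2 K \<times> ?T)" using finK finO by (simp add: finite_PiE)
  ultimately have "card ?C \<le> card (Hom2 K \<times> ?T)"
    using card_inj_on_le[OF inj] by blast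
  \<comment> \<open>With \<open>n = card B\<close> and \<open>k = card Orb\<close>, the exponent
    left for \<open>Hom2 K\<close> is at least \<open>n k - k + 1\<close>. It exceeds
    \<open>n\<close> by \<open>(n - 1) (k - 1)\<close>, which is positive as both numbers are at
    least 2.\<close>
  then have le: "2 ^ (card B * card Orb) \<le> card (Hom2 K) * 2 ^ (card Orb - 1)"
    using B(2) finO pO by (simp add: card_PiE card_cartesian_product)
  have "2 ^ card B < card (Hom2 K)"
  proof (rule ccontr)
    assume "\<not> 2 ^ card B < card (Hom2 K)"
    then have "card (Hom2 K) * 2 ^ (card Orb - 1) \<le> 2 ^ card B * 2 ^ (card Orb - 1)" by simp
    then have "(2::nat) ^ (card B * card Orb) \<le> 2 ^ (card B + (card Orb - 1))"
      unfolding power_add using le by (rule order_trans[rotated])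
    then have 1: "card B * card Orb \<le> card B + (card Orb - 1)" by simp
    obtain m where m: "card Orb = Suc (Suc m)" using k2 by (metis Suc_le_D numeral_2_eq_2 Suc_le_mono)
    have "2 * m \<le> card B * m" using B(3) by (rule mult_le_mono1)
    moreover have "card B * card Orb = card B + (card B + card B * m)" unfolding m by simp
    moreover have "card Orb - 1 = Suc m" unfolding m by simp
    ultimately show False using 1 B(3) by linarith
  qed
  then show ?thesis using that[OF Y(1)] Y(2) by (simp add: K_def L_def)
qed

text \<open>In a counterexample \<open>Z\<close> of minimal rank, measured by homomorphisms to the group of order two, every
  element added to \<open>Z\<close> satisfies a relation, so all larger finitely generated subgroups have the same
  rank. Choosing one that \<open>Z\<close> does not fill, the stabilizer of a point in a finite action separating the
  two contradicts the Schreier bound.\<close>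

lemma exists_free_over_finitely_generated:
  assumes lf: "locally_free G" and ab: "a \<in> carrier G" "b \<in> carrier G" "a \<otimes> b \<noteq> b \<otimes> a"
    and nfg: "\<And>S. finite S \<Longrightarrow> S \<subseteq> carrier G \<Longrightarrow> generate G S \<noteq> carrier G"
    and X: "finite X" "X \<subseteq> carrier G"
  obtains y where "free_over (generate G X) y"
proof (rule ccontr)
  assume nt: "\<not> thesis"
  define bad where "bad Y \<longleftrightarrow> finite Y \<and> Y \<subseteq> carrier G \<and> (\<forall>y. \<not> free_over (generate G Y) y)" for Y
  have "bad X" using X nt that by (auto simp: bad_def)
  define r where "r Y = card (Hom2 (generate G Y))" for Y
  define Z where "Z = arg_min r bad"
  have Z: "bad Z" "\<And>Y. bad Y \<Longrightarrow> r Z \<le> r Y"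
    using arg_min_nat_lemma[of bad X r] \<open>bad X\<close> by (auto simp: Z_def)
  have ZG: "finite Z" "Z \<subseteq> carrier G" using Z(1) by (auto simp: bad_def)
  have bad_un: "bad (Z \<union> Y)" if "finite Y" "Y \<subseteq> carrier G" for Y
  proof -
    have "generate G Z \<subseteq> generate G (Z \<union> Y)" using ZG that by (intro mono_generate) auto
    then show ?thesis using Z(1) that free_over_mono unfolding bad_def by blast
  qed
  have rank: "r (Z \<union> Y) = r Z" if "finite Y" "Y \<subseteq> carrier G" for Y
    using that
  proof (induction Y)
    case (insert y Y)
    have ZY: "finite (Z \<union> Y)" "Z \<union> Y \<subseteq> carrier G" using ZG insert by auto
    have "r (insert y (Z \<union> Y)) \<le> r (Z \<union> Y)"
      unfolding r_def using Hom2_card_insert_le[OF lf ZY, of y] bad_un[of Y] insert by (auto simp: bad_def)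
    moreover have "r Z \<le> r (Z \<union> insert y Y)" using insert by (intro Z(2) bad_un) auto
    ultimately show ?case using insert by simp
  qed simp
  \<comment> \<open>The noncommuting pair is added to force rank at least two, as the Schreier bound
    requires.\<close>
  define W where "W = Z \<union> {a, b}"
  have W: "finite W" "W \<subseteq> carrier G" using ZG ab by (auto simp: W_def)
  have rW: "r (W \<union> Y) = r Z" if "finite Y" "Y \<subseteq> carrier G" for Y
    using rank[of "{a, b} \<union> Y"] that ab by (simp add: W_def Un_assoc)
  have "generate G W \<noteq> carrier G" using nfg W by blast
  then obtain z where z: "z \<in> carrier G" "z \<notin> generate G W" using generate_incl[OF W(2)] by blast
  let ?S = "W \<union> {z}"
  have S: "finite ?S" "?S \<subseteq> carrier G" using W z by auto
  obtain B where B: "finite B" "free_basis G B" "generate G B = generate G ?S"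
    using locally_free_basis[OF lf S] by blast
  have BG: "B \<subseteq> carrier G" using B by (simp add: free_basis_def)
  have in_S: "s \<in> generate G B" if "s \<in> ?S" for s using generate.incl[OF that, of G] B(3) by simp
  have "2 \<le> card B"
  proof -
    obtain x y where xy: "x \<in> B" "y \<in> B" "x \<noteq> y"
      using noncommuting_basis[OF BG in_S in_S ab(3)] by (auto simp: W_def)
    then have "card {x, y} \<le> card B" using B(1) by (intro card_mono) auto
    then show ?thesis using xy by simp
  qed
  \<comment> \<open>The count is the same for the free group on \<open>B\<close> and for the
    subgroup generated by \<open>W\<close> and any finitely many further elements; the Schreier
    bound produces one where it is larger.\<close>
  have rB: "r Z = 2 ^ card B"
    using rW[of "{z}"] z Hom2_card_free[OF B(2,1)] B(3) by (simp add: r_def)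
  have WB: "W \<subseteq> generate G B" and zB: "z \<in> generate G B" using in_S by auto
  obtain P :: "'a set set" and p \<phi> where P: "finite P" "p \<in> P"
    "\<phi> \<in> hom (G\<lparr>carrier := generate G B\<rparr>) (perm_group P)" "\<And>x. x \<in> W \<Longrightarrow> \<phi> x p = p" "\<phi> z p \<noteq> p"
    using free_subgroup_separable[OF B(2) W(1) WB zB z(2)] by metis
  obtain Y where Y: "finite Y" "Y \<subseteq> generate G B" "2 ^ card B < card (Hom2 (generate G (W \<union> Y)))"
    by (rule stabilizer_Hom2_card[OF B(2,1) \<open>2 \<le> card B\<close> P(1-3) zB P(5) W(1) WB P(4)])
  have "Y \<subseteq> carrier G" using Y(2) generate_incl[OF BG] by blast
  then show False using rW[OF Y(1)] Y(3) rB by (simp add: r_def)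
qed

end

section \<open>Chains of group elements\<close>

type_synonym ('i, 'a) step = "'i \<times> (bool \<times> 'a) option \<times> bool \<times> 'a"

text \<open>Labels of the terms of \<open>1 + \<Sum>\<^sub>j L i j \<cdot> s i \<cdot> L' i j\<close>: \<open>None\<close> stands for the unit and
  \<open>Some (j, a)\<close> for the group element \<open>L i j \<cdot> a \<cdot> L' i j\<close> with \<open>a\<close> in the support of \<open>s i\<close>.
  A step \<open>(i, l, j, a)\<close> passes from label \<open>l\<close> to label \<open>Some (j, a)\<close>; chains have the latest step first.\<close>

definition label_val :: "('a, 'b) monoid_scheme \<Rightarrow> ('i \<Rightarrow> bool \<Rightarrow> 'a) \<Rightarrow> ('i \<Rightarrow> bool \<Rightarrow> 'a) \<Rightarrow> 'i
    \<Rightarrow> (bool \<times> 'a) option \<Rightarrow> 'a" where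
  "label_val G L L' i l = (case l of None \<Rightarrow> \<one>\<^bsub>G\<^esub> | Some (j, a) \<Rightarrow> L i j \<otimes>\<^bsub>G\<^esub> a \<otimes>\<^bsub>G\<^esub> L' i j)"

definition step_val :: "('a, 'b) monoid_scheme \<Rightarrow> ('i \<Rightarrow> bool \<Rightarrow> 'a) \<Rightarrow> ('i \<Rightarrow> bool \<Rightarrow> 'a)
    \<Rightarrow> ('i, 'a) step \<Rightarrow> 'a" where
  "step_val G L L' = (\<lambda>(i, l, j, a). label_val G L L' i (Some (j, a)) \<otimes>\<^bsub>G\<^esub> inv\<^bsub>G\<^esub> (label_val G L L' i l))"

definition chain_val :: "('a, 'b) monoid_scheme \<Rightarrow> ('i \<Rightarrow> bool \<Rightarrow> 'a) \<Rightarrow> ('i \<Rightarrow> bool \<Rightarrow> 'a)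
    \<Rightarrow> ('i, 'a) step list \<Rightarrow> 'a" where
  "chain_val G L L' cs = foldr (\<lambda>p g. step_val G L L' p \<otimes>\<^bsub>G\<^esub> g) cs \<one>\<^bsub>G\<^esub>"

definition valid_step :: "'i set \<Rightarrow> ('i \<Rightarrow> 'a set) \<Rightarrow> ('i, 'a) step \<Rightarrow> bool" where
  "valid_step I A = (\<lambda>(i, l, j, a). i \<in> I \<and> a \<in> A i \<and>
     (case l of None \<Rightarrow> True | Some (j', a') \<Rightarrow> j' \<noteq> j \<and> a' \<in> A i))"

text \<open>Where two steps meet, one term of the sum has just been reached and a different term,
  cancelling it, is left next. Hence index and label together must change at the junction.\<close>

definition chain :: "'i set \<Rightarrow> ('i \<Rightarrow> 'a set) \<Rightarrow> ('i, 'a) step list \<Rightarrow> bool" where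
  "chain I A cs \<longleftrightarrow> (\<forall>p\<in>set cs. valid_step I A p) \<and>
     successively (\<lambda>p q. (fst p, fst (snd p)) \<noteq> (fst q, Some (snd (snd q)))) cs"

text \<open>Together with membership in the group, this is all that the ring-theoretic part uses
  about the multipliers.\<close>

definition no_cycles :: "('a, 'b) monoid_scheme \<Rightarrow> 'i set \<Rightarrow> ('i \<Rightarrow> 'a set) \<Rightarrow> ('i \<Rightarrow> bool \<Rightarrow> 'a)
    \<Rightarrow> ('i \<Rightarrow> bool \<Rightarrow> 'a) \<Rightarrow> bool" where
  "no_cycles G I A L L' \<longleftrightarrow> (\<forall>cs. cs \<noteq> [] \<and> chain I A cs \<longrightarrow> chain_val G L L' cs \<noteq> \<one>\<^bsub>G\<^esub>)"

lemma chain_val_simps [simp]: "chain_val G L L' [] = \<one>\<^bsub>G\<^esub>"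
  "chain_val G L L' (p # cs) = step_val G L L' p \<otimes>\<^bsub>G\<^esub> chain_val G L L' cs"
  by (simp_all add: chain_val_def)

lemma chain_append: "chain I A (xs @ ys) \<Longrightarrow> chain I A xs \<and> chain I A ys"
  by (auto simp: chain_def successively_append_iff)

section \<open>Multipliers from a tower of relatively free elements\<close>

context group
begin

lemma inv_cancel_left [simp]:
  "x \<in> carrier G \<Longrightarrow> g \<in> carrier G \<Longrightarrow> inv x \<otimes> (x \<otimes> g) = g"
  "x \<in> carrier G \<Longrightarrow> g \<in> carrier G \<Longrightarrow> x \<otimes> (inv x \<otimes> g) = g"
  by (simp_all add: m_assoc[symmetric])

lemma alt_eval_closed [simp]: "y \<in> carrier G \<Longrightarrow> letters l \<subseteq> carrier G \<Longrightarrow> alt_eval y l \<in> carrier G"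
  by (induction l) auto

lemma alt_eval_append:
  "y \<in> carrier G \<Longrightarrow> letters u \<subseteq> carrier G \<Longrightarrow> letters v \<subseteq> carrier G \<Longrightarrow>
   alt_eval y (u @ v) = alt_eval y u \<otimes> alt_eval y v"
  by (induction u) (auto simp: m_assoc)

text \<open>The last coefficient is not constrained by \<open>alt_red\<close>, so it can absorb the
  inverse of a value in \<open>H\<close>, which would give a forbidden relation.\<close>

lemma free_over_notin:
  assumes H: "subgroup H G" and y: "free_over H y" and l: "l \<noteq> []" "letters l \<subseteq> H" "alt_red l"
  shows "alt_eval y l \<notin> H"
proof
  assume g: "alt_eval y l \<in> H"
  have HG: "H \<subseteq> carrier G" using H subgroup.subset by auto
  have yG: "y \<in> carrier G" using y by (simp add: free_over_def)
  obtain u p where u: "l = u @ [p]" using l(1) by (metis rev_exhaust)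
  let ?g = "inv (alt_eval y l)"
  let ?p = "(fst p, snd p \<otimes> ?g)"
  have gH: "?g \<in> H" using g subgroup.m_inv_closed[OF H] by blast
  have "alt_red (u @ [?p])" using l(3) unfolding u successively_append_iff by auto
  moreover have "letters (u @ [?p]) \<subseteq> H" using l(2) gH subgroup.m_closed[OF H] by (auto simp: u)
  ultimately have "alt_eval y (u @ [?p]) \<noteq> \<one>" using y unfolding free_over_def by blast
  moreover have "alt_eval y (u @ [?p]) = alt_eval y l \<otimes> ?g"
  proof -
    have c: "letters u \<subseteq> carrier G" "snd p \<in> carrier G" "?g \<in> carrier G" using l(2) HG gH by (auto simp: u)
    have "alt_eval y [?p] = alt_eval y [p] \<otimes> ?g" using c yG by (simp add: m_assoc)
    then have "alt_eval y (u @ [?p]) = alt_eval y u \<otimes> (alt_eval y [p] \<otimes> ?g)"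
      using c yG by (subst alt_eval_append) auto
    also have "\<dots> = alt_eval y (u @ [p]) \<otimes> ?g"
      using c yG by (subst alt_eval_append) (auto simp: m_assoc)
    finally show ?thesis by (simp add: u)
  qed
  ultimately show False using g HG by auto
qed

text \<open>The multipliers \<open>y c y\<close> and \<open>y^2 c y^2\<close>, each used on both
  sides. In a quotient of the two, one pair of opposite powers of \<open>y\<close> cancels and then
  the nontrivial \<open>c\<close> stops the cancellation.\<close>

definition padded :: "'a \<Rightarrow> 'a \<Rightarrow> bool \<Rightarrow> 'a" where
  "padded c y j = (if j then y \<otimes> c \<otimes> y else y \<otimes> y \<otimes> c \<otimes> (y \<otimes> y))"

context
  fixes H :: "'a set" and y c :: 'a
  assumes H: "subgroup H G" and y: "free_over H y" and c: "c \<in> H" "c \<noteq> \<one>"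
begin

text \<open>The invariant of the chain computation: the label reached by the latest step is still
  visible at the left end, shielded by a positive power of \<open>y\<close> on its right.\<close>

definition top_form :: "bool \<Rightarrow> 'a \<Rightarrow> 'a \<Rightarrow> bool" where
  "top_form j a W \<longleftrightarrow> (\<exists>l. l \<noteq> [] \<and> fst (hd l) \<and> letters l \<subseteq> H \<and> alt_red l \<and>
     W = padded c y j \<otimes> a \<otimes> alt_eval y l)"

lemma in_carrier: "h \<in> H \<Longrightarrow> h \<in> carrier G"
  using H subgroup.subset by auto

lemma y_carrier: "y \<in> carrier G"
  using y by (simp add: free_over_def)

lemma top_formI:
  "l \<noteq> [] \<Longrightarrow> fst (hd l) \<Longrightarrow> letters l \<subseteq> H \<Longrightarrow> alt_red l \<Longrightarrow> W = padded c y j \<otimes> a \<otimes> alt_eval y l \<Longrightarrow> top_form j a W"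
  unfolding top_form_def by blast

lemma top_form_step:
  assumes e: "e \<in> H" and a': "a' \<in> H" and lab: "\<And>j a. lb = Some (j, a) \<Longrightarrow> j \<noteq> j' \<and> a \<in> H"
    and R: "R = \<one> \<or> a1 \<in> H \<and> top_form j1 a1 R \<and> (e = \<one> \<longrightarrow> lb \<noteq> Some (j1, a1))"
  shows "top_form j' a' (padded c y j' \<otimes> a' \<otimes> padded c y j' \<otimes>
     inv (case lb of None \<Rightarrow> \<one> | Some (j, a) \<Rightarrow> padded c y j \<otimes> a \<otimes> padded c y j) \<otimes> (e \<otimes> R))"
proof -
  note yG = y_carrier
  have oneH: "\<one> \<in> H" using H subgroup.one_closed by auto
  have icH: "inv c \<in> H" using subgroup.m_inv_closed[OF H c(1)] .
  have ic: "inv c \<noteq> \<one>" using c in_carrier by (metis inv_eq_1_iff)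
  \<comment> \<open>With \<open>P j\<close> for the multiplier \<open>padded c y j\<close>:
    \<open>Lw j h\<close> spells \<open>P j * h\<close>, \<open>Li j h\<close> spells
    \<open>inv (P j) * h\<close>, \<open>D j h\<close> spells
    \<open>P j * inv (P (\<not> j)) * h\<close> and \<open>E j h\<close> spells
    \<open>inv (P j) * P (\<not> j) * h\<close>, the last two after their one cancellation.\<close>
  define Lw where "Lw j h = (if j then [(True, c), (True, h)] else [(True, \<one>), (True, c), (True, \<one>), (True, h)])" for j h
  define Li where "Li j h = (if j then [(False, inv c), (False, h)]
    else [(False, \<one>), (False, inv c), (False, \<one>), (False, h)])" for j h
  define D where "D j h = (if j then [(True, c), (False, inv c), (False, \<one>), (False, h)]
    else [(True, \<one>), (True, c), (True, inv c), (False, h)])" for j h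
  define E where "E j h = (if j then [(False, inv c), (True, c), (True, \<one>), (True, h)]
    else [(False, \<one>), (False, inv c), (False, c), (True, h)])" for j h
  note defs = Lw_def Li_def D_def E_def
  note carr = yG in_carrier[OF c(1)] in_carrier[OF e] in_carrier[OF a']
  have letH: "letters (Lw j h) \<subseteq> H" "letters (Li j h) \<subseteq> H" "letters (D j h) \<subseteq> H" "letters (E j h) \<subseteq> H"
    if "h \<in> H" for j h using that oneH icH c by (auto simp: defs)
  have letG: "letters l \<subseteq> carrier G" if "letters l \<subseteq> H" for l :: "(bool \<times> 'a) list" using that in_carrier by auto
  show ?thesis
  proof (cases "R = \<one>")
    case R1: True
    show ?thesis
    proof (cases lb)
      case None
      show ?thesis
        using carr letH(1)[OF e] None R1
        by (intro top_formI[of "Lw j' e"]) (auto simp: Lw_def padded_def m_assoc)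
    next
      case (Some p)
      then obtain j a where p: "lb = Some (j, a)" "j \<noteq> j'" "a \<in> H" using lab by (cases p) auto
      have aG: "a \<in> carrier G" "inv a \<in> H" using p in_carrier subgroup.m_inv_closed[OF H] by auto
      show ?thesis
        using carr letH(2)[OF e] letH(3)[OF aG(2)] p(1,2) R1 aG ic c
        by (intro top_formI[of "D j' (inv a) @ Li j e"])
          (auto simp: D_def Li_def padded_def m_assoc inv_mult_group)
    qed
  next
    case False
    then have R: "a1 \<in> H" "top_form j1 a1 R" "e = \<one> \<longrightarrow> lb \<noteq> Some (j1, a1)" using R by auto
    then obtain l where l: "l \<noteq> []" "fst (hd l)" "letters l \<subseteq> H" "alt_red l"
      "R = padded c y j1 \<otimes> a1 \<otimes> alt_eval y l" by (auto simp: top_form_def)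
    note carr = carr in_carrier[OF R(1)] alt_eval_closed[OF yG letG[OF l(3)]]
    show ?thesis
    proof (cases lb)
      case None
      show ?thesis
        using carr letH(1)[OF e] letH(1)[OF R(1)] None l
        by (intro top_formI[of "Lw j' e @ Lw j1 a1 @ l"])
          (auto simp: Lw_def padded_def m_assoc successively_Cons)
    next
      case (Some p)
      then obtain j a where p: "lb = Some (j, a)" "j \<noteq> j'" "a \<in> H" using lab by (cases p) auto
      have aG: "a \<in> carrier G" "inv a \<in> H" using p in_carrier subgroup.m_inv_closed[OF H] by auto
      \<comment> \<open>What stops cancellation between the inverse multiplier ending the new step
        and the multiplier opening \<open>R\<close>: a nontrivial coefficient, the difference of the
        multipliers, or, once equal multipliers have cancelled, the nontrivial quotient of
        \<open>a1\<close> and \<open>a\<close>.\<close>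
      consider "e \<noteq> \<one>" | "e = \<one>" "j1 \<noteq> j" | "e = \<one>" "j1 = j" "a1 \<noteq> a" using R(3) p(1) by blast
      then show ?thesis
      proof cases
        case 1
        show ?thesis
          using carr letH(2)[OF e] letH(3)[OF aG(2)] letH(1)[OF R(1)] p(1,2) aG ic c l 1
          by (intro top_formI[of "D j' (inv a) @ Li j e @ Lw j1 a1 @ l"])
            (auto simp: D_def Li_def Lw_def padded_def m_assoc inv_mult_group successively_Cons)
      next
        case 2
        show ?thesis
          using carr letH(4)[OF R(1)] letH(3)[OF aG(2)] p(1,2) aG ic c l 2
          by (intro top_formI[of "D j' (inv a) @ E j a1 @ l"])
            (auto simp: D_def E_def padded_def m_assoc inv_mult_group successively_Cons)
      next
        case 3
        have h: "inv a \<otimes> a1 \<in> H" "inv a \<otimes> a1 \<noteq> \<one>"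
          using aG(2) R(1) subgroup.m_closed[OF H] 3(3) aG(1) carr(5)
          by (auto dest: inv_equality[of "inv a" a1, rotated] simp: inv_equality) (metis inv_inv inv_equality inv_closed)
        show ?thesis
          using carr letH(3)[OF h(1)] p(1,2) aG ic c l 3 h(2)
          by (intro top_formI[of "D j' (inv a \<otimes> a1) @ l"])
            (auto simp: D_def padded_def m_assoc inv_mult_group successively_Cons)
      qed
    qed
  qed
qed

lemma top_form_not_in:
  assumes "top_form j a W" "a \<in> H"
  shows "W \<notin> H"
proof -
  obtain l where l: "l \<noteq> []" "fst (hd l)" "letters l \<subseteq> H" "alt_red l"
    "W = padded c y j \<otimes> a \<otimes> alt_eval y l" using assms(1) by (auto simp: top_form_def)
  have oneH: "\<one> \<in> H" using H subgroup.one_closed by auto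
  have lG: "letters l \<subseteq> carrier G" using l(3) in_carrier by auto
  define u where "u = (if j then [(True, c), (True, a)] else [(True, \<one>), (True, c), (True, \<one>), (True, a)]) @ l"
  have "W = alt_eval y u"
    using l(5) y_carrier in_carrier assms(2) c alt_eval_closed[OF y_carrier lG]
    by (auto simp: u_def padded_def m_assoc)
  moreover have "alt_eval y u \<notin> H"
    by (rule free_over_notin[OF H y]) (use l assms(2) c oneH in \<open>auto simp: u_def successively_Cons\<close>)
  ultimately show ?thesis by simp
qed

end

lemma finite_max:
  assumes "trans r" "total_on I r" "finite T" "T \<noteq> {}" "T \<subseteq> I"
  obtains i where "i \<in> T" "\<And>j. j \<in> T \<Longrightarrow> j \<noteq> i \<Longrightarrow> (j, i) \<in> r"
proof -
  have "\<exists>i\<in>T. \<forall>j\<in>T. j \<noteq> i \<longrightarrow> (j, i) \<in> r"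
    using assms(3-5)
  proof (induction rule: finite_ne_induct)
    case (insert x F)
    then obtain i where i: "i \<in> F" "\<forall>j\<in>F. j \<noteq> i \<longrightarrow> (j, i) \<in> r" by auto
    show ?case
    proof (cases "(x, i) \<in> r")
      case True
      then show ?thesis using i by auto
    next
      case False
      have "x \<noteq> i" using insert i by auto
      then have xi: "(i, x) \<in> r" using False insert.prems i(1) assms(2) by (auto simp: total_on_def)
      have "(j, x) \<in> r" if "j \<in> F" for j
        using i(2) that xi assms(1) by (cases "j = i") (auto dest: transD)
      then show ?thesis by auto
    qed
  qed auto
  then show ?thesis using that by blast
qed

text \<open>Induction on the number of indices that occur. Stretches between steps of the largest
  index \<open>i\<close> evaluate into \<open>H i\<close>, and nontrivially by induction. So from
  its first step of index \<open>i\<close> on, the chain is an alternating word in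
  \<open>y i\<close> over \<open>H i\<close>; it keeps its top form and hence stays outside
  \<open>H i\<close>.\<close>

lemma tower_no_cycles:
  assumes r: "trans r" "total_on I r"
    and H: "\<And>i. i \<in> I \<Longrightarrow> subgroup (H i) G" "\<And>i. i \<in> I \<Longrightarrow> A i \<subseteq> H i" "\<And>i. i \<in> I \<Longrightarrow> c \<in> H i" "c \<noteq> \<one>"
    and y: "\<And>i. i \<in> I \<Longrightarrow> free_over (H i) (y i)"
    and below: "\<And>i j. i \<in> I \<Longrightarrow> j \<in> I \<Longrightarrow> (j, i) \<in> r \<Longrightarrow> j \<noteq> i \<Longrightarrow> y j \<in> H i \<and> A j \<subseteq> H i"
  shows "no_cycles G I A (\<lambda>i. padded c (y i)) (\<lambda>i. padded c (y i))"
proof -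
  let ?L = "\<lambda>i. padded c (y i)"
  have pad: "padded c g j \<in> K" if "subgroup K G" "c \<in> K" "g \<in> K" for K g j
    using that subgroup.m_closed[OF that(1)] by (simp add: padded_def)
  have "chain_val G ?L ?L cs \<noteq> \<one>"
    if "finite T" "T \<subseteq> I" "cs \<noteq> []" "chain I A cs" "fst ` set cs \<subseteq> T" for T cs
    using that
  proof (induction "card T" arbitrary: T cs rule: less_induct)
    case less
    have "T \<noteq> {}" using less.prems by (cases cs) auto
    then obtain i where i: "i \<in> T" "\<And>j. j \<in> T \<Longrightarrow> j \<noteq> i \<Longrightarrow> (j, i) \<in> r"
      using finite_max[OF r less.prems(1) _ less.prems(2)] by blast
    then have iI: "i \<in> I" using less.prems by auto
    let ?T = "T - {i}"
    have cT: "card ?T < card T" using i less.prems by (intro psubset_card_mono) auto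
    have low: "chain_val G ?L ?L ds \<in> H i" "ds \<noteq> [] \<Longrightarrow> chain_val G ?L ?L ds \<noteq> \<one>"
      if ds: "chain I A ds" "fst ` set ds \<subseteq> ?T" for ds
    proof -
      show "chain_val G ?L ?L ds \<noteq> \<one>" if "ds \<noteq> []"
        using less.hyps[OF cT _ _ that ds] less.prems by auto
      have "step_val G ?L ?L p \<in> H i" if p: "p \<in> set ds" for p
      proof -
        obtain k lb j a where pk: "p = (k, lb, j, a)" by (metis prod_cases4)
        have k: "k \<in> I" "y k \<in> H i" "A k \<subseteq> H i"
          using below[OF iI, of k] i(2)[of k] ds p less.prems by (force simp: pk)+
        have v: "a \<in> A k" "\<And>j' a'. lb = Some (j', a') \<Longrightarrow> a' \<in> A k"
          using ds(1) p by (auto simp: chain_def valid_step_def pk)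
        note sg = H(1)[OF iI]
        have lv: "label_val G ?L ?L k l \<in> H i" if "\<And>j' a'. l = Some (j', a') \<Longrightarrow> a' \<in> A k" for l
          using that k pad[OF sg H(3)[OF iI] k(2)] subgroup.m_closed[OF sg] subgroup.one_closed[OF sg]
          by (auto simp: label_val_def split: option.split)
        show ?thesis
          using lv[of lb] lv[of "Some (j, a)"] v subgroup.m_closed[OF sg] subgroup.m_inv_closed[OF sg]
          by (simp add: step_val_def pk)
      qed
      then show "chain_val G ?L ?L ds \<in> H i"
        using subgroup.m_closed[OF H(1)[OF iI]] subgroup.one_closed[OF H(1)[OF iI]] by (induction ds) auto
    qed
    note tf = H(1)[OF iI] y[OF iI] H(3)[OF iI] H(4)
    have HG: "H i \<subseteq> carrier G" using H(1)[OF iI] subgroup.subset by auto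
    have yG: "y i \<in> carrier G" using y[OF iI] by (simp add: free_over_def)
    have split: "\<exists>run rest. ds = run @ rest \<and> fst ` set run \<subseteq> ?T \<and> (rest \<noteq> [] \<longrightarrow> fst (hd rest) = i)"
      if "fst ` set ds \<subseteq> T" for ds :: "('c, 'a) step list"
    proof (intro exI conjI)
      show "ds = takeWhile (\<lambda>p. fst p \<noteq> i) ds @ dropWhile (\<lambda>p. fst p \<noteq> i) ds" by simp
      show "fst ` set (takeWhile (\<lambda>p. fst p \<noteq> i) ds) \<subseteq> ?T"
        using that by (auto dest: set_takeWhileD)
      show "dropWhile (\<lambda>p. fst p \<noteq> i) ds \<noteq> [] \<longrightarrow> fst (hd (dropWhile (\<lambda>p. fst p \<noteq> i) ds)) = i"
        using hd_dropWhile[of "\<lambda>p. fst p \<noteq> i" ds] by auto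
    qed
    have stepc: "step_val G ?L ?L p \<in> carrier G" if p: "valid_step I A p" for p
      proof -
        obtain k lb j a where pk: "p = (k, lb, j, a)" by (metis prod_cases4)
        have k: "k \<in> I" "a \<in> A k" "\<And>j' a'. lb = Some (j', a') \<Longrightarrow> a' \<in> A k"
          using p by (auto simp: valid_step_def pk)
        have yk: "y k \<in> carrier G" using y[OF k(1)] by (simp add: free_over_def)
        have kG: "A k \<subseteq> carrier G" "c \<in> carrier G"
          using H(1-3)[OF k(1)] subgroup.subset by blast+
        have pc: "padded c (y k) j \<in> carrier G" for j using yk kG by (simp add: padded_def)
        have lv: "label_val G ?L ?L k l \<in> carrier G" if l: "\<And>j' a'. l = Some (j', a') \<Longrightarrow> a' \<in> A k" for l
        proof (cases l)
          case (Some q)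
          then show ?thesis using l[of "fst q" "snd q"] pc kG
            by (auto simp: label_val_def case_prod_unfold)
        qed (simp add: label_val_def)
        show ?thesis using lv[of lb] lv[of "Some (j, a)"] k by (simp add: step_val_def pk)
      qed
    have stepG: "chain_val G ?L ?L ds \<in> carrier G" if "chain I A ds" for ds
      using that stepc by (induction ds) (auto simp: chain_def successively_Cons)
    have chain_val_append: "chain_val G ?L ?L (u @ v) = chain_val G ?L ?L u \<otimes> chain_val G ?L ?L v"
      if "chain I A (u @ v)" for u v
      using that
    proof (induction u)
      case (Cons p u)
      have "chain I A u" "chain I A v" "chain I A (u @ v)"
        using chain_append[of I A "[p]" "u @ v"] chain_append[of I A "p # u" v] chain_append[of I A "[p]" u] Cons.prems by auto
      moreover have "step_val G ?L ?L p \<in> carrier G" using Cons.prems stepc by (simp add: chain_def)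
      ultimately show ?case using Cons.IH stepG[of u] stepG[of v] by (simp add: m_assoc)
    qed (use stepG in auto)
    \<comment> \<open>The stretch \<open>run\<close> up to the next step of index \<open>i\<close>
      takes the role of \<open>e\<close> in \<open>top_form_step\<close>. By \<open>low\<close>, its
      value is \<open>\<one>\<close> only if it is empty, and then the chain condition separates the
      two labels.\<close>
    have top: "top_form (H i) (y i) c (fst (snd (snd (hd ds)))) (snd (snd (snd (hd ds)))) (chain_val G ?L ?L ds)"
      if "ds \<noteq> []" "chain I A ds" "fst ` set ds \<subseteq> T" "fst (hd ds) = i" for ds
      using that
    proof (induction "length ds" arbitrary: ds rule: less_induct)
      case (less ds)
      obtain p ps where ds: "ds = p # ps" using less.prems by (cases ds) auto
      obtain lb j' a' where p: "p = (i, lb, j', a')" using less.prems(4) ds by (cases p) auto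
      obtain run rest where rr: "ps = run @ rest" "fst ` set run \<subseteq> ?T" "rest \<noteq> [] \<longrightarrow> fst (hd rest) = i"
        using split[of ps] less.prems(3) ds by auto
      have ch: "chain I A run" "chain I A rest" "chain I A ps"
        using less.prems(2) chain_append[of I A "p # run" rest] chain_append[of I A "[p]" run]
          chain_append[of I A "[p]" "run @ rest"]
        by (auto simp: ds rr)
      let ?e = "chain_val G ?L ?L run" and ?R = "chain_val G ?L ?L rest"
      have v: "a' \<in> H i" "\<And>j a. lb = Some (j, a) \<Longrightarrow> j \<noteq> j' \<and> a \<in> H i"
        using less.prems(2) H(2)[OF iI] by (auto simp: chain_def ds p valid_step_def)
      define q where "q = hd rest"
      have "?R = \<one> \<or> snd (snd (snd q)) \<in> H i \<and> top_form (H i) (y i) c (fst (snd (snd q))) (snd (snd (snd q))) ?R \<and>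
          (?e = \<one> \<longrightarrow> lb \<noteq> Some (fst (snd (snd q)), snd (snd (snd q))))"
      proof (cases "rest = []")
        case False
        have t: "top_form (H i) (y i) c (fst (snd (snd q))) (snd (snd (snd q))) ?R"
          using less.hyps[of rest] less.prems ch False rr by (auto simp: ds q_def)
        have "valid_step I A q" "fst q = i" using ch(2) False rr(3) by (auto simp: chain_def q_def)
        then have "snd (snd (snd q)) \<in> H i" using H(2)[OF iI] by (auto simp: valid_step_def)
        moreover have "lb \<noteq> Some (fst (snd (snd q)), snd (snd (snd q)))" if "?e = \<one>"
        proof -
          have "run = []" using low(2)[OF ch(1) rr(2)] that by blast
          then have "(fst p, fst (snd p)) \<noteq> (fst q, Some (snd (snd q)))"
            using less.prems(2) False by (auto simp: chain_def ds rr q_def successively_Cons)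
          then show ?thesis using \<open>fst q = i\<close> by (auto simp: p)
        qed
        ultimately show ?thesis using t by blast
      qed simp
      from top_form_step[OF tf low(1)[OF ch(1) rr(2)] v this]
      have "top_form (H i) (y i) c j' a' (step_val G ?L ?L p \<otimes> (?e \<otimes> ?R))"
        by (simp add: step_val_def label_val_def p)
      moreover have "?e \<otimes> ?R = chain_val G ?L ?L ps" using chain_val_append[of run rest] ch rr(1) by simp
      ultimately show ?case by (simp add: ds p)
    qed
    obtain run rest where rr: "cs = run @ rest" "fst ` set run \<subseteq> ?T" "rest \<noteq> [] \<longrightarrow> fst (hd rest) = i"
      using split[of cs] less.prems by auto
    have ch: "chain I A run" "chain I A rest" using chain_append less.prems by (auto simp: rr)
    show ?case
    proof (cases "rest = []")
      case True
      then show ?thesis using low(2)[OF ch(1) rr(2)] rr(1) less.prems by simp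
    next
      case False
      have "valid_step I A (hd rest)" using ch(2) False by (auto simp: chain_def)
      then have "snd (snd (snd (hd rest))) \<in> H i" using H(2)[OF iI] rr(3) False by (auto simp: valid_step_def)
      then have R: "chain_val G ?L ?L rest \<notin> H i"
      proof -
        have "fst ` set rest \<subseteq> T" using less.prems(5) rr(1) by auto
        then show ?thesis
          using top_form_not_in[OF tf top[of rest]] ch False rr(3) \<open>snd (snd (snd (hd rest))) \<in> H i\<close> by auto
      qed
      have "chain_val G ?L ?L run \<otimes> chain_val G ?L ?L rest \<noteq> \<one>"
      proof
        assume "chain_val G ?L ?L run \<otimes> chain_val G ?L ?L rest = \<one>"
        then have "chain_val G ?L ?L rest = inv (chain_val G ?L ?L run)"
          using stepG[OF ch(1)] stepG[OF ch(2)] by (metis inv_equality inv_inv inv_closed)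
        then show False using R low(1)[OF ch(1) rr(2)] subgroup.m_inv_closed[OF H(1)[OF iI]] by simp
      qed
      then show ?thesis using chain_val_append[of run rest] less.prems rr(1) by simp
    qed
  qed
  then show ?thesis unfolding no_cycles_def
  proof (intro allI impI)
    fix cs :: "('c, 'a) step list" assume cs: "cs \<noteq> [] \<and> chain I A cs"
    then have "fst ` set cs \<subseteq> I" by (auto simp: chain_def valid_step_def)
    then show "chain_val G ?L ?L cs \<noteq> \<one>"
      using \<open>\<And>cs T. finite T \<Longrightarrow> T \<subseteq> I \<Longrightarrow> cs \<noteq> [] \<Longrightarrow> chain I A cs \<Longrightarrow> fst ` set cs \<subseteq> T \<Longrightarrow> chain_val G ?L ?L cs \<noteq> \<one>\<close>[of "fst ` set cs" cs] cs
      by auto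
  qed
qed

end

section \<open>Embedding into SL2 of an ultrapower\<close>

text \<open>A filter minimal among the proper ones below \<open>F\<close>. Its infimum with the
  principal filter of \<open>P\<close> is either improper, so that the negation of \<open>P\<close>
  holds eventually, or the filter itself.\<close>

lemma ultrafilter_exists:
  assumes "F \<noteq> (bot :: 'i filter)"
  obtains U where "U \<le> F" "U \<noteq> bot" "\<And>P. eventually P U \<or> eventually (\<lambda>x. \<not> P x) U"
proof -
  define S where "S = {U. U \<le> F \<and> U \<noteq> bot}"
  have "\<exists>M\<in>S. \<forall>A\<in>S. A \<le> M \<longrightarrow> A = M"
  proof (rule predicate_Zorn[where P = "\<lambda>x y. y \<le> x", simplified])
    show "partial_order_on S (relation_of (\<lambda>x y. y \<le> x) S)"
      by (rule partial_order_on_relation_ofI) auto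
    fix C assume C: "C \<in> Chains (relation_of (\<lambda>x y. y \<le> x) S)"
    then have CS: "C \<subseteq> S" and ch: "\<And>A B. A \<in> C \<Longrightarrow> B \<in> C \<Longrightarrow> A \<le> B \<or> B \<le> A"
      by (auto simp: Chains_def relation_of_def)
    show "\<exists>u\<in>S. \<forall>a\<in>C. u \<le> a"
    proof (cases "C = {}")
      case True
      then show ?thesis using assms by (auto simp: S_def)
    next
      case False
      have ev: "eventually P (Inf C) \<longleftrightarrow> (\<exists>b\<in>C. eventually P b)" for P
      proof (rule eventually_Inf_base[OF False])
        fix A B assume "A \<in> C" "B \<in> C"
        then show "\<exists>x\<in>C. x \<le> inf A B" using ch[of A B] by (auto simp: inf.absorb1 inf.absorb2 intro: bexI[of _ A] bexI[of _ B])
      qed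
      have "Inf C \<noteq> bot"
      proof
        assume "Inf C = bot"
        then have "eventually (\<lambda>_. False) (Inf C)" by simp
        then obtain b where "b \<in> C" "eventually (\<lambda>_. False) b" unfolding ev by blast
        then show False using CS by (auto simp: S_def trivial_limit_def)
      qed
      moreover have "Inf C \<le> F" using False CS by (auto simp: S_def intro: Inf_lower2)
      ultimately show ?thesis by (intro bexI[of _ "Inf C"]) (auto simp: S_def intro: Inf_lower)
    qed
  qed
  then obtain U where U: "U \<in> S" "\<And>A. A \<in> S \<Longrightarrow> A \<le> U \<Longrightarrow> A = U" by blast
  have "eventually P U \<or> eventually (\<lambda>x. \<not> P x) U" for P
  proof (rule ccontr)
    assume n: "\<not> ?thesis"
    let ?A = "inf U (principal {x. P x})"
    have "?A \<noteq> bot"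
    proof
      assume "?A = bot"
      then have "eventually (\<lambda>_. False) ?A" by simp
      then have "eventually (\<lambda>x. \<not> P x) U" by (simp add: eventually_inf_principal)
      then show False using n by blast
    qed
    moreover have "?A \<le> F" using U(1) by (auto simp: S_def intro: le_infI1)
    ultimately have "?A = U" using U(2)[of ?A] by (simp add: S_def)
    moreover have "eventually P ?A" by (simp add: eventually_inf_principal)
    ultimately show False using n by simp
  qed
  then show ?thesis using that U(1) by (auto simp: S_def)
qed

text \<open>Lying below \<open>finite_subsets_at_top\<close> means that \<open>T\<close> is
  eventually finite and eventually contains any given finite set.\<close>

definition ultra :: "'g set filter" where
  "ultra = (SOME U. U \<le> finite_subsets_at_top UNIV \<and> U \<noteq> bot \<and>
     (\<forall>P. eventually P U \<or> eventually (\<lambda>x. \<not> P x) U))"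

lemma ultra_spec: "(ultra :: 'g set filter) \<le> finite_subsets_at_top UNIV \<and> (ultra :: 'g set filter) \<noteq> bot \<and>
  (\<forall>P. eventually P (ultra :: 'g set filter) \<or> eventually (\<lambda>x. \<not> P x) ultra)"
proof -
  obtain U :: "'g set filter" where "U \<le> finite_subsets_at_top UNIV" "U \<noteq> bot"
    "\<And>P. eventually P U \<or> eventually (\<lambda>x. \<not> P x) U"
    using ultrafilter_exists[OF finite_subsets_at_top_neq_bot] by metis
  then have "\<exists>U::'g set filter. U \<le> finite_subsets_at_top UNIV \<and> U \<noteq> bot \<and>
      (\<forall>P. eventually P U \<or> eventually (\<lambda>x. \<not> P x) U)" by blast
  from someI_ex[OF this] show ?thesis by (simp add: ultra_def)
qed

lemmas ultra = ultra_spec[THEN conjunct1] ultra_spec[THEN conjunct2, THEN conjunct1]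
  ultra_spec[THEN conjunct2, THEN conjunct2, THEN spec]

lemma ultra_finite_superset: "finite A \<Longrightarrow> eventually (\<lambda>T. finite T \<and> A \<subseteq> T) ultra"
  by (rule filter_leD[OF ultra(1)]) (auto simp: eventually_finite_subsets_at_top)

lemma ultra_const [simp]: "eventually (\<lambda>_. P) ultra \<longleftrightarrow> P"
  using ultra(2) by (cases P) (auto simp: trivial_limit_def)

text \<open>The ultrapower of the rationals over the finite subsets of the group: a group that embeds
  locally into \<open>SL\<^sub>2(\<rat>)\<close> embeds into \<open>SL\<^sub>2\<close> of this field.\<close>

quotient_type 'g hrat = "'g set \<Rightarrow> rat" / "\<lambda>f g. eventually (\<lambda>T. f T = g T) ultra"
proof (rule equivpI)
  show "transp (\<lambda>f g :: 'a set \<Rightarrow> rat. eventually (\<lambda>T. f T = g T) ultra)"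
    by (rule transpI) (auto elim: eventually_elim2)
qed (auto intro!: reflpI sympI elim: eventually_mono)

instantiation hrat :: (type) field
begin

lift_definition zero_hrat :: "'a hrat" is "\<lambda>_. 0" .
lift_definition one_hrat :: "'a hrat" is "\<lambda>_. 1" .
lift_definition plus_hrat :: "'a hrat \<Rightarrow> 'a hrat \<Rightarrow> 'a hrat" is "\<lambda>f g T. f T + g T"
  by (erule (1) eventually_elim2, simp)
lift_definition times_hrat :: "'a hrat \<Rightarrow> 'a hrat \<Rightarrow> 'a hrat" is "\<lambda>f g T. f T * g T"
  by (erule (1) eventually_elim2, simp)
lift_definition uminus_hrat :: "'a hrat \<Rightarrow> 'a hrat" is "\<lambda>f T. - f T"
  by (erule eventually_mono, simp)
lift_definition minus_hrat :: "'a hrat \<Rightarrow> 'a hrat \<Rightarrow> 'a hrat" is "\<lambda>f g T. f T - g T"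
  by (erule (1) eventually_elim2, simp)
lift_definition inverse_hrat :: "'a hrat \<Rightarrow> 'a hrat" is "\<lambda>f T. inverse (f T)"
  by (erule eventually_mono, simp)
lift_definition divide_hrat :: "'a hrat \<Rightarrow> 'a hrat \<Rightarrow> 'a hrat" is "\<lambda>f g T. f T / g T"
  by (erule (1) eventually_elim2, simp)

instance
proof
  fix a b c :: "'a hrat"
  show "a + b + c = a + (b + c)" by transfer (simp add: add.assoc)
  show "a + b = b + a" by transfer (simp add: add.commute)
  show "0 + a = a" by transfer simp
  show "- a + a = 0" by transfer simp
  show "a - b = a + - b" by transfer simp
  show "a * b * c = a * (b * c)" by transfer (simp add: mult.assoc)
  show "a * b = b * a" by transfer (simp add: mult.commute)
  show "1 * a = a" by transfer simp
  show "(a + b) * c = a * c + b * c" by transfer (simp add: distrib_right)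
  show "(0 :: 'a hrat) \<noteq> 1" by transfer simp
  show "a div b = a * inverse b" by transfer (simp add: divide_inverse)
  show "inverse (0 :: 'a hrat) = 0" by transfer simp
  show "inverse a * a = 1" if "a \<noteq> 0"
    using that
  proof transfer
    fix f :: "'a set \<Rightarrow> rat" assume "\<not> eventually (\<lambda>T. f T = 0) ultra"
    then have "eventually (\<lambda>T. f T \<noteq> 0) ultra" using ultra(3) by blast
    then show "eventually (\<lambda>T. inverse (f T) * f T = 1) ultra" by (rule eventually_mono) simp
  qed
qed

end

section \<open>Matrices of determinant one and a free subgroup over the rationals\<close>

datatype 'f mat2 = Mat2 (m11: 'f) (m12: 'f) (m21: 'f) (m22: 'f)

fun mmul :: "'f::comm_ring_1 mat2 \<Rightarrow> 'f mat2 \<Rightarrow> 'f mat2" where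
  "mmul (Mat2 a b c d) (Mat2 a' b' c' d') = Mat2 (a*a' + b*c') (a*b' + b*d') (c*a' + d*c') (c*b' + d*d')"

fun mdet :: "'f::comm_ring_1 mat2 \<Rightarrow> 'f" where "mdet (Mat2 a b c d) = a * d - b * c"

fun madj :: "'f::comm_ring_1 mat2 \<Rightarrow> 'f mat2" where "madj (Mat2 a b c d) = Mat2 d (- b) (- c) a"

definition SL2 :: "'f::comm_ring_1 mat2 monoid" where
  "SL2 = \<lparr>carrier = {A. mdet A = 1}, monoid.mult = mmul, one = Mat2 1 0 0 1\<rparr>"

lemma SL2_simps [simp]: "A \<in> carrier SL2 \<longleftrightarrow> mdet A = 1" "monoid.mult SL2 = mmul" "\<one>\<^bsub>SL2\<^esub> = Mat2 1 0 0 1"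
  by (simp_all add: SL2_def)

lemma mmul_assoc: "mmul (mmul A B) C = mmul A (mmul B C)"
  by (cases A; cases B; cases C) (simp add: algebra_simps)

lemma mdet_mmul: "mdet (mmul A B) = mdet A * mdet B"
  by (cases A; cases B) (simp add: algebra_simps)

lemma mmul_one [simp]: "mmul (Mat2 1 0 0 1) A = A" "mmul A (Mat2 1 0 0 1) = A"
  by (cases A; simp)+

lemma mmul_madj: "mdet A = 1 \<Longrightarrow> mmul (madj A) A = Mat2 1 0 0 1" "mdet A = 1 \<Longrightarrow> mmul A (madj A) = Mat2 1 0 0 1"
  by (cases A; simp add: algebra_simps)+

lemma mdet_madj [simp]: "mdet (madj A) = mdet A"
  by (cases A) (simp add: algebra_simps)

lemma group_SL2: "group (SL2 :: 'f::comm_ring_1 mat2 monoid)"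
proof (rule groupI)
  fix A :: "'f mat2" assume "A \<in> carrier SL2"
  then show "\<exists>B\<in>carrier SL2. B \<otimes>\<^bsub>SL2\<^esub> A = \<one>\<^bsub>SL2\<^esub>" by (intro bexI[of _ "madj A"]) (simp_all add: mmul_madj)
qed (auto simp: mmul_assoc mdet_mmul)

lemma SL2_inv: "mdet A = 1 \<Longrightarrow> inv\<^bsub>SL2\<^esub> A = madj A"
  using group.inv_equality[OF group_SL2, of "madj A" A] by (simp add: mmul_madj)

text \<open>A Schottky group: the generator with index \<open>n\<close> is \<open>z \<mapsto> c - 1 / (z - d)\<close> with \<open>c = 6 n\<close> and
  \<open>d = 6 n + 3\<close>. It maps the outside of the unit interval about \<open>d\<close> into the one about \<open>c\<close>, and
  these intervals are all disjoint.\<close>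

definition ctr :: "bool \<times> nat \<Rightarrow> int" where
  "ctr p = (if fst p then 6 * int (snd p) else 6 * int (snd p) + 3)"

definition schottky :: "nat \<Rightarrow> rat mat2" where
  "schottky n = (let c = of_int (6 * int n); d = of_int (6 * int n + 3) in Mat2 c (- c * d - 1) 1 (- d))"

fun act :: "rat mat2 \<Rightarrow> rat \<times> rat \<Rightarrow> rat \<times> rat" where
  "act (Mat2 a b c d) (u, v) = (a * u + b * v, c * u + d * v)"

lemma act_mmul: "act (mmul A B) x = act A (act B x)"
  by (cases A; cases B; cases x) (simp add: algebra_simps)

text \<open>Ping-pong in homogeneous coordinates \<open>(u, v)\<close>, so that nothing is divided
  by zero: the image of the base point lies in the interval of the first letter. The base point
  \<open>-10\<close> is outside all intervals, as their centres are nonnegative.\<close>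

lemma schottky_word:
  assumes "w \<noteq> []" "reduced_word w"
  shows "let x = act (word_eval SL2 (map (map_prod id schottky) w)) (- 10, 1) in
    \<bar>fst x - of_int (ctr (hd w)) * snd x\<bar> < \<bar>snd x\<bar>"
  using assms
proof (induction w)
  case (Cons p w)
  define x where "x = act (word_eval SL2 (map (map_prod id schottky) w)) (- 10, 1)"
  obtain u v where uv: "x = (u, v)" by (cases x)
  let ?c = "of_int (6 * int (snd p)) :: rat" and ?d = "of_int (6 * int (snd p) + 3) :: rat"
  \<comment> \<open>The pole of the letter \<open>p\<close>, which is the centre belonging to its
    inverse. Reducedness keeps the current point in the interval of another centre, and distinct
    centres are at least 3 apart.\<close>
  let ?o = "of_int (ctr (\<not> fst p, snd p)) :: rat"
  have far: "\<bar>v\<bar> < \<bar>u - ?o * v\<bar>"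
  proof (cases "w = []")
    case True
    then have "u = - 10" "v = 1" using uv by (auto simp: x_def)
    then show ?thesis by (simp add: ctr_def)
  next
    case False
    let ?k = "of_int (ctr (hd w)) :: rat"
    have IH: "\<bar>u - ?k * v\<bar> < \<bar>v\<bar>"
    proof -
      have "reduced_word w" using Cons.prems(2) False by (auto simp: reduced_word_iff successively_Cons)
      from Cons.IH[OF False this] show ?thesis unfolding x_def[symmetric] Let_def uv by simp
    qed
    have "hd w \<noteq> (\<not> fst p, snd p)"
      using Cons.prems False by (auto simp: reduced_word_iff successively_Cons)
    then have "\<bar>ctr (hd w) - ctr (\<not> fst p, snd p)\<bar> \<ge> 3"
      by (cases "hd w") (auto simp: ctr_def split: if_splits, presburger+)
    then have "\<bar>?k - ?o\<bar> \<ge> 3" by (metis of_int_abs of_int_diff of_int_le_iff of_int_numeral)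
    then have "3 * \<bar>v\<bar> \<le> \<bar>(?k - ?o) * v\<bar>" by (simp add: abs_mult mult_right_mono)
    also have "(?k - ?o) * v = (u - ?o * v) - (u - ?k * v)" by (simp add: algebra_simps)
    also have "\<bar>\<dots>\<bar> \<le> \<bar>u - ?o * v\<bar> + \<bar>u - ?k * v\<bar>" by (rule abs_triangle_ineq4)
    finally show ?thesis using IH by linarith
  qed
  have det: "mdet (schottky n) = 1" for n by (simp add: schottky_def Let_def algebra_simps)
  have id1: "c * u + (- c * d - 1) * v - c * (u - d * v) = - v"
    and id2: "- d * u + (c * d + 1) * v - d * (- u + c * v) = v" for c d u v :: rat
    by (simp_all add: algebra_simps)
  show ?case
  proof (cases "fst p")
    case True
    have a: "act (word_eval SL2 (map (map_prod id schottky) (p # w))) (- 10, 1) =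
        (?c * u + (- ?c * ?d - 1) * v, u - ?d * v)"
      using True uv by (simp add: act_mmul x_def[symmetric] schottky_def Let_def distrib_right left_diff_distrib)
    have c: "of_int (ctr p) = ?c" "?o = ?d" using True by (simp_all add: ctr_def)
    show ?thesis using far unfolding Let_def a list.sel fst_conv snd_conv c id1 by simp
  next
    case False
    have a: "act (word_eval SL2 (map (map_prod id schottky) (p # w))) (- 10, 1) =
        (- ?d * u + (?c * ?d + 1) * v, - u + ?c * v)"
      using False uv by (simp add: act_mmul x_def[symmetric] SL2_inv det) (simp add: schottky_def Let_def)
    have c: "of_int (ctr p) = ?d" "?o = ?c" using False by (simp_all add: ctr_def)
    have "\<bar>- u + ?c * v\<bar> = \<bar>u - ?c * v\<bar>" by (simp add: abs_minus_commute)
    then show ?thesis using far unfolding Let_def a list.sel fst_conv snd_conv c id2 by simp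
  qed
qed simp

lemma schottky_det: "mdet (schottky n) = 1"
  by (simp add: schottky_def Let_def algebra_simps)

lemma schottky_free:
  assumes "w \<noteq> []" "reduced_word w"
  shows "word_eval SL2 (map (map_prod id schottky) w) \<noteq> \<one>\<^bsub>SL2\<^esub>"
proof
  assume "word_eval SL2 (map (map_prod id schottky) w) = \<one>\<^bsub>SL2\<^esub>"
  then have "\<bar>- 10 - of_int (ctr (hd w)) :: rat\<bar> < 1"
    using schottky_word[OF assms] by (simp add: Let_def)
  moreover have "(0::rat) \<le> of_int (ctr (hd w))" by (simp add: ctr_def)
  ultimately show False by linarith
qed

context group
begin

lemma free_embeds_SL2:
  assumes B: "free_basis G B" "finite B"
  obtains \<phi> :: "'a \<Rightarrow> rat mat2" where "\<phi> \<in> hom (G\<lparr>carrier := generate G B\<rparr>) SL2"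
    "\<And>g. g \<in> generate G B \<Longrightarrow> g \<noteq> \<one> \<Longrightarrow> \<phi> g \<noteq> \<one>\<^bsub>SL2\<^esub>"
proof -
  have BG: "B \<subseteq> carrier G" using B by (simp add: free_basis_def)
  obtain \<iota> :: "'a \<Rightarrow> nat" where \<iota>: "inj_on \<iota> B" using finite_imp_inj_to_nat_seg[OF B(2)] by blast
  have "(schottky \<circ> \<iota>) ` B \<subseteq> carrier SL2" by (auto simp: schottky_det)
  from free_basis_hom_extend[OF B(1) group_SL2 this] obtain \<phi> where
    \<phi>: "\<phi> \<in> hom (G\<lparr>carrier := generate G B\<rparr>) SL2"
      "\<And>w. letters w \<subseteq> B \<Longrightarrow> \<phi> (word_eval G w) = word_eval SL2 (map (map_prod id (schottky \<circ> \<iota>)) w)"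
    by metis
  show ?thesis
  proof (rule that[OF \<phi>(1)])
    fix g assume g: "g \<in> generate G B" "g \<noteq> \<one>"
    obtain w where w: "letters w \<subseteq> B" "reduced_word w" "word_eval G w = g"
      using reduced_word_exists[OF BG g(1)] by blast
    let ?w = "map (map_prod id \<iota>) w"
    have "reduced_word ?w" using w(1,2) \<iota> unfolding reduced_word_iff successively_map
      by (auto elim!: successively_mono simp: letters_def inj_on_def subset_iff)
    moreover have "?w \<noteq> []" using w g by auto
    ultimately have "word_eval SL2 (map (map_prod id schottky) ?w) \<noteq> \<one>\<^bsub>SL2\<^esub>" by (intro schottky_free)
    moreover have "map (map_prod id schottky) ?w = map (map_prod id (schottky \<circ> \<iota>)) w" by auto
    ultimately show "\<phi> g \<noteq> \<one>\<^bsub>SL2\<^esub>" using \<phi>(2)[OF w(1)] unfolding w(3) by argo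
  qed
qed

text \<open>The entries of \<open>\<rho> g\<close> are the classes of those of
  \<open>\<phi> T g\<close>, where \<open>\<phi> T\<close> embeds the subgroup generated by the
  group elements in \<open>T\<close>. Off that subgroup \<open>\<phi> T\<close> is arbitrary, but
  every equation to be checked involves finitely many elements, which eventually lie in
  \<open>T\<close>.\<close>

lemma locally_free_embeds_SL2:
  assumes lf: "locally_free G"
  obtains \<rho> :: "'a \<Rightarrow> 'a hrat mat2" where "\<rho> \<in> hom G SL2" "inj_on \<rho> (carrier G)"
proof -
  have "\<exists>\<phi> :: 'a \<Rightarrow> rat mat2. \<phi> \<in> hom (G\<lparr>carrier := generate G (T \<inter> carrier G)\<rparr>) SL2 \<and>
      (\<forall>g\<in>generate G (T \<inter> carrier G). g \<noteq> \<one> \<longrightarrow> \<phi> g \<noteq> \<one>\<^bsub>SL2\<^esub>)" if "finite T" for T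
  proof -
    have T: "finite (T \<inter> carrier G)" "T \<inter> carrier G \<subseteq> carrier G" using that by auto
    obtain B where B: "finite B" "free_basis G B" "generate G B = generate G (T \<inter> carrier G)"
      by (rule locally_free_basis[OF lf T])
    obtain \<phi> :: "'a \<Rightarrow> rat mat2" where "\<phi> \<in> hom (G\<lparr>carrier := generate G B\<rparr>) SL2"
      "\<And>g. g \<in> generate G B \<Longrightarrow> g \<noteq> \<one> \<Longrightarrow> \<phi> g \<noteq> \<one>\<^bsub>SL2\<^esub>"
      using free_embeds_SL2[OF B(2,1)] by metis
    then show ?thesis unfolding B(3) by blast
  qed
  then obtain \<phi> :: "'a set \<Rightarrow> 'a \<Rightarrow> rat mat2" where
    \<phi>: "\<And>T. finite T \<Longrightarrow> \<phi> T \<in> hom (G\<lparr>carrier := generate G (T \<inter> carrier G)\<rparr>) SL2"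
      "\<And>T g. finite T \<Longrightarrow> g \<in> generate G (T \<inter> carrier G) \<Longrightarrow> g \<noteq> \<one> \<Longrightarrow> \<phi> T g \<noteq> \<one>\<^bsub>SL2\<^esub>"
    by metis
  define \<rho> :: "'a \<Rightarrow> 'a hrat mat2" where
    "\<rho> g = Mat2 (abs_hrat (\<lambda>T. m11 (\<phi> T g))) (abs_hrat (\<lambda>T. m12 (\<phi> T g)))
       (abs_hrat (\<lambda>T. m21 (\<phi> T g))) (abs_hrat (\<lambda>T. m22 (\<phi> T g)))" for g
  have mul: "eventually (\<lambda>T. \<phi> T (g \<otimes> h) = mmul (\<phi> T g) (\<phi> T h)) ultra"
    if "g \<in> carrier G" "h \<in> carrier G" for g h
  proof (rule eventually_mono[OF ultra_finite_superset[of "{g, h}"]])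
    fix T assume T: "finite T \<and> {g, h} \<subseteq> T"
    then have "g \<in> generate G (T \<inter> carrier G)" "h \<in> generate G (T \<inter> carrier G)"
      using that by (auto intro: generate.incl)
    then show "\<phi> T (g \<otimes> h) = mmul (\<phi> T g) (\<phi> T h)" using \<phi>(1)[of T] T by (simp add: hom_def)
  qed simp
  have det: "eventually (\<lambda>T. mdet (\<phi> T g) = 1) ultra" if "g \<in> carrier G" for g
  proof (rule eventually_mono[OF ultra_finite_superset[of "{g}"]])
    fix T assume T: "finite T \<and> {g} \<subseteq> T"
    then have "g \<in> generate G (T \<inter> carrier G)" using that by (auto intro: generate.incl)
    then show "mdet (\<phi> T g) = 1" using hom_in_carrier[OF \<phi>(1)[of T], of g] T by simp
  qed simp
  have "\<rho> \<in> hom G SL2"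
  proof (rule homI)
    fix g assume g: "g \<in> carrier G"
    have "m11 A * m22 A - m12 A * m21 A = mdet A" for A :: "rat mat2" by (cases A) simp
    then have "mdet (\<rho> g) = 1"
      using det[OF g] unfolding \<rho>_def mdet.simps one_hrat_def
      by (simp add: times_hrat.abs_eq minus_hrat.abs_eq hrat.abs_eq_iff)
    then show "\<rho> g \<in> carrier SL2" by simp
  next
    fix g h assume gh: "g \<in> carrier G" "h \<in> carrier G"
    have m: "m11 (mmul A C) = m11 A * m11 C + m12 A * m21 C" "m12 (mmul A C) = m11 A * m12 C + m12 A * m22 C"
      "m21 (mmul A C) = m21 A * m11 C + m22 A * m21 C" "m22 (mmul A C) = m21 A * m12 C + m22 A * m22 C"
      for A C :: "rat mat2" by (cases A; cases C; simp)+
    show "\<rho> (g \<otimes> h) = \<rho> g \<otimes>\<^bsub>SL2\<^esub> \<rho> h"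
      using mul[OF gh] unfolding \<rho>_def
      by (auto simp: times_hrat.abs_eq plus_hrat.abs_eq hrat.abs_eq_iff elim!: eventually_mono simp: m)
  qed
  moreover have "inj_on \<rho> (carrier G)"
  proof -
    interpret h: group_hom G SL2 \<rho>
      using \<open>\<rho> \<in> hom G SL2\<close> by (simp add: group_hom_def group_hom_axioms_def group_SL2 is_group)
    have "g = \<one>" if g: "g \<in> carrier G" "\<rho> g = \<one>\<^bsub>SL2\<^esub>" for g
    proof (rule ccontr)
      assume "g \<noteq> \<one>"
      have "eventually (\<lambda>T. m11 (\<phi> T g) = 1 \<and> m12 (\<phi> T g) = 0 \<and> m21 (\<phi> T g) = 0 \<and> m22 (\<phi> T g) = 1) ultra"
        using g(2) unfolding \<rho>_def
        by (simp add: one_hrat_def zero_hrat_def hrat.abs_eq_iff eventually_conj_iff)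
      moreover have "eventually (\<lambda>T. \<phi> T g \<noteq> \<one>\<^bsub>SL2\<^esub>) ultra"
      proof (rule eventually_mono[OF ultra_finite_superset[of "{g}"]])
        fix T assume T: "finite T \<and> {g} \<subseteq> T"
        then have "g \<in> generate G (T \<inter> carrier G)" using g by (auto intro: generate.incl)
        then show "\<phi> T g \<noteq> \<one>\<^bsub>SL2\<^esub>" using \<phi>(2) T \<open>g \<noteq> \<one>\<close> by blast
      qed simp
      ultimately have "eventually (\<lambda>T. False) (ultra :: 'a set filter)"
      proof (rule eventually_elim2)
        fix T assume "m11 (\<phi> T g) = 1 \<and> m12 (\<phi> T g) = 0 \<and> m21 (\<phi> T g) = 0 \<and> m22 (\<phi> T g) = 1" "\<phi> T g \<noteq> \<one>\<^bsub>SL2\<^esub>"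
        then show False by (cases "\<phi> T g") simp
      qed
      then show False by simp
    qed
    then show ?thesis using h.inj_iff_trivial_ker by (auto simp: kernel_def h.inj_iff_trivial_ker)
  qed
  ultimately show ?thesis using that by blast
qed

end

section \<open>Cardinality and valuation rings\<close>

unbundle cardinal_syntax

lemma card_of_countable: "countable A \<Longrightarrow> infinite \<Lambda> \<Longrightarrow> |A| \<le>o |\<Lambda>|"
proof -
  assume A: "countable A" and L: "infinite \<Lambda>"
  have "|A| \<le>o |UNIV :: nat set|"
    using A by (auto simp: countable_def card_of_ordLeq[symmetric])
  then show ?thesis using L infinite_iff_card_of_nat ordLeq_transitive by blast
qed

lemma card_of_lists_ordLeq:
  assumes L: "infinite \<Lambda>" and A: "|A| \<le>o |\<Lambda>|"
  shows "|{l. set l \<subseteq> A}| \<le>o |\<Lambda>|"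
proof -
  have n: "|{l. set l \<subseteq> A \<and> length l = n}| \<le>o |\<Lambda>|" for n
  proof (induction n)
    case 0
    have "{l. set l \<subseteq> A \<and> length l = 0} = {[]}" by auto
    then show ?case using card_of_countable[OF _ L, of "{[]}"] by simp
  next
    case (Suc n)
    let ?S = "SIGMA a:A. {l. set l \<subseteq> A \<and> length l = n}"
    have "{l. set l \<subseteq> A \<and> length l = Suc n} = (\<lambda>(a, l). a # l) ` ?S"
      by (auto simp: image_iff length_Suc_conv)
    then have "|{l. set l \<subseteq> A \<and> length l = Suc n}| \<le>o |?S|" by (simp add: card_of_image)
    moreover have "|?S| \<le>o |\<Lambda>|" by (rule card_of_Sigma_ordLeq_infinite[OF L A]) (use Suc in auto)
    ultimately show ?case by (rule ordLeq_transitive)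
  qed
  have "{l. set l \<subseteq> A} = (\<Union>n. {l. set l \<subseteq> A \<and> length l = n})" by auto
  moreover have "|\<Union>n. {l. set l \<subseteq> A \<and> length l = n}| \<le>o |\<Lambda>|"
    by (rule card_of_UNION_ordLeq_infinite[OF L card_of_countable[OF _ L]]) (use n in auto)
  ultimately show ?thesis by simp
qed

lemma card_of_Un_ordLeq:
  assumes "infinite \<Lambda>" "|A| \<le>o |\<Lambda>|" "|B| \<le>o |\<Lambda>|"
  shows "|A \<union> B| \<le>o |\<Lambda>|"
proof -
  have "|\<Union>b\<in>(UNIV :: bool set). if b then A else B| \<le>o |\<Lambda>|"
    by (rule card_of_UNION_ordLeq_infinite[OF assms(1) card_of_countable[OF _ assms(1)]]) (use assms in auto)
  moreover have "(\<Union>b\<in>(UNIV :: bool set). if b then A else B) = A \<union> B" by (auto split: if_splits)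
  ultimately show ?thesis by simp
qed

text \<open>Operations take lists, so that one function covers all arities, and return sets, so that
  it can add all solutions of an equation at once. Countably many rounds suffice because lists are
  finite.\<close>

lemma small_closure_exists:
  fixes opr :: "'x list \<Rightarrow> 'x set"
  assumes L: "infinite \<Lambda>" and X: "|X| \<le>o |\<Lambda>|" "X \<subseteq> Z" and opr: "\<And>l. |opr l| \<le>o |\<Lambda>|" "\<And>l. opr l \<subseteq> Z"
  obtains Y where "X \<subseteq> Y" "Y \<subseteq> Z" "|Y| \<le>o |\<Lambda>|" "\<And>l. set l \<subseteq> Y \<Longrightarrow> opr l \<subseteq> Y"
proof -
  define S where "S n = ((\<lambda>Y. Y \<union> (\<Union>l\<in>{l. set l \<subseteq> Y}. opr l)) ^^ n) X" for n
  have S: "S 0 = X" "S (Suc n) = S n \<union> (\<Union>l\<in>{l. set l \<subseteq> S n}. opr l)" for n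
    by (simp_all add: S_def)
  have c: "|S n| \<le>o |\<Lambda>|" for n
  proof (induction n)
    case (Suc n)
    have "|\<Union>l\<in>{l. set l \<subseteq> S n}. opr l| \<le>o |\<Lambda>|"
      by (rule card_of_UNION_ordLeq_infinite[OF L card_of_lists_ordLeq[OF L Suc]]) (use opr in auto)
    then show ?case unfolding S by (rule card_of_Un_ordLeq[OF L Suc])
  qed (simp add: S X)
  have mono: "S m \<subseteq> S n" if "m \<le> n" for m n
    using that by (induction n) (auto simp: S le_Suc_eq)
  show ?thesis
  proof (rule that[of "\<Union>n. S n"])
    show "X \<subseteq> (\<Union>n. S n)" using S(1) by auto
    have "S n \<subseteq> Z" for n by (induction n) (use X(2) opr(2) in \<open>auto simp: S\<close>)
    then show "(\<Union>n. S n) \<subseteq> Z" by auto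
    show "|\<Union>n. S n| \<le>o |\<Lambda>|"
      by (rule card_of_UNION_ordLeq_infinite[OF L card_of_countable[OF _ L]]) (use c in auto)
    fix l assume "set l \<subseteq> (\<Union>n. S n)"
    then have "\<exists>n. set l \<subseteq> S n"
    proof (induction l)
      case (Cons a l)
      then obtain n m where "set l \<subseteq> S n" "a \<in> S m" by auto
      then have "set (a # l) \<subseteq> S (max m n)" using mono[of n "max m n"] mono[of m "max m n"] by auto
      then show ?case ..
    qed auto
    then obtain n where "set l \<subseteq> S n" ..
    then have "opr l \<subseteq> S (Suc n)" by (auto simp: S)
    then show "opr l \<subseteq> (\<Union>n. S n)" by auto
  qed
qed

section \<open>Subrings, algebraic elements and valuation rings\<close>

definition is_subring :: "'f::comm_ring_1 set \<Rightarrow> bool" where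
  "is_subring S \<longleftrightarrow> 1 \<in> S \<and> (\<forall>a\<in>S. \<forall>b\<in>S. a + b \<in> S \<and> a * b \<in> S) \<and> (\<forall>a\<in>S. - a \<in> S)"

lemma is_subringD:
  assumes "is_subring S"
  shows "1 \<in> S" "0 \<in> S" "a \<in> S \<Longrightarrow> b \<in> S \<Longrightarrow> a + b \<in> S" "a \<in> S \<Longrightarrow> b \<in> S \<Longrightarrow> a * b \<in> S" "a \<in> S \<Longrightarrow> - a \<in> S"
    "a \<in> S \<Longrightarrow> b \<in> S \<Longrightarrow> a - b \<in> S" "a \<in> S \<Longrightarrow> a ^ n \<in> S"
proof -
  show *: "1 \<in> S" "a \<in> S \<Longrightarrow> b \<in> S \<Longrightarrow> a + b \<in> S" "a \<in> S \<Longrightarrow> b \<in> S \<Longrightarrow> a * b \<in> S" "a \<in> S \<Longrightarrow> - a \<in> S" for a b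
    using assms by (auto simp: is_subring_def)
  show "0 \<in> S" using *(2)[of 1 "- 1"] *(1,4) by simp
  show "a \<in> S \<Longrightarrow> b \<in> S \<Longrightarrow> a - b \<in> S" using *(2)[of a "- b"] *(4) by simp
  show "a \<in> S \<Longrightarrow> a ^ n \<in> S" by (induction n) (auto intro: *)
qed

definition pol :: "'f::comm_ring_1 set \<Rightarrow> 'f poly set" where
  "pol S = {p. \<forall>i. coeff p i \<in> S}"

lemma sum_in_subring: "is_subring S \<Longrightarrow> (\<And>i. i \<in> I \<Longrightarrow> f i \<in> S) \<Longrightarrow> sum f I \<in> S"
  by (induction I rule: infinite_finite_induct) (auto intro: is_subringD)

lemma pol_closed:
  assumes S: "is_subring S"
  shows "p \<in> pol S \<Longrightarrow> q \<in> pol S \<Longrightarrow> p + q \<in> pol S" "p \<in> pol S \<Longrightarrow> q \<in> pol S \<Longrightarrow> p * q \<in> pol S"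
    "p \<in> pol S \<Longrightarrow> - p \<in> pol S" "p \<in> pol S \<Longrightarrow> q \<in> pol S \<Longrightarrow> p - q \<in> pol S" "a \<in> S \<Longrightarrow> monom a n \<in> pol S"
    "(\<And>i. i \<in> I \<Longrightarrow> f i \<in> pol S) \<Longrightarrow> sum f I \<in> pol S"
  by (auto simp: pol_def coeff_mult coeff_sum intro!: is_subringD[OF S] sum_in_subring[OF S])

lemma poly_in_subring: "is_subring S \<Longrightarrow> p \<in> pol S \<Longrightarrow> z \<in> S \<Longrightarrow> poly p z \<in> S"
  unfolding poly_altdef pol_def by (auto intro!: sum_in_subring is_subringD)

lemma adjoin_subring:
  assumes S: "is_subring S"
  shows "is_subring {poly p z | p. p \<in> pol S}" "S \<subseteq> {poly p z | p. p \<in> pol S}" "z \<in> {poly p z | p. p \<in> pol S}"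
proof -
  show "is_subring {poly p z | p. p \<in> pol S}"
    unfolding is_subring_def
  proof (intro conjI ballI)
    show "1 \<in> {poly p z | p. p \<in> pol S}"
      using pol_closed(5)[OF S is_subringD(1)[OF S], of 0] by (force simp: poly_monom)
  next
    fix a b assume "a \<in> {poly p z | p. p \<in> pol S}" "b \<in> {poly p z | p. p \<in> pol S}"
    then obtain p q where "p \<in> pol S" "q \<in> pol S" "a = poly p z" "b = poly q z" by auto
    then show "a + b \<in> {poly p z | p. p \<in> pol S}" "a * b \<in> {poly p z | p. p \<in> pol S}"
      using pol_closed(1,2)[OF S, of p q] by (metis (mono_tags, lifting) mem_Collect_eq poly_add poly_mult)+
  next
    fix a assume "a \<in> {poly p z | p. p \<in> pol S}"
    then obtain p where "p \<in> pol S" "a = poly p z" by auto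
    then show "- a \<in> {poly p z | p. p \<in> pol S}"
      using pol_closed(3)[OF S, of p] by (metis (mono_tags, lifting) mem_Collect_eq poly_minus)
  qed
  show "S \<subseteq> {poly p z | p. p \<in> pol S}"
  proof
    fix s assume "s \<in> S"
    then have "monom s 0 \<in> pol S" "poly (monom s 0) z = s" using pol_closed(5)[OF S] by (auto simp: poly_monom)
    then show "s \<in> {poly p z | p. p \<in> pol S}" by (metis (mono_tags, lifting) mem_Collect_eq)
  qed
  have "monom 1 1 \<in> pol S" "poly (monom 1 1) z = z" using pol_closed(5)[OF S is_subringD(1)[OF S]] by (auto simp: poly_monom)
  then show "z \<in> {poly p z | p. p \<in> pol S}" by (metis (mono_tags, lifting) mem_Collect_eq)
qed

definition algebraic_over :: "'f::field set \<Rightarrow> 'f \<Rightarrow> bool" where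
  "algebraic_over F e \<longleftrightarrow> (\<exists>p\<in>pol F. p \<noteq> 0 \<and> poly p e = 0)"

lemma card_of_algebraic:
  assumes L: "infinite \<Lambda>" and F: "|F| \<le>o |\<Lambda>|"
  shows "|{e. algebraic_over F e}| \<le>o |\<Lambda>|"
proof -
  have "inj_on coeffs (pol F)" by (simp add: inj_on_def coeffs_eq_iff)
  moreover have "coeffs ` pol F \<subseteq> {l. set l \<subseteq> F}" by (auto simp: pol_def coeffs_def split: if_splits)
  ultimately have "|pol F| \<le>o |{l. set l \<subseteq> F}|" using card_of_ordLeq[of "pol F" "{l. set l \<subseteq> F}"] by blast
  then have "|pol F| \<le>o |\<Lambda>|" using card_of_lists_ordLeq[OF L F] ordLeq_transitive by blast
  moreover have "pol F - {0} \<subseteq> pol F" by auto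
  ultimately have P: "|pol F - {0}| \<le>o |\<Lambda>|" using card_of_mono1 ordLeq_transitive by blast
  have "{e. algebraic_over F e} = (\<Union>p\<in>pol F - {0}. {e. poly p e = 0})" by (auto simp: algebraic_over_def)
  moreover have "|\<Union>p\<in>pol F - {0}. {e. poly p e = 0}| \<le>o |\<Lambda>|"
    by (rule card_of_UNION_ordLeq_infinite[OF L P]) (auto intro!: card_of_countable[OF _ L] countable_finite poly_roots_finite)
  ultimately show ?thesis by simp
qed

locale val_ring =
  fixes V :: "'f::field set"
  assumes subring: "is_subring V" and total: "z \<in> V \<or> inverse z \<in> V"
begin

text \<open>The nonunits of \<open>V\<close>, its maximal ideal. Zero is listed separately because
  \<open>inverse 0 = 0\<close> lies in \<open>V\<close>.\<close>

definition mx :: "'f set" where "mx = {z \<in> V. z = 0 \<or> inverse z \<notin> V}"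

lemmas V_closed [simp, intro] = is_subringD[OF subring]

lemma mx_V: "a \<in> mx \<Longrightarrow> a \<in> V" by (simp add: mx_def)

lemma zero_mx [simp]: "0 \<in> mx" by (simp add: mx_def)

lemma one_mx [simp]: "1 \<notin> mx" by (simp add: mx_def)

lemma unit_inverse: "a \<in> V \<Longrightarrow> a \<notin> mx \<Longrightarrow> inverse a \<in> V" by (simp add: mx_def)

lemma mx_mult: "a \<in> V \<Longrightarrow> b \<in> mx \<Longrightarrow> a * b \<in> mx"
proof -
  assume a: "a \<in> V" "b \<in> mx"
  have "inverse b \<in> V" if "a * b \<noteq> 0" "inverse (a * b) \<in> V"
  proof -
    have "a * inverse (a * b) \<in> V" using a that by blast
    then show ?thesis using that by (simp add: field_simps)
  qed
  then show "a * b \<in> mx" using a by (auto simp: mx_def)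
qed

lemma mx_mult': "b \<in> mx \<Longrightarrow> a \<in> V \<Longrightarrow> b * a \<in> mx"
  using mx_mult by (simp add: mult.commute)

lemma mx_add: "a \<in> mx \<Longrightarrow> b \<in> mx \<Longrightarrow> a + b \<in> mx"
proof -
  have *: "a + b \<in> mx" if ab: "a \<in> mx" "b \<in> mx" "b \<noteq> 0" "a / b \<in> V" for a b
  proof -
    have "1 + a / b \<in> V" using ab(4) by blast
    then have "(1 + a / b) * b \<in> mx" using mx_mult ab(2) by blast
    then show ?thesis using ab(3) by (simp add: distrib_right add.commute)
  qed
  assume ab: "a \<in> mx" "b \<in> mx"
  show "a + b \<in> mx"
  proof (cases "a = 0 \<or> b = 0")
    case False
    then show ?thesis using total[of "a / b"] *[of a b] *[of b a] ab by (auto simp: add.commute)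
  qed (use ab in auto)
qed

lemma mx_minus: "a \<in> mx \<Longrightarrow> - a \<in> mx"
  using mx_mult[of "- 1" a] by auto

lemma mx_diff: "a \<in> mx \<Longrightarrow> b \<in> mx \<Longrightarrow> a - b \<in> mx"
  using mx_add[of a "- b"] mx_minus by simp

lemma mx_prime: "a \<in> V \<Longrightarrow> b \<in> V \<Longrightarrow> a * b \<in> mx \<Longrightarrow> a \<in> mx \<or> b \<in> mx"
proof (rule ccontr)
  assume a: "a \<in> V" "b \<in> V" "a * b \<in> mx" "\<not> (a \<in> mx \<or> b \<in> mx)"
  then have "inverse a * inverse b \<in> V" "a * b \<noteq> 0" using unit_inverse by (auto simp: mx_def)
  then show False using a by (auto simp: mx_def mult.commute)
qed

lemma max_exists:
  assumes "finite E" "E \<noteq> {}" "0 \<notin> E"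
  shows "\<exists>\<theta>\<in>E. \<forall>z\<in>E. z / \<theta> \<in> V"
  using assms
proof (induction rule: finite_ne_induct)
  case (insert x F)
  then obtain \<theta> where \<theta>: "\<theta> \<in> F" "\<forall>z\<in>F. z / \<theta> \<in> V" by auto
  have nz: "x \<noteq> 0" "\<theta> \<noteq> 0" using insert \<theta> by auto
  show ?case
  proof (cases "x / \<theta> \<in> V")
    case False
    then have x: "\<theta> / x \<in> V" using total[of "x / \<theta>"] by simp
    have "z / x \<in> V" if "z \<in> F" for z
    proof -
      have "z / \<theta> * (\<theta> / x) \<in> V" using \<theta>(2) that x by blast
      then show ?thesis using nz by simp
    qed
    then show ?thesis using nz by auto
  qed (use \<theta> in auto)
qed auto

lemma inverse_mx: "z \<notin> V \<Longrightarrow> inverse z \<in> mx"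
  using total[of z] by (auto simp: mx_def)

end

text \<open>A subring maximal among those omitting \<open>e\<close> is a valuation ring.\<close>

lemma val_ring_exists:
  fixes F :: "'f::field set"
  assumes F: "is_subring F" and e: "\<not> algebraic_over F e"
  obtains V where "val_ring V" "F \<subseteq> V" "e \<notin> V"
proof -
  \<comment> \<open>Adjoining \<open>1 / e\<close> to \<open>F\<close> beforehand makes
    \<open>1 / e\<close> a nonunit in all rings considered, since these omit
    \<open>e\<close>.\<close>
  let ?A0 = "{poly p (inverse e) | p. p \<in> pol F}"
  note A0 = adjoin_subring[OF F, of "inverse e"]
  have e0: "e \<noteq> 0"
  proof
    assume "e = 0"
    then have "algebraic_over F e" unfolding algebraic_over_def
      using pol_closed(5)[OF F is_subringD(1)[OF F], of 1] by (intro bexI[of _ "monom 1 1"]) (auto simp: poly_monom)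
    then show False using e by simp
  qed
  \<comment> \<open>Multiplying \<open>e = p (1 / e)\<close> by \<open>e ^ degree p\<close> turns it
    into a monic algebraic equation for \<open>e\<close>.\<close>
  have eA0: "e \<notin> ?A0"
  proof
    assume "e \<in> ?A0"
    then obtain p where p: "p \<in> pol F" "e = poly p (inverse e)" by auto
    let ?q = "monom 1 (Suc (degree p)) - reflect_poly p"
    have "reflect_poly p \<in> pol F" using p(1) is_subringD(2)[OF F] by (auto simp: pol_def coeff_reflect_poly)
    then have "?q \<in> pol F" by (intro pol_closed(4)[OF F] pol_closed(5)[OF F] is_subringD(1)[OF F])
    moreover have "coeff ?q (Suc (degree p)) = 1" by (simp add: coeff_reflect_poly)
    then have "?q \<noteq> 0" by (metis coeff_0 zero_neq_one)
    moreover have "poly ?q e = 0" using p(2) e0 by (simp add: poly_monom poly_reflect_poly_nz mult.commute)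
    ultimately show False using e unfolding algebraic_over_def by blast
  qed
  define \<A> where "\<A> = {A. is_subring A \<and> ?A0 \<subseteq> A \<and> e \<notin> A}"
  have "\<exists>M\<in>\<A>. \<forall>X\<in>\<A>. M \<subseteq> X \<longrightarrow> X = M"
  proof (rule subset_Zorn_nonempty)
    show "\<A> \<noteq> {}" using A0 eA0 by (auto simp: \<A>_def)
    fix C assume C: "C \<noteq> {}" "subset.chain \<A> C"
    then have CA: "C \<subseteq> \<A>" and ch: "\<And>A B. A \<in> C \<Longrightarrow> B \<in> C \<Longrightarrow> A \<subseteq> B \<or> B \<subseteq> A"
      by (auto simp: subset_chain_def)
    have two: "\<exists>A\<in>C. a \<in> A \<and> b \<in> A" if "a \<in> \<Union>C" "b \<in> \<Union>C" for a b
      using that ch by (meson UnionE subsetD)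
    have "is_subring (\<Union>C)"
      unfolding is_subring_def
    proof (intro conjI ballI)
      have sr: "is_subring A" if "A \<in> C" for A using CA that by (auto simp: \<A>_def)
      obtain A where "A \<in> C" using C(1) by auto
      then show "1 \<in> \<Union>C" using is_subringD(1)[OF sr] by auto
      fix a assume a: "a \<in> \<Union>C"
      then show "- a \<in> \<Union>C" using is_subringD(5)[OF sr] by auto
      fix b assume b: "b \<in> \<Union>C"
      obtain A where "A \<in> C" "a \<in> A" "b \<in> A" using two[OF a b] by blast
      moreover from this have "is_subring A" using CA by (auto simp: \<A>_def)
      ultimately show "a + b \<in> \<Union>C" "a * b \<in> \<Union>C" using is_subringD(3,4) by blast+
    qed
    then show "\<Union>C \<in> \<A>" using C(1) CA by (auto simp: \<A>_def)
  qed
  then obtain V where V: "V \<in> \<A>" "\<And>X. X \<in> \<A> \<Longrightarrow> V \<subseteq> X \<Longrightarrow> X = V" by blast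
  have sV: "is_subring V" "e \<notin> V" "inverse e \<in> V" "F \<subseteq> V" using V(1) A0 by (auto simp: \<A>_def)
  note Vc = is_subringD[OF sV(1)]
  have adj: "\<exists>p\<in>pol V. poly p z = e" if "z \<notin> V" for z
  proof (rule ccontr)
    assume n: "\<not> ?thesis"
    let ?X = "{poly p z | p. p \<in> pol V}"
    note X = adjoin_subring[OF sV(1), of z]
    have "?X \<in> \<A>" using X n V(1) by (auto simp: \<A>_def)
    then have "?X = V" using V(2) X(2) by blast
    then show False using X(3) that by blast
  qed
  define t where "t = inverse e"
  have t: "t \<in> V" "t * e = 1" using sV(3) e0 by (auto simp: t_def)
  \<comment> \<open>\<open>t\<close> lies in the Jacobson radical. If \<open>u = 1 - t * c\<close>
    had no inverse in \<open>V\<close>, maximality would make \<open>e\<close> a polynomial in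
    \<open>1 / u\<close>. Clearing denominators puts some \<open>u ^ n * e\<close> into
    \<open>V\<close>; but \<open>u ^ n\<close> again has the form \<open>1 - t * d\<close>, so this
    is \<open>e - d\<close>.\<close>
  have unit: "inverse (1 - t * c) \<in> V" "1 - t * c \<noteq> 0" if c: "c \<in> V" for c
  proof -
    let ?u = "1 - t * c"
    have "e = c" if "?u = 0" using that t(2) by (metis e0 mult_cancel_left mult.commute eq_iff_diff_eq_0 mult_zero_left zero_neq_one)
    then show u0: "?u \<noteq> 0" using c sV(2) by auto
    show "inverse ?u \<in> V"
    proof (rule ccontr)
      assume "inverse ?u \<notin> V"
      then obtain p where p: "p \<in> pol V" "poly p (inverse ?u) = e" using adj by blast
      have "?u ^ degree p * e = poly (reflect_poly p) ?u"
        using p(2) u0 by (simp add: poly_reflect_poly_nz)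
      moreover have "reflect_poly p \<in> pol V" using p(1) Vc(2) by (auto simp: pol_def coeff_reflect_poly)
      ultimately have *: "?u ^ degree p * e \<in> V" using poly_in_subring[OF sV(1)] Vc t c by auto
      have "\<exists>d\<in>V. ?u ^ n = 1 - t * d" for n
      proof (induction n)
        case (Suc n)
        then obtain d where d: "d \<in> V" "?u ^ n = 1 - t * d" by blast
        have "?u ^ Suc n = 1 - t * (c + d - t * c * d)"
          unfolding power_Suc d(2) by (simp add: algebra_simps)
        moreover have "c + d - t * c * d \<in> V" by (intro Vc(3,4,6) d(1) c t(1))
        ultimately show ?case by blast
      qed (auto intro!: bexI[of _ 0] Vc)
      then obtain d where d: "d \<in> V" "?u ^ degree p = 1 - t * d" by blast
      have "?u ^ degree p * e = e - d" unfolding d(2) using t(2) by (simp add: algebra_simps)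
      then have "e - d \<in> V" using * by simp
      then have "(e - d) + d \<in> V" by (rule Vc(3)[OF _ d(1)])
      then show False using sV(2) by simp
    qed
  qed
  \<comment> \<open>The relation for \<open>1 / z\<close>, multiplied by \<open>t\<close>, expresses
    the unit \<open>1 - t * coeff q 0\<close> by negative powers of \<open>z\<close>. So the leading
    term of \<open>p\<close> can be rewritten in lower powers, none of them negative since
    \<open>degree q \<le> degree p\<close>.\<close>
  have reduce: "\<exists>p'\<in>pol V. poly p' z = e \<and> degree p' < degree p"
    if z: "z \<noteq> 0" and p: "p \<in> pol V" "poly p z = e" and q: "q \<in> pol V" "poly q (inverse z) = e"
      and le: "degree q \<le> degree p" for p q z
  proof -
    let ?m = "degree p" and ?l = "degree q"
    have m: "?m \<noteq> 0"
    proof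
      assume "?m = 0"
      then obtain a where "p = [:a:]" by (meson degree_eq_zeroE)
      then show False using p sV(2) by (auto simp: pol_def dest: spec[of _ 0])
    qed
    define u where "u = 1 - t * coeff q 0"
    have q0: "coeff q i \<in> V" "coeff p i \<in> V" for i using q p by (auto simp: pol_def)
    have u: "inverse u \<in> V" "u \<noteq> 0" using unit[OF q0(1)] by (auto simp: u_def)
    define c where "c = coeff p ?m * t * inverse u"
    have cV: "c \<in> V" unfolding c_def by (intro Vc(4) q0 t u)
    define r where "r = (\<Sum>j=1..?l. monom (c * coeff q j) (?m - j))"
    have rV: "r \<in> pol V" unfolding r_def by (intro pol_closed(5,6)[OF sV(1)] Vc(4) cV q0)
    have "poly r z = (\<Sum>j=1..?l. c * z ^ ?m * (coeff q j * inverse z ^ j))"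
      unfolding r_def poly_sum poly_monom
    proof (rule sum.cong)
      fix j assume "j \<in> {1..?l}"
      then have "z ^ ?m = z ^ (?m - j) * z ^ j" using le by (simp add: power_add[symmetric])
      then show "c * coeff q j * z ^ (?m - j) = c * z ^ ?m * (coeff q j * inverse z ^ j)"
        using z by (simp add: power_inverse field_simps)
    qed simp
    also have "\<dots> = c * z ^ ?m * (\<Sum>j=1..?l. coeff q j * inverse z ^ j)" by (simp add: sum_distrib_left)
    also have "(\<Sum>j=1..?l. coeff q j * inverse z ^ j) = e - coeff q 0"
    proof -
      have "e = (\<Sum>j\<le>?l. coeff q j * inverse z ^ j)" using q(2) by (simp add: poly_altdef)
      also have "\<dots> = coeff q 0 + (\<Sum>j=1..?l. coeff q j * inverse z ^ j)"
        by (simp add: atMost_atLeast0 sum.atLeast_Suc_atMost)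
      finally show ?thesis by simp
    qed
    also have "c * z ^ ?m * (e - coeff q 0) = coeff p ?m * z ^ ?m"
    proof -
      have "t * (e - coeff q 0) = u" using t(2) by (simp add: u_def right_diff_distrib)
      then have "c * (e - coeff q 0) = coeff p ?m * (inverse u * u)" by (simp add: c_def mult_ac)
      then have "c * (e - coeff q 0) = coeff p ?m" using u(2) by simp
      then show ?thesis by (metis mult.commute mult.left_commute)
    qed
    finally have r: "poly r z = coeff p ?m * z ^ ?m" .
    let ?p = "p - monom (coeff p ?m) ?m + r"
    have "poly ?p z = e" using r p(2) by (simp add: poly_monom)
    moreover have "?p \<in> pol V" by (intro pol_closed(1,4,5)[OF sV(1)] p(1) rV q0)
    moreover have "degree ?p < ?m"
    proof (rule degree_lessI)
      show "?p \<noteq> 0 \<or> 0 < ?m" using m by simp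
      show "\<forall>k\<ge>?m. coeff ?p k = 0"
        using m by (auto simp: r_def coeff_sum coeff_monom coeff_eq_0 le_less intro!: sum.neutral)
    qed
    ultimately show ?thesis by blast
  qed
  have no_pair: False if "z \<noteq> 0" "p \<in> pol V" "poly p z = e" "q \<in> pol V" "poly q (inverse z) = e" for p q z
    using that
  proof (induction "degree p + degree q" arbitrary: p q z rule: less_induct)
    case less
    show ?case
    proof (cases "degree q \<le> degree p")
      case True
      then obtain p' where "p' \<in> pol V" "poly p' z = e" "degree p' < degree p"
        using reduce[OF less.prems(1-5)] by blast
      then show ?thesis using less.hyps[of p' q z] less.prems by auto
    next
      case False
      then obtain q' where "q' \<in> pol V" "poly q' (inverse z) = e" "degree q' < degree q"
        using reduce[of "inverse z" q p] less.prems by (metis inverse_inverse_eq inverse_zero_imp_zero nat_le_linear)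
      then show ?thesis using less.hyps[of p q' z] less.prems by auto
    qed
  qed
  have "val_ring V"
  proof
    show "z \<in> V \<or> inverse z \<in> V" for z
    proof (rule ccontr)
      assume n: "\<not> ?thesis"
      then obtain p q where "p \<in> pol V" "poly p z = e" "q \<in> pol V" "poly q (inverse z) = e" using adj by meson
      moreover have "z \<noteq> 0" using n Vc(2) by auto
      ultimately show False using no_pair by blast
    qed
  qed (rule sV)
  then show ?thesis using that sV by blast
qed

section \<open>Vectors and matrices modulo the maximal ideal\<close>

fun mv :: "'f::comm_ring_1 mat2 \<Rightarrow> 'f \<times> 'f \<Rightarrow> 'f \<times> 'f" where
  "mv (Mat2 a b c d) (x, y) = (a * x + b * y, c * x + d * y)"

text \<open>The determinant of two column vectors. For unimodular vectors, a value in the maximal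
  ideal means that they span the same line over the residue field.\<close>

fun om :: "'f::comm_ring_1 \<times> 'f \<Rightarrow> 'f \<times> 'f \<Rightarrow> 'f" where
  "om (x, y) (x', y') = x * y' - y * x'"

lemma mv_mmul: "mv (mmul A B) u = mv A (mv B u)"
  by (cases A; cases B; cases u) (simp add: algebra_simps)

lemma om_mv: "om (mv A u) (mv A v) = mdet A * om u v"
  by (cases A; cases u; cases v) (simp add: algebra_simps)

lemma om_swap: "om u v = - om v u"
  by (cases u; cases v) (simp add: algebra_simps)

lemma mv_one [simp]: "mv (Mat2 1 0 0 1) u = u"
  by (cases u) simp

context val_ring
begin

definition intmat :: "'f mat2 \<Rightarrow> bool" where
  "intmat A \<longleftrightarrow> m11 A \<in> V \<and> m12 A \<in> V \<and> m21 A \<in> V \<and> m22 A \<in> V"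

definition intvec :: "'f \<times> 'f \<Rightarrow> bool" where "intvec u \<longleftrightarrow> fst u \<in> V \<and> snd u \<in> V"

definition nullvec :: "'f \<times> 'f \<Rightarrow> bool" where "nullvec u \<longleftrightarrow> fst u \<in> mx \<and> snd u \<in> mx"

definition veq :: "'f \<times> 'f \<Rightarrow> 'f \<times> 'f \<Rightarrow> bool" where
  "veq u v \<longleftrightarrow> fst u - fst v \<in> mx \<and> snd u - snd v \<in> mx"

definition scl :: "'f \<Rightarrow> 'f \<times> 'f \<Rightarrow> 'f \<times> 'f" where "scl c u = (c * fst u, c * snd u)"

text \<open>A representative of a point of the projective line over the residue field.\<close>

definition unimod :: "'f \<times> 'f \<Rightarrow> bool" where "unimod u \<longleftrightarrow> intvec u \<and> \<not> nullvec u"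

lemma intvec_mv: "intmat A \<Longrightarrow> intvec u \<Longrightarrow> intvec (mv A u)"
  by (cases A; cases u) (auto simp: intmat_def intvec_def)

lemma nullvec_mv: "intmat A \<Longrightarrow> nullvec u \<Longrightarrow> nullvec (mv A u)"
  by (cases A; cases u) (auto simp: intmat_def nullvec_def mx_add mx_mult)

lemma intvec_scl: "c \<in> V \<Longrightarrow> intvec u \<Longrightarrow> intvec (scl c u)"
  by (auto simp: intvec_def scl_def)

lemma om_V: "intvec u \<Longrightarrow> intvec v \<Longrightarrow> om u v \<in> V"
  by (cases u; cases v) (auto simp: intvec_def)

lemma veq_sym: "veq u v \<Longrightarrow> veq v u"
  using mx_minus by (fastforce simp: veq_def)

lemma veq_trans [trans]: "veq u v \<Longrightarrow> veq v w \<Longrightarrow> veq u w"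
  unfolding veq_def using mx_add by (metis (no_types, lifting) diff_add_cancel add_diff_eq)

lemma veq_mv: "intmat A \<Longrightarrow> veq u v \<Longrightarrow> veq (mv A u) (mv A v)"
proof -
  assume A: "intmat A" "veq u v"
  have "nullvec (mv A (fst u - fst v, snd u - snd v))"
    using A by (intro nullvec_mv) (auto simp: veq_def nullvec_def)
  then show ?thesis by (cases A; cases u; cases v) (simp add: veq_def nullvec_def algebra_simps)
qed

lemma veq_scl: "c \<in> V \<Longrightarrow> veq u v \<Longrightarrow> veq (scl c u) (scl c v)"
  by (auto simp: veq_def scl_def right_diff_distrib[symmetric] mx_mult)

lemma veq_om: "intvec w \<Longrightarrow> veq u v \<Longrightarrow> om w u - om w v \<in> mx"
proof -
  assume w: "intvec w" "veq u v"
  have "om w u - om w v = fst w * (snd u - snd v) - snd w * (fst u - fst v)"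
    by (cases w; cases u; cases v) (simp add: algebra_simps)
  then show ?thesis using w by (auto simp: veq_def intvec_def intro!: mx_diff mx_mult)
qed

lemma mx_cong: "a - b \<in> mx \<Longrightarrow> a \<in> mx \<longleftrightarrow> b \<in> mx"
  using mx_add[of "a - b" b] mx_diff[of a "a - b"] by auto

lemma veq_intvec: "intvec u \<Longrightarrow> veq v u \<Longrightarrow> intvec v"
  unfolding intvec_def veq_def using mx_V V_closed(3) by (metis diff_add_cancel)

lemma veq_nullvec: "veq u v \<Longrightarrow> nullvec u \<longleftrightarrow> nullvec v"
  unfolding veq_def nullvec_def using mx_cong by blast

lemma mv_scl: "mv A (scl c u) = scl c (mv A u)"
  by (cases A; cases u) (simp add: scl_def algebra_simps)

lemma om_scl: "om u (scl c v) = c * om u v"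
  by (cases u; cases v) (simp add: scl_def algebra_simps)

lemma scl_scl [simp]: "scl c (scl d u) = scl (c * d) u"
  by (simp add: scl_def mult.assoc)

text \<open>Pluecker's relation \<open>om u v \<cdot> w + om v w \<cdot> u + om w u \<cdot> v = 0\<close>.\<close>

lemma om_trans:
  assumes "intvec u" "unimod v" "intvec w" "om u v \<in> mx" "om v w \<in> mx"
  shows "om u w \<in> mx"
proof -
  have p: "om u w * fst v = om u v * fst w + om v w * fst u" "om u w * snd v = om u v * snd w + om v w * snd u"
    by (cases u; cases v; cases w; simp add: algebra_simps)+
  have v: "fst v \<in> V" "snd v \<in> V" "fst v \<notin> mx \<or> snd v \<notin> mx"
    using assms(2) by (auto simp: unimod_def nullvec_def intvec_def)
  have "om u w * fst v \<in> mx" "om u w * snd v \<in> mx"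
    unfolding p using assms by (auto simp: intvec_def intro!: mx_add mx_mult')
  then show ?thesis using v mx_prime[OF om_V[OF assms(1,3)]] by blast
qed

text \<open>One coordinate of the unimodular \<open>v\<close> is a unit; \<open>\<mu>\<close> is the
  same coordinate of \<open>u\<close> divided by it.\<close>

lemma om_mx_scalar:
  assumes v: "unimod v" and u: "intvec u" "om v u \<in> mx"
  obtains \<mu> where "\<mu> \<in> V" "veq u (scl \<mu> v)"
proof (cases "fst v \<in> mx")
  case False
  let ?i = "inverse (fst v)"
  have i: "?i \<in> V" "fst v \<noteq> 0" using v False unit_inverse by (auto simp: unimod_def intvec_def)
  have "snd u - fst u * ?i * snd v = ?i * om v u"
    using i(2) by (cases u; cases v) (simp add: field_simps)
  moreover have "?i * om v u \<in> mx" using mx_mult[OF i(1) u(2)] .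
  moreover have "fst u - fst u * ?i * fst v = 0" using i(2) by simp
  ultimately have "veq u (scl (fst u * ?i) v)"
    unfolding veq_def scl_def fst_conv snd_conv by (simp only: zero_mx simp_thms)
  then show ?thesis using that[of "fst u * ?i"] i(1) u(1) by (simp add: intvec_def)
next
  case True
  let ?i = "inverse (snd v)"
  have n: "snd v \<notin> mx" using v True by (auto simp: unimod_def nullvec_def)
  then have i: "?i \<in> V" "snd v \<noteq> 0" using v unit_inverse by (auto simp: unimod_def intvec_def)
  have "fst u - snd u * ?i * fst v = - (?i * om v u)"
    using i(2) by (cases u; cases v) (simp add: field_simps)
  moreover have "- (?i * om v u) \<in> mx" using mx_minus[OF mx_mult[OF i(1) u(2)]] .
  moreover have "snd u - snd u * ?i * snd v = 0" using i(2) by simp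
  ultimately have "veq u (scl (snd u * ?i) v)"
    unfolding veq_def scl_def fst_conv snd_conv by (simp only: zero_mx simp_thms)
  then show ?thesis using that[of "snd u * ?i"] i(1) u(1) by (simp add: intvec_def)
qed

lemma unimod_mv:
  assumes "intmat A" "mdet A = 1" "unimod u"
  shows "unimod (mv A u)"
proof -
  have "intmat (madj A)" using assms(1) by (cases A) (auto simp: intmat_def)
  then have "nullvec (mv A u) \<Longrightarrow> nullvec (mv (madj A) (mv A u))" by (rule nullvec_mv)
  moreover have "mv (madj A) (mv A u) = u" using assms(2) by (simp add: mv_mmul[symmetric] mmul_madj)
  ultimately show ?thesis using assms intvec_mv by (auto simp: unimod_def)
qed

text \<open>Modulo the maximal ideal, a matrix of determinant \<open>1\<close> fixing \<open>v\<close> is a transvection, and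
  transvections with the same axis commute.\<close>

lemma fix_commute:
  assumes v: "unimod v" and M: "intmat M" "mdet M = 1" "veq (mv M v) v"
    and N: "intmat N" "mdet N = 1" "veq (mv N v) v"
  shows "m11 (mmul M N) - m11 (mmul N M) \<in> mx" "m12 (mmul M N) - m12 (mmul N M) \<in> mx"
    "m21 (mmul M N) - m21 (mmul N M) \<in> mx" "m22 (mmul M N) - m22 (mmul N M) \<in> mx"
proof -
  have vi: "intvec v" using v by (simp add: unimod_def)
  \<comment> \<open>\<open>om v (A w - w)\<close> lies in \<open>mx\<close>, because
    \<open>om v w = om (A v) (A w)\<close> and \<open>A v\<close> is congruent to \<open>v\<close>.
    Hence \<open>A w - w\<close> is congruent to a multiple of \<open>v\<close>.\<close>
  have shift: "\<exists>s\<in>V. veq (mv A w) (fst w + s * fst v, snd w + s * snd v)"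
    if A: "intmat A" "mdet A = 1" "veq (mv A v) v" and w: "intvec w" for A w
  proof -
    let ?d = "(fst (mv A w) - fst w, snd (mv A w) - snd w)"
    have Aw: "intvec (mv A w)" using intvec_mv[OF A(1) w] .
    have "om v ?d = om v (mv A w) - om v w"
      by (cases v; cases "mv A w"; cases w) (simp add: algebra_simps)
    also have "om v w = om (mv A v) (mv A w)" using A(2) by (simp add: om_mv)
    also have "om v (mv A w) - \<dots> = om (mv A w) (mv A v) - om (mv A w) v"
      using om_swap[of v "mv A w"] om_swap[of "mv A v" "mv A w"] by simp
    also have "\<dots> \<in> mx" by (rule veq_om[OF Aw A(3)])
    finally have "om v ?d \<in> mx" .
    moreover have "intvec ?d" using Aw w by (auto simp: intvec_def)
    ultimately obtain s where s: "s \<in> V" "veq ?d (scl s v)" using om_mx_scalar[OF v] by blast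
    then have "veq (mv A w) (fst w + s * fst v, snd w + s * snd v)"
      by (simp add: veq_def scl_def algebra_simps)
    then show ?thesis using s by blast
  qed
  \<comment> \<open>A standard vector independent of \<open>v\<close> over the residue field; a
    matrix is determined modulo \<open>mx\<close> by its values on \<open>v\<close> and
    \<open>w\<close>.\<close>
  define w :: "'f \<times> 'f" where "w = (if fst v \<notin> mx then (0, 1) else (1, 0))"
  have wi: "intvec w" by (simp add: w_def intvec_def)
  have comm: "veq (mv (mmul M N) w) (mv (mmul N M) w)"
  proof -
    obtain s where s: "s \<in> V" "veq (mv M w) (fst w + s * fst v, snd w + s * snd v)" using shift[OF M wi] by blast
    obtain t where t: "t \<in> V" "veq (mv N w) (fst w + t * fst v, snd w + t * snd v)" using shift[OF N wi] by blast
    have two: "veq (mv (mmul A C) w) (fst w + (a + c) * fst v, snd w + (a + c) * snd v)"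
      if A: "intmat A" "veq (mv A v) v" "a \<in> V" "veq (mv A w) (fst w + a * fst v, snd w + a * snd v)"
        and C: "c \<in> V" "veq (mv C w) (fst w + c * fst v, snd w + c * snd v)" for A C a c
    proof -
      have "veq (mv (mmul A C) w) (mv A (fst w + c * fst v, snd w + c * snd v))"
        unfolding mv_mmul by (rule veq_mv[OF A(1) C(2)])
      also have "mv A (fst w + c * fst v, snd w + c * snd v) =
          (fst (mv A w) + c * fst (mv A v), snd (mv A w) + c * snd (mv A v))"
        by (cases A; cases w; cases v) (simp add: algebra_simps)
      also have "veq \<dots> (fst w + (a + c) * fst v, snd w + (a + c) * snd v)"
      proof -
        have e: "fst (mv A w) + c * fst (mv A v) - (fst w + (a + c) * fst v) =
            (fst (mv A w) - (fst w + a * fst v)) + c * (fst (mv A v) - fst v)"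
          "snd (mv A w) + c * snd (mv A v) - (snd w + (a + c) * snd v) =
            (snd (mv A w) - (snd w + a * snd v)) + c * (snd (mv A v) - snd v)"
          by (simp_all add: algebra_simps)
        show ?thesis unfolding veq_def fst_conv snd_conv e
          using A(2,4) C(1) by (auto simp: veq_def intro!: mx_add mx_mult)
      qed
      finally show ?thesis .
    qed
    show ?thesis
      using two[OF M(1,3) s t] veq_sym[OF two[OF N(1,3) t s]] by (auto simp: add.commute intro: veq_trans)
  qed
  have commv: "veq (mv (mmul M N) v) (mv (mmul N M) v)"
  proof -
    have "veq (mv (mmul M N) v) v" unfolding mv_mmul using veq_mv[OF M(1) N(3)] M(3) veq_trans by blast
    moreover have "veq (mv (mmul N M) v) v" unfolding mv_mmul using veq_mv[OF N(1) M(3)] N(3) veq_trans by blast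
    ultimately show ?thesis using veq_sym veq_trans by blast
  qed
  obtain a b c d where P: "mmul M N = Mat2 a b c d" by (cases "mmul M N")
  obtain a' b' c' d' where Q: "mmul N M = Mat2 a' b' c' d'" by (cases "mmul N M")
  have int: "a - a' \<in> V" "b - b' \<in> V" "c - c' \<in> V" "d - d' \<in> V"
  proof -
    have "intmat (mmul A B)" if "intmat A" "intmat B" for A B
      using that by (cases A; cases B) (auto simp: intmat_def)
    from this[OF M(1) N(1)] this[OF N(1) M(1)] show "a - a' \<in> V" "b - b' \<in> V" "c - c' \<in> V" "d - d' \<in> V"
      unfolding P Q by (auto simp: intmat_def)
  qed
  have ev: "(a - a') * fst v + (b - b') * snd v \<in> mx" "(c - c') * fst v + (d - d') * snd v \<in> mx"
    using commv unfolding P Q by (cases v; simp add: veq_def algebra_simps)+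
  have "a - a' \<in> mx \<and> b - b' \<in> mx \<and> c - c' \<in> mx \<and> d - d' \<in> mx"
  proof (cases "fst v \<notin> mx")
    case True
    then have bd: "b - b' \<in> mx" "d - d' \<in> mx" using comm unfolding P Q by (auto simp: w_def veq_def)
    have "(a - a') * fst v \<in> mx" "(c - c') * fst v \<in> mx"
      using mx_diff[OF ev(1) mx_mult'[OF bd(1), of "snd v"]] mx_diff[OF ev(2) mx_mult'[OF bd(2), of "snd v"]] vi
      by (auto simp: intvec_def)
    then show ?thesis using bd mx_prime int vi True by (auto simp: intvec_def)
  next
    case False
    then have ac: "a - a' \<in> mx" "c - c' \<in> mx" using comm unfolding P Q by (auto simp: w_def veq_def)
    have "(b - b') * snd v \<in> mx" "(d - d') * snd v \<in> mx"
      using mx_diff[OF ev(1) mx_mult'[OF ac(1), of "fst v"]] mx_diff[OF ev(2) mx_mult'[OF ac(2), of "fst v"]] vi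
      by (auto simp: intvec_def)
    moreover have "snd v \<notin> mx" using False v by (auto simp: unimod_def nullvec_def)
    ultimately show ?thesis using ac mx_prime int vi by (auto simp: intvec_def)
  qed
  then show "m11 (mmul M N) - m11 (mmul N M) \<in> mx" "m12 (mmul M N) - m12 (mmul N M) \<in> mx"
    "m21 (mmul M N) - m21 (mmul N M) \<in> mx" "m22 (mmul M N) - m22 (mmul N M) \<in> mx"
    unfolding P Q by auto
qed

text \<open>A matrix of determinant \<open>1\<close> that is not integral is a multiple of an integral matrix of rank
  one modulo the maximal ideal.\<close>

lemma rank_one_reduction:
  assumes A: "mdet A = 1" "\<not> intmat A"
  obtains \<theta> a b where "\<theta> \<notin> V" "unimod a" "unimod b"
    "\<And>u. intvec u \<Longrightarrow> \<exists>w. mv A u = scl \<theta> w \<and> veq w (scl (om b u) a)"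
    "\<And>u. intvec u \<Longrightarrow> \<exists>w. mv (madj A) u = scl \<theta> w \<and> veq w (scl (- om a u) b)"
proof -
  obtain p q r s where P: "A = Mat2 p q r s" by (cases A)
  have det: "p * s - q * r = 1" using A(1) by (simp add: P)
  let ?E = "{p, q, r, s} - {0}"
  have "?E \<noteq> {}"
  proof
    assume "?E = {}"
    then have "p = 0" "q = 0" by blast+
    then show False using det by simp
  qed
  then obtain \<theta> where \<theta>: "\<theta> \<in> ?E" "\<forall>z\<in>?E. z / \<theta> \<in> V"
    using max_exists[of ?E] by blast
  then have nz: "\<theta> \<noteq> 0" by blast
  have "z / \<theta> \<in> V" if "z \<in> {p, q, r, s}" for z
    using \<theta>(2) that by (cases "z = 0") auto
  then have div: "p / \<theta> \<in> V" "q / \<theta> \<in> V" "r / \<theta> \<in> V" "s / \<theta> \<in> V" by blast+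
  have "\<theta> \<notin> V"
  proof
    assume "\<theta> \<in> V"
    then have "z \<in> V" if "z / \<theta> \<in> V" for z using V_closed(4)[OF that \<open>\<theta> \<in> V\<close>] nz by simp
    then show False using A(2) div by (auto simp: P intmat_def)
  qed
  note witness = that
  \<comment> \<open>The determinant of \<open>A / \<theta>\<close> is this square, an element of
    \<open>mx\<close>: hence the rank one.\<close>
  have imx: "inverse \<theta> * inverse \<theta> \<in> mx"
    using inverse_mx[OF \<open>\<theta> \<notin> V\<close>] mx_V mx_mult by blast
  \<comment> \<open>\<open>A / \<theta>\<close> is congruent to the column \<open>(a, a')\<close>
    times the row \<open>(b, b')\<close>. The row is recorded as the vector
    \<open>(b', - b)\<close>, so that applying it becomes \<open>om\<close>; in the adjugate the two
    vectors change places, up to sign.\<close>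
  have fin: thesis if a: "a \<in> V" "a' \<in> V" "a = 1 \<or> a' = 1" and b: "b \<in> V" "b' \<in> V" "b = 1 \<or> b' = 1"
    and d: "p / \<theta> - a * b \<in> mx" "q / \<theta> - a * b' \<in> mx" "r / \<theta> - a' * b \<in> mx" "s / \<theta> - a' * b' \<in> mx"
    for a a' b b'
  proof (rule witness[OF \<open>\<theta> \<notin> V\<close>])
    show "unimod (a, a')" "unimod (b', - b)"
      using a b mx_minus[of "- b"] by (auto simp: unimod_def intvec_def nullvec_def)
    fix u :: "'f \<times> 'f" assume u: "intvec u"
    obtain x y where xy: "u = (x, y)" by (cases u)
    have V: "x \<in> V" "y \<in> V" using u by (auto simp: xy intvec_def)
    let ?w = "(p / \<theta> * x + q / \<theta> * y, r / \<theta> * x + s / \<theta> * y)"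
    have "mv A u = scl \<theta> ?w" using nz by (simp add: P xy scl_def distrib_left)
    moreover have "veq ?w (scl (om (b', - b) u) (a, a'))"
    proof -
      have "p / \<theta> * x + q / \<theta> * y - (b' * y + b * x) * a = (p / \<theta> - a * b) * x + (q / \<theta> - a * b') * y"
        "r / \<theta> * x + s / \<theta> * y - (b' * y + b * x) * a' = (r / \<theta> - a' * b) * x + (s / \<theta> - a' * b') * y"
        by (simp_all add: algebra_simps)
      then show ?thesis using d V by (simp add: veq_def scl_def xy mx_add mx_mult')
    qed
    ultimately show "\<exists>w. mv A u = scl \<theta> w \<and> veq w (scl (om (b', - b) u) (a, a'))" by blast
    let ?w = "(s / \<theta> * x - q / \<theta> * y, p / \<theta> * y - r / \<theta> * x)"
    have "mv (madj A) u = scl \<theta> ?w" using nz by (simp add: P xy scl_def right_diff_distrib)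
    moreover have "veq ?w (scl (- om (a, a') u) (b', - b))"
    proof -
      have "s / \<theta> * x - q / \<theta> * y - (a' * x - a * y) * b' = (s / \<theta> - a' * b') * x - (q / \<theta> - a * b') * y"
        "p / \<theta> * y - r / \<theta> * x + (a' * x - a * y) * b = (p / \<theta> - a * b) * y - (r / \<theta> - a' * b) * x"
        by (simp_all add: algebra_simps)
      then show ?thesis using d V by (simp add: veq_def scl_def xy mx_diff mx_mult')
    qed
    ultimately show "\<exists>w. mv (madj A) u = scl \<theta> w \<and> veq w (scl (- om (a, a') u) (b', - b))" by blast
  qed
  consider "\<theta> = p" | "\<theta> = q" | "\<theta> = r" | "\<theta> = s" using \<theta>(1) by blast
  then show ?thesis
  proof cases
    case 1
    have "s / \<theta> - r / \<theta> * (q / \<theta>) = inverse \<theta> * inverse \<theta>"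
      using nz det unfolding 1 by (simp add: field_simps)
    then show ?thesis using fin[of 1 "r / \<theta>" 1 "q / \<theta>"] div imx nz 1 by simp
  next
    case 2
    have "r / \<theta> - s / \<theta> * (p / \<theta>) = - (inverse \<theta> * inverse \<theta>)"
      using nz det unfolding 2 by (simp add: field_simps)
    then show ?thesis using fin[of 1 "s / \<theta>" "p / \<theta>" 1] div imx mx_minus nz 2 by simp
  next
    case 3
    have "q / \<theta> - p / \<theta> * (s / \<theta>) = - (inverse \<theta> * inverse \<theta>)"
      using nz det unfolding 3 by (simp add: field_simps)
    then show ?thesis using fin[of "p / \<theta>" 1 1 "s / \<theta>"] div imx mx_minus nz 3 by simp
  next
    case 4
    have "p / \<theta> - q / \<theta> * (r / \<theta>) = inverse \<theta> * inverse \<theta>"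
      using nz det unfolding 4 by (simp add: field_simps)
    then show ?thesis using fin[of "q / \<theta>" 1 "r / \<theta>" 1] div imx nz 4 by simp
  qed
qed

end

section \<open>Elements free over small subgroups\<close>

lemma subfield_closure_exists:
  fixes X :: "'f::field set"
  assumes L: "infinite \<Lambda>" and X: "|X| \<le>o |\<Lambda>|"
  obtains F where "X \<subseteq> F" "is_subring F" "\<And>a. a \<in> F \<Longrightarrow> inverse a \<in> F" "|F| \<le>o |\<Lambda>|"
proof -
  define opr :: "'f list \<Rightarrow> 'f set" where
    "opr l = (case l of [] \<Rightarrow> {1} | [a] \<Rightarrow> {- a, inverse a} | [a, b] \<Rightarrow> {a + b, a * b} | _ \<Rightarrow> {})" for l
  have "finite (opr l)" for l by (auto simp: opr_def split: list.split)
  then have opr: "|opr l| \<le>o |\<Lambda>|" for l by (intro card_of_countable[OF countable_finite L])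
  obtain Y where Y: "X \<subseteq> Y" "|Y| \<le>o |\<Lambda>|" "\<And>l. set l \<subseteq> Y \<Longrightarrow> opr l \<subseteq> Y"
    using small_closure_exists[OF L X subset_UNIV, of opr] opr by auto
  have "is_subring Y"
    unfolding is_subring_def
    using Y(3)[of "[]"] Y(3)[of "[a]" for a] Y(3)[of "[a, b]" for a b] by (auto simp: opr_def)
  moreover have "inverse a \<in> Y" if "a \<in> Y" for a using Y(3)[of "[a]"] that by (auto simp: opr_def)
  ultimately show ?thesis using that Y by blast
qed

context group
begin

text \<open>Closure under conjugators between nontrivial elements, hence under centralizers. As the
  solution sets are countable, the closure of an infinite set is no larger than the set.\<close>

definition conj_closed :: "'a set \<Rightarrow> bool" where
  "conj_closed C \<longleftrightarrow> subgroup C G \<and>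
     (\<forall>a\<in>C. \<forall>b\<in>C. \<forall>g\<in>carrier G. a \<noteq> \<one> \<longrightarrow> g \<otimes> a = b \<otimes> g \<longrightarrow> g \<in> C)"

lemma conj_closure_exists:
  assumes lf: "locally_free G" and L: "infinite \<Lambda>" and X: "X \<subseteq> carrier G" "|X| \<le>o |\<Lambda>|"
  shows "\<exists>C. X \<subseteq> C \<and> conj_closed C \<and> |C| \<le>o |\<Lambda>|"
proof -
  define opr where "opr l = (if set l \<subseteq> carrier G then (case l of [] \<Rightarrow> {\<one>} | [a] \<Rightarrow> {inv a}
     | [a, b] \<Rightarrow> {a \<otimes> b} \<union> (if a \<noteq> \<one> then {g \<in> carrier G. g \<otimes> a = b \<otimes> g} else {}) | _ \<Rightarrow> {}) else {})" for l
  have "countable (opr l)" for l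
    using locally_free_countable_conjugators[OF lf] by (auto simp: opr_def split: list.split)
  then have opr: "|opr l| \<le>o |\<Lambda>|" for l by (intro card_of_countable[OF _ L])
  have "opr l \<subseteq> carrier G" for l by (auto simp: opr_def split: list.splits if_splits)
  then obtain Y where Y: "X \<subseteq> Y" "Y \<subseteq> carrier G" "|Y| \<le>o |\<Lambda>|" "\<And>l. set l \<subseteq> Y \<Longrightarrow> opr l \<subseteq> Y"
    using small_closure_exists[OF L X(2,1), of opr] opr by metis
  have two: "a \<otimes> b \<in> Y" "a \<noteq> \<one> \<Longrightarrow> g \<in> carrier G \<Longrightarrow> g \<otimes> a = b \<otimes> g \<Longrightarrow> g \<in> Y" if "a \<in> Y" "b \<in> Y" for a b g
  proof -
    have "a \<in> carrier G" "b \<in> carrier G" using that Y(2) by auto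
    then have "{a \<otimes> b} \<union> (if a \<noteq> \<one> then {g \<in> carrier G. g \<otimes> a = b \<otimes> g} else {}) \<subseteq> Y"
      using Y(4)[of "[a, b]"] that by (simp add: opr_def)
    then show "a \<otimes> b \<in> Y" "a \<noteq> \<one> \<Longrightarrow> g \<in> carrier G \<Longrightarrow> g \<otimes> a = b \<otimes> g \<Longrightarrow> g \<in> Y" by auto
  qed
  have one: "inv a \<in> Y" if "a \<in> Y" for a
  proof -
    have "a \<in> carrier G" using that Y(2) by auto
    then show ?thesis using Y(4)[of "[a]"] that by (simp add: opr_def)
  qed
  have "\<one> \<in> Y" using Y(4)[of "[]"] by (auto simp: opr_def)
  then have "subgroup Y G" using Y(2) two(1) one by (intro subgroupI) auto
  then have "conj_closed Y"
    unfolding conj_closed_def by (intro conjI ballI impI) (assumption, rule two(2))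
  then show ?thesis using Y by blast
qed

text \<open>The entries of \<open>H = generate G X\<close> lie in a small subfield \<open>F\<close>. An element \<open>x\<close> with an entry
  transcendental over \<open>F\<close> is unbounded for a valuation trivial on \<open>F\<close>, so it has an attracting and a
  repelling line modulo \<open>mx\<close>. The elements \<open>p i\<close> of a tower of small subgroups closed under solving
  \<open>g \<cdot> a = b \<cdot> g\<close> move these lines so that \<open>H\<close> identifies none of them: stabilizers of lines modulo
  \<open>mx\<close> are metabelian, hence abelian. Then \<open>y = p i \<cdot> x \<cdot> (p k)\<^sup>-\<^sup>1\<close> plays ping-pong with \<open>H\<close>.\<close>

lemma exists_free_over_small:
  fixes \<rho> :: "'a \<Rightarrow> 'f::field mat2" and \<Lambda> :: "'l set"
  assumes lf: "locally_free G" and \<rho>: "\<rho> \<in> hom G SL2" "inj_on \<rho> (carrier G)"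
    and L: "infinite \<Lambda>" "|\<Lambda>| <o |carrier G|" and X: "X \<subseteq> carrier G" "|X| \<le>o |\<Lambda>|"
  obtains y where "free_over (generate G X) y"
proof -
  define cl where "cl Y = (SOME C. Y \<subseteq> C \<and> conj_closed C \<and> |C| \<le>o |\<Lambda>| )" for Y
  have cl: "Y \<subseteq> cl Y" "conj_closed (cl Y)" "|cl Y| \<le>o |\<Lambda>|" if "Y \<subseteq> carrier G" "|Y| \<le>o |\<Lambda>|" for Y
    using someI_ex[OF conj_closure_exists[OF lf L(1) that]] unfolding cl_def by auto
  have ccG: "C \<subseteq> carrier G" if "conj_closed C" for C
    using that subgroup.subset unfolding conj_closed_def by blast
  define pick where "pick Y = (SOME g. g \<in> carrier G - Y)" for Y
  have pick: "pick Y \<in> carrier G - Y" if "|Y| \<le>o |\<Lambda>|" for Y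
  proof -
    have "\<not> carrier G \<subseteq> Y"
    proof
      assume "carrier G \<subseteq> Y"
      then have "|carrier G| \<le>o |\<Lambda>|" using card_of_mono1 that ordLeq_transitive by blast
      then show False using L(2) not_ordLess_ordLeq by blast
    qed
    then have "\<exists>g. g \<in> carrier G - Y" by auto
    then show ?thesis unfolding pick_def by (rule someI_ex)
  qed
  define C where "C = rec_nat (cl X) (\<lambda>_ Y. cl (insert (pick Y) Y))"
  define p where "p n = (case n of 0 \<Rightarrow> \<one> | Suc k \<Rightarrow> pick (C k))" for n
  have C_simps: "C 0 = cl X" "C (Suc k) = cl (insert (p (Suc k)) (C k))" for k
    by (simp_all add: C_def p_def)
  have C: "conj_closed (C k) \<and> |C k| \<le>o |\<Lambda>|" for k
  proof (induction k)
    case 0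
    then show ?case using cl[OF X] by (simp add: C_simps)
  next
    case (Suc k)
    have "insert (p (Suc k)) (C k) \<subseteq> carrier G" using Suc ccG pick[of "C k"] by (auto simp: p_def)
    moreover have "|insert (p (Suc k)) (C k)| \<le>o |\<Lambda>|"
      using card_of_Un_ordLeq[OF L(1) card_of_countable[OF _ L(1), of "{p (Suc k)}"], of "C k"] Suc by simp
    ultimately show ?case using cl by (simp add: C_simps)
  qed
  have pC: "p (Suc k) \<in> carrier G - C k" for k using pick[of "C k"] C by (simp add: p_def)
  have ins: "insert (p (Suc k)) (C k) \<subseteq> C (Suc k)" for k
  proof -
    have "insert (p (Suc k)) (C k) \<subseteq> carrier G" using C ccG pC by auto
    moreover have "|insert (p (Suc k)) (C k)| \<le>o |\<Lambda>|"
      using card_of_Un_ordLeq[OF L(1) card_of_countable[OF _ L(1), of "{p (Suc k)}"], of "C k"] C by simp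
    ultimately show ?thesis unfolding C_simps by (rule cl(1))
  qed
  have Csg: "subgroup (C k) G" for k using C by (simp add: conj_closed_def)
  have Cconj: "g \<in> C k" if "a \<in> C k" "b \<in> C k" "a \<noteq> \<one>" "g \<in> carrier G" "g \<otimes> a = b \<otimes> g" for a b g k
    using C[of k] that unfolding conj_closed_def by blast
  have mono: "C i \<subseteq> C j" if "i \<le> j" for i j
    using that by (induction j) (use ins in \<open>auto simp: le_Suc_eq\<close>)
  have p_in: "p i \<in> C i" for i
    using ins subgroup.one_closed[OF Csg] by (cases i) (auto simp: p_def)
  have p_notin: "p j \<notin> C i" if "i < j" for i j
    using pC[of "j - 1"] mono[of i "j - 1"] that by (cases j) auto
  \<comment> \<open>The four elements \<open>p 0\<close> to \<open>p 3\<close> are enough: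
    collisions (\<open>coll\<close> below) rule out at most one index and orbit coincidences
    (\<open>orb\<close>) at most two.\<close>
  define K where "K = C 3"
  have K: "subgroup K G" "|K| \<le>o |\<Lambda>|" using Csg C by (auto simp: K_def)
  have KG: "K \<subseteq> carrier G" using K(1) subgroup.subset by auto
  have CK: "C i \<subseteq> K" if "i \<le> 3" for i unfolding K_def using mono that by blast
  have pK: "p i \<in> K" if "i \<le> 3" for i using p_in CK that by auto
  define H where "H = generate G X"
  have XC: "X \<subseteq> C 0" using cl(1)[OF X] by (simp add: C_simps)
  have HC: "H \<subseteq> C i" for i
    unfolding H_def using generate_subgroup_incl[OF XC Csg] mono[of 0 i] by auto
  have HK: "H \<subseteq> K" using HC by (auto simp: K_def)
  have Hsg: "subgroup H G" unfolding H_def by (rule generate_is_subgroup[OF X(1)])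
  interpret rh: group_hom G SL2 \<rho>
    using \<rho>(1) by (simp add: group_hom_def group_hom_axioms_def group_SL2 is_group)
  define act where "act g u = mv (\<rho> g) u" for g u
  have act_mult: "act (g \<otimes> h) u = act g (act h u)" if "g \<in> carrier G" "h \<in> carrier G" for g h u
    using that by (simp add: act_def mv_mmul[symmetric])
  have act_one: "act \<one> u = u" for u by (simp add: act_def)
  have det: "mdet (\<rho> g) = 1" if "g \<in> carrier G" for g using rh.hom_closed[OF that] by simp
  have act_inv: "act (inv g) (act g u) = u" "act g (act (inv g) u) = u" if "g \<in> carrier G" for g u
    using that by (simp_all add: act_mult[symmetric] act_one)
  have om_act: "om (act g u) (act g v) = om u v" if "g \<in> carrier G" for g u v
    using det[OF that] by (simp add: act_def om_mv)
  have om_shift: "om u (act g v) = om (act (inv g) u) v" "om (act g u) v = om u (act (inv g) v)" if "g \<in> carrier G" for g u v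
    using om_act[OF that, of "act (inv g) u" v] om_act[OF that, of u "act (inv g) v"] act_inv[OF that] by simp_all
  define ents where "ents A = {m11 A, m12 A, m21 A, m22 A}" for A :: "'f mat2"
  have small_ents: "|\<Union>g\<in>K. ents (\<rho> g)| \<le>o |\<Lambda>|"
    by (rule card_of_UNION_ordLeq_infinite[OF L(1) K(2)]) (auto simp: ents_def intro!: card_of_countable[OF _ L(1)])
  obtain F where F: "(\<Union>g\<in>K. ents (\<rho> g)) \<subseteq> F" "is_subring F" "\<And>a. a \<in> F \<Longrightarrow> inverse a \<in> F" "|F| \<le>o |\<Lambda>|"
    using subfield_closure_exists[OF L(1) small_ents] by blast
  \<comment> \<open>Otherwise all entries are among the at most \<open>|\<Lambda>|\<close> elements
    algebraic over \<open>F\<close>, and \<open>G\<close> would be no larger than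
    \<open>\<Lambda>\<close>.\<close>
  have "\<exists>x\<in>carrier G. \<exists>e\<in>ents (\<rho> x). \<not> algebraic_over F e"
  proof (rule ccontr)
    assume n: "\<not> ?thesis"
    let ?A = "{e. algebraic_over F e}"
    let ?l = "\<lambda>A :: 'f mat2. [m11 A, m12 A, m21 A, m22 A]"
    have "inj_on (?l \<circ> \<rho>) (carrier G)"
    proof (rule comp_inj_on[OF \<rho>(2)])
      show "inj_on ?l (\<rho> ` carrier G)" by (rule inj_onI) (simp add: mat2.expand)
    qed
    moreover have "(?l \<circ> \<rho>) ` carrier G \<subseteq> {l. set l \<subseteq> ?A}" using n by (auto simp: ents_def)
    ultimately have "|carrier G| \<le>o |{l. set l \<subseteq> ?A}|" using card_of_ordLeq by blast
    moreover have "|{l. set l \<subseteq> ?A}| \<le>o |\<Lambda>|" by (intro card_of_lists_ordLeq card_of_algebraic L(1) F(4))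
    ultimately have "|carrier G| \<le>o |\<Lambda>|" by (rule ordLeq_transitive)
    then show False using L(2) not_ordLess_ordLeq by blast
  qed
  then obtain x e where x: "x \<in> carrier G" "e \<in> ents (\<rho> x)" "\<not> algebraic_over F e" by blast
  obtain V where V: "val_ring V" "F \<subseteq> V" "e \<notin> V" using val_ring_exists[OF F(2) x(3)] by blast
  interpret val_ring V by (rule V(1))
  \<comment> \<open>Nonzero elements of the subfield \<open>F\<close> are units of \<open>V\<close>,
    so matrices over \<open>F\<close> that agree modulo \<open>mx\<close> are equal.\<close>
  have F_mx: "z = 0" if "z \<in> F" "z \<in> mx" for z
    using that F(3)[OF that(1)] V(2) by (auto simp: mx_def)
  have im: "intmat (\<rho> g)" if "g \<in> K" for g
    using F(1) V(2) that by (auto simp: intmat_def ents_def)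
  have act_int: "intvec (act g u)" if "g \<in> K" "intvec u" for g u
    using intvec_mv[OF im[OF that(1)] that(2)] by (simp add: act_def)
  have act_uni: "unimod (act g u)" if "g \<in> K" "unimod u" for g u
    using unimod_mv[OF im det that(2)] that(1) KG by (auto simp: act_def)
  have act_veq: "veq (act g u) (act g v)" if "g \<in> K" "veq u v" for g u v
    using veq_mv[OF im[OF that(1)] that(2)] by (simp add: act_def)
  have act_scl: "act g (scl c u) = scl c (act g u)" for g c u by (simp add: act_def mv_scl)
  have uni_int: "intvec u" if "unimod u" for u using that by (simp add: unimod_def)
  have "\<not> intmat (\<rho> x)" using x(2) V(3) by (auto simp: intmat_def ents_def)
  from rank_one_reduction[OF det[OF x(1)] this] obtain \<theta> a b where ab: "\<theta> \<notin> V" "unimod a" "unimod b"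
    "\<And>u. intvec u \<Longrightarrow> \<exists>w. act x u = scl \<theta> w \<and> veq w (scl (om b u) a)"
    "\<And>u. intvec u \<Longrightarrow> \<exists>w. mv (madj (\<rho> x)) u = scl \<theta> w \<and> veq w (scl (- om a u) b)"
    unfolding act_def by metis
  have xinv: "\<rho> (inv x) = madj (\<rho> x)" using rh.hom_inv[OF x(1)] SL2_inv[OF det[OF x(1)]] by simp
  have ab5: "\<exists>w. act (inv x) u = scl \<theta> w \<and> veq w (scl (- om a u) b)" if "intvec u" for u
    using ab(5)[OF that] by (simp add: act_def xinv)
  \<comment> \<open>Elements of \<open>K\<close> preserving the line of \<open>v\<close> act on it
    by scalars modulo \<open>mx\<close>, so their commutators fix \<open>v\<close>. By
    \<open>fix_commute\<close> the commutators commute modulo \<open>mx\<close> and, having entries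
    in \<open>F\<close>, commute in \<open>G\<close>.\<close>
  have stab_comm: "g \<otimes> h = h \<otimes> g"
    if v: "unimod v" and g: "g \<in> K" "om v (act g v) \<in> mx" and h: "h \<in> K" "om v (act h v) \<in> mx" for v g h
  proof -
    define S where "S = {g \<in> K. om v (act g v) \<in> mx}"
    have SK: "S \<subseteq> K" by (auto simp: S_def)
    have "subgroup S G"
    proof (rule subgroupI)
      show "S \<subseteq> carrier G" using SK KG by auto
      show "S \<noteq> {}" using g by (auto simp: S_def)
      fix c assume c: "c \<in> S"
      then have cK: "c \<in> K" "c \<in> carrier G" using SK KG by auto
      have "om v (act (inv c) v) = - om v (act c v)"
        using om_shift(2)[OF cK(2), of v v] om_swap[of "act c v" v] by simp
      then show "inv c \<in> S" using c cK subgroup.m_inv_closed[OF K(1)] mx_minus by (auto simp: S_def)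
      fix d assume d: "d \<in> S"
      then have dK: "d \<in> K" "d \<in> carrier G" using SK KG by auto
      have "om (act c v) (act c (act d v)) \<in> mx" using d om_act[OF cK(2)] by (simp add: S_def)
      then have "om v (act c (act d v)) \<in> mx"
        using om_trans[OF uni_int[OF v] act_uni[OF cK(1) v] act_int[OF cK(1) act_int[OF dK(1) uni_int[OF v]]]] c
        by (simp add: S_def)
      then show "c \<otimes> d \<in> S" using cK dK subgroup.m_closed[OF K(1)] by (simp add: S_def act_mult)
    qed
    moreover have "(c \<otimes> d \<otimes> inv (d \<otimes> c)) \<otimes> (r \<otimes> s \<otimes> inv (s \<otimes> r)) = (r \<otimes> s \<otimes> inv (s \<otimes> r)) \<otimes> (c \<otimes> d \<otimes> inv (d \<otimes> c))"
      if cd: "c \<in> S" "d \<in> S" "r \<in> S" "s \<in> S" for c d r s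
    proof -
      have fix': "c \<otimes> d \<otimes> inv (d \<otimes> c) \<in> K \<and> veq (act (c \<otimes> d \<otimes> inv (d \<otimes> c)) v) v" if cd: "c \<in> S" "d \<in> S" for c d
      proof -
        have cdK: "c \<in> K" "d \<in> K" "c \<in> carrier G" "d \<in> carrier G" using cd SK KG by auto
        note Kc = subgroup.m_closed[OF K(1)] subgroup.m_inv_closed[OF K(1)]
        let ?q = "c \<otimes> d \<otimes> inv (d \<otimes> c)"
        have qK: "?q \<in> K" using cdK Kc by blast
        have vi: "intvec v" using v by (rule uni_int)
        obtain \<mu> where \<mu>: "\<mu> \<in> V" "veq (act c v) (scl \<mu> v)"
          using om_mx_scalar[OF v act_int[OF cdK(1) vi]] cd by (auto simp: S_def)
        obtain \<nu> where \<nu>: "\<nu> \<in> V" "veq (act d v) (scl \<nu> v)"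
          using om_mx_scalar[OF v act_int[OF cdK(2) vi]] cd by (auto simp: S_def)
        have 1: "veq (act (d \<otimes> c) v) (scl (\<mu> * \<nu>) v)"
          using veq_trans[OF act_veq[OF cdK(2) \<mu>(2)], of "scl (\<mu> * \<nu>) v"] veq_scl[OF \<mu>(1) \<nu>(2)] cdK
          by (simp add: act_mult act_scl)
        have 2: "veq (act (c \<otimes> d) v) (scl (\<mu> * \<nu>) v)"
          using veq_trans[OF act_veq[OF cdK(1) \<nu>(2)], of "scl (\<mu> * \<nu>) v"] veq_scl[OF \<nu>(1) \<mu>(2)] cdK
          by (simp add: act_mult act_scl mult.commute)
        have n: "\<mu> * \<nu> \<notin> mx"
        proof
          assume "\<mu> * \<nu> \<in> mx"
          then have "nullvec (scl (\<mu> * \<nu>) v)" using vi by (auto simp: nullvec_def scl_def intvec_def mx_mult')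
          then have "nullvec (act (d \<otimes> c) v)" using veq_nullvec[OF 1] by simp
          then show False using act_uni[OF _ v, of "d \<otimes> c"] cdK Kc by (auto simp: unimod_def)
        qed
        have "veq (act ?q (scl (\<mu> * \<nu>) v)) (act ?q (act (d \<otimes> c) v))" by (rule act_veq[OF qK veq_sym[OF 1]])
        also have "act ?q (act (d \<otimes> c) v) = act (c \<otimes> d) v"
          using cdK by (simp add: act_mult[symmetric] m_assoc)
        also note 2
        finally have "veq (scl (\<mu> * \<nu>) (act ?q v)) (scl (\<mu> * \<nu>) v)" by (simp add: act_scl)
        then have m: "(\<mu> * \<nu>) * (fst (act ?q v) - fst v) \<in> mx" "(\<mu> * \<nu>) * (snd (act ?q v) - snd v) \<in> mx"
          by (auto simp: veq_def scl_def right_diff_distrib)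
        have "intvec (act ?q v)" using act_int[OF qK vi] .
        then have dV: "fst (act ?q v) - fst v \<in> V" "snd (act ?q v) - snd v \<in> V" using vi by (auto simp: intvec_def)
        have mnV: "\<mu> * \<nu> \<in> V" using \<mu>(1) \<nu>(1) by blast
        have "veq (act ?q v) v"
          using mx_prime[OF mnV dV(1) m(1)] mx_prime[OF mnV dV(2) m(2)] n by (simp add: veq_def)
        then show ?thesis using qK by blast
      qed
      let ?q = "c \<otimes> d \<otimes> inv (d \<otimes> c)" and ?r = "r \<otimes> s \<otimes> inv (s \<otimes> r)"
      have q: "?q \<in> K" "veq (mv (\<rho> ?q) v) v" "?r \<in> K" "veq (mv (\<rho> ?r) v) v"
        using fix'[OF cd(1,2)] fix'[OF cd(3,4)] by (auto simp: act_def)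
      have qG: "?q \<in> carrier G" "?r \<in> carrier G" using q KG by auto
      note fc = fix_commute[OF v im[OF q(1)] det[OF qG(1)] q(2) im[OF q(3)] det[OF qG(2)] q(4)]
      have qr: "mmul (\<rho> ?q) (\<rho> ?r) = \<rho> (?q \<otimes> ?r)" "mmul (\<rho> ?r) (\<rho> ?q) = \<rho> (?r \<otimes> ?q)"
        using qG by simp_all
      have entK: "ents (\<rho> g) \<subseteq> F" if "g \<in> K" for g
        by (rule subset_trans[OF UN_upper F(1)]) (rule that)
      have "?q \<otimes> ?r \<in> K" "?r \<otimes> ?q \<in> K" using q subgroup.m_closed[OF K(1)] by blast+
      note E = this[THEN entK]
      have eq: "u = w" if "u \<in> F" "w \<in> F" "u - w \<in> mx" for u w
        using F_mx[OF is_subringD(6)[OF F(2) that(1,2)] that(3)] by simp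
      have "\<rho> (?q \<otimes> ?r) = \<rho> (?r \<otimes> ?q)"
        by (rule mat2.expand) (intro conjI eq fc[unfolded qr] E[THEN subsetD]; simp add: ents_def)
      then show ?thesis by (rule inj_onD[OF \<rho>(2)]) (intro m_closed qG)+
    qed
    ultimately show ?thesis
      using locally_free_metabelian_abelian[OF lf, of S g h] g h by (simp add: S_def)
  qed
  \<comment> \<open>Modulo \<open>mx\<close>, \<open>coll\<close> means that a nontrivial element of
    \<open>H\<close> fixes the line of \<open>p i v\<close>, and \<open>orb\<close> that the line of
    \<open>w\<close> can be moved to it by \<open>H\<close>.\<close>
  define coll where "coll v i \<longleftrightarrow> (\<exists>h\<in>H. h \<noteq> \<one> \<and> om (act (p i) v) (act h (act (p i) v)) \<in> mx)" for v i
  define orb where "orb w v i \<longleftrightarrow> (\<exists>h\<in>H. om (act (p i) v) (act h w) \<in> mx)" for w v i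
  have pG: "p i \<in> carrier G" if "i \<le> 3" for i using pK[OF that] KG by auto
  have HG: "H \<subseteq> carrier G" using HK KG by auto
  have Kc: "inv u \<otimes> h \<otimes> w \<in> K" if "u \<in> K" "h \<in> K" "w \<in> K" for u h w
    by (intro subgroup.m_closed[OF K(1)] subgroup.m_inv_closed[OF K(1)] that)
  have Cc: "inv u \<otimes> h \<otimes> w \<in> C i" if "u \<in> C i" "h \<in> C i" "w \<in> C i" for u h w i
    by (intro subgroup.m_closed[OF Csg] subgroup.m_inv_closed[OF Csg] that)
  \<comment> \<open>Two collisions, conjugated back by \<open>p i\<close> and \<open>p j\<close>,
    give nontrivial commuting elements \<open>?s\<close> and \<open>?t\<close> stabilizing the line
    of \<open>v\<close>. As \<open>?s\<close> is in \<open>C i\<close>, closure captures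
    \<open>?t\<close> and then \<open>p j\<close>, which conjugates \<open>?t\<close> to
    \<open>h'\<close>.\<close>
  have coll_once: False if v: "unimod v" and ij: "i < j" "j \<le> 3" and c: "coll v i" "coll v j" for v i j
  proof -
    have conj: "\<exists>h\<in>H. h \<noteq> \<one> \<and> (let s = inv (p k) \<otimes> h \<otimes> p k in s \<in> K \<and> s \<noteq> \<one> \<and> om v (act s v) \<in> mx)"
      if k: "k \<le> 3" "coll v k" for k
    proof -
      obtain h where h: "h \<in> H" "h \<noteq> \<one>" "om (act (p k) v) (act h (act (p k) v)) \<in> mx"
        using k by (auto simp: coll_def)
      have hG: "h \<in> carrier G" using h HG by auto
      let ?s = "inv (p k) \<otimes> h \<otimes> p k"
      have "om v (act ?s v) = om (act (p k) v) (act h (act (p k) v))"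
        using om_shift(2)[OF pG[OF k(1)]] pG[OF k(1)] hG by (simp add: act_mult)
      moreover have "?s \<in> K" by (intro Kc pK[OF k(1)] subsetD[OF HK h(1)])
      moreover have "?s \<noteq> \<one>"
      proof
        assume "?s = \<one>"
        then have "p k \<otimes> ?s \<otimes> inv (p k) = \<one>" using pG[OF k(1)] by simp
        moreover have "p k \<otimes> ?s \<otimes> inv (p k) = h" using pG[OF k(1)] hG by (simp add: m_assoc)
        ultimately show False using h by simp
      qed
      ultimately show ?thesis using h by (intro bexI[of _ h]) (simp_all add: Let_def)
    qed
    have i3: "i \<le> 3" using ij by simp
    obtain h where h: "h \<in> H" "inv (p i) \<otimes> h \<otimes> p i \<in> K" "inv (p i) \<otimes> h \<otimes> p i \<noteq> \<one>" "om v (act (inv (p i) \<otimes> h \<otimes> p i) v) \<in> mx"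
      using conj[OF i3 c(1)] unfolding Let_def by (elim bexE conjE)
    obtain h' where h': "h' \<in> H" "inv (p j) \<otimes> h' \<otimes> p j \<in> K" "inv (p j) \<otimes> h' \<otimes> p j \<noteq> \<one>" "om v (act (inv (p j) \<otimes> h' \<otimes> p j) v) \<in> mx"
      using conj[OF ij(2) c(2)] unfolding Let_def by (elim bexE conjE)
    let ?s = "inv (p i) \<otimes> h \<otimes> p i" and ?t = "inv (p j) \<otimes> h' \<otimes> p j"
    have ts: "?t \<otimes> ?s = ?s \<otimes> ?t" by (rule stab_comm[OF v h'(2,4) h(2,4)])
    have sC: "?s \<in> C i" by (intro Cc p_in subsetD[OF HC h(1)])
    have tC: "?t \<in> C i" by (rule Cconj[OF sC sC h(3) subsetD[OF KG h'(2)] ts])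
    have "p j \<otimes> ?t = h' \<otimes> p j" using pG[OF ij(2)] subsetD[OF HG h'(1)] by (simp add: m_assoc[symmetric])
    then have "p j \<in> C i" by (rule Cconj[OF tC subsetD[OF HC h'(1)] h'(3) pG[OF ij(2)]])
    then show False using p_notin[OF ij(1)] by contradiction
  qed
  \<comment> \<open>The first two coincidences give a stabilizing element \<open>?s\<close> in
    \<open>C j\<close>, nontrivial since \<open>p j\<close> is outside \<open>C i\<close>. The third
    gives \<open>?t\<close>, which commutes with \<open>?s\<close>, hence falls into
    \<open>C j\<close> and takes \<open>p k\<close> with it.\<close>
  have orb_twice: False if w: "unimod w" and v: "unimod v" and ijk: "i < j" "j < k" "k \<le> 3"
    and o: "orb w v i" "orb w v j" "orb w v k" for v w i j k
  proof -
    have i3: "i \<le> 3" and j3: "j \<le> 3" using ijk by auto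
    obtain hi where hi: "hi \<in> H" "om (act (p i) v) (act hi w) \<in> mx" using o by (auto simp: orb_def)
    obtain hj where hj: "hj \<in> H" "om (act (p j) v) (act hj w) \<in> mx" using o by (auto simp: orb_def)
    obtain hk where hk: "hk \<in> H" "om (act (p k) v) (act hk w) \<in> mx" using o by (auto simp: orb_def)
    have vi: "intvec v" and wi: "intvec w" using v w uni_int by auto
    have tr: "inv (p i) \<otimes> (hi \<otimes> inv hn) \<otimes> p n \<in> K \<and> om v (act (inv (p i) \<otimes> (hi \<otimes> inv hn) \<otimes> p n) v) \<in> mx"
      if n: "n \<le> 3" "hn \<in> H" "om (act (p n) v) (act hn w) \<in> mx" for n hn
    proof -
      have G: "hi \<in> carrier G" "hn \<in> carrier G" "hi \<in> K" "hn \<in> K" using hi n HG HK by auto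
      have Ki: "hi \<otimes> inv hn \<in> K" using G subgroup.m_closed[OF K(1)] subgroup.m_inv_closed[OF K(1)] by blast
      have "om (act (p n) v) (act hn w) = om (act (hi \<otimes> inv hn) (act (p n) v)) (act (hi \<otimes> inv hn) (act hn w))"
        using om_act[of "hi \<otimes> inv hn"] G by simp
      also have "act (hi \<otimes> inv hn) (act hn w) = act hi w" using G by (simp add: act_mult act_inv)
      finally have "om (act hi w) (act (hi \<otimes> inv hn) (act (p n) v)) \<in> mx"
        using n(3) om_swap[of "act hi w"] mx_minus by simp
      then have "om (act (p i) v) (act (hi \<otimes> inv hn) (act (p n) v)) \<in> mx"
        by (rule om_trans[OF act_int[OF pK[OF i3] vi] act_uni[OF G(3) w] act_int[OF Ki act_int[OF pK[OF n(1)] vi]] hi(2)])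
      then have "om v (act (inv (p i) \<otimes> (hi \<otimes> inv hn) \<otimes> p n) v) \<in> mx"
        using om_shift(2)[OF pG[OF i3]] pG[OF i3] pG[OF n(1)] G by (simp add: act_mult)
      then show ?thesis by (intro conjI Kc pK[OF i3] pK[OF n(1)] Ki)
    qed
    let ?s = "inv (p i) \<otimes> (hi \<otimes> inv hj) \<otimes> p j" and ?t = "inv (p i) \<otimes> (hi \<otimes> inv hk) \<otimes> p k"
    have hG: "hi \<in> carrier G" "hj \<in> carrier G" "hk \<in> carrier G" using hi hj hk HG by auto
    have s: "?s \<in> K" "om v (act ?s v) \<in> mx" using tr[OF j3 hj] by auto
    have t: "?t \<in> K" "om v (act ?t v) \<in> mx" using tr[OF ijk(3) hk] by auto
    note Cm = subgroup.m_closed[OF Csg] subgroup.m_inv_closed[OF Csg]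
    have undo: "p n = hn \<otimes> inv hi \<otimes> p i \<otimes> (inv (p i) \<otimes> (hi \<otimes> inv hn) \<otimes> p n)"
      if "n \<le> 3" "hn \<in> carrier G" for n hn
      using that hG pG[OF i3] pG[OF that(1)] by (simp add: m_assoc)
    have left: "hn \<otimes> inv hi \<otimes> p i \<in> C i" if "hn \<in> H" for hn
      by (intro Cm p_in subsetD[OF HC that] subsetD[OF HC hi(1)])
    have s1: "?s \<noteq> \<one>"
    proof
      assume s1: "?s = \<one>"
      have "p j = hj \<otimes> inv hi \<otimes> p i" using undo[OF j3 hG(2)] hG pG[OF i3] by (simp add: s1)
      then show False using left[OF hj(1)] p_notin[OF ijk(1)] by simp
    qed
    have sC: "?s \<in> C j"
    proof -
      have "p i \<in> C j" using p_in[of i] mono[of i j] ijk by auto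
      then show ?thesis by (intro Cm p_in subsetD[OF HC hi(1)] subsetD[OF HC hj(1)])
    qed
    have "?t \<otimes> ?s = ?s \<otimes> ?t" by (rule stab_comm[OF v t s])
    then have "?t \<in> C j" by (rule Cconj[OF sC sC s1 subsetD[OF KG t(1)]])
    then have "hk \<otimes> inv hi \<otimes> p i \<otimes> ?t \<in> C j"
      by (rule Cm(1)[OF subsetD[OF mono[OF less_imp_le_nat[OF ijk(1)]] left[OF hk(1)]]])
    then show False using undo[OF ijk(3) hG(3)] p_notin[OF ijk(2)] by simp
  qed
  have "\<exists>i0\<le>3. \<not> coll a i0"
  proof (cases "coll a 0")
    case True
    then have "\<not> coll a 1" using coll_once[OF ab(2), of 0 1] by auto
    then show ?thesis by (intro exI[of _ 1]) simp
  qed auto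
  then obtain i0 where i0: "i0 \<le> 3" "\<not> coll a i0" by blast
  define \<alpha> where "\<alpha> = act (p i0) a"
  have \<alpha>: "unimod \<alpha>" unfolding \<alpha>_def by (rule act_uni[OF pK[OF i0(1)] ab(2)])
  obtain k where k: "k \<le> 3" "\<not> coll b k" "\<not> orb \<alpha> b k"
  proof (rule ccontr)
    assume "\<not> thesis"
    then have all: "coll b n \<or> orb \<alpha> b n" if "n \<le> 3" for n using that \<open>\<And>k. k \<le> 3 \<Longrightarrow> \<not> coll b k \<Longrightarrow> \<not> orb \<alpha> b k \<Longrightarrow> thesis\<close> by blast
    note c = coll_once[OF ab(3)] and d = orb_twice[OF \<alpha> ab(3)]
    have "\<not> (coll b 0 \<and> coll b 1)" "\<not> (coll b 0 \<and> coll b 2)" "\<not> (coll b 0 \<and> coll b 3)"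
      "\<not> (coll b 1 \<and> coll b 2)" "\<not> (coll b 1 \<and> coll b 3)" "\<not> (coll b 2 \<and> coll b 3)"
      using c[of 0 1] c[of 0 2] c[of 0 3] c[of 1 2] c[of 1 3] c[of 2 3] by auto
    moreover have "\<not> (orb \<alpha> b 0 \<and> orb \<alpha> b 1 \<and> orb \<alpha> b 2)" "\<not> (orb \<alpha> b 0 \<and> orb \<alpha> b 1 \<and> orb \<alpha> b 3)"
      "\<not> (orb \<alpha> b 0 \<and> orb \<alpha> b 2 \<and> orb \<alpha> b 3)" "\<not> (orb \<alpha> b 1 \<and> orb \<alpha> b 2 \<and> orb \<alpha> b 3)"
      using d[of 0 1 2] d[of 0 1 3] d[of 0 2 3] d[of 1 2 3] by auto
    ultimately show False using all[of 0] all[of 1] all[of 2] all[of 3] by auto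
  qed
  define \<beta> where "\<beta> = act (p k) b"
  have \<beta>: "unimod \<beta>" unfolding \<beta>_def by (rule act_uni[OF pK[OF k(1)] ab(3)])
  \<comment> \<open>Its attracting line is that of \<open>\<alpha>\<close> and its repelling line
    that of \<open>\<beta>\<close>; for the inverse the two change roles.\<close>
  define y where "y = p i0 \<otimes> x \<otimes> inv (p k)"
  note p0G = pG[OF i0(1)] and pkG = pG[OF k(1)]
  have yG: "y \<in> carrier G" using p0G pkG x(1) by (simp add: y_def)
  define dir where "dir e = (if e then \<alpha> else \<beta>)" for e
  have dir: "unimod (dir e)" for e using \<alpha> \<beta> by (simp add: dir_def)
  \<comment> \<open>The attracting line left by one letter, moved by \<open>h\<close>, misses the
    repelling line of the next letter. The exception, \<open>h = \<one>\<close> between opposite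
    powers of \<open>y\<close>, is the case that \<open>alt_red\<close> excludes.\<close>
  have generic: "om (dir (\<not> e)) (act h (dir e')) \<notin> mx" if h: "h \<in> H" and "e \<noteq> e' \<longrightarrow> h \<noteq> \<one>" for e e' h
  proof -
    have hG: "h \<in> carrier G" "inv h \<in> H" using h HG subgroup.m_inv_closed[OF Hsg] by auto
    have 1: "om \<alpha> (act h \<alpha>) \<notin> mx" if "h \<noteq> \<one>" using i0(2) h that by (auto simp: coll_def \<alpha>_def)
    have 2: "om \<beta> (act h \<beta>) \<notin> mx" if "h \<noteq> \<one>" using k(2) h that by (auto simp: coll_def \<beta>_def)
    have 3: "om \<beta> (act g \<alpha>) \<notin> mx" if "g \<in> H" for g using k(3) that by (auto simp: orb_def \<beta>_def)
    have "om \<alpha> (act h \<beta>) = - om \<beta> (act (inv h) \<alpha>)"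
      using om_shift(1)[OF hG(1), of \<alpha> \<beta>] om_swap[of "act (inv h) \<alpha>" \<beta>] by simp
    then have "om \<alpha> (act h \<beta>) \<notin> mx" using 3[OF hG(2)] mx_minus by fastforce
    then show ?thesis using 1 2 3[OF h] that(2) by (cases e; cases e') (auto simp: dir_def)
  qed
  have ystep: "\<exists>w c. act (if e then y else inv y) u = scl \<theta> w \<and> veq w (scl c (dir e)) \<and> c \<in> V \<and> c \<notin> mx"
    if u: "intvec u" "om (dir (\<not> e)) u \<notin> mx" for e u
  proof (cases e)
    case True
    have u': "intvec (act (inv (p k)) u)" using act_int[OF subgroup.m_inv_closed[OF K(1) pK[OF k(1)]] u(1)] .
    obtain w where w: "act x (act (inv (p k)) u) = scl \<theta> w" "veq w (scl (om b (act (inv (p k)) u)) a)"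
      using ab(4)[OF u'] by blast
    have "om b (act (inv (p k)) u) = om \<beta> u" using om_shift(2)[OF pkG, of b u] by (simp add: \<beta>_def)
    then have "veq (act (p i0) w) (scl (om \<beta> u) \<alpha>)"
      using act_veq[OF pK[OF i0(1)] w(2)] by (simp add: act_scl \<alpha>_def)
    moreover have "act y u = scl \<theta> (act (p i0) w)"
      using w(1) p0G pkG x(1) by (simp add: y_def act_mult act_scl)
    moreover have "om \<beta> u \<in> V" using om_V[OF uni_int[OF \<beta>] u(1)] .
    moreover have "om \<beta> u \<notin> mx" using u(2) True by (simp add: dir_def)
    ultimately show ?thesis using True
      by (intro exI[of _ "act (p i0) w"] exI[of _ "om \<beta> u"]) (simp add: dir_def)
  next
    case False
    have u': "intvec (act (inv (p i0)) u)" using act_int[OF subgroup.m_inv_closed[OF K(1) pK[OF i0(1)]] u(1)] .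
    obtain w where w: "act (inv x) (act (inv (p i0)) u) = scl \<theta> w" "veq w (scl (- om a (act (inv (p i0)) u)) b)"
      using ab5[OF u'] by blast
    have "om a (act (inv (p i0)) u) = om \<alpha> u" using om_shift(2)[OF p0G, of a u] by (simp add: \<alpha>_def)
    then have "veq (act (p k) w) (scl (- om \<alpha> u) \<beta>)"
      using act_veq[OF pK[OF k(1)] w(2)] by (simp add: act_scl \<beta>_def)
    moreover have "act (inv y) u = scl \<theta> (act (p k) w)"
      using w(1) p0G pkG x(1) by (simp add: y_def act_mult act_scl inv_mult_group)
    moreover have "- om \<alpha> u \<in> V" using om_V[OF uni_int[OF \<alpha>] u(1)] by blast
    moreover have "- om \<alpha> u \<notin> mx" using u(2) False mx_minus[of "- om \<alpha> u"] by (auto simp: dir_def)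
    ultimately show ?thesis using False
      by (intro exI[of _ "act (p k) w"] exI[of _ "- om \<alpha> u"]) (simp add: dir_def)
  qed
  \<comment> \<open>A word of length \<open>n\<close> sends some integral vector to
    \<open>\<theta> ^ n\<close> times a vector that is nonzero modulo \<open>mx\<close>. The
    identity cannot do this, because \<open>\<theta>\<close> is not integral.\<close>
  have word: "\<exists>v0 w c. intvec v0 \<and> act (alt_eval y l) v0 = scl (\<theta> ^ length l) w \<and>
      veq w (scl c (dir (fst (hd l)))) \<and> c \<in> V \<and> c \<notin> mx"
    if "l \<noteq> []" "letters l \<subseteq> H" "alt_red l" for l
    using that
  proof (induction l)
    case (Cons q l)
    obtain e h where q: "q = (e, h)" by (cases q)
    have h: "h \<in> H" "h \<in> K" "h \<in> carrier G" using Cons.prems(2) HK HG by (auto simp: q)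
    have lG: "alt_eval y l \<in> carrier G" using Cons.prems(2) HG yG by (intro alt_eval_closed) auto
    let ?y = "if e then y else inv y"
    have ev: "act (alt_eval y (q # l)) v = act ?y (act h (act (alt_eval y l) v))" for v
      using h yG lG by (simp add: q act_mult)
    show ?case
    proof (cases "l = []")
      case True
      \<comment> \<open>The starting vector only has to avoid the line repelled by the innermost
        letter.\<close>
      define z where "z = act (inv h) (dir (\<not> e))"
      have z: "unimod z" unfolding z_def by (rule act_uni[OF subgroup.m_inv_closed[OF K(1) h(2)] dir])
      obtain v0 where v0: "intvec v0" "om z v0 \<notin> mx"
      proof (cases "fst z \<in> mx")
        case True
        then have "snd z \<notin> mx" using z by (auto simp: unimod_def nullvec_def)
        then have "om z (1, 0) \<notin> mx" using mx_minus[of "- snd z"] by (cases z) auto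
        then show ?thesis using that[of "(1, 0)"] by (auto simp: intvec_def)
      next
        case False
        then have "om z (0, 1) \<notin> mx" by (cases z) auto
        then show ?thesis using that[of "(0, 1)"] by (auto simp: intvec_def)
      qed
      have "om (dir (\<not> e)) (act h v0) \<notin> mx" using v0(2) om_shift(1)[OF h(3)] by (simp add: z_def)
      from ystep[OF act_int[OF h(2) v0(1)] this] obtain w c where w: "act ?y (act h v0) = scl \<theta> w"
        "veq w (scl c (dir e))" "c \<in> V" "c \<notin> mx" by (elim exE conjE)
      have "act (alt_eval y (q # l)) v0 = scl (\<theta> ^ length (q # l)) w"
        unfolding ev using w(1) True by (simp add: act_one)
      with v0(1) w show ?thesis
        by (intro exI[of _ v0] exI[of _ w] exI[of _ c]) (simp add: q)
    next
      case False
      obtain v0 w c where IH: "intvec v0" "act (alt_eval y l) v0 = scl (\<theta> ^ length l) w"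
        "veq w (scl c (dir (fst (hd l))))" "c \<in> V" "c \<notin> mx"
      proof -
        have "letters l \<subseteq> H" "alt_red l" using Cons.prems(2,3) False by (auto simp: successively_Cons)
        from Cons.IH[OF False this] show thesis by (elim exE conjE) (rule that)
      qed
      have di: "intvec (dir e')" for e' using dir uni_int by blast
      have wi: "intvec w" using veq_intvec[OF intvec_scl[OF IH(4) di] IH(3)] .
      have "veq (act h w) (scl c (act h (dir (fst (hd l)))))" using act_veq[OF h(2) IH(3)] by (simp add: act_scl)
      then have "om (dir (\<not> e)) (act h w) - c * om (dir (\<not> e)) (act h (dir (fst (hd l)))) \<in> mx"
        using veq_om[OF di] by (simp add: om_scl[symmetric])
      moreover have "om (dir (\<not> e)) (act h (dir (fst (hd l)))) \<notin> mx"
        using generic[OF h(1)] Cons.prems(3) False by (auto simp: successively_Cons q)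
      then have "c * om (dir (\<not> e)) (act h (dir (fst (hd l)))) \<notin> mx"
        using mx_prime[OF IH(4) om_V[OF di act_int[OF h(2) di]]] IH(5) by blast
      ultimately have "om (dir (\<not> e)) (act h w) \<notin> mx" using mx_cong by blast
      from ystep[OF act_int[OF h(2) wi] this] obtain w' c' where
        w': "act ?y (act h w) = scl \<theta> w'" "veq w' (scl c' (dir e))" "c' \<in> V" "c' \<notin> mx" by (elim exE conjE)
      have "act (alt_eval y (q # l)) v0 = scl (\<theta> ^ length l) (act ?y (act h w))"
        unfolding ev using IH(2) by (simp add: act_scl)
      also have "\<dots> = scl (\<theta> ^ length (q # l)) w'" unfolding w'(1) by (simp add: scl_def mult_ac)
      finally have "act (alt_eval y (q # l)) v0 = scl (\<theta> ^ length (q # l)) w'" .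
      with IH(1) w' show ?thesis
        by (intro exI[of _ v0] exI[of _ w'] exI[of _ c']) (simp add: q)
    qed
  qed simp
  have \<theta>0: "\<theta> \<noteq> 0" using ab(1) by auto
  have pow: "inverse (\<theta> ^ Suc n) \<in> mx" for n
  proof (induction n)
    case 0
    then show ?case using inverse_mx[OF ab(1)] by simp
  next
    case (Suc n)
    then have "inverse \<theta> * inverse (\<theta> ^ Suc n) \<in> mx" using mx_mult inverse_mx[OF ab(1)] mx_V by blast
    then show ?case by simp
  qed
  have "free_over H y"
    unfolding free_over_def
  proof (intro conjI allI impI yG)
    fix l assume l: "l \<noteq> [] \<and> letters l \<subseteq> H \<and> alt_red l"
    then obtain v0 w c where w: "intvec v0" "act (alt_eval y l) v0 = scl (\<theta> ^ length l) w"
      "veq w (scl c (dir (fst (hd l))))" "c \<in> V" "c \<notin> mx"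
      using word by blast
    show "alt_eval y l \<noteq> \<one>"
    proof
      assume "alt_eval y l = \<one>"
      then have v: "v0 = scl (\<theta> ^ length l) w" using w(2) by (simp add: act_one)
      obtain n where n: "length l = Suc n" using l by (cases l) auto
      have "w = scl (inverse (\<theta> ^ Suc n)) v0" unfolding v n using \<theta>0 by (simp add: scl_def prod_eq_iff field_simps)
      then have "nullvec w" using pow w(1) by (auto simp: scl_def nullvec_def intvec_def intro: mx_mult')
      then have "nullvec (scl c (dir (fst (hd l))))" using veq_nullvec[OF w(3)] by simp
      then show False
        using dir[of "fst (hd l)"] mx_prime[OF w(4)] w(5) by (auto simp: scl_def nullvec_def unimod_def intvec_def)
    qed
  qed
  then show ?thesis using that by (simp add: H_def)
qed

end

section \<open>Free groups of finite rank\<close>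

context group
begin

context
  fixes B :: "'a set"
  assumes B: "free_basis G B" and gen: "generate G B = carrier G"
begin

text \<open>The sign of the first letter is ignored, so any nonzero power of \<open>z\<close>
  carries the complement into this set.\<close>

definition starts :: "'a \<Rightarrow> 'a \<Rightarrow> bool" where
  "starts z g \<longleftrightarrow> (\<exists>w. w \<noteq> [] \<and> letters w \<subseteq> B \<and> reduced_word w \<and> word_eval G w = g \<and> snd (hd w) = z)"

lemma B_carrier: "B \<subseteq> carrier G"
  using B by (simp add: free_basis_def)

lemma starts_unique:
  assumes "starts z g" "letters w \<subseteq> B" "reduced_word w" "word_eval G w = g"
  shows "w \<noteq> [] \<and> snd (hd w) = z"
proof -
  obtain v where "v \<noteq> []" "letters v \<subseteq> B" "reduced_word v" "word_eval G v = g" "snd (hd v) = z"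
    using assms(1) by (auto simp: starts_def)
  then show ?thesis using reduced_word_unique[OF B, of v w] assms(2-) by auto
qed

lemma not_starts_one: "\<not> starts z \<one>"
  using starts_unique[of z \<one> "[]"] by (auto simp: reduced_word_iff)

lemma starts_disjoint: "starts x g \<Longrightarrow> starts y g \<Longrightarrow> x = y"
  unfolding starts_def using starts_unique by (metis starts_def)

lemma starts_carrier: "starts z g \<Longrightarrow> g \<in> carrier G"
  using B_carrier unfolding starts_def by (meson word_eval_closed order_trans)

lemma starts_pow:
  assumes z: "z \<in> B" and k: "k \<noteq> (0::int)" and g: "g \<in> carrier G" "\<not> starts z g"
  shows "starts z (z [^] k \<otimes> g)"
proof -
  have zG: "z \<in> carrier G" using z B_carrier by auto
  obtain w where w: "letters w \<subseteq> B" "reduced_word w" "word_eval G w = g"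
    using reduced_word_exists[OF B_carrier, of g] g(1) gen by auto
  have hd: "snd (hd w) \<noteq> z" if "w \<noteq> []" using g(2) w that unfolding starts_def by blast
  let ?u = "replicate (nat \<bar>k\<bar>) (k > 0, z)"
  have ne: "nat \<bar>k\<bar> \<noteq> 0" using k by simp
  have "reduced_word (?u @ w)"
    using w(2) hd ne unfolding reduced_word_iff successively_append_iff by (auto simp: successively_conv_nth)
  moreover have "word_eval G (?u @ w) = z [^] k \<otimes> g"
  proof -
    have pow: "word_eval G (replicate n (True, z)) = z [^] n" for n
      using zG by (induction n) (auto simp: nat_pow_comm[of z 1, simplified])
    have ipow: "word_eval G (replicate n (False, z)) = inv (z [^] n)" for n :: nat
      using zG by (induction n) (auto simp: inv_mult_group)
    have "word_eval G ?u = z [^] k"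
    proof (cases "k > 0")
      case True
      then show ?thesis using pow[of "nat k"] int_pow_int[of G z "nat k"] by simp
    next
      case False
      then show ?thesis using ipow[of "nat (- k)"] int_pow_neg_int[OF zG, of "nat (- k)"] by simp
    qed
    moreover have "letters ?u \<subseteq> carrier G" using zG by (auto simp: letters_def)
    ultimately show ?thesis using w B_carrier by (subst word_eval_append) auto
  qed
  moreover have "letters (?u @ w) \<subseteq> B" using w(1) z by (auto simp: letters_def)
  moreover have "snd (hd (?u @ w)) = z" "?u @ w \<noteq> []" using ne by (auto simp: hd_append)
  ultimately show ?thesis unfolding starts_def by blast
qed

text \<open>Meant for elements whose reduced word neither begins nor ends in a power of
  \<open>y\<close>, but stated through their action, in the form that ping-pong uses.\<close>

definition core :: "'a \<Rightarrow> 'a \<Rightarrow> bool" where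
  "core y m \<longleftrightarrow> m \<in> carrier G \<and> (m = \<one> \<or> (\<forall>g. starts y g \<longrightarrow> \<not> starts y (m \<otimes> g)))"

lemma power_word:
  assumes "y \<in> carrier G" "\<And>p. p \<in> set u \<Longrightarrow> snd p = y"
  obtains i :: int where "word_eval G u = y [^] i"
proof -
  have "letters u \<subseteq> {y}" using assms(2) by (auto simp: letters_def)
  then have "word_eval G u \<in> generate G {y}" using assms(1) by (subst generate_eq_words) auto
  then show ?thesis using that assms(1) by (auto simp: generate_pow)
qed

lemma core_decomposition:
  assumes y: "y \<in> B" and a: "a \<in> carrier G"
  obtains i j :: int and m where "core y m" "a = y [^] i \<otimes> m \<otimes> y [^] j"
proof -
  have yG: "y \<in> carrier G" using y B_carrier by auto
  obtain w where w: "letters w \<subseteq> B" "reduced_word w" "word_eval G w = a"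
    using reduced_word_exists[OF B_carrier, of a] a gen by auto
  let ?P = "\<lambda>p. snd p = y"
  define u where "u = takeWhile ?P w"
  define r where "r = dropWhile ?P w"
  define t where "t = rev (takeWhile ?P (rev r))"
  define v where "v = rev (dropWhile ?P (rev r))"
  have r: "r = v @ t" unfolding v_def t_def by (metis rev_append rev_rev_ident takeWhile_dropWhile_id)
  have wd: "w = u @ v @ t" by (simp add: u_def r[symmetric] r_def)
  have "v \<noteq> [] \<Longrightarrow> snd (hd v) \<noteq> y"
    using r hd_dropWhile[of ?P w] by (auto simp: r_def[symmetric])
  have "v \<noteq> [] \<Longrightarrow> snd (last v) \<noteq> y"
    using hd_dropWhile[of ?P "rev r"] by (auto simp: v_def last_rev)
  obtain i :: int where i: "word_eval G u = y [^] i"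
    using power_word[OF yG, of u] by (auto simp: u_def dest: set_takeWhileD)
  obtain j :: int where j: "word_eval G t = y [^] j"
    using power_word[OF yG, of t] by (auto simp: t_def dest: set_takeWhileD)
  let ?m = "word_eval G v"
  have lts: "letters u \<subseteq> carrier G" "letters v \<subseteq> carrier G" "letters t \<subseteq> carrier G" "letters v \<subseteq> B"
    using w(1) B_carrier by (auto simp: wd)
  have vr: "reduced_word v" using w(2) by (auto simp: wd reduced_word_iff successively_append_iff)
  have "core y ?m"
  proof (cases "v = []")
    case False
    have "\<not> starts y (?m \<otimes> g)" if g: "starts y g" for g
    proof
      assume s: "starts y (?m \<otimes> g)"
      obtain w' where w': "w' \<noteq> []" "letters w' \<subseteq> B" "reduced_word w'" "word_eval G w' = g" "snd (hd w') = y"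
        using g by (auto simp: starts_def)
      have "reduced_word (v @ w')"
        using vr w' \<open>v \<noteq> [] \<Longrightarrow> snd (last v) \<noteq> y\<close> False
        by (auto simp: reduced_word_iff successively_append_iff)
      moreover have "letters w' \<subseteq> carrier G" using w'(2) B_carrier by auto
      then have "word_eval G (v @ w') = ?m \<otimes> g" using w'(4) lts by (simp add: word_eval_append)
      ultimately have "snd (hd (v @ w')) = y" using starts_unique[OF s, of "v @ w'"] w'(2) lts by auto
      then show False using \<open>v \<noteq> [] \<Longrightarrow> snd (hd v) \<noteq> y\<close> False by simp
    qed
    then show ?thesis using lts by (simp add: core_def)
  qed (simp add: core_def)
  moreover have "a = y [^] i \<otimes> ?m \<otimes> y [^] j"
    using w(3) lts i j yG by (simp add: wd word_eval_append m_assoc[symmetric])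
  ultimately show ?thesis using that by blast
qed

text \<open>The bound \<open>n\<close> says which powers of \<open>y\<close> survive multiplication
  by \<open>a\<close> on either side.\<close>

definition tame :: "'a \<Rightarrow> nat \<Rightarrow> 'a \<Rightarrow> bool" where
  "tame y n a \<longleftrightarrow> (\<exists>(i::int) (j::int) m. core y m \<and> a = y [^] i \<otimes> m \<otimes> y [^] j \<and> \<bar>i\<bar> < int n \<and> \<bar>j\<bar> < int n)"

lemma tame_mono: "tame y n a \<Longrightarrow> n \<le> n' \<Longrightarrow> tame y n' a"
  unfolding tame_def by (elim exE conjE, intro exI conjI, assumption+) linarith+

lemma tame_exists:
  assumes "y \<in> B" "a \<in> carrier G"
  shows "\<exists>n. tame y n a"
proof -
  obtain i j :: int and m where "core y m" "a = y [^] i \<otimes> m \<otimes> y [^] j"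
    using core_decomposition[OF assms] by blast
  then have "tame y (nat (\<bar>i\<bar> + \<bar>j\<bar> + 1)) a" unfolding tame_def by (intro exI[of _ i] exI[of _ j] exI[of _ m]) auto
  then show ?thesis ..
qed

lemma tame_finite:
  assumes "y \<in> B" "finite K" "K \<subseteq> carrier G"
  shows "\<exists>n. \<forall>a\<in>K. tame y n a"
  using assms(2,3)
proof (induction K)
  case (insert a K)
  then obtain n where "\<forall>a\<in>K. tame y n a" by auto
  moreover obtain n' where "tame y n' a" using tame_exists[OF assms(1), of a] insert.prems by auto
  ultimately show ?case by (intro exI[of _ "max n n'"]) (auto intro: tame_mono)
qed auto

text \<open>The exponents \<open>p\<close> and \<open>q\<close> dominate those at the ends of
  \<open>a\<close>. Only a trivial core merges both sides into one power of \<open>y\<close>; its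
  exponent is nonzero because \<open>p + q\<close> is large or, if \<open>p + q = 0\<close>, because
  \<open>a\<close> is not \<open>\<one>\<close>.\<close>

lemma sandwich_starts:
  assumes y: "y \<in> B" and a: "tame y n a" and pq: "\<bar>p\<bar> \<ge> int n" "\<bar>q\<bar> \<ge> int n" "p + q \<noteq> 0 \<and> \<bar>p + q\<bar> \<ge> 2 * int n \<or> p + q = 0 \<and> a \<noteq> \<one>"
    and g: "g \<in> carrier G" "\<not> starts y g"
  shows "starts y (y [^] (p::int) \<otimes> a \<otimes> y [^] (q::int) \<otimes> g)"
proof -
  have yG: "y \<in> carrier G" using y B_carrier by auto
  obtain i j :: int and m where m: "core y m" "a = y [^] i \<otimes> m \<otimes> y [^] j" "\<bar>i\<bar> < int n" "\<bar>j\<bar> < int n"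
    using a unfolding tame_def by blast
  have mG: "m \<in> carrier G" using m by (simp add: core_def)
  have eq: "y [^] p \<otimes> a \<otimes> y [^] q \<otimes> g = y [^] (p + i) \<otimes> (m \<otimes> (y [^] (j + q) \<otimes> g))"
    using yG mG g(1) unfolding m(2) by (simp add: int_pow_mult m_assoc)
  have nz: "p + i \<noteq> 0" "j + q \<noteq> 0" using m pq by auto
  show ?thesis
  proof (cases "m = \<one>")
    case True
    have "y [^] (p + i) \<otimes> (m \<otimes> (y [^] (j + q) \<otimes> g)) = y [^] (p + q + i + j) \<otimes> g"
    proof -
      have "y [^] (p + i) \<otimes> (y [^] (j + q) \<otimes> g) = y [^] (p + i + (j + q)) \<otimes> g"
        using yG g(1) by (simp add: int_pow_mult[symmetric] m_assoc[symmetric] del: int_pow_mult)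
      moreover have "p + i + (j + q) = p + q + i + j" by simp
      ultimately show ?thesis using yG g(1) True by simp
    qed
    moreover have "p + q + i + j \<noteq> 0"
    proof (cases "p + q = 0")
      case t: True
      then have "i + j \<noteq> 0" using pq m True yG by (auto simp: int_pow_mult[symmetric])
      then show ?thesis using t by simp
    next
      case False
      then show ?thesis using pq m by linarith
    qed
    ultimately show ?thesis using starts_pow[OF y _ g] eq by simp
  next
    case False
    have "starts y (y [^] (j + q) \<otimes> g)" using starts_pow[OF y nz(2) g] .
    then have "\<not> starts y (m \<otimes> (y [^] (j + q) \<otimes> g))" using m(1) False by (simp add: core_def)
    then show ?thesis using starts_pow[OF y nz(1)] eq yG mG g(1) by simp
  qed
qed

text \<open>The multipliers are \<open>x^p y^p\<close> and \<open>y^p x^p\<close>, with an exponent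
  \<open>p\<close> peculiar to each pair \<open>(i, j)\<close>. Powers of \<open>x\<close> cancel
  only between equal exponents, that is, at the same multiplier; then the two support elements
  differ, and the powers of \<open>y\<close> around them do not vanish.\<close>

lemma finite_rank_no_cycles:
  assumes x: "x \<in> B" and y: "y \<in> B" and xy: "x \<noteq> y"
    and I: "countable I" and A: "\<And>i. i \<in> I \<Longrightarrow> finite (A i) \<and> A i \<subseteq> carrier G"
  obtains L L' where "\<And>i j. L i j \<in> carrier G" "\<And>i j. L' i j \<in> carrier G" "no_cycles G I A L L'"
proof -
  have xG: "x \<in> carrier G" and yG: "y \<in> carrier G" using x y B_carrier by auto
  \<comment> \<open>All that can stand between two powers of \<open>y\<close>: a support element,
    its inverse, or a quotient left by a cancellation.\<close>
  define K where "K i = A i \<union> (\<lambda>a. inv a) ` A i \<union> (\<lambda>(a, b). inv a \<otimes> b) ` (A i \<times> A i)" for i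
  have "\<forall>i\<in>I. \<exists>n. \<forall>a\<in>K i. tame y n a"
  proof
    fix i assume "i \<in> I"
    then show "\<exists>n. \<forall>a\<in>K i. tame y n a"
      using A[of i] by (intro tame_finite[OF y]) (auto simp: K_def)
  qed
  then obtain b where b: "\<And>i a. i \<in> I \<Longrightarrow> a \<in> K i \<Longrightarrow> tame y (b i) a" by metis
  define e where "e = to_nat_on I"
  have e: "inj_on e I" unfolding e_def by (rule inj_on_to_nat_on[OF I])
  define \<beta> where "\<beta> n = Suc (b (inv_into I e n))" for n
  define s where "s n = sum \<beta> {..n}" for n
  have smono: "strict_mono s" unfolding s_def by (simp add: strict_mono_Suc_iff \<beta>_def)
  \<comment> \<open>The partial sums \<open>s\<close> are strictly increasing and exceed the bounds
    \<open>b i\<close>; doubling makes room for the bit \<open>j\<close>, so the exponents are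
    pairwise distinct.\<close>
  define p where "p i j = int (2 * s (e i) + (if j then 1 else 0))" for i and j :: bool
  have pinj: "p i j = p i' j' \<longleftrightarrow> i = i' \<and> j = j'" if "i \<in> I" "i' \<in> I" for i i' j j'
  proof
    assume "p i j = p i' j'"
    then have "2 * s (e i) + (if j then 1 else 0) = 2 * s (e i') + (if j' then 1 else (0::nat))"
      unfolding p_def of_nat_eq_iff .
    then have "s (e i) = s (e i')" "j = j'" by (auto split: if_splits) presburger+
    then have "e i = e i'" using smono by (simp add: strict_mono_eq)
    then show "i = i' \<and> j = j'" using e that \<open>j = j'\<close> by (simp add: inj_on_eq_iff)
  qed simp
  have pb: "p i j \<ge> int (b i)" "p i j > 0" if "i \<in> I" for i j
  proof -
    have "\<beta> (e i) \<le> s (e i)" unfolding s_def by (rule member_le_sum) auto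
    moreover have "\<beta> (e i) = Suc (b i)" using e that by (simp add: \<beta>_def)
    ultimately show "p i j \<ge> int (b i)" "p i j > 0" by (auto simp: p_def)
  qed
  define L where "L i j = x [^] p i j \<otimes> y [^] p i j" for i j
  define L' where "L' i j = y [^] p i j \<otimes> x [^] p i j" for i j
  have Lc: "L i j \<in> carrier G" "L' i j \<in> carrier G" for i j using xG yG by (simp_all add: L_def L'_def)
  have chunk_pos: "starts y (y [^] p i j \<otimes> a \<otimes> y [^] p i j \<otimes> g)"
    if "i \<in> I" "a \<in> A i" "g \<in> carrier G" "\<not> starts y g" for i j a g
    using sandwich_starts[OF y b[OF that(1), of a] _ _ _ that(3,4), of "p i j" "p i j"] that pb[OF that(1), of j]
    by (auto simp: K_def)
  have chunk_neg: "starts y (y [^] (- p i j) \<otimes> inv a \<otimes> y [^] (- p i j) \<otimes> g)"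
    if "i \<in> I" "a \<in> A i" "g \<in> carrier G" "\<not> starts y g" for i j a g
    using sandwich_starts[OF y b[OF that(1), of "inv a"] _ _ _ that(3,4), of "- p i j" "- p i j"] that pb[OF that(1), of j]
    by (auto simp: K_def)
  have chunk_mix: "starts y (y [^] (- p i j) \<otimes> (inv a \<otimes> a') \<otimes> y [^] p i j \<otimes> g)"
    if i: "i \<in> I" and a: "a \<in> A i" "a' \<in> A i" "a \<noteq> a'" and g: "g \<in> carrier G" "\<not> starts y g" for i j a a' g
  proof -
    have aG: "a \<in> carrier G" "a' \<in> carrier G" using A[OF i] a by auto
    then have "inv a \<otimes> a' \<noteq> \<one>" using a(3) by (metis inv_equality inv_inv inv_closed)
    moreover have "inv a \<otimes> a' \<in> K i" using a by (auto simp: K_def)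
    ultimately show ?thesis
      using sandwich_starts[OF y b[OF i], of "inv a \<otimes> a'" "- p i j" "p i j" g] pb[OF i, of j] g by auto
  qed
  \<comment> \<open>The shape kept along a chain: a power of \<open>x\<close>, the latest label
    between powers of \<open>y\<close>, then an element starting with \<open>x\<close>
    again.\<close>
  define cone where "cone i j a = {x [^] p i j \<otimes> (y [^] p i j \<otimes> a \<otimes> y [^] p i j \<otimes> g) | g. starts x g}" for i j a
  have x_pow: "starts x (x [^] k \<otimes> g)" if "starts y g" "k \<noteq> 0" for k :: int and g
    using starts_pow[OF x that(2) starts_carrier[OF that(1)]] starts_disjoint[OF that(1), of x] xy by auto
  have Yel: "starts y (y [^] p i j \<otimes> a \<otimes> y [^] p i j \<otimes> g)" if "i \<in> I" "a \<in> A i" "starts x g" for i j a g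
    using chunk_pos[OF that(1,2) starts_carrier[OF that(3)]] starts_disjoint[OF that(3), of y] xy by auto
  have main: "chain_val G L L' cs \<in> cone i j' a'"
    if "chain I A cs" "cs = (i, lb, j', a') # ps" for cs i lb j' a' ps
    using that
  proof (induction cs arbitrary: i lb j' a' ps)
    case (Cons p0 ps0)
    then have [simp]: "p0 = (i, lb, j', a')" "ps0 = ps" by auto
    define W where "W = chain_val G L L' ps"
    have ch: "chain I A ps" using Cons.prems(1) chain_append[of I A "[p0]" ps] by simp
    have v: "i \<in> I" "a' \<in> A i" "\<And>j a. lb = Some (j, a) \<Longrightarrow> j \<noteq> j' \<and> a \<in> A i"
      using Cons.prems(1) by (auto simp: chain_def valid_step_def)
    have aG: "a \<in> carrier G" if "a \<in> A i" for a using A[OF v(1)] that by auto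
    have cases_W: "W = \<one> \<or> (\<exists>i1 j1 a1 g. i1 \<in> I \<and> a1 \<in> A i1 \<and> (i, lb) \<noteq> (i1, Some (j1, a1)) \<and> starts x g \<and>
        W = x [^] p i1 j1 \<otimes> (y [^] p i1 j1 \<otimes> a1 \<otimes> y [^] p i1 j1 \<otimes> g))"
    proof (cases ps)
      case (Cons q qs)
      obtain i1 l1 j1 a1 where q: "q = (i1, l1, j1, a1)" by (metis prod_cases4)
      have "W \<in> cone i1 j1 a1" unfolding W_def using Cons.IH[OF _ , of i1 l1 j1 a1 qs] ch Cons q by simp
      moreover have "i1 \<in> I" "a1 \<in> A i1" "(i, lb) \<noteq> (i1, Some (j1, a1))"
        using Cons.prems(1) Cons q by (auto simp: chain_def valid_step_def)
      ultimately show ?thesis unfolding cone_def by blast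
    qed (simp add: W_def)
    have WG: "W \<in> carrier G"
    proof -
      have "x [^] k \<otimes> (y [^] k \<otimes> a \<otimes> y [^] k \<otimes> g) \<in> carrier G" if "i1 \<in> I" "a \<in> A i1" "starts x g" for i1 a g and k :: int
        using that A[OF that(1)] starts_carrier[OF that(3)] xG yG by auto
      then show ?thesis using cases_W by auto
    qed
    let ?p' = "p i j'"
    have X: "starts x (x [^] ?p' \<otimes> inv (label_val G L L' i lb) \<otimes> W)"
    proof (cases lb)
      case None
      show ?thesis
      proof (cases "W = \<one>")
        case True
        then show ?thesis using starts_pow[OF x _ one_closed not_starts_one] pb[OF v(1), of j'] None xG
          by (simp add: label_val_def)
      next
        case False
        then obtain i1 j1 a1 g where W: "i1 \<in> I" "a1 \<in> A i1" "starts x g"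
          "W = x [^] p i1 j1 \<otimes> (y [^] p i1 j1 \<otimes> a1 \<otimes> y [^] p i1 j1 \<otimes> g)" using cases_W by blast
        have "starts x (x [^] (?p' + p i1 j1) \<otimes> (y [^] p i1 j1 \<otimes> a1 \<otimes> y [^] p i1 j1 \<otimes> g))"
          using x_pow[OF Yel[OF W(1-3)], of "?p' + p i1 j1" j1] pb[OF v(1), of j'] pb[OF W(1), of j1] by simp
        then show ?thesis using None xG starts_carrier[OF Yel[OF W(1-3), of j1]]
          by (simp add: W(4) label_val_def int_pow_mult m_assoc)
      qed
    next
      case (Some la)
      obtain j a where ja: "lb = Some (j, a)" using Some by (cases la) auto
      have v': "j \<noteq> j'" "a \<in> A i" using v(3)[OF ja] by auto
      let ?p = "p i j"
      have pp: "?p' + - ?p \<noteq> 0" using pinj[OF v(1,1), of j' j] v'(1) by auto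
      have lv: "inv (label_val G L L' i lb) = x [^] (- ?p) \<otimes> (y [^] (- ?p) \<otimes> inv a \<otimes> y [^] (- ?p) \<otimes> x [^] (- ?p))"
        using xG yG aG[OF v'(2)] by (simp add: ja label_val_def L_def L'_def inv_mult_group m_assoc int_pow_neg)
      have fin: ?thesis if "starts y (y [^] (- ?p) \<otimes> inv a \<otimes> y [^] (- ?p) \<otimes> (x [^] (- ?p) \<otimes> W))"
      proof -
        let ?h = "y [^] (- ?p) \<otimes> inv a \<otimes> y [^] (- ?p) \<otimes> (x [^] (- ?p) \<otimes> W)"
        have hG: "?h \<in> carrier G" using xG yG aG[OF v'(2)] WG by simp
        have "x [^] (?p' + - ?p) \<otimes> ?h = x [^] ?p' \<otimes> (x [^] (- ?p) \<otimes> ?h)"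
          using int_pow_mult[OF xG, of ?p' "- ?p"] hG xG by (simp only: m_assoc int_pow_closed)
        also have "\<dots> = x [^] ?p' \<otimes> inv (label_val G L L' i lb) \<otimes> W"
          using xG yG aG[OF v'(2)] WG unfolding lv by (simp add: m_assoc)
        finally show ?thesis using x_pow[OF that pp] by simp
      qed
      show ?thesis
      proof (cases "W = \<one>")
        case True
        have "starts x (x [^] (- ?p) \<otimes> \<one>)"
          using starts_pow[OF x _ one_closed not_starts_one, of "- ?p"] pb[OF v(1), of j] by simp
        then have "\<not> starts y (x [^] (- ?p) \<otimes> \<one>)" using starts_disjoint xy by blast
        then show ?thesis using fin chunk_neg[OF v(1) v'(2), of "x [^] (- ?p) \<otimes> \<one>" j] xG True by simp
      next
        case False
        then obtain i1 j1 a1 g where W: "i1 \<in> I" "a1 \<in> A i1" "starts x g" "(i, lb) \<noteq> (i1, Some (j1, a1))"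
          "W = x [^] p i1 j1 \<otimes> (y [^] p i1 j1 \<otimes> a1 \<otimes> y [^] p i1 j1 \<otimes> g)" using cases_W by blast
        note gG = starts_carrier[OF W(3)]
        let ?Y = "y [^] p i1 j1 \<otimes> a1 \<otimes> y [^] p i1 j1 \<otimes> g"
        note YG = starts_carrier[OF Yel[OF W(1-3), of j1]]
        have xW: "x [^] (- ?p) \<otimes> W = x [^] (- ?p + p i1 j1) \<otimes> ?Y"
          using int_pow_mult[OF xG, of "- ?p" "p i1 j1"] YG xG unfolding W(5)
          by (simp only: m_assoc int_pow_closed)
        show ?thesis
        proof (cases "?p = p i1 j1")
          case False
          then have "starts x (x [^] (- ?p) \<otimes> W)" unfolding xW using x_pow[OF Yel[OF W(1-3)]] by simp
          then have "\<not> starts y (x [^] (- ?p) \<otimes> W)" using starts_disjoint xy by blast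
          then show ?thesis using fin chunk_neg[OF v(1) v'(2)] xG WG by simp
        next
          case True
          then have eq: "i1 = i" "j1 = j" using pinj[OF v(1) W(1)] by auto
          then have "a \<noteq> a1" using W(4) ja by auto
          have "\<not> starts y g" using starts_disjoint[OF W(3), of y] xy by auto
          then have "starts y (y [^] (- ?p) \<otimes> (inv a \<otimes> a1) \<otimes> y [^] ?p \<otimes> g)"
            using chunk_mix[OF v(1) v'(2) _ \<open>a \<noteq> a1\<close> gG] W(2) eq by simp
          moreover have "y [^] (- ?p) \<otimes> inv a \<otimes> y [^] (- ?p) \<otimes> (x [^] (- ?p) \<otimes> W) =
              y [^] (- ?p) \<otimes> (inv a \<otimes> a1) \<otimes> y [^] ?p \<otimes> g"
            unfolding xW using eq yG aG[OF v'(2)] aG[of a1] W(2) gG YG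
            by (simp add: m_assoc int_pow_neg)
          ultimately show ?thesis using fin by simp
        qed
      qed
    qed
    have lc: "label_val G L L' i lb \<in> carrier G"
    proof (cases lb)
      case (Some q)
      then show ?thesis using v(3)[of "fst q" "snd q"] aG Lc by (auto simp: label_val_def case_prod_unfold)
    qed (simp add: label_val_def)
    have "chain_val G L L' (p0 # ps0) =
        x [^] ?p' \<otimes> (y [^] ?p' \<otimes> a' \<otimes> y [^] ?p' \<otimes> (x [^] ?p' \<otimes> inv (label_val G L L' i lb) \<otimes> W))"
      using xG yG aG[OF v(2)] WG lc by (simp add: step_val_def label_val_def[of _ _ _ _ "Some _"] L_def L'_def m_assoc W_def[symmetric])
    then show ?case unfolding cone_def using X Cons.prems(2) by auto
  qed simp
  have "no_cycles G I A L L'"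
    unfolding no_cycles_def
  proof (intro allI impI)
    fix cs assume cs: "cs \<noteq> [] \<and> chain I A cs"
    then obtain i lb j' a' ps where c: "cs = (i, lb, j', a') # ps" by (metis list.exhaust prod_cases4)
    obtain g where g: "starts x g" "chain_val G L L' cs = x [^] p i j' \<otimes> (y [^] p i j' \<otimes> a' \<otimes> y [^] p i j' \<otimes> g)"
      using main[of cs] cs c unfolding cone_def by blast
    have v: "i \<in> I" "a' \<in> A i" using cs c by (auto simp: chain_def valid_step_def)
    have "starts x (chain_val G L L' cs)"
      unfolding g(2) using x_pow[OF Yel[OF v g(1)]] pb[OF v(1), of j'] by simp
    then show "chain_val G L L' cs \<noteq> \<one>" using not_starts_one by metis
  qed
  then show ?thesis using that Lc by blast
qed

end

end

section \<open>Multipliers without cycles in every nonabelian locally free group\<close>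

context group
begin

lemma exists_free_over_small_index:
  fixes J :: "'i set"
  assumes lf: "locally_free G" and ab: "a \<in> carrier G" "b \<in> carrier G" "a \<otimes> b \<noteq> b \<otimes> a"
    and nfg: "\<And>S. finite S \<Longrightarrow> S \<subseteq> carrier G \<Longrightarrow> generate G S \<noteq> carrier G"
    and J: "|J| <o |carrier G|" and c: "c \<in> carrier G"
    and A: "\<And>j. j \<in> J \<Longrightarrow> finite (A j) \<and> A j \<subseteq> carrier G" and B: "finite B" "B \<subseteq> carrier G"
  obtains y where "free_over (generate G (B \<union> (\<Union>j\<in>J. A j))) y"
proof (cases "finite J")
  case True
  have "finite (B \<union> (\<Union>j\<in>J. A j))" "B \<union> (\<Union>j\<in>J. A j) \<subseteq> carrier G" using True A B by auto
  from exists_free_over_finitely_generated[OF lf ab nfg this] that show ?thesis by blast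
next
  case False
  obtain \<rho> :: "'a \<Rightarrow> 'a hrat mat2" where \<rho>: "\<rho> \<in> hom G SL2" "inj_on \<rho> (carrier G)"
    by (rule locally_free_embeds_SL2[OF lf])
  have "|\<Union>j\<in>J. A j| \<le>o |J|"
    by (rule card_of_UNION_ordLeq_infinite[OF False card_of_mono1[OF subset_refl]])
       (use A countable_finite in \<open>blast intro: card_of_countable[OF _ False]\<close>)
  then have "|B \<union> (\<Union>j\<in>J. A j)| \<le>o |J|"
    by (rule card_of_Un_ordLeq[OF False card_of_countable[OF countable_finite[OF B(1)] False]])
  moreover have "B \<union> (\<Union>j\<in>J. A j) \<subseteq> carrier G" using A B by blast
  ultimately show ?thesis using exists_free_over_small[OF lf \<rho> False J] that by blast
qed

lemma locally_free_no_cycles: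
  fixes I :: "'i set"
  assumes lf: "locally_free G" and ab: "a \<in> carrier G" "b \<in> carrier G" "a \<otimes> b \<noteq> b \<otimes> a"
    and I: "|I| \<le>o |carrier G|" and A: "\<And>i. i \<in> I \<Longrightarrow> finite (A i) \<and> A i \<subseteq> carrier G"
  obtains L L' where "\<And>i j. L i j \<in> carrier G" "\<And>i j. L' i j \<in> carrier G" "no_cycles G I A L L'"
proof (cases "\<exists>S. finite S \<and> S \<subseteq> carrier G \<and> generate G S = carrier G")
  case True
  then obtain S where S: "finite S" "S \<subseteq> carrier G" "generate G S = carrier G" by blast
  obtain B where B: "finite B" "free_basis G B" "generate G B = generate G S"
    by (rule locally_free_basis[OF lf S(1,2)])
  have BG: "B \<subseteq> carrier G" using B(2) by (simp add: free_basis_def)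
  have gen: "generate G B = carrier G" using B(3) S(3) by simp
  obtain x y where xy: "x \<in> B" "y \<in> B" "x \<noteq> y"
    using noncommuting_basis[OF BG, of a b] ab gen by blast
  have "countable (carrier G)"
  proof -
    have "carrier G \<subseteq> word_eval G ` lists (UNIV \<times> B)"
    proof
      fix g assume "g \<in> carrier G"
      then obtain w where "letters w \<subseteq> B" "word_eval G w = g"
        using generate_eq_words[OF BG] gen by (auto simp: image_iff)
      then show "g \<in> word_eval G ` lists (UNIV \<times> B)"
        by (intro image_eqI[of _ _ w]) (auto simp: letters_def)
    qed
    moreover have "countable (lists ((UNIV :: bool set) \<times> B))" using B(1) by (intro countable_lists countable_finite) simp
    ultimately show ?thesis by (blast intro: countable_subset countable_image)
  qed
  then have "countable I"
    using I countable_image_inj_on countable_subset unfolding card_of_ordLeq[symmetric] by metis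
  show ?thesis by (rule finite_rank_no_cycles[OF B(2) gen xy \<open>countable I\<close>, of A]) (fact A that)+
next
  case False
  then have nfg: "\<And>S. finite S \<Longrightarrow> S \<subseteq> carrier G \<Longrightarrow> generate G S \<noteq> carrier G" by blast
  \<comment> \<open>The initial segments of a cardinal order are strictly smaller than
    \<open>I\<close>, hence smaller than \<open>G\<close>; an arbitrary well-order would not give
    this.\<close>
  define r where "r = |I|"
  have wo: "well_order_on I r" and co: "Card_order r" and Fr: "Field r = I"
    using card_of_well_order_on[of I] card_of_Card_order[of I] Field_card_of[of I] by (simp_all add: r_def)
  have wf: "wf (r - Id)" and tr: "trans r" and tot: "total_on I r"
    using wo by (auto simp: well_order_on_def linear_order_on_def partial_order_on_def preorder_on_def)
  obtain c where c: "c \<in> carrier G" "c \<noteq> \<one>" using ab by (metis l_one r_one)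
  \<comment> \<open>What \<open>y i\<close> must be free over: its own support, the constant
    \<open>c\<close> of the multipliers, and the elements and supports of all earlier
    stages.\<close>
  define D where "D f i = insert c (A i) \<union> (\<Union>j\<in>underS r i. insert (f j) (A j))" for f i
  have uI: "underS r i \<subseteq> I" for i using Fr by (auto simp: underS_def Field_def)
  have "\<exists>y. \<forall>i. i \<in> I \<longrightarrow> free_over (generate G (D y i)) (y i)"
  proof (rule dependent_wf_choice[OF wf])
    fix f g :: "'i \<Rightarrow> 'a" and i y assume "\<And>z. (z, i) \<in> r - Id \<Longrightarrow> f z = g z"
    then have "D f i = D g i" by (auto simp: D_def underS_def)
    then show "(i \<in> I \<longrightarrow> free_over (generate G (D f i)) y) = (i \<in> I \<longrightarrow> free_over (generate G (D g i)) y)" by simp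
  next
    fix i f assume f: "\<And>j. (j, i) \<in> r - Id \<Longrightarrow> j \<in> I \<longrightarrow> free_over (generate G (D f j)) (f j)"
    show "\<exists>y. i \<in> I \<longrightarrow> free_over (generate G (D f i)) y"
    proof (cases "i \<in> I")
      case True
      have "|underS r i| <o r" using card_of_underS[OF co] True Fr by simp
      then have J: "|underS r i| <o |carrier G|" using I unfolding r_def by (rule ordLess_ordLeq_trans)
      have B: "finite (insert c (A i))" "insert c (A i) \<subseteq> carrier G" using A[OF True] c by auto
      have "finite (insert (f j) (A j)) \<and> insert (f j) (A j) \<subseteq> carrier G" if "j \<in> underS r i" for j
      proof -
        have "(j, i) \<in> r - Id" "j \<in> I" using that uI by (auto simp: underS_def)
        then show ?thesis using f[of j] A[of j] by (auto simp: free_over_def)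
      qed
      note fin = this
      show ?thesis
        by (rule exists_free_over_small_index[OF lf ab _ J c(1) _ B, of "\<lambda>j. insert (f j) (A j)"])
           (use nfg fin in \<open>auto simp: D_def\<close>)
    qed simp
  qed
  then obtain y where y: "\<And>i. i \<in> I \<Longrightarrow> free_over (generate G (D y i)) (y i)" by blast
  \<comment> \<open>The value \<open>\<one>\<close> off \<open>I\<close> keeps the multipliers
    inside the group for every index, as the conclusion demands.\<close>
  define z where "z i = (if i \<in> I then y i else \<one>)" for i
  have zG: "z i \<in> carrier G" for i using y[of i] by (auto simp: z_def free_over_def)
  have DG: "D y i \<subseteq> carrier G" if "i \<in> I" for i
  proof -
    have "insert (y j) (A j) \<subseteq> carrier G" if "j \<in> I" for j
      using A[OF that] y[OF that] by (simp add: free_over_def)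
    then show ?thesis unfolding D_def using A[OF that] c(1) subsetD[OF uI] by (intro Un_least UN_least) auto
  qed
  have inc: "D y i \<subseteq> generate G (D y i)" for i using generate.incl by fast
  have "no_cycles G I A (\<lambda>i. padded c (z i)) (\<lambda>i. padded c (z i))"
  proof (rule tower_no_cycles[OF tr tot, where H = "\<lambda>i. generate G (D y i)"])
    fix i assume i: "i \<in> I"
    show "subgroup (generate G (D y i)) G" using DG[OF i] by (rule generate_is_subgroup)
    show "A i \<subseteq> generate G (D y i)" by (rule subset_trans[OF _ inc]) (auto simp: D_def)
    show "c \<in> generate G (D y i)" by (rule subsetD[OF inc]) (auto simp: D_def)
    show "free_over (generate G (D y i)) (z i)" using y i by (simp add: z_def)
    fix j assume j: "j \<in> I" "(j, i) \<in> r" "j \<noteq> i"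
    then have "j \<in> underS r i" by (simp add: underS_def)
    then have "insert (z j) (A j) \<subseteq> D y i" using j(1) by (auto simp: D_def z_def)
    from subset_trans[OF this inc] show "z j \<in> generate G (D y i) \<and> A j \<subseteq> generate G (D y i)" by simp
  qed (rule c(2))
  moreover have "padded c (z i) j \<in> carrier G" for i j using zG c by (simp add: padded_def)
  ultimately show ?thesis by (intro that)
qed

end

section \<open>Primitive rings and group rings\<close>

definition right_ideal :: "('a, 'c) ring_scheme \<Rightarrow> 'a set \<Rightarrow> bool" where
  "right_ideal S J \<longleftrightarrow> J \<subseteq> carrier S \<and> \<zero>\<^bsub>S\<^esub> \<in> J \<and> (\<forall>a\<in>J. \<forall>b\<in>J. a \<oplus>\<^bsub>S\<^esub> b \<in> J) \<and>
     (\<forall>a\<in>J. \<forall>s\<in>carrier S. a \<otimes>\<^bsub>S\<^esub> s \<in> J)"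

context ring
begin

lemma right_idealD:
  assumes "right_ideal R J"
  shows "J \<subseteq> carrier R" "\<zero> \<in> J" "a \<in> J \<Longrightarrow> b \<in> J \<Longrightarrow> a \<oplus> b \<in> J"
    "a \<in> J \<Longrightarrow> s \<in> carrier R \<Longrightarrow> a \<otimes> s \<in> J" "a \<in> J \<Longrightarrow> \<ominus> a \<in> J" "a \<in> J \<Longrightarrow> b \<in> J \<Longrightarrow> a \<ominus> b \<in> J"
proof -
  show "J \<subseteq> carrier R" "\<zero> \<in> J" "a \<in> J \<Longrightarrow> b \<in> J \<Longrightarrow> a \<oplus> b \<in> J"
    "a \<in> J \<Longrightarrow> s \<in> carrier R \<Longrightarrow> a \<otimes> s \<in> J"
    using assms by (auto simp: right_ideal_def)
  have *: "\<ominus> x \<in> J" if "x \<in> J" for x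
  proof -
    have "x \<in> carrier R" using that assms by (auto simp: right_ideal_def)
    then have "\<ominus> x = x \<otimes> (\<ominus> \<one>)" by (simp add: r_minus)
    then show ?thesis using that assms by (simp add: right_ideal_def)
  qed
  then show "a \<in> J \<Longrightarrow> \<ominus> a \<in> J" .
  show "a \<in> J \<Longrightarrow> b \<in> J \<Longrightarrow> a \<ominus> b \<in> J" using * assms by (simp add: right_ideal_def minus_eq)
qed

lemma maximal_right_ideal_exists:
  assumes J: "right_ideal R J" "\<one> \<notin> J"
  obtains M where "right_ideal R M" "J \<subseteq> M" "\<one> \<notin> M"
    "\<And>N. right_ideal R N \<Longrightarrow> M \<subseteq> N \<Longrightarrow> \<one> \<notin> N \<Longrightarrow> N = M"
proof -
  define A where "A = {K. right_ideal R K \<and> J \<subseteq> K \<and> \<one> \<notin> K}"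
  have "\<Union>C \<in> A" if C: "C \<noteq> {}" "subset.chain A C" for C
  proof -
    have CA: "right_ideal R K" "J \<subseteq> K" "\<one> \<notin> K" if "K \<in> C" for K
      using C(2) that by (auto simp: subset_chain_def A_def)
    have "a \<oplus> b \<in> \<Union>C" if "a \<in> K" "K \<in> C" "b \<in> L" "L \<in> C" for a b K L
    proof -
      have "K \<subseteq> L \<or> L \<subseteq> K" using C(2) that by (auto simp: subset_chain_def)
      then show ?thesis
      proof
        assume "K \<subseteq> L"
        then show ?thesis using that right_idealD(3)[OF CA(1)[OF that(4)]] by blast
      next
        assume "L \<subseteq> K"
        then show ?thesis using that right_idealD(3)[OF CA(1)[OF that(2)]] by blast
      qed
    qed
    moreover have "a \<otimes> s \<in> \<Union>C" if "a \<in> K" "K \<in> C" "s \<in> carrier R" for a s K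
      using right_idealD(4)[OF CA(1)[OF that(2)]] that by blast
    moreover have "\<Union>C \<subseteq> carrier R" using right_idealD(1)[OF CA(1)] by blast
    moreover have "\<zero> \<in> \<Union>C" "J \<subseteq> \<Union>C" using C(1) right_idealD(2)[OF CA(1)] CA(2) by blast+
    moreover have "\<one> \<notin> \<Union>C" using CA(3) by blast
    ultimately show ?thesis by (auto simp: A_def right_ideal_def)
  qed
  moreover have "A \<noteq> {}" using J by (auto simp: A_def)
  ultimately obtain M where M: "M \<in> A" "\<forall>N\<in>A. M \<subseteq> N \<longrightarrow> N = M"
    using subset_Zorn_nonempty[of A] by blast
  have M1: "right_ideal R M" "J \<subseteq> M" "\<one> \<notin> M" using M(1) by (simp_all add: A_def)
  have "N = M" if "right_ideal R N" "M \<subseteq> N" "\<one> \<notin> N" for N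
  proof -
    have "N \<in> A" using that M1(2) by (simp add: A_def)
    then show ?thesis using M(2) that(2) by blast
  qed
  then show ?thesis using M1 that by metis
qed

text \<open>The module is the quotient by a maximal right ideal, carried by a set of coset representatives.
  Its annihilator is a two-sided ideal inside the maximal right ideal.\<close>

lemma right_primitiveI:
  assumes J: "right_ideal R J" "\<one> \<notin> J"
    and meets: "\<And>I. ideal I R \<Longrightarrow> I \<noteq> {\<zero>} \<Longrightarrow> \<exists>i\<in>I. \<one> \<oplus> i \<in> J"
  shows "right_primitive R"
proof -
  obtain M where M: "right_ideal R M" "J \<subseteq> M" "\<one> \<notin> M"
    "\<And>N. right_ideal R N \<Longrightarrow> M \<subseteq> N \<Longrightarrow> \<one> \<notin> N \<Longrightarrow> N = M"
    by (rule maximal_right_ideal_exists[OF J]) blast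
  note MD = right_idealD[OF M(1)]
  \<comment> \<open>The predicate under \<open>SOME\<close> depends on the coset alone, so
    \<open>rep\<close> is constant on cosets. The quotient thus lives in the element type of the
    ring, as \<open>right_primitive\<close> requires.\<close>
  define rep where "rep x = (SOME y. y \<in> carrier R \<and> x \<ominus> y \<in> M)" for x
  have rep: "rep x \<in> carrier R \<and> x \<ominus> rep x \<in> M" if "x \<in> carrier R" for x
    unfolding rep_def by (rule someI[of _ x]) (use that MD(2) in \<open>simp add: minus_eq r_neg\<close>)
  then have rep_closed [simp]: "rep x \<in> carrier R" if "x \<in> carrier R" for x using that by blast
  have rep_eqI: "rep x = rep y" if xy: "x \<in> carrier R" "y \<in> carrier R" "x \<ominus> y \<in> M" for x y
  proof -
    have "x \<ominus> z \<in> M \<longleftrightarrow> y \<ominus> z \<in> M" if z: "z \<in> carrier R" for z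
    proof
      assume "x \<ominus> z \<in> M"
      then have "(x \<ominus> z) \<ominus> (x \<ominus> y) \<in> M" using MD(6) xy by blast
      moreover have "(x \<ominus> z) \<ominus> (x \<ominus> y) = y \<ominus> z" using xy z by algebra
      ultimately show "y \<ominus> z \<in> M" by simp
    next
      assume "y \<ominus> z \<in> M"
      then have "(y \<ominus> z) \<oplus> (x \<ominus> y) \<in> M" using MD(3) xy by blast
      moreover have "(y \<ominus> z) \<oplus> (x \<ominus> y) = x \<ominus> z" using xy z by algebra
      ultimately show "x \<ominus> z \<in> M" by simp
    qed
    then show ?thesis unfolding rep_def by (intro arg_cong[where f = Eps] ext) auto
  qed
  have rep_eqD: "x \<ominus> y \<in> M" if xy: "x \<in> carrier R" "y \<in> carrier R" "rep x = rep y" for x y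
  proof -
    have "(x \<ominus> rep x) \<ominus> (y \<ominus> rep y) \<in> M" using rep xy MD(6) by blast
    moreover have "(x \<ominus> rep y) \<ominus> (y \<ominus> rep y) = x \<ominus> y" using xy(1,2) rep_closed[of y] by algebra
    ultimately show ?thesis using xy(3) by simp
  qed
  have rep_zero: "rep x = rep \<zero> \<longleftrightarrow> x \<in> M" if x: "x \<in> carrier R" for x
    using rep_eqI[OF x zero_closed] rep_eqD[OF x zero_closed] x by (auto simp: minus_eq)
  have rep_add1: "rep (rep x \<oplus> y) = rep (x \<oplus> y)" if xy: "x \<in> carrier R" "y \<in> carrier R" for x y
  proof (rule sym, rule rep_eqI)
    have "(x \<oplus> y) \<ominus> (rep x \<oplus> y) = x \<ominus> rep x" using xy rep_closed[of x] by algebra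
    then show "(x \<oplus> y) \<ominus> (rep x \<oplus> y) \<in> M" using rep xy by simp
  qed (use xy in auto)
  have rep_add2: "rep (y \<oplus> rep x) = rep (y \<oplus> x)" if xy: "x \<in> carrier R" "y \<in> carrier R" for x y
    using rep_add1[OF xy] xy by (simp add: a_comm)
  have rep_mult: "rep (rep x \<otimes> s) = rep (x \<otimes> s)" if xs: "x \<in> carrier R" "s \<in> carrier R" for x s
  proof (rule sym, rule rep_eqI)
    have "(x \<otimes> s) \<ominus> (rep x \<otimes> s) = (x \<ominus> rep x) \<otimes> s" using xs rep_closed[of x] by algebra
    then show "(x \<otimes> s) \<ominus> (rep x \<otimes> s) \<in> M" using rep[OF xs(1)] xs MD(4) by simp
  qed (use xs in auto)
  define Q where "Q = rep ` carrier R"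
  define ad where "ad a b = rep (a \<oplus> b)" for a b
  define act where "act a s = rep (a \<otimes> s)" for a s
  have ad_rep: "ad (rep x) (rep y) = rep (x \<oplus> y)" if "x \<in> carrier R" "y \<in> carrier R" for x y
    using that by (simp add: ad_def rep_add1 rep_add2)
  have act_rep: "act (rep x) s = rep (x \<otimes> s)" if "x \<in> carrier R" "s \<in> carrier R" for x s
    using that by (simp add: act_def rep_mult)
  let ?Q = "\<lparr>carrier = Q, monoid.mult = ad, one = rep \<zero>\<rparr>"
  have Q: "comm_group ?Q"
  proof (rule comm_groupI; simp)
    show "ad x y \<in> Q" if "x \<in> Q" "y \<in> Q" for x y using that by (auto simp: Q_def ad_rep)
    show "rep \<zero> \<in> Q" by (simp add: Q_def)
    show "ad (ad x y) z = ad x (ad y z)" if "x \<in> Q" "y \<in> Q" "z \<in> Q" for x y z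
      using that by (auto simp: Q_def ad_rep a_assoc)
    show "ad x y = ad y x" if "x \<in> Q" "y \<in> Q" for x y using that by (auto simp: Q_def ad_rep a_comm)
    show "ad (rep \<zero>) x = x" if "x \<in> Q" for x using that by (auto simp: Q_def ad_rep)
    show "\<exists>y\<in>Q. ad y x = rep \<zero>" if x: "x \<in> Q" for x
    proof -
      obtain z where z: "z \<in> carrier R" "x = rep z" using x by (auto simp: Q_def)
      then have "ad (rep (\<ominus> z)) x = rep \<zero>" by (simp add: ad_rep l_neg)
      then show ?thesis using z by (auto simp: Q_def)
    qed
  qed
  have mod: "right_module R Q ad (rep \<zero>) act"
    unfolding right_module_def
    using Q by (auto simp: ring_axioms Q_def ad_rep act_rep l_distr r_distr m_assoc)
  have simple: "N = {rep \<zero>} \<or> N = Q" if "submodule R N Q ad (rep \<zero>) act" for N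
  proof -
    have N: "subgroup N ?Q" and Nact: "\<And>n s. n \<in> N \<Longrightarrow> s \<in> carrier R \<Longrightarrow> act n s \<in> N"
      using that by (auto simp: submodule_def)
    have NQ: "N \<subseteq> Q" using subgroup.subset[OF N] by simp
    have N0: "rep \<zero> \<in> N" using subgroup.one_closed[OF N] by simp
    have Nad: "ad x y \<in> N" if "x \<in> N" "y \<in> N" for x y using subgroup.m_closed[OF N that] by simp
    \<comment> \<open>The preimage of the submodule, a right ideal above \<open>M\<close>;
      maximality leaves \<open>M\<close> or the whole ring.\<close>
    define P where "P = {x \<in> carrier R. rep x \<in> N}"
    have P: "right_ideal R P"
      unfolding right_ideal_def
    proof (intro conjI ballI)
      show "P \<subseteq> carrier R" "\<zero> \<in> P" using N0 by (auto simp: P_def)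
      fix a assume a: "a \<in> P"
      show "a \<oplus> b \<in> P" if "b \<in> P" for b
        using a that Nad[of "rep a" "rep b"] by (simp add: P_def ad_rep)
      show "a \<otimes> s \<in> P" if "s \<in> carrier R" for s
        using a that Nact[of "rep a" s] by (simp add: P_def act_rep)
    qed
    have MP: "M \<subseteq> P"
    proof
      fix x assume x: "x \<in> M"
      then have xR: "x \<in> carrier R" using MD(1) by blast
      then have "rep x = rep \<zero>" using x rep_zero by blast
      then show "x \<in> P" using xR N0 by (simp add: P_def)
    qed
    show ?thesis
    proof (cases "\<one> \<in> P")
      case True
      have "Q \<subseteq> N"
      proof
        fix q assume "q \<in> Q"
        then obtain x where x: "x \<in> carrier R" "q = rep x" by (auto simp: Q_def)
        have "\<one> \<otimes> x \<in> P" by (rule right_idealD(4)[OF P True x(1)])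
        then show "q \<in> N" using x by (simp add: P_def)
      qed
      then show ?thesis using NQ by blast
    next
      case False
      then have PM: "P = M" using M(4)[OF P MP] by simp
      have "N \<subseteq> {rep \<zero>}"
      proof
        fix q assume q: "q \<in> N"
        then obtain x where x: "x \<in> carrier R" "q = rep x" using NQ by (auto simp: Q_def)
        then have "x \<in> M" using q PM by (auto simp: P_def)
        then show "q \<in> {rep \<zero>}" using rep_zero[OF x(1)] x(2) by simp
      qed
      then show ?thesis using N0 by blast
    qed
  qed
  have "rep \<one> \<noteq> rep \<zero>" using rep_zero[OF one_closed] M(3) by simp
  then have "Q \<noteq> {rep \<zero>}" by (auto simp: Q_def)
  then have simp_mod: "simple_right_module R Q ad (rep \<zero>) act"
    using mod simple by (simp add: simple_right_module_def)
  have "s = \<zero>" if s: "s \<in> carrier R" "\<forall>m\<in>Q. act m s = rep \<zero>" for s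
  proof (rule ccontr)
    assume "s \<noteq> \<zero>"
    define I where "I = {s \<in> carrier R. \<forall>x\<in>carrier R. x \<otimes> s \<in> M}"
    have sx: "x \<otimes> s \<in> M" if x: "x \<in> carrier R" for x
    proof -
      have "rep (x \<otimes> s) = rep \<zero>" using s x act_rep[OF x s(1)] by (simp add: Q_def)
      then show ?thesis using rep_zero[of "x \<otimes> s"] x s(1) by simp
    qed
    have "ideal I R"
    proof (rule idealI[OF ring_axioms])
      show "subgroup I (add_monoid R)"
        by (rule add.subgroupI)
          (use MD(2,3,5) in \<open>auto simp: I_def r_distr r_minus\<close>)
      fix a x assume ax: "a \<in> I" "x \<in> carrier R"
      then have aR: "a \<in> carrier R" by (simp add: I_def)
      have "y \<otimes> (x \<otimes> a) \<in> M" if "y \<in> carrier R" for y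
      proof -
        have "y \<otimes> x \<otimes> a \<in> M" using ax that by (simp add: I_def)
        then show ?thesis using m_assoc[OF that ax(2) aR] by simp
      qed
      then show "x \<otimes> a \<in> I" using ax aR by (simp add: I_def)
      have "y \<otimes> (a \<otimes> x) \<in> M" if "y \<in> carrier R" for y
      proof -
        have "y \<otimes> a \<otimes> x \<in> M" by (rule MD(4)) (use ax that in \<open>auto simp: I_def\<close>)
        then show ?thesis using m_assoc[OF that aR ax(2)] by simp
      qed
      then show "a \<otimes> x \<in> I" using ax aR by (simp add: I_def)
    qed
    moreover have "s \<in> I" using s(1) sx by (simp add: I_def)
    then have "I \<noteq> {\<zero>}" using \<open>s \<noteq> \<zero>\<close> by blast
    ultimately obtain i where i: "i \<in> I" "\<one> \<oplus> i \<in> M" using meets M(2) by blast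
    then have iR: "i \<in> carrier R" by (simp add: I_def)
    have "\<one> \<otimes> i \<in> M" using i(1) one_closed unfolding I_def by blast
    then have "(\<one> \<oplus> i) \<ominus> i \<in> M" using MD(6) i(2) iR by simp
    moreover have "(\<one> \<oplus> i) \<ominus> i = \<one>" using iR by algebra
    ultimately show False using M(3) by simp
  qed
  then have "faithful_right_module R Q (rep \<zero>) act" by (simp add: faithful_right_module_def)
  then show ?thesis unfolding right_primitive_def using simp_mod by blast
qed

text \<open>Sums of right multiples built one summand at a time, so that membership unfolds into an
  explicit finite sum by induction.\<close>

inductive_set right_ideal_gen :: "'a set \<Rightarrow> 'a set" for E where
  zero: "\<zero> \<in> right_ideal_gen E"
| step: "e \<in> E \<Longrightarrow> s \<in> carrier R \<Longrightarrow> x \<in> right_ideal_gen E \<Longrightarrow> e \<otimes> s \<oplus> x \<in> right_ideal_gen E"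

lemma right_ideal_gen:
  assumes E: "E \<subseteq> carrier R"
  shows "right_ideal R (right_ideal_gen E)" "E \<subseteq> right_ideal_gen E"
proof -
  have cl: "x \<in> carrier R" if "x \<in> right_ideal_gen E" for x
    using that by induction (use E in auto)
  have add: "x \<oplus> y \<in> right_ideal_gen E" if "x \<in> right_ideal_gen E" "y \<in> right_ideal_gen E" for x y
    using that
  proof induction
    case (step e s x)
    have "(e \<otimes> s \<oplus> x) \<oplus> y = e \<otimes> s \<oplus> (x \<oplus> y)"
      using step.hyps(1,2) cl[OF step.hyps(3)] cl[OF step.prems] E by (intro a_assoc) auto
    then show ?case using right_ideal_gen.step[OF step.hyps(1,2) step.IH[OF step.prems]] by simp
  qed (use cl in simp)
  have mult: "x \<otimes> u \<in> right_ideal_gen E" if "x \<in> right_ideal_gen E" "u \<in> carrier R" for x u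
    using that
  proof induction
    case (step e s x)
    have "(e \<otimes> s \<oplus> x) \<otimes> u = e \<otimes> (s \<otimes> u) \<oplus> x \<otimes> u"
      using step.hyps(1,2) cl[OF step.hyps(3)] step.prems E by (auto simp: l_distr m_assoc)
    then show ?case using right_ideal_gen.step[OF step.hyps(1) _ step.IH[OF step.prems]] step by simp
  qed (simp add: right_ideal_gen.zero)
  show "right_ideal R (right_ideal_gen E)"
    unfolding right_ideal_def using cl add mult right_ideal_gen.zero by blast
  show "E \<subseteq> right_ideal_gen E"
  proof
    fix e assume e: "e \<in> E"
    have "e \<otimes> \<one> \<oplus> \<zero> \<in> right_ideal_gen E"
      by (rule right_ideal_gen.step[OF e one_closed right_ideal_gen.zero])
    then show "e \<in> right_ideal_gen E" using e E by auto
  qed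
qed

end

section \<open>Arithmetic of the group ring\<close>

lemma gr_mult_sum:
  fixes f h :: "'g \<Rightarrow> 'r::ring_1"
  assumes "finite T" "{g. f g \<noteq> 0} \<subseteq> T" "x \<in> carrier G"
  shows "gr_mult G f h x = (\<Sum>y\<in>T. f y * h (inv\<^bsub>G\<^esub> y \<otimes>\<^bsub>G\<^esub> x))"
proof -
  have "(\<Sum>y\<in>{y. f y \<noteq> 0}. f y * h (inv\<^bsub>G\<^esub> y \<otimes>\<^bsub>G\<^esub> x)) = (\<Sum>y\<in>T. f y * h (inv\<^bsub>G\<^esub> y \<otimes>\<^bsub>G\<^esub> x))"
    using assms(1,2) by (intro sum.mono_neutral_left) auto
  then show ?thesis using assms(3) by (simp add: gr_mult_def)
qed

definition single :: "'g \<Rightarrow> 'g \<Rightarrow> 'r::ring_1" where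
  "single g x = (if x = g then 1 else 0)"

lemma group_ring_sel [simp]: "carrier (group_ring G) = gr_carrier G" "monoid.mult (group_ring G) = gr_mult G"
  "one (group_ring G) = gr_one G" "zero (group_ring G) = (\<lambda>x. 0)" "add (group_ring G) = (\<lambda>f h x. f x + h x)"
  by (simp_all add: group_ring_def)

context group
begin

lemma gr_carrierD: "f \<in> gr_carrier G \<Longrightarrow> finite {g. f g \<noteq> 0}" "f \<in> gr_carrier G \<Longrightarrow> {g. f g \<noteq> 0} \<subseteq> carrier G"
  "f \<in> gr_carrier G \<Longrightarrow> x \<notin> carrier G \<Longrightarrow> f x = 0"
  by (auto simp: gr_carrier_def)

lemma gr_mult_support:
  fixes f h :: "'a \<Rightarrow> 'r::ring_1"
  assumes "f \<in> gr_carrier G" "h \<in> gr_carrier G"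
  shows "{x. gr_mult G f h x \<noteq> 0} \<subseteq> (\<lambda>(y, z). y \<otimes> z) ` ({y. f y \<noteq> 0} \<times> {z. h z \<noteq> 0})"
proof
  fix x assume "x \<in> {x. gr_mult G f h x \<noteq> 0}"
  then have x: "gr_mult G f h x \<noteq> 0" by simp
  then have xG: "x \<in> carrier G" by (auto simp: gr_mult_def split: if_splits)
  from x xG have "(\<Sum>y\<in>{y. f y \<noteq> 0}. f y * h (inv y \<otimes> x)) \<noteq> 0" by (simp add: gr_mult_def)
  then obtain y where y: "f y \<noteq> 0" "f y * h (inv y \<otimes> x) \<noteq> 0" by (auto elim: sum.not_neutral_contains_not_neutral)
  then have "y \<in> carrier G" using gr_carrierD(2)[OF assms(1)] by auto
  then have "x = y \<otimes> (inv y \<otimes> x)" using xG by (simp add: m_assoc[symmetric])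
  then show "x \<in> (\<lambda>(y, z). y \<otimes> z) ` ({y. f y \<noteq> 0} \<times> {z. h z \<noteq> 0})"
    using y by (intro image_eqI[of _ _ "(y, inv y \<otimes> x)"]) auto
qed

lemma gr_mult_closed:
  fixes f h :: "'a \<Rightarrow> 'r::ring_1"
  assumes "f \<in> gr_carrier G" "h \<in> gr_carrier G"
  shows "gr_mult G f h \<in> gr_carrier G"
proof -
  have "finite {x. gr_mult G f h x \<noteq> 0}"
    by (rule finite_subset[OF gr_mult_support[OF assms]])
       (intro finite_imageI finite_cartesian_product gr_carrierD(1) assms)
  then show ?thesis by (auto simp: gr_carrier_def gr_mult_def)
qed

text \<open>Both sides equal the double sum over \<open>z\<close>, \<open>w\<close> in the supports
  of \<open>f\<close> and \<open>h\<close>. The inner sum is reindexed by \<open>y = z w\<close>,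
  and enlarging it to the product set \<open>T\<close> adds only zeros.\<close>

lemma gr_mult_assoc:
  fixes f h k :: "'a \<Rightarrow> 'r::ring_1"
  assumes f: "f \<in> gr_carrier G" and h: "h \<in> gr_carrier G" and k: "k \<in> gr_carrier G"
  shows "gr_mult G (gr_mult G f h) k = gr_mult G f (gr_mult G h k)"
proof
  fix x
  let ?F = "{y. f y \<noteq> 0}" and ?H = "{y. h y \<noteq> 0}"
  note fin = gr_carrierD(1)[OF f] gr_carrierD(1)[OF h]
  have cF: "z \<in> carrier G" if "z \<in> ?F" for z using gr_carrierD(2)[OF f] that by blast
  have cH: "z \<in> carrier G" if "z \<in> ?H" for z using gr_carrierD(2)[OF h] that by blast
  show "gr_mult G (gr_mult G f h) k x = gr_mult G f (gr_mult G h k) x"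
  proof (cases "x \<in> carrier G")
    case x: True
    define T where "T = (\<lambda>(y, z). y \<otimes> z) ` (?F \<times> ?H)"
    have T: "finite T" unfolding T_def using fin by simp
    have TG: "y \<in> carrier G" if "y \<in> T" for y using that cF cH by (auto simp: T_def)
    have "gr_mult G (gr_mult G f h) k x = (\<Sum>y\<in>T. gr_mult G f h y * k (inv y \<otimes> x))"
      by (rule gr_mult_sum[OF T _ x]) (use gr_mult_support[OF f h] in \<open>simp add: T_def\<close>)
    also have "\<dots> = (\<Sum>y\<in>T. \<Sum>z\<in>?F. f z * h (inv z \<otimes> y) * k (inv y \<otimes> x))"
      using TG by (intro sum.cong refl) (simp add: gr_mult_def sum_distrib_right)
    also have "\<dots> = (\<Sum>z\<in>?F. \<Sum>y\<in>T. f z * h (inv z \<otimes> y) * k (inv y \<otimes> x))" by (rule sum.swap)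
    also have "\<dots> = (\<Sum>z\<in>?F. \<Sum>w\<in>?H. f z * h w * k (inv w \<otimes> (inv z \<otimes> x)))"
    proof (rule sum.cong[OF refl])
      fix z assume z: "z \<in> ?F"
      have "(\<Sum>w\<in>?H. f z * h w * k (inv w \<otimes> (inv z \<otimes> x))) =
          (\<Sum>y\<in>(\<lambda>w. z \<otimes> w) ` ?H. f z * h (inv z \<otimes> y) * k (inv y \<otimes> x))"
      proof (subst sum.reindex)
        show "inj_on (\<lambda>w. z \<otimes> w) ?H" 
          by (rule inj_onI) (use cF[OF z] cH in simp)
        show "(\<Sum>w\<in>?H. f z * h w * k (inv w \<otimes> (inv z \<otimes> x))) =
            sum ((\<lambda>y. f z * h (inv z \<otimes> y) * k (inv y \<otimes> x)) \<circ> (\<otimes>) z) ?H"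
        proof (rule sum.cong[OF refl])
          fix w assume w: "w \<in> ?H"
          have "inv z \<otimes> (z \<otimes> w) = w" "inv (z \<otimes> w) \<otimes> x = inv w \<otimes> (inv z \<otimes> x)"
            using cF[OF z] cH[OF w] x by (simp_all add: inv_mult_group m_assoc)
          then show "f z * h w * k (inv w \<otimes> (inv z \<otimes> x)) =
              ((\<lambda>y. f z * h (inv z \<otimes> y) * k (inv y \<otimes> x)) \<circ> (\<otimes>) z) w" by simp
        qed
      qed
      also have "\<dots> = (\<Sum>y\<in>T. f z * h (inv z \<otimes> y) * k (inv y \<otimes> x))"
      proof (rule sum.mono_neutral_left[OF T])
        show "(\<lambda>w. z \<otimes> w) ` ?H \<subseteq> T" using z by (auto simp: T_def)
        show "\<forall>y\<in>T - (\<lambda>w. z \<otimes> w) ` ?H. f z * h (inv z \<otimes> y) * k (inv y \<otimes> x) = 0"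
        proof
          fix y assume y: "y \<in> T - (\<lambda>w. z \<otimes> w) ` ?H"
          have "y = z \<otimes> (inv z \<otimes> y)" using cF[OF z] TG y by (simp add: m_assoc[symmetric])
          then have "inv z \<otimes> y \<notin> ?H" using y by blast
          then show "f z * h (inv z \<otimes> y) * k (inv y \<otimes> x) = 0" by simp
        qed
      qed
      finally show "(\<Sum>y\<in>T. f z * h (inv z \<otimes> y) * k (inv y \<otimes> x)) =
        (\<Sum>w\<in>?H. f z * h w * k (inv w \<otimes> (inv z \<otimes> x)))" by simp
    qed
    also have "\<dots> = (\<Sum>z\<in>?F. f z * gr_mult G h k (inv z \<otimes> x))"
    proof (rule sum.cong[OF refl])
      fix z assume "z \<in> ?F"
      then have "inv z \<otimes> x \<in> carrier G" using cF x by blast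
      then show "(\<Sum>w\<in>?H. f z * h w * k (inv w \<otimes> (inv z \<otimes> x))) = f z * gr_mult G h k (inv z \<otimes> x)"
        by (simp add: gr_mult_def sum_distrib_left mult.assoc)
    qed
    also have "\<dots> = gr_mult G f (gr_mult G h k) x" using x by (simp add: gr_mult_def)
    finally show ?thesis .
  qed (simp add: gr_mult_def)
qed

lemma single_carrier: "g \<in> carrier G \<Longrightarrow> (single g :: 'a \<Rightarrow> 'r::ring_1) \<in> gr_carrier G"
  by (auto simp: gr_carrier_def single_def)

lemma gr_add_closed:
  "f \<in> gr_carrier G \<Longrightarrow> h \<in> gr_carrier G \<Longrightarrow> (\<lambda>x. f x + h x :: 'r::ring_1) \<in> gr_carrier G"
proof -
  assume f: "f \<in> gr_carrier G" and h: "h \<in> gr_carrier G"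
  have "{g. f g + h g \<noteq> 0} \<subseteq> {g. f g \<noteq> 0} \<union> {g. h g \<noteq> 0}" by auto
  then show ?thesis using gr_carrierD[OF f] gr_carrierD[OF h]
    unfolding gr_carrier_def by (auto intro: finite_subset)
qed

lemma single_mult:
  assumes "g \<in> carrier G" "x \<in> carrier G"
  shows "gr_mult G (single g) f x = (f (inv g \<otimes> x) :: 'r::ring_1)"
  using assms by (subst gr_mult_sum[of "{g}"]) (auto simp: single_def)

lemma mult_single:
  fixes f :: "'a \<Rightarrow> 'r::ring_1"
  assumes f: "f \<in> gr_carrier G" and g: "g \<in> carrier G" and x: "x \<in> carrier G"
  shows "gr_mult G f (single g) x = f (x \<otimes> inv g)"
proof -
  have eq: "inv y \<otimes> x = g \<longleftrightarrow> y = x \<otimes> inv g" if "y \<in> carrier G" for y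
    using that g x by (metis inv_closed inv_solve_left inv_solve_right m_closed)
  have "f y * single g (inv y \<otimes> x) = (if y = x \<otimes> inv g then f y else 0)" for y
    using eq[of y] gr_carrierD(3)[OF f, of y] by (cases "y \<in> carrier G") (auto simp: single_def)
  then have "gr_mult G f (single g) x = (\<Sum>y\<in>{y. f y \<noteq> 0}. if y = x \<otimes> inv g then f y else 0)"
    using x by (simp add: gr_mult_def)
  then show ?thesis using gr_carrierD(1)[OF f] by (simp add: sum.delta')
qed

lemma gr_one_eq: "gr_one G = (single \<one> :: 'a \<Rightarrow> 'r::ring_1)"
  by (auto simp: gr_one_def single_def fun_eq_iff)

lemma gr_mult_out: "x \<notin> carrier G \<Longrightarrow> gr_mult G f h x = 0"
  by (simp add: gr_mult_def)

lemma gr_l_distr: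
  fixes f h k :: "'a \<Rightarrow> 'r::ring_1"
  assumes f: "f \<in> gr_carrier G" and h: "h \<in> gr_carrier G"
  shows "gr_mult G (\<lambda>x. f x + h x) k = (\<lambda>x. gr_mult G f k x + gr_mult G h k x)"
proof
  fix x
  let ?T = "{g. f g \<noteq> 0} \<union> {g. h g \<noteq> 0}"
  have T: "finite ?T" using gr_carrierD(1) f h by blast
  show "gr_mult G (\<lambda>x. f x + h x) k x = gr_mult G f k x + gr_mult G h k x"
  proof (cases "x \<in> carrier G")
    case x: True
    have 1: "gr_mult G (\<lambda>x. f x + h x) k x = (\<Sum>y\<in>?T. (f y + h y) * k (inv y \<otimes> x))"
      by (rule gr_mult_sum[OF T _ x]) auto
    have 2: "gr_mult G f k x = (\<Sum>y\<in>?T. f y * k (inv y \<otimes> x))" by (rule gr_mult_sum[OF T _ x]) auto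
    have 3: "gr_mult G h k x = (\<Sum>y\<in>?T. h y * k (inv y \<otimes> x))" by (rule gr_mult_sum[OF T _ x]) auto
    show ?thesis unfolding 1 2 3 by (simp add: distrib_right sum.distrib)
  qed (simp add: gr_mult_def)
qed

lemma gr_r_distr:
  "gr_mult G k (\<lambda>x. f x + h x :: 'r::ring_1) = (\<lambda>x. gr_mult G k f x + gr_mult G k h x)"
  by (rule ext) (simp add: gr_mult_def distrib_left sum.distrib)

lemma group_ring_is_ring: "ring (group_ring G :: ('a \<Rightarrow> 'r::ring_1) ring)"
proof (rule ringI)
  show "abelian_group (group_ring G :: ('a \<Rightarrow> 'r) ring)"
  proof (rule abelian_groupI; simp)
    fix f h :: "'a \<Rightarrow> 'r" assume f: "f \<in> gr_carrier G" and h: "h \<in> gr_carrier G"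
    show "(\<lambda>x. f x + h x) \<in> gr_carrier G" using f h by (rule gr_add_closed)
    show "(\<lambda>x. f x + h x) = (\<lambda>x. h x + f x)" by (simp add: add.commute)
    show "(\<lambda>x. f x + h x + k x) = (\<lambda>x. f x + (h x + k x))" for k by (simp add: add.assoc)
    show "\<exists>y\<in>gr_carrier G. (\<lambda>x. y x + f x) = (\<lambda>x. 0)"
      using f by (intro bexI[of _ "\<lambda>x. - f x"]) (auto simp: gr_carrier_def)
  qed (simp add: gr_carrier_def)
  show "Group.monoid (group_ring G :: ('a \<Rightarrow> 'r) ring)"
  proof (rule monoidI; simp)
    fix f h k :: "'a \<Rightarrow> 'r" assume f: "f \<in> gr_carrier G"
    show "gr_mult G f h \<in> gr_carrier G" if "h \<in> gr_carrier G" using f that by (rule gr_mult_closed)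
    show "gr_mult G (gr_mult G f h) k = gr_mult G f (gr_mult G h k)"
      if "h \<in> gr_carrier G" "k \<in> gr_carrier G" using f that by (rule gr_mult_assoc)
    show "gr_mult G (gr_one G) f = f"
    proof
      fix x show "gr_mult G (gr_one G) f x = f x"
        using gr_carrierD(3)[OF f] by (cases "x \<in> carrier G") (auto simp: gr_one_eq single_mult gr_mult_out)
    qed
    show "gr_mult G f (gr_one G) = f"
    proof
      fix x show "gr_mult G f (gr_one G) x = f x"
        using gr_carrierD(3)[OF f] f by (cases "x \<in> carrier G") (auto simp: gr_one_eq mult_single gr_mult_out)
    qed
  qed (simp add: gr_one_eq single_carrier)
qed (auto simp: gr_l_distr gr_r_distr)

end

section \<open>From the absence of cycles to a proper right ideal\<close>

definition labs :: "'a set \<Rightarrow> (bool \<times> 'a) option set" where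
  "labs A = insert None (Some ` (UNIV \<times> A))"

context group
begin

lemma label_val_closed:
  "(\<And>i j. L i j \<in> carrier G) \<Longrightarrow> (\<And>i j. L' i j \<in> carrier G) \<Longrightarrow> A \<subseteq> carrier G \<Longrightarrow> l \<in> labs A \<Longrightarrow>
   label_val G L L' i l \<in> carrier G"
  by (auto simp: labs_def label_val_def)

text \<open>A nonidentity element that occurs in one summand must be cancelled by another one. Following the
  cancelling partners yields arbitrarily long chains whose values are distinct but stay in a finite set.\<close>

lemma no_cycles_sum:
  fixes t :: "'i \<Rightarrow> 'a \<Rightarrow> 'r::ring_1_no_zero_divisors"
  assumes nc: "no_cycles G I A L L'" and L: "\<And>i j. L i j \<in> carrier G" "\<And>i j. L' i j \<in> carrier G"
    and F: "finite F" "F \<subseteq> I" and A: "\<And>i. i \<in> F \<Longrightarrow> finite (A i) \<and> A i \<subseteq> carrier G \<and> A i \<noteq> {}"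
    and cf: "\<And>i l. i \<in> F \<Longrightarrow> l \<in> labs (A i) \<Longrightarrow> cf i l \<noteq> 0"
    and t: "\<And>i. i \<in> F \<Longrightarrow> finite {x. t i x \<noteq> 0}"
    and eq: "\<And>x. x \<in> carrier G \<Longrightarrow>
      (\<Sum>i\<in>F. \<Sum>l\<in>labs (A i). cf i l * t i (inv (label_val G L L' i l) \<otimes> x)) = (if x = \<one> then 1 else 0)"
  shows False
proof -
  define w where "w = label_val G L L'"
  define P where "P = Sigma F (\<lambda>i. labs (A i))"
  define tm where "tm p x = cf (fst p) (snd p) * t (fst p) (inv (w (fst p) (snd p)) \<otimes> x)" for p x
  \<comment> \<open>The term labelled \<open>p\<close> has a nonzero coefficient at
    \<open>x\<close>. As there are no zero divisors, this depends on the factor \<open>t\<close>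
    alone, so it carries over to any label of the same index once \<open>x\<close> is translated
    accordingly.\<close>
  define live where "live p x \<longleftrightarrow> p \<in> P \<and> t (fst p) (inv (w (fst p) (snd p)) \<otimes> x) \<noteq> 0" for p x
  have finlabs: "finite (labs (A i))" if "i \<in> F" for i using A[OF that] by (simp add: labs_def)
  then have finP: "finite P" using F(1) by (auto simp: P_def)
  have wG: "w i l \<in> carrier G" if "(i, l) \<in> P" for i l
    using label_val_closed[where L = L and L' = L' and A = "A i" and l = l and i = i] L A that by (auto simp: P_def w_def)
  have sum: "(\<Sum>p\<in>P. tm p x) = (if x = \<one> then 1 else 0)" if "x \<in> carrier G" for x
    using eq[OF that] F(1) finlabs by (simp add: P_def tm_def w_def sum.Sigma case_prod_beta)
  have tm0: "tm p x \<noteq> 0 \<longleftrightarrow> live p x" if "p \<in> P" for p x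
    using that cf by (auto simp: tm_def live_def P_def)
  have start: "\<exists>p. live p \<one>"
  proof -
    have "(\<Sum>p\<in>P. tm p \<one>) \<noteq> 0" using sum[OF one_closed] by simp
    then obtain p where "p \<in> P" "tm p \<one> \<noteq> 0" by (rule sum.not_neutral_contains_not_neutral)
    then show ?thesis using tm0 by blast
  qed
  have partner: "\<exists>q. q \<noteq> p \<and> live q x" if x: "x \<in> carrier G" "x \<noteq> \<one>" and p: "live p x" for p x
  proof (rule ccontr)
    assume n: "\<nexists>q. q \<noteq> p \<and> live q x"
    have pP: "p \<in> P" using p by (simp add: live_def)
    have "(\<Sum>q\<in>P. tm q x) = tm p x + (\<Sum>q\<in>P - {p}. tm q x)" using finP pP by (rule sum.remove)
    also have "(\<Sum>q\<in>P - {p}. tm q x) = 0" using n tm0 by (intro sum.neutral ballI) blast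
    finally have "tm p x = 0" using sum[OF x(1)] x(2) by simp
    then show False using tm0[OF pP, of x] p by simp
  qed
  define X where "X = (\<Union>p\<in>P. (\<lambda>g. w (fst p) (snd p) \<otimes> g) ` {x. t (fst p) x \<noteq> 0})"
  have finX: "finite X" unfolding X_def using finP t by (auto simp: P_def)
  have liveX: "x \<in> X" if "x \<in> carrier G" "live p x" for p x
  proof -
    have "p \<in> P" using that by (simp add: live_def)
    then have "w (fst p) (snd p) \<in> carrier G" using wG[of "fst p" "snd p"] by simp
    then have "x = w (fst p) (snd p) \<otimes> (inv (w (fst p) (snd p)) \<otimes> x)" using that by simp
    then show ?thesis unfolding X_def using that(2)
      by (intro UN_I[OF \<open>p \<in> P\<close>] image_eqI[of _ _ "inv (w (fst p) (snd p)) \<otimes> x"]) (simp_all add: live_def)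
  qed
  define good where "good cs \<longleftrightarrow> chain I A cs \<and> fst ` set cs \<subseteq> F \<and> (\<forall>k\<le>length cs. chain_val G L L' (drop k cs) \<in> X) \<and>
    (cs \<noteq> [] \<longrightarrow> live (fst (hd cs), Some (snd (snd (hd cs)))) (chain_val G L L' cs))" for cs
  have stepG: "step_val G L L' p \<in> carrier G" if vp: "valid_step I A p" "fst p \<in> F" for p
  proof -
    obtain i l j a where p: "p = (i, l, j, a)" by (cases p)
    have "l \<in> labs (A i)" using vp(1) by (cases l) (auto simp: p valid_step_def labs_def)
    then have "(i, l) \<in> P" "(i, Some (j, a)) \<in> P" using vp by (simp_all add: p P_def labs_def valid_step_def)
    from this[THEN wG] show ?thesis by (simp add: p step_val_def w_def)
  qed
  have chainG: "chain_val G L L' cs \<in> carrier G" if "chain I A cs" "fst ` set cs \<subseteq> F" for cs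
  proof -
    have "valid_step I A p \<and> fst p \<in> F" if "p \<in> set cs" for p
      using \<open>chain I A cs\<close> \<open>fst ` set cs \<subseteq> F\<close> that by (auto simp: chain_def)
    then show ?thesis using stepG by (induction cs) auto
  qed
  \<comment> \<open>At the value of a nonempty chain, which is not \<open>\<one>\<close>, the last
    label needs a live partner; the empty chain starts with any live term at \<open>\<one>\<close>.
    The step then moves to the other multiplier of the same index while the argument of
    \<open>t\<close> stays the same, so the new label is live.\<close>
  have extend: "\<exists>p. good (p # cs)" if g: "good cs" for cs
  proof -
    let ?x = "chain_val G L L' cs"
    have ch: "chain I A cs" "fst ` set cs \<subseteq> F" using g by (simp_all add: good_def)
    have xG: "?x \<in> carrier G" using chainG[OF ch] .
    obtain q where q: "live q ?x" "cs \<noteq> [] \<Longrightarrow> q \<noteq> (fst (hd cs), Some (snd (snd (hd cs))))"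
    proof (cases "cs = []")
      case True
      then show ?thesis using that start by (auto simp del: split_paired_All split_paired_Ex)
    next
      case False
      then have "?x \<noteq> \<one>" using nc ch(1) by (simp add: no_cycles_def)
      moreover have "live (fst (hd cs), Some (snd (snd (hd cs)))) ?x" using g False by (simp add: good_def)
      ultimately show ?thesis using partner[OF xG] that by metis
    qed
    obtain i l where il: "q = (i, l)" by (cases q)
    have iF: "i \<in> F" and lA: "l \<in> labs (A i)" using q(1) by (auto simp: live_def P_def il)
    obtain a where a: "a \<in> A i" using A[OF iF] by blast
    \<comment> \<open>From the unit label both multipliers are admissible; \<open>True\<close> is an
      arbitrary choice.\<close>
    define j where "j = (case l of None \<Rightarrow> True | Some (j', a') \<Rightarrow> \<not> j')"
    let ?p = "(i, l, j, a)"
    have P': "(i, Some (j, a)) \<in> P" using iF a by (simp add: P_def labs_def)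
    have v: "valid_step I A ?p" using iF F(2) a lA by (auto simp: valid_step_def j_def labs_def)
    have ch': "chain I A (?p # cs)"
      using ch(1) v q(2) by (auto simp: chain_def successively_Cons il)
    have F': "fst ` set (?p # cs) \<subseteq> F" using ch(2) iF by simp
    have "w i l \<in> carrier G" "w i (Some (j, a)) \<in> carrier G"
      using wG q(1) P' by (auto simp: live_def il)
    then have "inv (w i (Some (j, a))) \<otimes> chain_val G L L' (?p # cs) = inv (w i l) \<otimes> ?x"
      using xG by (simp add: step_val_def w_def m_assoc)
    then have l': "live (i, Some (j, a)) (chain_val G L L' (?p # cs))"
      using P' q(1) by (simp add: live_def il)
    have "chain_val G L L' (drop k (?p # cs)) \<in> X" if "k \<le> length (?p # cs)" for k
    proof (cases k)
      case 0
      then show ?thesis using liveX[OF chainG[OF ch' F'] l'] by simp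
    next
      case (Suc n)
      then show ?thesis using g that by (simp add: good_def)
    qed
    then have "good (?p # cs)" using ch' F' l' by (simp add: good_def)
    then show ?thesis by blast
  qed
  have "\<exists>cs. good cs \<and> length cs = n" for n
  proof (induction n)
    case 0
    have "good []" using start liveX by (auto simp: good_def chain_def)
    then show ?case by blast
  next
    case (Suc n)
    then obtain cs where cs: "good cs" "length cs = n" by blast
    then obtain p where "good (p # cs)" using extend by blast
    then show ?case using cs(2) by (intro exI[of _ "p # cs"]) simp
  qed
  \<comment> \<open>A chain of \<open>card X\<close> steps has one suffix more than \<open>X\<close>
    has elements, and two suffixes of equal value would cut out a chain with value
    \<open>\<one>\<close>.\<close>
  then obtain cs where cs: "good cs" "length cs = card X" by blast
  have "chain_val G L L' (drop k cs) \<noteq> chain_val G L L' (drop m cs)" if km: "k < m" "m \<le> length cs" for k m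
  proof
    assume e: "chain_val G L L' (drop k cs) = chain_val G L L' (drop m cs)"
    define u where "u = take (m - k) (drop k cs)"
    have split: "drop k cs = u @ drop m cs"
      using append_take_drop_id[of "m - k" "drop k cs"] km(1) by (simp add: u_def)
    have ch: "chain I A (take k cs @ drop k cs)" "fst ` set cs \<subseteq> F" using cs(1) by (simp_all add: good_def)
    then have ch2: "chain I A (u @ drop m cs)" using chain_append split by metis
    then have chu: "chain I A u" "chain I A (drop m cs)" using chain_append by blast+
    have Fu: "fst ` set u \<subseteq> F" "fst ` set (drop m cs) \<subseteq> F"
      unfolding u_def by (auto dest!: in_set_takeD in_set_dropD intro: subsetD[OF ch(2)])
    have app: "chain_val G L L' (v @ z) = chain_val G L L' v \<otimes> chain_val G L L' z"
      if "chain I A (v @ z)" "fst ` set v \<subseteq> F" "chain_val G L L' z \<in> carrier G" for v z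
      using that
    proof (induction v)
      case (Cons p v)
      have c: "chain I A ([p] @ (v @ z))" using Cons.prems(1) by simp
      then have c1: "chain I A (v @ z)" "chain I A [p]" using chain_append by blast+
      then have "chain I A v" using chain_append by blast
      moreover have "fst ` set v \<subseteq> F" "fst p \<in> F" using Cons.prems(2) by auto
      ultimately have "chain_val G L L' v \<in> carrier G" "step_val G L L' p \<in> carrier G"
        using chainG stepG c1(2) by (auto simp: chain_def)
      then show ?case using Cons c1 by (simp add: m_assoc)
    qed simp
    have zG: "chain_val G L L' (drop m cs) \<in> carrier G" "chain_val G L L' u \<in> carrier G"
      using chainG chu Fu by blast+
    have "chain_val G L L' u \<otimes> chain_val G L L' (drop m cs) = chain_val G L L' (drop m cs)"
      using e app[OF ch2 Fu(1) zG(1)] split by simp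
    then have "chain_val G L L' u = \<one>" using zG by (metis r_cancel_one)
    moreover have "u \<noteq> []" using km by (simp add: u_def)
    ultimately show False using nc chu(1) by (simp add: no_cycles_def)
  qed
  then have "inj_on (\<lambda>k. chain_val G L L' (drop k cs)) {..length cs}"
    by (intro linorder_inj_onI) auto
  moreover have "(\<lambda>k. chain_val G L L' (drop k cs)) ` {..length cs} \<subseteq> X" using cs(1) by (auto simp: good_def)
  ultimately have "card {..length cs} \<le> card X" using finX by (rule card_inj_on_le)
  then show False using cs(2) by simp
qed

end

context group
begin

text \<open>The multipliers are indexed by the ring element itself, so \<open>S\<close> serves as
  the index set of the chains.\<close>

definition one_plus :: "(('a \<Rightarrow> 'r::ring_1) \<Rightarrow> bool \<Rightarrow> 'a) \<Rightarrow> (('a \<Rightarrow> 'r) \<Rightarrow> bool \<Rightarrow> 'a) \<Rightarrow> ('a \<Rightarrow> 'r) \<Rightarrow> 'a \<Rightarrow> 'r" where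
  "one_plus L L' s = (\<lambda>x. gr_one G x +
     (gr_mult G (single (L s True)) (gr_mult G s (single (L' s True))) x +
      gr_mult G (single (L s False)) (gr_mult G s (single (L' s False))) x))"

lemma sandwich_coeff:
  fixes s u :: "'a \<Rightarrow> 'r::ring_1"
  assumes s: "s \<in> gr_carrier G" and u: "u \<in> gr_carrier G" and l: "l \<in> carrier G" "l' \<in> carrier G" and x: "x \<in> carrier G"
  shows "gr_mult G (gr_mult G (single l) (gr_mult G s (single l'))) u x =
    (\<Sum>a\<in>{a. s a \<noteq> 0}. s a * u (inv (l \<otimes> a \<otimes> l') \<otimes> x))"
proof -
  note c = single_carrier[OF l(1)] single_carrier[OF l(2)] gr_mult_closed
  have "gr_mult G (gr_mult G (single l) (gr_mult G s (single l'))) u x =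
      gr_mult G (single l) (gr_mult G s (gr_mult G (single l') u)) x"
    by (simp add: gr_mult_assoc s u c)
  also have "\<dots> = gr_mult G s (gr_mult G (single l') u) (inv l \<otimes> x)"
    using l x by (simp add: single_mult)
  also have "\<dots> = (\<Sum>a\<in>{a. s a \<noteq> 0}. s a * gr_mult G (single l') u (inv a \<otimes> (inv l \<otimes> x)))"
    using l x by (simp add: gr_mult_def)
  also have "\<dots> = (\<Sum>a\<in>{a. s a \<noteq> 0}. s a * u (inv (l \<otimes> a \<otimes> l') \<otimes> x))"
  proof (rule sum.cong[OF refl])
    fix a assume "a \<in> {a. s a \<noteq> 0}"
    then have a: "a \<in> carrier G" using gr_carrierD(2)[OF s] by blast
    then have "gr_mult G (single l') u (inv a \<otimes> (inv l \<otimes> x)) = u (inv l' \<otimes> (inv a \<otimes> (inv l \<otimes> x)))"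
      using l x by (intro single_mult) auto
    also have "inv l' \<otimes> (inv a \<otimes> (inv l \<otimes> x)) = inv (l \<otimes> a \<otimes> l') \<otimes> x"
      using a l x by (simp add: inv_mult_group m_assoc)
    finally show "s a * gr_mult G (single l') u (inv a \<otimes> (inv l \<otimes> x)) = s a * u (inv (l \<otimes> a \<otimes> l') \<otimes> x)" by simp
  qed
  finally show ?thesis .
qed

lemma sandwich_closed:
  assumes s: "s \<in> gr_carrier G" and l: "l \<in> carrier G" "l' \<in> carrier G"
  shows "gr_mult G (single l) (gr_mult G s (single l')) \<in> (gr_carrier G :: ('a \<Rightarrow> 'r::ring_1) set)"
  by (intro gr_mult_closed single_carrier s l)

lemma gr_mult_zero [simp]: "gr_mult G f (\<lambda>x. 0 :: 'r::ring_1) x = 0"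
  by (simp add: gr_mult_def)

lemma gr_one_closed: "gr_one G \<in> (gr_carrier G :: ('a \<Rightarrow> 'r::ring_1) set)"
  by (simp add: gr_one_eq single_carrier)

context
  fixes L L' :: "('a \<Rightarrow> 'r::ring_1_no_zero_divisors) \<Rightarrow> bool \<Rightarrow> 'a"
  assumes L: "\<And>s j. L s j \<in> carrier G" "\<And>s j. L' s j \<in> carrier G"
begin

lemma one_plus_closed: "s \<in> gr_carrier G \<Longrightarrow> one_plus L L' s \<in> gr_carrier G"
  unfolding one_plus_def by (intro gr_add_closed sandwich_closed gr_one_closed L)

lemma one_plus_coeff:
  assumes s: "s \<in> gr_carrier G" and u: "u \<in> gr_carrier G" and x: "x \<in> carrier G"
  shows "gr_mult G (one_plus L L' s) u x = (\<Sum>l\<in>labs {a. s a \<noteq> 0}.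
    (case l of None \<Rightarrow> 1 | Some (j, a) \<Rightarrow> s a) * u (inv (label_val G L L' s l) \<otimes> x))"
proof -
  let ?A = "{a. s a \<noteq> 0}"
  let ?f = "\<lambda>l. (case l of None \<Rightarrow> 1 | Some (j, a) \<Rightarrow> s a) * u (inv (label_val G L L' s l) \<otimes> x)"
  have fin: "finite ?A" by (rule gr_carrierD(1)[OF s])
  have sw: "gr_mult G (gr_mult G (single (L s j)) (gr_mult G s (single (L' s j)))) u x = (\<Sum>a\<in>?A. ?f (Some (j, a)))" for j
    using sandwich_coeff[OF s u L x] by (simp add: label_val_def)
  have "gr_mult G (one_plus L L' s) u x = gr_mult G (gr_one G) u x +
    ((\<Sum>a\<in>?A. ?f (Some (True, a))) + (\<Sum>a\<in>?A. ?f (Some (False, a))))"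
    unfolding one_plus_def
    by (simp only: gr_l_distr gr_add_closed sandwich_closed[OF s L] gr_one_closed sw)
  also have "gr_mult G (gr_one G) u x = ?f None"
    using x by (simp add: gr_one_eq single_mult label_val_def)
  also have "(\<Sum>a\<in>?A. ?f (Some (True, a))) + (\<Sum>a\<in>?A. ?f (Some (False, a))) = (\<Sum>p\<in>UNIV \<times> ?A. ?f (Some p))"
  proof -
    have "(\<Sum>p\<in>UNIV \<times> ?A. ?f (Some p)) = (\<Sum>j\<in>UNIV. \<Sum>a\<in>?A. ?f (Some (j, a)))"
      unfolding sum.cartesian_product by (rule sum.cong) auto
    then show ?thesis by (simp add: UNIV_bool add.commute)
  qed
  also have "\<dots> = (\<Sum>l\<in>Some ` (UNIV \<times> ?A). ?f l)" by (subst sum.reindex) (auto simp: inj_on_def)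
  also have "?f None + \<dots> = (\<Sum>l\<in>labs ?A. ?f l)"
    unfolding labs_def using fin by (subst sum.insert) auto
  finally show ?thesis .
qed

text \<open>Multiples of one generator are collected into a single right factor \<open>t s\<close>,
  because the cancellation argument sums over a set of indices.\<close>

lemma right_ideal_gen_one_plus:
  assumes S: "S \<subseteq> gr_carrier G" and f: "f \<in> ring.right_ideal_gen (group_ring G) (one_plus L L' ` S)"
  shows "\<exists>F t. finite F \<and> F \<subseteq> S \<and> (\<forall>s\<in>F. t s \<in> gr_carrier G) \<and>
    f = (\<lambda>x. \<Sum>s\<in>F. gr_mult G (one_plus L L' s) (t s) x)"
proof -
  interpret RG: ring "group_ring G :: ('a \<Rightarrow> 'r) ring" by (rule group_ring_is_ring)
  show ?thesis
    using f
  proof (induction rule: RG.right_ideal_gen.induct)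
    case zero
    show ?case by (intro exI[of _ "{}"]) simp
  next
    case (step e u f)
    obtain s where s: "s \<in> S" "e = one_plus L L' s" using step by auto
    have u: "u \<in> gr_carrier G" using step by simp
    obtain F t where F: "finite F" "F \<subseteq> S" "\<forall>s\<in>F. t s \<in> gr_carrier G"
      "f = (\<lambda>x. \<Sum>s\<in>F. gr_mult G (one_plus L L' s) (t s) x)" using step.IH by blast
    define t' where "t' = t(s := \<lambda>x. (if s \<in> F then t s x else 0) + u x)"
    have t': "t' s \<in> gr_carrier G" "\<And>k. k \<noteq> s \<Longrightarrow> t' k = t k"
      using F(3) u gr_add_closed[of "t s" u] by (cases "s \<in> F"; simp add: t'_def)+
    have rest: "(\<Sum>k\<in>F - {s}. gr_mult G (one_plus L L' k) (t' k) x) = (\<Sum>k\<in>F - {s}. gr_mult G (one_plus L L' k) (t k) x)" for x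
      using t'(2) by (intro sum.cong) auto
    have "(\<Sum>k\<in>insert s F. gr_mult G (one_plus L L' k) (t' k) x) =
        gr_mult G (one_plus L L' s) u x + (\<Sum>k\<in>F. gr_mult G (one_plus L L' k) (t k) x)" for x
    proof -
      have "(\<Sum>k\<in>insert s F. gr_mult G (one_plus L L' k) (t' k) x) =
          gr_mult G (one_plus L L' s) (t' s) x + (\<Sum>k\<in>F - {s}. gr_mult G (one_plus L L' k) (t k) x)"
        using F(1) by (simp add: sum.insert_remove rest)
      moreover have "gr_mult G (one_plus L L' s) (t' s) x =
          gr_mult G (one_plus L L' s) u x + (if s \<in> F then gr_mult G (one_plus L L' s) (t s) x else 0)"
        by (simp add: t'_def gr_r_distr add.commute)
      ultimately show ?thesis using sum.remove[OF F(1), of s "\<lambda>k. gr_mult G (one_plus L L' k) (t k) x"]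
        by (cases "s \<in> F") simp_all
    qed
    then have "e \<otimes>\<^bsub>group_ring G\<^esub> u \<oplus>\<^bsub>group_ring G\<^esub> f =
        (\<lambda>x. \<Sum>k\<in>insert s F. gr_mult G (one_plus L L' k) (t' k) x)"
      by (simp add: F(4) s(2))
    moreover have "\<forall>k\<in>insert s F. t' k \<in> gr_carrier G"
    proof
      fix k assume "k \<in> insert s F"
      then show "t' k \<in> gr_carrier G" using t' F(3) by (cases "k = s") simp_all
    qed
    ultimately show ?case
      using F(1,2) s(1) by (intro exI[of _ "insert s F"] exI[of _ t']) simp
  qed
qed

lemma one_notin_right_ideal_gen:
  assumes S: "S \<subseteq> gr_carrier G - {\<lambda>x. 0}" and nc: "no_cycles G S (\<lambda>s. {a. s a \<noteq> 0}) L L'"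
  shows "gr_one G \<notin> ring.right_ideal_gen (group_ring G) (one_plus L L' ` S)"
proof
  assume g: "gr_one G \<in> ring.right_ideal_gen (group_ring G) (one_plus L L' ` S)"
  have "S \<subseteq> gr_carrier G" using S by auto
  from right_ideal_gen_one_plus[OF this g] obtain F t where F: "finite F" "F \<subseteq> S" "\<forall>s\<in>F. t s \<in> gr_carrier G"
      "gr_one G = (\<lambda>x. \<Sum>s\<in>F. gr_mult G (one_plus L L' s) (t s) x)"
    by (elim exE conjE)
  have sG: "s \<in> gr_carrier G" "s \<noteq> (\<lambda>x. 0)" if "s \<in> F" for s using that F(2) S by blast+
  show False
  proof (rule no_cycles_sum[OF nc L F(1,2), of "\<lambda>s l. case l of None \<Rightarrow> 1 | Some (j, a) \<Rightarrow> s a" t])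
    fix s assume s: "s \<in> F"
    show "finite {a. s a \<noteq> 0} \<and> {a. s a \<noteq> 0} \<subseteq> carrier G \<and> {a. s a \<noteq> 0} \<noteq> {}"
      using gr_carrierD(1,2)[OF sG(1)[OF s]] sG(2)[OF s] by auto
    show "finite {x. t s x \<noteq> 0}" using F(3) s gr_carrierD(1) by blast
    show "(case l of None \<Rightarrow> 1 | Some (j, a) \<Rightarrow> s a) \<noteq> 0" if "l \<in> labs {a. s a \<noteq> 0}" for l
      using that by (auto simp: labs_def)
  next
    fix x assume x: "x \<in> carrier G"
    have "(if x = \<one> then 1 else 0) = (\<Sum>s\<in>F. gr_mult G (one_plus L L' s) (t s) x)"
      using fun_cong[OF F(4), of x] by (simp add: gr_one_def)
    also have "\<dots> = (\<Sum>s\<in>F. \<Sum>l\<in>labs {a. s a \<noteq> 0}.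
        (case l of None \<Rightarrow> 1 | Some (j, a) \<Rightarrow> s a) * t s (inv (label_val G L L' s l) \<otimes> x))"
      using F(3) sG(1) x by (intro sum.cong refl one_plus_coeff) auto
    finally show "(\<Sum>s\<in>F. \<Sum>l\<in>labs {a. s a \<noteq> 0}.
        (case l of None \<Rightarrow> 1 | Some (j, a) \<Rightarrow> s a) * t s (inv (label_val G L L' s l) \<otimes> x)) = (if x = \<one> then 1 else 0)" ..
  qed
qed

end

lemma group_ring_right_primitive:
  fixes S :: "('a \<Rightarrow> 'r::ring_1_no_zero_divisors) set"
  assumes lf: "locally_free G" and ab: "a \<in> carrier G" "b \<in> carrier G" "a \<otimes> b \<noteq> b \<otimes> a"
    and S: "S \<subseteq> gr_carrier G - {\<lambda>x. 0}" "|S| \<le>o |carrier G|"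
    and meets: "\<And>I. ideal I (group_ring G :: ('a \<Rightarrow> 'r) ring) \<Longrightarrow> I \<noteq> {\<lambda>x. 0} \<Longrightarrow> \<exists>s\<in>S. s \<in> I"
  shows "right_primitive (group_ring G :: ('a \<Rightarrow> 'r) ring)"
proof -
  interpret RG: ring "group_ring G :: ('a \<Rightarrow> 'r) ring" by (rule group_ring_is_ring)
  have A: "finite {a. s a \<noteq> 0} \<and> {a. s a \<noteq> 0} \<subseteq> carrier G" if "s \<in> S" for s
    using that S(1) by (intro conjI gr_carrierD) auto
  obtain L L' where L: "\<And>s j. L s j \<in> carrier G" "\<And>s j. L' s j \<in> carrier G"
    and nc: "no_cycles G S (\<lambda>s. {a. s a \<noteq> 0}) L L'"
    by (rule locally_free_no_cycles[OF lf ab S(2), of "\<lambda>s. {a. s a \<noteq> 0}"]) (use A in blast)+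
  let ?E = "one_plus L L' ` S"
  have E: "?E \<subseteq> carrier (group_ring G)" using one_plus_closed[of L L', OF L] S(1) by auto
  show ?thesis
  proof (rule RG.right_primitiveI[OF RG.right_ideal_gen(1)[OF E]])
    show "\<one>\<^bsub>group_ring G\<^esub> \<notin> RG.right_ideal_gen ?E"
      using one_notin_right_ideal_gen[of L L', OF L S(1) nc] by simp
    fix I :: "('a \<Rightarrow> 'r) set" assume I: "ideal I (group_ring G)" "I \<noteq> {\<zero>\<^bsub>group_ring G\<^esub>}"
    then obtain s where s: "s \<in> S" "s \<in> I" using meets by auto
    interpret I: ideal I "group_ring G :: ('a \<Rightarrow> 'r) ring" by (rule I(1))
    have sw: "gr_mult G (single (L s j)) (gr_mult G s (single (L' s j))) \<in> I" for j
      using I.I_l_closed[OF I.I_r_closed[OF s(2)], of "single (L' s j)" "single (L s j)"]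
      by (simp add: single_carrier L)
    have "(\<lambda>x. gr_mult G (single (L s True)) (gr_mult G s (single (L' s True))) x +
      gr_mult G (single (L s False)) (gr_mult G s (single (L' s False))) x) \<in> I" (is "?i \<in> I")
      using additive_subgroup.a_closed[OF I.additive_subgroup_axioms sw sw] by simp
    moreover have "\<one>\<^bsub>group_ring G\<^esub> \<oplus>\<^bsub>group_ring G\<^esub> ?i \<in> RG.right_ideal_gen ?E"
      using RG.right_ideal_gen(2)[OF E] s(1) by (auto simp: one_plus_def)
    ultimately show "\<exists>i\<in>I. \<one>\<^bsub>group_ring G\<^esub> \<oplus>\<^bsub>group_ring G\<^esub> i \<in> RG.right_ideal_gen ?E" by blast
  qed
qed

text \<open>An element is coded by a list enumerating its graph over the support.\<close>

lemma card_of_gr_carrier: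
  fixes Q :: "'r::ring_1 set"
  assumes inf: "infinite (carrier G)" and Q: "|Q| \<le>o |carrier G|"
  shows "|{u \<in> gr_carrier G. range u \<subseteq> Q}| \<le>o |carrier G|"
proof -
  let ?C = "{u \<in> gr_carrier G. range u \<subseteq> Q}"
  define gr where "gr u = (\<lambda>g. (g, u g)) ` {g. u g \<noteq> 0}" for u :: "'a \<Rightarrow> 'r"
  define c where "c u = (SOME l. set l = gr u)" for u
  have c: "set (c u) = gr u" if "u \<in> ?C" for u
  proof -
    have "finite (gr u)" using that gr_carrierD(1) by (auto simp: gr_def)
    then show ?thesis unfolding c_def by (rule someI_ex[OF finite_list])
  qed
  have "inj_on c ?C"
  proof (rule inj_onI)
    fix u v assume uv: "u \<in> ?C" "v \<in> ?C" "c u = c v"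
    have g: "gr u = gr v" using c[OF uv(1)] c[OF uv(2)] uv(3) by simp
    have iff: "(x, r) \<in> gr w \<longleftrightarrow> r = w x \<and> r \<noteq> 0" for x r and w :: "'a \<Rightarrow> 'r" by (auto simp: gr_def)
    show "u = v"
    proof
      fix x
      have "u x \<noteq> 0 \<Longrightarrow> u x = v x" using iff[of x "u x" u] iff[of x "u x" v] g by simp
      moreover have "v x \<noteq> 0 \<Longrightarrow> v x = u x" using iff[of x "v x" u] iff[of x "v x" v] g by simp
      ultimately show "u x = v x" by metis
    qed
  qed
  moreover have "c ` ?C \<subseteq> {l. set l \<subseteq> carrier G \<times> Q}"
  proof
    fix l assume "l \<in> c ` ?C"
    then obtain u where u: "u \<in> ?C" "l = c u" by blast
    have "gr u \<subseteq> carrier G \<times> Q" using u(1) gr_carrierD(2)[of u] by (auto simp: gr_def)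
    then show "l \<in> {l. set l \<subseteq> carrier G \<times> Q}" using c[OF u(1)] u(2) by simp
  qed
  ultimately have "|?C| \<le>o |{l. set l \<subseteq> carrier G \<times> Q}|" using card_of_ordLeq by blast
  also have "|{l. set l \<subseteq> carrier G \<times> Q}| \<le>o |carrier G|"
    by (intro card_of_lists_ordLeq inf card_of_Times_ordLeq_infinite_Field card_of_Card_order Q
        card_of_mono1 subset_refl) (simp add: inf Field_card_of)
  finally show ?thesis .
qed

end

section \<open>Generic elements and coefficients in the image of the integers\<close>

context group
begin

definition generic :: "'a set \<Rightarrow> 'a \<Rightarrow> bool" where
  "generic A x \<longleftrightarrow> (\<forall>g\<in>A. \<forall>h\<in>A. \<forall>g'\<in>A. \<forall>h'\<in>A. g \<otimes> x \<otimes> h = g' \<otimes> x \<otimes> h' \<longrightarrow> g = g' \<and> h = h')"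

text \<open>A generic element is read off from chains of length two that start and end with different
  padding elements.\<close>

lemma generic_element_exists:
  assumes lf: "locally_free G" and ab: "a \<in> carrier G" "b \<in> carrier G" "a \<otimes> b \<noteq> b \<otimes> a"
    and A: "finite A" "A \<subseteq> carrier G"
  obtains x where "x \<in> carrier G" "generic A x"
proof -
  define D where "D = A \<union> (\<lambda>a. inv a) ` A"
  have D: "finite D \<and> D \<subseteq> carrier G" using A by (auto simp: D_def)
  have "|{()}| \<le>o |carrier G|" by (rule card_of_singl_ordLeq) (use ab in auto)
  then obtain L L' :: "unit \<Rightarrow> bool \<Rightarrow> 'a" where L: "\<And>i j. L i j \<in> carrier G" "\<And>i j. L' i j \<in> carrier G"
    and nc: "no_cycles G {()} (\<lambda>_. D) L L'"
    by (rule locally_free_no_cycles[OF lf ab, of "{()}" "\<lambda>_. D"]) (use D in auto)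
  let ?p = "L () True" and ?q = "L () False" and ?r = "L' () True" and ?s = "L' () False"
  define x where "x = ?r \<otimes> inv ?s"
  have xG: "x \<in> carrier G" using L by (simp add: x_def)
  have h: "h = h'" if e: "g \<otimes> x \<otimes> h = g' \<otimes> x \<otimes> h'" and gh: "g \<in> A" "h \<in> A" "g' \<in> A" "h' \<in> A" for g h g' h'
  proof (rule ccontr)
    assume ne: "h \<noteq> h'"
    have G: "g \<in> carrier G" "h \<in> carrier G" "g' \<in> carrier G" "h' \<in> carrier G" using gh A by auto
    \<comment> \<open>The two steps multiply to \<open>g x h\<close> times the inverse of
      \<open>g' x h'\<close>, conjugated by \<open>?p\<close>. They meet at the labels of
      \<open>inv h\<close> and \<open>inv h'\<close>, so the junction condition is
      \<open>h \<noteq> h'\<close>.\<close>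
    let ?cs = "[((), Some (False, inv h), True, g), ((), Some (True, g'), False, inv h')]"
    have "inv h \<noteq> inv h'" using ne G by (metis inv_inv)
    then have "chain {()} (\<lambda>_. D) ?cs" using gh by (auto simp: chain_def valid_step_def D_def)
    then have "chain_val G L L' ?cs \<noteq> \<one>" using nc unfolding no_cycles_def by blast
    moreover have "chain_val G L L' ?cs = ?p \<otimes> (g \<otimes> x \<otimes> h \<otimes> (inv h' \<otimes> (inv x \<otimes> inv g'))) \<otimes> inv ?p"
      using L G by (simp add: step_val_def label_val_def x_def inv_mult_group m_assoc)
    moreover have "g' \<otimes> x \<otimes> h' \<otimes> (inv h' \<otimes> (inv x \<otimes> inv g')) = \<one>"
      using G xG by (simp add: m_assoc)
    ultimately show False using e L by simp
  qed
  have "g = g'" if e: "g \<otimes> x \<otimes> h = g' \<otimes> x \<otimes> h'" and gh: "g \<in> A" "h \<in> A" "g' \<in> A" "h' \<in> A" for g h g' h'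
  proof -
    have "g \<in> carrier G" "h \<in> carrier G" "g' \<in> carrier G" using gh A by auto
    then show ?thesis using e h[OF that] xG by (simp add: m_assoc)
  qed
  then have "generic A x" unfolding generic_def using h by blast
  then show ?thesis by (rule that[OF xG])
qed

text \<open>Genericity leaves a single pair of support elements contributing at
  \<open>g x h\<close>, so the product of their coefficients can be read off.\<close>

lemma generic_product_coeff:
  fixes f k :: "'a \<Rightarrow> 'r::ring_1"
  assumes f: "f \<in> gr_carrier G" "{y. f y \<noteq> 0} \<subseteq> A" and k: "k \<in> gr_carrier G" "{y. k y \<noteq> 0} \<subseteq> A"
    and A: "finite A" "A \<subseteq> carrier G" and x: "x \<in> carrier G"
    and gen: "generic A x"
    and gh: "g \<in> A" "h \<in> A"
  shows "gr_mult G f (gr_mult G (single x) k) (g \<otimes> x \<otimes> h) = f g * k h"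
proof -
  have G: "g \<in> carrier G" "h \<in> carrier G" using gh A by auto
  have "gr_mult G f (gr_mult G (single x) k) (g \<otimes> x \<otimes> h) =
      (\<Sum>y\<in>A. f y * gr_mult G (single x) k (inv y \<otimes> (g \<otimes> x \<otimes> h)))"
    by (rule gr_mult_sum[OF A(1) f(2)]) (use G x in simp)
  also have "\<dots> = (\<Sum>y\<in>A. if y = g then f g * k h else 0)"
  proof (rule sum.cong[OF refl])
    fix y assume y: "y \<in> A"
    then have yG: "y \<in> carrier G" using A by auto
    let ?z = "inv x \<otimes> (inv y \<otimes> (g \<otimes> x \<otimes> h))"
    have sm: "gr_mult G (single x) k (inv y \<otimes> (g \<otimes> x \<otimes> h)) = k ?z"
      using yG G x by (intro single_mult) auto
    have yz: "y \<otimes> x \<otimes> ?z = g \<otimes> x \<otimes> h" using yG G x by (simp add: m_assoc)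
    show "f y * gr_mult G (single x) k (inv y \<otimes> (g \<otimes> x \<otimes> h)) = (if y = g then f g * k h else 0)"
    proof (cases "y = g")
      case True
      then have "?z = h" using G x by (simp add: m_assoc)
      then show ?thesis using sm True by simp
    next
      case False
      then have "?z \<notin> A" using gen y gh yz unfolding generic_def by metis
      then have "k ?z = 0" using k(2) by blast
      then show ?thesis using sm False by simp
    qed
  qed
  also have "\<dots> = f g * k h" using A(1) gh(1) by simp
  finally show ?thesis .
qed

lemma gr_mult_sum_right:
  fixes k :: "'i \<Rightarrow> 'k::comm_ring_1"
  shows "gr_mult G f (\<lambda>x. \<Sum>i\<in>T. k i * h i x) y = (\<Sum>i\<in>T. k i * gr_mult G f (h i) y)"
proof (cases "y \<in> carrier G")
  case True
  have "gr_mult G f (\<lambda>x. \<Sum>i\<in>T. k i * h i x) y =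
      (\<Sum>z\<in>{z. f z \<noteq> 0}. \<Sum>i\<in>T. k i * (f z * h i (inv z \<otimes> y)))"
    using True by (simp add: gr_mult_def sum_distrib_left mult.left_commute)
  also have "\<dots> = (\<Sum>i\<in>T. \<Sum>z\<in>{z. f z \<noteq> 0}. k i * (f z * h i (inv z \<otimes> y)))" by (rule sum.swap)
  finally show ?thesis using True by (simp add: gr_mult_def sum_distrib_left)
qed (simp add: gr_mult_def)

lemma gr_mult_sum_left:
  fixes k :: "'i \<Rightarrow> 'k::comm_ring_1"
  assumes T: "finite T" and h: "\<And>i. i \<in> T \<Longrightarrow> h i \<in> gr_carrier G"
  shows "gr_mult G (\<lambda>x. \<Sum>i\<in>T. k i * h i x) f y = (\<Sum>i\<in>T. k i * gr_mult G (h i) f y)"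
proof (cases "y \<in> carrier G")
  case True
  define U where "U = (\<Union>i\<in>T. {z. h i z \<noteq> 0})"
  have U: "finite U" unfolding U_def using T h gr_carrierD(1) by blast
  have hU: "{z. h i z \<noteq> 0} \<subseteq> U" if "i \<in> T" for i using that by (auto simp: U_def)
  have "{z. (\<Sum>i\<in>T. k i * h i z) \<noteq> 0} \<subseteq> U"
  proof
    fix z assume "z \<in> {z. (\<Sum>i\<in>T. k i * h i z) \<noteq> 0}"
    then obtain i where "i \<in> T" "k i * h i z \<noteq> 0" by (auto elim: sum.not_neutral_contains_not_neutral)
    then have "z \<in> {z. h i z \<noteq> 0}" by auto
    then show "z \<in> U" using hU[OF \<open>i \<in> T\<close>] by blast
  qed
  from gr_mult_sum[OF U this True] have "gr_mult G (\<lambda>x. \<Sum>i\<in>T. k i * h i x) f y =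
      (\<Sum>z\<in>U. \<Sum>i\<in>T. k i * (h i z * f (inv z \<otimes> y)))"
    by (simp add: sum_distrib_right mult.assoc)
  also have "\<dots> = (\<Sum>i\<in>T. \<Sum>z\<in>U. k i * (h i z * f (inv z \<otimes> y)))" by (rule sum.swap)
  also have "\<dots> = (\<Sum>i\<in>T. k i * gr_mult G (h i) f y)"
    by (intro sum.cong refl) (simp add: gr_mult_sum[OF U hU True] sum_distrib_left)
  finally show ?thesis .
qed (simp add: gr_mult_def)

lemma gr_mult_Ints:
  fixes f h :: "'a \<Rightarrow> 'k::comm_ring_1"
  shows "range f \<subseteq> \<int> \<Longrightarrow> range h \<subseteq> \<int> \<Longrightarrow> range (gr_mult G f h) \<subseteq> \<int>"
  by (auto simp: gr_mult_def intro!: Ints_sum Ints_mult)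

lemma single_Ints: "range (single g :: 'a \<Rightarrow> 'k::comm_ring_1) \<subseteq> \<int>"
  by (auto simp: single_def)

text \<open>If \<open>\<beta> = \<Sum>\<^sub>i k i \<cdot> \<alpha> i\<close> lies in the ideal, so does \<open>\<alpha> m \<cdot> x \<cdot> \<beta> - \<beta> \<cdot> x \<cdot> \<alpha> m\<close>, which needs one summand
  less. If it vanishes for a generic \<open>x\<close>, then \<open>\<beta>\<close> is a scalar multiple of \<open>\<alpha> m\<close>.\<close>

lemma ideal_meets_prime_ring:
  fixes I :: "('a \<Rightarrow> 'k::field) set"
  assumes lf: "locally_free G" and ab: "a \<in> carrier G" "b \<in> carrier G" "a \<otimes> b \<noteq> b \<otimes> a"
    and I: "ideal I (group_ring G :: ('a \<Rightarrow> 'k) ring)" "I \<noteq> {\<lambda>x. 0}"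
  shows "\<exists>s\<in>I. s \<noteq> (\<lambda>x. 0) \<and> range s \<subseteq> \<int>"
proof -
  interpret RG: ring "group_ring G :: ('a \<Rightarrow> 'k) ring" by (rule group_ring_is_ring)
  interpret I: ideal I "group_ring G :: ('a \<Rightarrow> 'k) ring" by (rule I(1))
  have IG: "I \<subseteq> gr_carrier G" using I.a_subset by simp
  have Imult: "gr_mult G f s \<in> I" "gr_mult G s f \<in> I" if "s \<in> I" "f \<in> gr_carrier G" for s f
    using I.I_l_closed[OF that(1)] I.I_r_closed[OF that(1)] that(2) by simp_all
  have Iscale: "(\<lambda>x. c * s x) \<in> I" if "s \<in> I" for c s
  proof -
    have c: "(\<lambda>x. c * gr_one G x) \<in> (gr_carrier G :: ('a \<Rightarrow> 'k) set)" by (auto simp: gr_carrier_def gr_one_def)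
    have "gr_mult G (\<lambda>x. \<Sum>i\<in>{()}. c * gr_one G x) s y = c * gr_mult G (gr_one G) s y" for y
      by (subst gr_mult_sum_left) (simp_all add: gr_one_eq single_carrier)
    moreover have "gr_mult G (gr_one G) s = s" using RG.l_one that IG by auto
    ultimately have "gr_mult G (\<lambda>x. c * gr_one G x) s = (\<lambda>x. c * s x)" by (simp add: fun_eq_iff)
    then show ?thesis using Imult(1)[OF that c] by simp
  qed
  have Idiff: "(\<lambda>x. s x - u x) \<in> I" if "s \<in> I" "u \<in> I" for s u
    using I.a_closed[OF that(1) Iscale[OF that(2), of "- 1"]] by simp
  \<comment> \<open>Arbitrary scalars, but summands with coefficients in the image of the integers.
    Initially the summands are the group elements in the support of a nonzero member of
    \<open>I\<close>.\<close>
  have main: "\<exists>s\<in>I. s \<noteq> (\<lambda>x. 0) \<and> range s \<subseteq> \<int>"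
    if "finite T" "\<And>i. i \<in> T \<Longrightarrow> \<alpha> i \<in> gr_carrier G \<and> range (\<alpha> i) \<subseteq> \<int>"
      "(\<lambda>x. \<Sum>i\<in>T. k i * \<alpha> i x) \<in> I" "(\<lambda>x. \<Sum>i\<in>T. k i * \<alpha> i x) \<noteq> (\<lambda>x. 0)" for T :: "'a set" and k \<alpha>
    using that
  proof (induction T arbitrary: \<alpha> k rule: finite_induct)
    case empty
    then show ?case by simp
  next
    case (insert m T)
    define \<beta> where "\<beta> = (\<lambda>x. \<Sum>i\<in>insert m T. k i * \<alpha> i x)"
    have \<beta>: "\<beta> \<in> I" "\<beta> \<noteq> (\<lambda>x. 0)" "\<beta> \<in> gr_carrier G" using insert.prems(2,3) IG by (auto simp: \<beta>_def)
    have \<alpha>: "\<alpha> i \<in> gr_carrier G" "range (\<alpha> i) \<subseteq> \<int>" if "i \<in> insert m T" for i using insert.prems(1)[OF that] by auto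
    note \<alpha>m = \<alpha>[OF insertI1]
    show ?case
    proof (cases "\<alpha> m = (\<lambda>x. 0)")
      case True
      then have "\<beta> = (\<lambda>x. \<Sum>i\<in>T. k i * \<alpha> i x)" using insert.hyps by (simp add: \<beta>_def)
      then show ?thesis using insert.IH[of \<alpha> k] \<alpha> \<beta> by simp
    next
      case False
      define A where "A = {x. \<alpha> m x \<noteq> 0} \<union> {x. \<beta> x \<noteq> 0}"
      have A: "finite A" "A \<subseteq> carrier G" using gr_carrierD(1,2)[OF \<alpha>m(1)] gr_carrierD(1,2)[OF \<beta>(3)] by (auto simp: A_def)
      have sA: "{x. \<alpha> m x \<noteq> 0} \<subseteq> A" "{x. \<beta> x \<noteq> 0} \<subseteq> A" by (auto simp: A_def)
      obtain x where x: "x \<in> carrier G" and gen: "generic A x"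
        by (rule generic_element_exists[OF lf ab A])
      let ?x = "single x :: 'a \<Rightarrow> 'k"
      define \<alpha>' where "\<alpha>' i = (\<lambda>y. gr_mult G (\<alpha> m) (gr_mult G ?x (\<alpha> i)) y - gr_mult G (\<alpha> i) (gr_mult G ?x (\<alpha> m)) y)" for i
      define \<gamma> where "\<gamma> = (\<lambda>y. gr_mult G (\<alpha> m) (gr_mult G ?x \<beta>) y - gr_mult G \<beta> (gr_mult G ?x (\<alpha> m)) y)"
      have xc: "?x \<in> gr_carrier G" by (rule single_carrier[OF x])
      have \<gamma>I: "\<gamma> \<in> I" unfolding \<gamma>_def by (intro Idiff Imult gr_mult_closed \<beta>(1) \<alpha>m(1) xc)
      have \<alpha>'G: "\<alpha>' i \<in> gr_carrier G" if "i \<in> T" for i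
      proof -
        have "gr_mult G (\<alpha> m) (gr_mult G ?x (\<alpha> i)) \<in> gr_carrier G" "gr_mult G (\<alpha> i) (gr_mult G ?x (\<alpha> m)) \<in> gr_carrier G"
          using that by (intro gr_mult_closed \<alpha> xc; simp)+
        from RG.minus_closed[of "gr_mult G (\<alpha> m) (gr_mult G ?x (\<alpha> i))" "gr_mult G (\<alpha> i) (gr_mult G ?x (\<alpha> m))"] this
          gr_add_closed[of "gr_mult G (\<alpha> m) (gr_mult G ?x (\<alpha> i))" "\<lambda>y. - gr_mult G (\<alpha> i) (gr_mult G ?x (\<alpha> m)) y"]
        show ?thesis by (simp add: \<alpha>'_def gr_carrier_def)
      qed
      have \<alpha>'Z: "range (\<alpha>' i) \<subseteq> \<int>" if "i \<in> T" for i
      proof -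
        have "range (gr_mult G (\<alpha> m) (gr_mult G ?x (\<alpha> i))) \<subseteq> \<int>" "range (gr_mult G (\<alpha> i) (gr_mult G ?x (\<alpha> m))) \<subseteq> \<int>"
          using that by (intro gr_mult_Ints \<alpha> single_Ints; simp)+
        then show ?thesis by (auto simp: \<alpha>'_def intro!: Ints_diff)
      qed
      have \<gamma>: "\<gamma> = (\<lambda>y. \<Sum>i\<in>T. k i * \<alpha>' i y)"
      proof
        fix y
        have 1: "gr_mult G ?x \<beta> = (\<lambda>z. \<Sum>i\<in>insert m T. k i * gr_mult G ?x (\<alpha> i) z)"
          unfolding \<beta>_def by (rule ext) (rule gr_mult_sum_right)
        have 2: "gr_mult G (\<alpha> m) (gr_mult G ?x \<beta>) y = (\<Sum>i\<in>insert m T. k i * gr_mult G (\<alpha> m) (gr_mult G ?x (\<alpha> i)) y)"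
          unfolding 1 by (rule gr_mult_sum_right)
        have 3: "gr_mult G \<beta> (gr_mult G ?x (\<alpha> m)) y = (\<Sum>i\<in>insert m T. k i * gr_mult G (\<alpha> i) (gr_mult G ?x (\<alpha> m)) y)"
          unfolding \<beta>_def by (rule gr_mult_sum_left) (use insert.hyps \<alpha> in auto)
        have "\<gamma> y = (\<Sum>i\<in>insert m T. k i * \<alpha>' i y)"
          unfolding \<gamma>_def 2 3 \<alpha>'_def by (simp only: right_diff_distrib sum_subtractf)
        \<comment> \<open>The summand for \<open>m\<close> drops out, as \<open>\<alpha>' m\<close>
          is zero.\<close>
        then show "\<gamma> y = (\<Sum>i\<in>T. k i * \<alpha>' i y)" using insert.hyps by (simp add: \<alpha>'_def)
      qed
      show ?thesis
      proof (cases "\<gamma> = (\<lambda>x. 0)")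
        case False
        then show ?thesis using insert.IH[of \<alpha>' k] \<alpha>'G \<alpha>'Z \<gamma>I \<gamma> by simp
      next
        case True
        \<comment> \<open>Read off from \<open>\<gamma>\<close> at \<open>g x h\<close>: the
          two-by-two minors of the coefficient functions of \<open>\<alpha> m\<close> and
          \<open>\<beta>\<close> vanish, so these are proportional.\<close>
        have cross: "\<alpha> m g * \<beta> h = \<beta> g * \<alpha> m h" if "g \<in> A" "h \<in> A" for g h
        proof -
          have "\<gamma> (g \<otimes> x \<otimes> h) = \<alpha> m g * \<beta> h - \<beta> g * \<alpha> m h"
            unfolding \<gamma>_def
            using generic_product_coeff[OF \<alpha>m(1) sA(1) \<beta>(3) sA(2) A x gen that]
              generic_product_coeff[OF \<beta>(3) sA(2) \<alpha>m(1) sA(1) A x gen that] by simp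
          then show ?thesis using True by simp
        qed
        obtain h where h: "\<beta> h \<noteq> 0" using \<beta>(2) by auto
        then have hA: "h \<in> A" by (simp add: A_def)
        have "\<alpha> m g = \<alpha> m h / \<beta> h * \<beta> g" for g
        proof (cases "g \<in> A")
          case True
          then show ?thesis using cross[OF True hA] h by (simp add: field_simps)
        qed (simp add: A_def)
        then have "\<alpha> m = (\<lambda>g. \<alpha> m h / \<beta> h * \<beta> g)" by (rule ext)
        then have "\<alpha> m \<in> I" using Iscale[OF \<beta>(1), of "\<alpha> m h / \<beta> h"] by simp
        then show ?thesis using \<alpha>m(2) \<open>\<alpha> m \<noteq> (\<lambda>x. 0)\<close> by blast
      qed
    qed
  qed
  obtain \<beta> where \<beta>: "\<beta> \<in> I" "\<beta> \<noteq> (\<lambda>x. 0)" using I(2) I.zero_closed by auto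
  let ?T = "{g. \<beta> g \<noteq> 0}"
  have \<beta>G: "\<beta> \<in> gr_carrier G" using \<beta>(1) IG by blast
  have "(\<Sum>g\<in>?T. \<beta> g * single g x) = \<beta> x" for x
  proof -
    have "(\<Sum>g\<in>?T. \<beta> g * single g x) = (\<Sum>g\<in>?T. if x = g then \<beta> g else 0)"
      by (intro sum.cong) (auto simp: single_def)
    then show ?thesis using gr_carrierD(1)[OF \<beta>G] by simp
  qed
  then have sum: "(\<lambda>x. \<Sum>g\<in>?T. \<beta> g * single g x) = \<beta>" by (rule ext)
  have "single g \<in> gr_carrier G \<and> range (single g :: 'a \<Rightarrow> 'k) \<subseteq> \<int>" if "g \<in> ?T" for g
    using that gr_carrierD(2)[OF \<beta>G] single_carrier single_Ints by blast
  from main[OF gr_carrierD(1)[OF \<beta>G] this, of "\<lambda>g. g" \<beta>, unfolded sum] \<beta> show ?thesis by blast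
qed

end

text \<open>Both halves apply \<open>group_ring_right_primitive\<close>, with all nonzero elements
  if the ring is no larger than the group, and for a field with the nonzero elements over the image
  of the integers, a family bounded by the size of the group alone.\<close>

theorem theorem2p5:
  fixes G :: "('g, 'b) monoid_scheme"
  assumes "group G" and "\<not> comm_group G" and "locally_free G"
  shows "((\<exists>f :: 'r::ring_1_no_zero_divisors \<Rightarrow> 'g. inj f \<and> range f \<subseteq> carrier G)
            \<longrightarrow> right_primitive (group_ring G :: ('g \<Rightarrow> 'r) ring))
         \<and> right_primitive (group_ring G :: ('g \<Rightarrow> 'k::field) ring)"
proof -
  interpret group G by (rule assms(1))
  note lf = assms(3)
  have "\<exists>a\<in>carrier G. \<exists>b\<in>carrier G. a \<otimes>\<^bsub>G\<^esub> b \<noteq> b \<otimes>\<^bsub>G\<^esub> a"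
    using group_comm_groupI assms(2) by blast
  then obtain a b where ab: "a \<in> carrier G" "b \<in> carrier G" "a \<otimes>\<^bsub>G\<^esub> b \<noteq> b \<otimes>\<^bsub>G\<^esub> a" by blast
  have "a \<noteq> \<one>\<^bsub>G\<^esub>" using ab by auto
  then have inf: "infinite (carrier G)" using locally_free_infinite[OF lf ab(1)] by blast
  show ?thesis
  proof (intro conjI impI)
    assume "\<exists>f :: 'r \<Rightarrow> 'g. inj f \<and> range f \<subseteq> carrier G"
    then have Q: "|UNIV :: 'r set| \<le>o |carrier G|" by (simp add: card_of_ordLeq[symmetric])
    show "right_primitive (group_ring G :: ('g \<Rightarrow> 'r) ring)"
    proof (rule group_ring_right_primitive[OF lf ab])
      show "gr_carrier G - {\<lambda>x. 0} \<subseteq> (gr_carrier G - {\<lambda>x. 0} :: ('g \<Rightarrow> 'r) set)" by simp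
      show "|gr_carrier G - {\<lambda>x. 0} :: ('g \<Rightarrow> 'r) set| \<le>o |carrier G|"
        by (rule ordLeq_transitive[OF card_of_mono1 card_of_gr_carrier[OF inf Q]]) auto
      fix I :: "('g \<Rightarrow> 'r) set" assume I: "ideal I (group_ring G)" "I \<noteq> {\<lambda>x. 0}"
      have s: "additive_subgroup I (group_ring G :: ('g \<Rightarrow> 'r) ring)" by (rule ideal.axioms(1)[OF I(1)])
      have "(\<lambda>x. 0) \<in> I" "I \<subseteq> gr_carrier G"
        using additive_subgroup.zero_closed[OF s] additive_subgroup.a_subset[OF s] by simp_all
      then show "\<exists>s\<in>gr_carrier G - {\<lambda>x. 0}. s \<in> I" using I(2) by blast
    qed
  next
    have Z: "|\<int> :: 'k set| \<le>o |carrier G|"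
      by (intro card_of_countable inf) (simp add: Ints_def)
    show "right_primitive (group_ring G :: ('g \<Rightarrow> 'k) ring)"
    proof (rule group_ring_right_primitive[OF lf ab])
      let ?S = "{u \<in> gr_carrier G. range u \<subseteq> \<int>} - {\<lambda>x. 0} :: ('g \<Rightarrow> 'k) set"
      show "?S \<subseteq> gr_carrier G - {\<lambda>x. 0}" by blast
      show "|?S| \<le>o |carrier G|"
        by (rule ordLeq_transitive[OF card_of_mono1 card_of_gr_carrier[OF inf Z]]) blast
      fix I :: "('g \<Rightarrow> 'k) set" assume I: "ideal I (group_ring G)" "I \<noteq> {\<lambda>x. 0}"
      have "I \<subseteq> gr_carrier G"
        using additive_subgroup.a_subset[OF ideal.axioms(1)[OF I(1)]] by simp
      then show "\<exists>s\<in>?S. s \<in> I" using ideal_meets_prime_ring[OF lf ab I] by blast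
    qed
  qed
qed

end
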